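(* Let $H$ be a quaternion algebra over a number field $K$, with orthogonal involution $\ddagger$. Let $\mathcal{O}_1, \mathcal{O}_2$ be maximal $\ddagger$-orders of $H$. Then $SL^\ddagger(2,\mathcal{O}_1)$ is conjugate to $SL^\ddagger(2,\mathcal{O}_2)$ in $SL^\ddagger(2,H)$ if and only if for every prime ideal $\mathfrak{p}$ of $\mathfrak{o}_K$, $SL^\ddagger(2,\mathcal{O}_{1,\mathfrak{p}})$ is conjugate to $SL^\ddagger(2,\mathcal{O}_{2,\mathfrak{p}})$ in $SL^\ddagger(2,H_\mathfrak{p})$.
   Context: Let $\mathfrak{o}_K$ be the ring of integers of $K$. An orthogonal involution $\ddagger$ on $H$ is a $K$-linear map $x\mapsto x^\ddagger$ with $(xy)^\ddagger = y^\ddagger x^\ddagger$ and $(x^\ddagger)^\ddagger = x$, different from the standard involution (quaternion conjugation). Set $H^+ = \{x \in H : x^\ddagger = x\}$. Define the group $$SL^\ddagger(2,H) = \left\{\begin{pmatrix} a & b \\ c & d \end{pmatrix} \in \mathrm{Mat}(2,H) : ab^\ddagger \in H^+,\ cd^\ddagger \in H^+,\ ad^\ddagger - bc^\ddagger = 1\right\}$$ under matrix multiplication. A $\ddagger$-order of $H$ is an order of $H$ (a subring with $1$ that is a finitely generated $\mathfrak{o}_K$-module spanning $H$ over $K$) closed under $\ddagger$; a maximal $\ddagger$-order is a $\ddagger$-order not contained in any strictly larger $\ddagger$-order. Set $SL^\ddagger(2,\mathcal{O}) = SL^\ddagger(2,H)\cap \mathrm{Mat}(2,\mathcal{O})$.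 For a nonzero prime ideal $\mathfrak{p}$ of $\mathfrak{o}_K$, $K_\mathfrak{p}$ is the completion with ring of integers $\mathfrak{o}_{K_\mathfrak{p}}$, $H_\mathfrak{p} = H\otimes_K K_\mathfrak{p}$ with the extended involution $\ddagger$, and $\mathcal{O}_{i,\mathfrak{p}} = \mathcal{O}_i\otimes_{\mathfrak{o}_K}\mathfrak{o}_{K_\mathfrak{p}}$; the groups $SL^\ddagger(2,H_\mathfrak{p})$ and $SL^\ddagger(2,\mathcal{O}_{i,\mathfrak{p}})$ are defined in the same way. *)

theory Defs
  imports "HOL-Algebra.Algebra"
begin

section \<open>Number fields and their completions\<close>

definition char_zero :: "('a, 'b) ring_scheme \<Rightarrow> bool"
  where "char_zero F \<longleftrightarrow> (\<forall>n::nat. n > 0 \<longrightarrow> [n] \<cdot>\<^bsub>F\<^esub> \<one>\<^bsub>F\<^esub> \<noteq> \<zero>\<^bsub>F\<^esub>)"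

text \<open>The subfield \<^term>\<open>generate_field F {}\<close> is the prime field of \<^term>\<open>F\<close>, i.e. the copy of the
  rational numbers inside a field of characteristic zero.\<close>

definition number_field :: "('a, 'b) ring_scheme \<Rightarrow> bool"
  where "number_field F \<longleftrightarrow>
    field F \<and> char_zero F \<and> ring.finite_dimension F (generate_field F {}) (carrier F)"

definition int_image :: "('a, 'b) ring_scheme \<Rightarrow> 'a set"
  where "int_image F = range (\<lambda>m::int. [m] \<cdot>\<^bsub>F\<^esub> \<one>\<^bsub>F\<^esub>)"

text \<open>The library represents polynomials as coefficient lists, leading coefficient first;
  \<^const>\<open>lead_coeff\<close> is \<^const>\<open>hd\<close>.\<close>

definition ring_of_integers :: "('a, 'b) ring_scheme \<Rightarrow> 'a set"
  where "ring_of_integers F =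
    {x \<in> carrier F. \<exists>p. polynomial\<^bsub>F\<^esub> (int_image F) p \<and> p \<noteq> [] \<and>
        lead_coeff p = \<one>\<^bsub>F\<^esub> \<and> ring.eval F p x = \<zero>\<^bsub>F\<^esub>}"

abbreviation integer_ring :: "('a, 'b) ring_scheme \<Rightarrow> ('a, 'b) ring_scheme"
  where "integer_ring F \<equiv> F \<lparr> carrier := ring_of_integers F \<rparr>"

definition finite_primes :: "('a, 'b) ring_scheme \<Rightarrow> 'a set set"
  where "finite_primes F = {P. primeideal P (integer_ring F) \<and> P \<noteq> {\<zero>\<^bsub>F\<^esub>}}"

text \<open>The set \<open>val_ge F P n\<close> consists of the \<open>x\<close> in \<open>F\<close> of \<open>P\<close>-adic valuation at least \<open>n\<close>:
  it is the \<open>n\<close>-th power of the maximal ideal of the localization of the ring of integers at \<open>P\<close>.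
  Note that the powers of \<open>P\<close> themselves would not do as neighbourhoods of zero, because their
  elements are also constrained at all the other primes.\<close>

definition val_ge :: "('a, 'b) ring_scheme \<Rightarrow> 'a set \<Rightarrow> nat \<Rightarrow> 'a set"
  where "val_ge F P n =
    {a \<otimes>\<^bsub>F\<^esub> inv\<^bsub>F\<^esub> s | a s.
        a \<in> P [^]\<^bsub>ideals_set (integer_ring F)\<^esub> n \<and> s \<in> ring_of_integers F - P}"

definition cauchy_seqs :: "('a, 'b) ring_scheme \<Rightarrow> 'a set \<Rightarrow> (nat \<Rightarrow> 'a) set"
  where "cauchy_seqs F P =
    {x. (\<forall>i. x i \<in> carrier F) \<and> (\<forall>n. \<exists>N. \<forall>i\<ge>N. \<forall>j\<ge>N. x i \<ominus>\<^bsub>F\<^esub> x j \<in> val_ge F P n)}"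

definition null_seqs :: "('a, 'b) ring_scheme \<Rightarrow> 'a set \<Rightarrow> (nat \<Rightarrow> 'a) set"
  where "null_seqs F P =
    {x. (\<forall>i. x i \<in> carrier F) \<and> (\<forall>n. \<exists>N. \<forall>i\<ge>N. x i \<in> val_ge F P n)}"

definition cauchy_ring :: "('a, 'b) ring_scheme \<Rightarrow> 'a set \<Rightarrow> (nat \<Rightarrow> 'a) ring"
  where "cauchy_ring F P =
    \<lparr>carrier = cauchy_seqs F P,
      monoid.mult = (\<lambda>x y i. x i \<otimes>\<^bsub>F\<^esub> y i), one = (\<lambda>i. \<one>\<^bsub>F\<^esub>),
      ring.zero = (\<lambda>i. \<zero>\<^bsub>F\<^esub>), add = (\<lambda>x y i. x i \<oplus>\<^bsub>F\<^esub> y i)\<rparr>"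

definition completion :: "('a, 'b) ring_scheme \<Rightarrow> 'a set \<Rightarrow> ((nat \<Rightarrow> 'a) set) ring"
  where "completion F P = cauchy_ring F P Quot null_seqs F P"

definition to_completion :: "('a, 'b) ring_scheme \<Rightarrow> 'a set \<Rightarrow> 'a \<Rightarrow> (nat \<Rightarrow> 'a) set"
  where "to_completion F P k = null_seqs F P +>\<^bsub>cauchy_ring F P\<^esub> (\<lambda>i. k)"

text \<open>A limit has nonnegative valuation iff it is the limit of a sequence of elements of
  nonnegative valuation.\<close>

definition completion_integers :: "('a, 'b) ring_scheme \<Rightarrow> 'a set \<Rightarrow> (nat \<Rightarrow> 'a) set set"
  where "completion_integers F P =
    {c \<in> carrier (completion F P). \<exists>x\<in>c. \<forall>i. x i \<in> val_ge F P 0}"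


section \<open>Quaternion algebras, involutions and orders\<close>

text \<open>An algebra over a field is given, as in the library theory of embedded algebras, by a (not
  necessarily commutative) ring \<open>H\<close> and a subfield \<open>K\<close> of \<open>H\<close>, here required to be central. As the
  structure map of a nonzero unital algebra over a field is injective, this is no restriction.\<close>

definition central_algebra :: "('a, 'b) ring_scheme \<Rightarrow> 'a set \<Rightarrow> bool"
  where "central_algebra H K \<longleftrightarrow>
    ring H \<and> subfield K H \<and> (\<forall>k\<in>K. \<forall>x\<in>carrier H. k \<otimes>\<^bsub>H\<^esub> x = x \<otimes>\<^bsub>H\<^esub> k)"

abbreviation base_field :: "('a, 'b) ring_scheme \<Rightarrow> 'a set \<Rightarrow> ('a, 'b) ring_scheme"
  where "base_field H K \<equiv> H \<lparr> carrier := K \<rparr>"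

definition quaternion_basis :: "('a, 'b) ring_scheme \<Rightarrow> 'a set \<Rightarrow> 'a \<Rightarrow> 'a \<Rightarrow> bool"
  where "quaternion_basis H K i j \<longleftrightarrow>
    i \<in> carrier H \<and> j \<in> carrier H \<and>
    i \<otimes>\<^bsub>H\<^esub> i \<in> K - {\<zero>\<^bsub>H\<^esub>} \<and> j \<otimes>\<^bsub>H\<^esub> j \<in> K - {\<zero>\<^bsub>H\<^esub>} \<and>
    j \<otimes>\<^bsub>H\<^esub> i = \<ominus>\<^bsub>H\<^esub> (i \<otimes>\<^bsub>H\<^esub> j) \<and>
    ring.independent H K [\<one>\<^bsub>H\<^esub>, i, j, i \<otimes>\<^bsub>H\<^esub> j] \<and>
    ring.Span H K [\<one>\<^bsub>H\<^esub>, i, j, i \<otimes>\<^bsub>H\<^esub> j] = carrier H"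

text \<open>This is the usual definition over a base field of characteristic different from 2.\<close>

definition quaternion_algebra :: "('a, 'b) ring_scheme \<Rightarrow> 'a set \<Rightarrow> bool"
  where "quaternion_algebra H K \<longleftrightarrow>
    central_algebra H K \<and> (\<exists>i j. quaternion_basis H K i j)"

definition quaternion_conjugation :: "('a, 'b) ring_scheme \<Rightarrow> 'a set \<Rightarrow> ('a \<Rightarrow> 'a) \<Rightarrow> bool"
  where "quaternion_conjugation H K \<sigma> \<longleftrightarrow>
    (\<exists>i j. quaternion_basis H K i j \<and>
      (\<forall>t\<in>K. \<forall>x\<in>K. \<forall>y\<in>K. \<forall>z\<in>K.
        \<sigma> (t \<oplus>\<^bsub>H\<^esub> x \<otimes>\<^bsub>H\<^esub> i \<oplus>\<^bsub>H\<^esub> y \<otimes>\<^bsub>H\<^esub> j \<oplus>\<^bsub>H\<^esub> z \<otimes>\<^bsub>H\<^esub> (i \<otimes>\<^bsub>H\<^esub> j)) =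
        t \<ominus>\<^bsub>H\<^esub> x \<otimes>\<^bsub>H\<^esub> i \<ominus>\<^bsub>H\<^esub> y \<otimes>\<^bsub>H\<^esub> j \<ominus>\<^bsub>H\<^esub> z \<otimes>\<^bsub>H\<^esub> (i \<otimes>\<^bsub>H\<^esub> j)))"

definition involution :: "('a, 'b) ring_scheme \<Rightarrow> 'a set \<Rightarrow> ('a \<Rightarrow> 'a) \<Rightarrow> bool"
  where "involution H K \<sigma> \<longleftrightarrow>
    \<sigma> \<in> carrier H \<rightarrow> carrier H \<and>
    (\<forall>x\<in>carrier H. \<forall>y\<in>carrier H. \<sigma> (x \<oplus>\<^bsub>H\<^esub> y) = \<sigma> x \<oplus>\<^bsub>H\<^esub> \<sigma> y) \<and>
    (\<forall>k\<in>K. \<forall>x\<in>carrier H. \<sigma> (k \<otimes>\<^bsub>H\<^esub> x) = k \<otimes>\<^bsub>H\<^esub> \<sigma> x) \<and>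
    (\<forall>x\<in>carrier H. \<forall>y\<in>carrier H. \<sigma> (x \<otimes>\<^bsub>H\<^esub> y) = \<sigma> y \<otimes>\<^bsub>H\<^esub> \<sigma> x) \<and>
    (\<forall>x\<in>carrier H. \<sigma> (\<sigma> x) = x)"

definition orthogonal_involution :: "('a, 'b) ring_scheme \<Rightarrow> 'a set \<Rightarrow> ('a \<Rightarrow> 'a) \<Rightarrow> bool"
  where "orthogonal_involution H K \<sigma> \<longleftrightarrow> involution H K \<sigma> \<and> \<not> quaternion_conjugation H K \<sigma>"

definition algebra_order :: "('a, 'b) ring_scheme \<Rightarrow> 'a set \<Rightarrow> 'a set \<Rightarrow> bool"
  where "algebra_order H K \<O> \<longleftrightarrow>
    subring \<O> H \<and>
    (\<exists>Us. set Us \<subseteq> \<O> \<and> ring.Span H (ring_of_integers (base_field H K)) Us = \<O>) \<and>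
    (\<exists>Vs. set Vs \<subseteq> \<O> \<and> ring.Span H K Vs = carrier H)"

definition involution_order :: "('a, 'b) ring_scheme \<Rightarrow> 'a set \<Rightarrow> ('a \<Rightarrow> 'a) \<Rightarrow> 'a set \<Rightarrow> bool"
  where "involution_order H K \<sigma> \<O> \<longleftrightarrow> algebra_order H K \<O> \<and> \<sigma> ` \<O> \<subseteq> \<O>"

definition maximal_involution_order :: "('a, 'b) ring_scheme \<Rightarrow> 'a set \<Rightarrow> ('a \<Rightarrow> 'a) \<Rightarrow> 'a set \<Rightarrow> bool"
  where "maximal_involution_order H K \<sigma> \<O> \<longleftrightarrow>
    involution_order H K \<sigma> \<O> \<and>
    (\<forall>\<O>'. involution_order H K \<sigma> \<O>' \<and> \<O> \<subseteq> \<O>' \<longrightarrow> \<O>' = \<O>)"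


section \<open>The groups \<open>SL\<close> with respect to an involution\<close>

text \<open>The quadruple \<open>(a, b, c, d)\<close> stands for the matrix with rows \<open>a b\<close> and \<open>c d\<close>.\<close>

type_synonym 'a mat2 = "'a \<times> 'a \<times> 'a \<times> 'a"

definition mat2_set :: "'a set \<Rightarrow> 'a mat2 set"
  where "mat2_set S = S \<times> S \<times> S \<times> S"

fun mat2_mult :: "('a, 'b) ring_scheme \<Rightarrow> 'a mat2 \<Rightarrow> 'a mat2 \<Rightarrow> 'a mat2"
  where "mat2_mult R (a, b, c, d) (a', b', c', d') =
    (a \<otimes>\<^bsub>R\<^esub> a' \<oplus>\<^bsub>R\<^esub> b \<otimes>\<^bsub>R\<^esub> c', a \<otimes>\<^bsub>R\<^esub> b' \<oplus>\<^bsub>R\<^esub> b \<otimes>\<^bsub>R\<^esub> d',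
     c \<otimes>\<^bsub>R\<^esub> a' \<oplus>\<^bsub>R\<^esub> d \<otimes>\<^bsub>R\<^esub> c', c \<otimes>\<^bsub>R\<^esub> b' \<oplus>\<^bsub>R\<^esub> d \<otimes>\<^bsub>R\<^esub> d')"

definition fixed_points :: "('a, 'b) ring_scheme \<Rightarrow> ('a \<Rightarrow> 'a) \<Rightarrow> 'a set"
  where "fixed_points R \<sigma> = {x \<in> carrier R. \<sigma> x = x}"

definition SL2_inv :: "('a, 'b) ring_scheme \<Rightarrow> ('a \<Rightarrow> 'a) \<Rightarrow> 'a mat2 monoid"
  where "SL2_inv R \<sigma> =
    \<lparr>carrier = {(a, b, c, d) \<in> mat2_set (carrier R).
        a \<otimes>\<^bsub>R\<^esub> \<sigma> b \<in> fixed_points R \<sigma> \<and> c \<otimes>\<^bsub>R\<^esub> \<sigma> d \<in> fixed_points R \<sigma> \<and>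
        a \<otimes>\<^bsub>R\<^esub> \<sigma> d \<ominus>\<^bsub>R\<^esub> b \<otimes>\<^bsub>R\<^esub> \<sigma> c = \<one>\<^bsub>R\<^esub>},
      monoid.mult = mat2_mult R, one = (\<one>\<^bsub>R\<^esub>, \<zero>\<^bsub>R\<^esub>, \<zero>\<^bsub>R\<^esub>, \<one>\<^bsub>R\<^esub>)\<rparr>"

definition SL2_inv_order :: "('a, 'b) ring_scheme \<Rightarrow> ('a \<Rightarrow> 'a) \<Rightarrow> 'a set \<Rightarrow> 'a mat2 set"
  where "SL2_inv_order R \<sigma> \<O> = carrier (SL2_inv R \<sigma>) \<inter> mat2_set \<O>"

definition conjugate_in :: "('a, 'b) monoid_scheme \<Rightarrow> 'a set \<Rightarrow> 'a set \<Rightarrow> bool"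
  where "conjugate_in G S T \<longleftrightarrow> (\<exists>g\<in>carrier G. T = (g <#\<^bsub>G\<^esub> S) #>\<^bsub>G\<^esub> inv\<^bsub>G\<^esub> g)"


section \<open>Tensor products and localization\<close>

text \<open>Let \<open>\<phi>\<close> map the central subfield \<open>K\<close> of \<open>A\<close> to the commutative ring \<open>L\<close>. The tensor product of
  \<open>A\<close> and \<open>L\<close> over \<open>K\<close> is the free abelian group on pairs \<open>(a, l)\<close>, with the product of pairs extended
  bilinearly, modulo the usual bilinearity relations.\<close>

definition free_pair_ring ::
    "('a, 'b) ring_scheme \<Rightarrow> ('c, 'd) ring_scheme \<Rightarrow> (('a \<times> 'c) \<Rightarrow>\<^sub>0 int) ring"
  where "free_pair_ring A L =
    \<lparr>carrier = {f. Poly_Mapping.keys f \<subseteq> carrier A \<times> carrier L},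
      monoid.mult = (\<lambda>f g. frag_extend (\<lambda>(a, l).
                frag_extend (\<lambda>(a', l'). frag_of (a \<otimes>\<^bsub>A\<^esub> a', l \<otimes>\<^bsub>L\<^esub> l')) g) f),
      one = frag_of (\<one>\<^bsub>A\<^esub>, \<one>\<^bsub>L\<^esub>), ring.zero = 0, add = (+)\<rparr>"

text \<open>That this is a ring matters below: \<^const>\<open>genideal\<close> intersects all ideals of a ring and is
  degenerate on a structure which is not one.\<close>

lemma frag_extend_add_fun:
  "frag_extend (\<lambda>x. h x + k x) f = frag_extend h f + frag_extend k f"
  by (simp add: frag_extend_def frag_cmul_distrib2 sum.distrib)

lemma free_pair_ring_is_ring:
  assumes "ring A" "ring L"
  shows "ring (free_pair_ring A L)"
proof -
  interpret A: ring A by fact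
  interpret L: ring L by fact
  define S where "S = carrier A \<times> carrier L"
  define m where "m = (\<lambda>p q. frag_of (fst p \<otimes>\<^bsub>A\<^esub> fst q, snd p \<otimes>\<^bsub>L\<^esub> snd q))"
  define M where "M = (\<lambda>f g. frag_extend (\<lambda>p. frag_extend (m p) g) f)"
  define C where "C = {f :: ('a \<times> 'c) \<Rightarrow>\<^sub>0 int. Poly_Mapping.keys f \<subseteq> S}"
  have Malt: "free_pair_ring A L =
    \<lparr>carrier = C, monoid.mult = M, one = frag_of (\<one>\<^bsub>A\<^esub>, \<one>\<^bsub>L\<^esub>), ring.zero = 0, add = (+)\<rparr>"
    by (simp add: free_pair_ring_def C_def M_def m_def S_def case_prod_unfold)
  have C_add: "f + g \<in> C" if "f \<in> C" "g \<in> C" for f g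
    using that Poly_Mapping.keys_add[of f g] unfolding C_def by blast
  have C_diff: "f - g \<in> C" if "f \<in> C" "g \<in> C" for f g
    using that keys_diff[of f g] unfolding C_def by blast
  have C_of: "frag_of p \<in> C \<longleftrightarrow> p \<in> S" for p
    by (simp add: C_def)
  have ext_C: "frag_extend h f \<in> C" if "f \<in> C" "\<And>p. p \<in> S \<Longrightarrow> h p \<in> C" for h f
    using that keys_frag_extend[of h f] unfolding C_def by blast
  have M_C: "M f g \<in> C" if "f \<in> C" "g \<in> C" for f g
    unfolding M_def using that
    by (intro ext_C) (auto simp: m_def C_of S_def)
  have M_add1: "M (f + g) h = M f h + M g h" for f g h
    by (simp add: M_def frag_extend_add)
  have M_add2: "M f (g + h) = M f g + M f h" for f g h
    by (simp add: M_def frag_extend_add frag_extend_add_fun)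
  have M_diff1: "M (f - g) h = M f h - M g h" for f g h
    by (simp add: M_def frag_extend_diff)
  have M_diff2: "M f (g - h) = M f g - M f h" for f g h
    using M_add2[of f "g - h" h] by simp
  have M_0 [simp]: "M 0 g = 0" "M f 0 = 0" for f g
    using M_diff1[of 0 0 g] M_diff2[of f 0 0] by simp_all
  have M_of: "M (frag_of p) (frag_of q) = m p q" for p q
    by (simp add: M_def)
  have ind: "P f" if "f \<in> C" "P 0" "\<And>p. p \<in> S \<Longrightarrow> P (frag_of p)"
      "\<And>f g. P f \<Longrightarrow> P g \<Longrightarrow> P (f - g)" for P and f :: "('a \<times> 'c) \<Rightarrow>\<^sub>0 int"
    using frag_induction[of f S P] that unfolding C_def by blast
  have assoc0: "M (M (frag_of p) (frag_of q)) (frag_of r) = M (frag_of p) (M (frag_of q) (frag_of r))"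
    if "p \<in> S" "q \<in> S" "r \<in> S" for p q r
    using that by (auto simp: M_of m_def S_def A.m_assoc L.m_assoc)
  have assoc1: "M (M (frag_of p) (frag_of q)) h = M (frag_of p) (M (frag_of q) h)"
    if "h \<in> C" "p \<in> S" "q \<in> S" for p q h
    using that(1) by (rule ind) (use assoc0 that in \<open>auto simp: M_diff2\<close>)
  have assoc2: "M (M (frag_of p) g) h = M (frag_of p) (M g h)"
    if "g \<in> C" "h \<in> C" "p \<in> S" for p g h
    using that(1) by (rule ind) (use assoc1 that in \<open>auto simp: M_diff1 M_diff2\<close>)
  have assoc: "M (M f g) h = M f (M g h)" if "f \<in> C" "g \<in> C" "h \<in> C" for f g h
    using that(1) by (rule ind) (use assoc2 that in \<open>auto simp: M_diff1\<close>)
  have one_l: "M (frag_of (\<one>\<^bsub>A\<^esub>, \<one>\<^bsub>L\<^esub>)) f = f" if "f \<in> C" for f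
    using that by (rule ind) (auto simp: M_diff2 M_of m_def S_def)
  have one_r: "M f (frag_of (\<one>\<^bsub>A\<^esub>, \<one>\<^bsub>L\<^esub>)) = f" if "f \<in> C" for f
    using that by (rule ind) (auto simp: M_diff1 M_of m_def S_def)
  have zero_C: "0 \<in> C"
    by (simp add: C_def)
  have inverse: "\<exists>g\<in>C. f + g = 0" if "f \<in> C" for f
    using C_diff[OF zero_C that] by (intro bexI[of _ "- f"]) auto
  show ?thesis
    unfolding Malt
  proof (rule ringI)
    show "Group.monoid \<lparr>carrier = C, monoid.mult = M,
      one = frag_of (\<one>\<^bsub>A\<^esub>, \<one>\<^bsub>L\<^esub>), ring.zero = 0, add = (+)\<rparr>"
      by (rule Group.monoid.intro) (simp_all add: M_C assoc one_l one_r C_of S_def)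
  qed (rule abelian_groupI, simp_all add: C_add zero_C M_add1 M_add2 inverse ac_simps)
qed

definition tensor_relations ::
    "('a, 'b) ring_scheme \<Rightarrow> 'a set \<Rightarrow> ('a \<Rightarrow> 'c) \<Rightarrow> ('c, 'd) ring_scheme \<Rightarrow> (('a \<times> 'c) \<Rightarrow>\<^sub>0 int) set"
  where "tensor_relations A K \<phi> L =
    {frag_of (a \<oplus>\<^bsub>A\<^esub> a', l) - frag_of (a, l) - frag_of (a', l) | a a' l.
        a \<in> carrier A \<and> a' \<in> carrier A \<and> l \<in> carrier L} \<union>
    {frag_of (a, l \<oplus>\<^bsub>L\<^esub> l') - frag_of (a, l) - frag_of (a, l') | a l l'.
        a \<in> carrier A \<and> l \<in> carrier L \<and> l' \<in> carrier L} \<union>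
    {frag_of (a \<otimes>\<^bsub>A\<^esub> k, l) - frag_of (a, \<phi> k \<otimes>\<^bsub>L\<^esub> l) | a k l.
        a \<in> carrier A \<and> k \<in> K \<and> l \<in> carrier L}"

definition tensor_ideal ::
    "('a, 'b) ring_scheme \<Rightarrow> 'a set \<Rightarrow> ('a \<Rightarrow> 'c) \<Rightarrow> ('c, 'd) ring_scheme \<Rightarrow> (('a \<times> 'c) \<Rightarrow>\<^sub>0 int) set"
  where "tensor_ideal A K \<phi> L = Idl\<^bsub>free_pair_ring A L\<^esub> (tensor_relations A K \<phi> L)"

definition tensor_ring ::
    "('a, 'b) ring_scheme \<Rightarrow> 'a set \<Rightarrow> ('a \<Rightarrow> 'c) \<Rightarrow> ('c, 'd) ring_scheme \<Rightarrow> (('a \<times> 'c) \<Rightarrow>\<^sub>0 int) set ring"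
  where "tensor_ring A K \<phi> L = free_pair_ring A L Quot tensor_ideal A K \<phi> L"

definition pure_tensor ::
    "('a, 'b) ring_scheme \<Rightarrow> 'a set \<Rightarrow> ('a \<Rightarrow> 'c) \<Rightarrow> ('c, 'd) ring_scheme \<Rightarrow> 'a \<Rightarrow> 'c
      \<Rightarrow> (('a \<times> 'c) \<Rightarrow>\<^sub>0 int) set"
  where "pure_tensor A K \<phi> L a l =
    tensor_ideal A K \<phi> L +>\<^bsub>free_pair_ring A L\<^esub> frag_of (a, l)"

text \<open>The map \<open>\<sigma> \<otimes> id\<close>, where \<open>\<sigma>\<close> is \<open>K\<close>-linear. All the cosets in the union coincide.\<close>

definition tensor_map ::
    "('a, 'b) ring_scheme \<Rightarrow> 'a set \<Rightarrow> ('a \<Rightarrow> 'c) \<Rightarrow> ('c, 'd) ring_scheme \<Rightarrow> ('a \<Rightarrow> 'a)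
      \<Rightarrow> (('a \<times> 'c) \<Rightarrow>\<^sub>0 int) set \<Rightarrow> (('a \<times> 'c) \<Rightarrow>\<^sub>0 int) set"
  where "tensor_map A K \<phi> L \<sigma> t =
    (\<Union>f\<in>t. tensor_ideal A K \<phi> L +>\<^bsub>free_pair_ring A L\<^esub> frag_extend (\<lambda>(a, l). frag_of (\<sigma> a, l)) f)"

type_synonym 'a local_alg = "('a \<times> (nat \<Rightarrow> 'a) set \<Rightarrow>\<^sub>0 int) set"

definition local_algebra :: "('a, 'b) ring_scheme \<Rightarrow> 'a set \<Rightarrow> 'a set \<Rightarrow> 'a local_alg ring"
  where "local_algebra H K P =
    tensor_ring H K (to_completion (base_field H K) P) (completion (base_field H K) P)"

definition local_involution ::
    "('a, 'b) ring_scheme \<Rightarrow> 'a set \<Rightarrow> 'a set \<Rightarrow> ('a \<Rightarrow> 'a) \<Rightarrow> 'a local_alg \<Rightarrow> 'a local_alg"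
  where "local_involution H K P \<sigma> =
    tensor_map H K (to_completion (base_field H K) P) (completion (base_field H K) P) \<sigma>"

text \<open>The tensor product of \<open>\<O>\<close> with the integers of the completion, regarded as a subset of the local
  algebra: the additive subgroup generated by the corresponding pure tensors. By flatness the tensor
  product over the ring of integers does embed in the local algebra.\<close>

definition local_order :: "('a, 'b) ring_scheme \<Rightarrow> 'a set \<Rightarrow> 'a set \<Rightarrow> 'a set \<Rightarrow> 'a local_alg set"
  where "local_order H K P \<O> =
    generate (add_monoid (local_algebra H K P))
      {pure_tensor H K (to_completion (base_field H K) P) (completion (base_field H K) P) x l | x l.
        x \<in> \<O> \<and> l \<in> completion_integers (base_field H K) P}"

end

theory Submission
  imports Defs
begin

text \<open>In a basis \<open>1, i, j, ij\<close> with \<open>i\<close> and \<open>j\<close> fixed by the involution one sees that every matrix in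
  \<open>SL\<close>, over \<open>H\<close> as well as over its completions, is a product of unipotent triangular matrices with
  entries fixed by the involution. Hence strong approximation in the number field implies strong
  approximation for \<open>SL\<close>: finitely many matrices over \<open>H\<close> are approximated, each at its own prime, by a
  single one which is integral at all other primes.

  Suppose that the groups are conjugate at every prime. As the local orders are open, the local
  conjugators may be taken over \<open>H\<close>. The two orders agree at almost all primes, so a matrix that
  approximates the conjugators at the remaining primes and is integral elsewhere conjugates the groups
  at every prime, hence globally, because an order is the intersection of its localizations.
  Conversely, the global group is dense in the local one, so that a global conjugator maps the one
  local group into the other, and its inverse does the same in the opposite direction.\<close>

section \<open>Finitely generated abelian groups and integrality\<close>

text \<open>Words in unipotent matrices are the right tool because only additive data can be
  prescribed at several primes at once: the elements fixed by \<open>\<sigma>\<close> form a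
  \<open>K\<close>-vector space, to which strong approximation in \<open>K\<close> applies
  coordinate by coordinate, while it fails for units. At a single prime a diagonal factor may be
  kept, since near a unit there are only units.

  An adapted basis exists because an orthogonal involution is not -1 on the pure quaternions;
  diagonalising it there, with the square as quadratic form, yields two anticommuting fixed vectors.
  They are scaled to have integral squares, so that the coordinates define a filtration compatible
  with products at every prime.

  The arithmetic of \<open>K\<close> is drawn from one fact, the finiteness of the residue ring
  modulo a nonzero integer: by pigeonhole it makes the local rings discrete valuation rings and
  distinct primes comaximal, and it bounds the set of primes containing a given integer. The
  filtrations are indexed by natural numbers, so an element with a denominator acts with a bounded
  loss of index; this is the constant \<open>c\<close> that recurs throughout.\<close>

lemma (in comm_group) generate_insert_subset:
  assumes "e \<in> carrier G" "E \<subseteq> carrier G"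
  shows "generate G (insert e E) \<subseteq> {e [^] (k::int) \<otimes> g | k g. g \<in> generate G E}"
proof
  fix x assume "x \<in> generate G (insert e E)"
  thus "x \<in> {e [^] (k::int) \<otimes> g | k g. g \<in> generate G E}"
  proof (induction rule: generate.induct)
    case one
    have "\<one> = e [^] (0::int) \<otimes> \<one>" by simp
    thus ?case using generate.one[of G E] by blast
  next
    case (incl h)
    show ?case
    proof (cases "h = e")
      case True
      hence "h = e [^] (1::int) \<otimes> \<one>" using assms by simp
      thus ?thesis using generate.one[of G E] by blast
    next
      case False
      hence "h \<in> E" using incl by simp
      hence "h = e [^] (0::int) \<otimes> h" using assms by auto
      thus ?thesis using generate.incl[OF \<open>h \<in> E\<close>, of G] by blast
    qed
  next
    case (inv h)
    show ?case
    proof (cases "h = e")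
      case True
      hence "inv h = e [^] (-1::int) \<otimes> \<one>" using assms by (simp add: int_pow_neg)
      thus ?thesis using generate.one[of G E] by blast
    next
      case False
      hence "h \<in> E" using inv by simp
      hence "inv h = e [^] (0::int) \<otimes> inv h" using assms by auto
      thus ?thesis using generate.inv[OF \<open>h \<in> E\<close>, of G] by blast
    qed
  next
    case (eng h1 h2)
    then obtain k1 g1 k2 g2 where h: "h1 = e [^] (k1::int) \<otimes> g1" "h2 = e [^] (k2::int) \<otimes> g2"
      and g: "g1 \<in> generate G E" "g2 \<in> generate G E" by blast
    have gc: "g1 \<in> carrier G" "g2 \<in> carrier G" using g generate_in_carrier[OF assms(2)] by auto
    have "h1 \<otimes> h2 = e [^] (k1 + k2) \<otimes> (g1 \<otimes> g2)"
      unfolding h using gc assms by (simp add: int_pow_mult m_ac)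
    thus ?case using generate.eng[OF g] by blast
  qed
qed

text \<open>Induction on the generators. The exponents with which the new generator \<open>e\<close>
  occurs in \<open>N\<close> form a subgroup of the integers, so one element of \<open>N\<close>
  realising the least positive exponent, added to generators of
  \<open>N \<inter> generate G E\<close>, suffices.\<close>

lemma (in comm_group) subgroup_finitely_generated:
  assumes "finite E" "E \<subseteq> carrier G" "subgroup N G" "N \<subseteq> generate G E"
  shows "\<exists>E'. finite E' \<and> E' \<subseteq> N \<and> N = generate G E'"
  using assms
proof (induction E arbitrary: N rule: finite_induct)
  case empty
  have "N = {\<one>}"
    using empty subgroup.one_closed[OF empty(2)] by (auto simp: generate_empty)
  thus ?case by (intro exI[of _ "{}"]) (simp add: generate_empty)
next
  case (insert e E)
  have ec: "e \<in> carrier G" and Ec: "E \<subseteq> carrier G" using insert.prems by auto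
  interpret N: subgroup N G by fact
  have genE: "subgroup (generate G E) G" using generate_is_subgroup[OF Ec] .
  interpret gE: subgroup "generate G E" G by fact
  define I where "I = {k::int. \<exists>g \<in> generate G E. e [^] k \<otimes> g \<in> N}"
  have sub: "subgroup (N \<inter> generate G E) G"
    by (rule subgroups_Inter_pair) fact+
  obtain E' where E': "finite E'" "E' \<subseteq> N \<inter> generate G E" "N \<inter> generate G E = generate G E'"
    using insert.IH[OF Ec sub] by auto
  have form: "\<exists>k g. x = e [^] (k::int) \<otimes> g \<and> g \<in> generate G E" if "x \<in> N" for x
    using generate_insert_subset[OF ec Ec] insert.prems that by blast
  show ?case
  proof (cases "\<exists>k\<in>I. k > 0")
    \<comment> \<open>\<open>I\<close> is closed under negation, so without a positive member it
      contains at most 0, and \<open>e\<close> does not occur in \<open>N\<close>.\<close>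
    case False
    have "N \<subseteq> generate G E"
    proof
      fix x assume x: "x \<in> N"
      obtain k g where kg: "x = e [^] (k::int) \<otimes> g" "g \<in> generate G E" using form[OF x] by blast
      have "k = 0"
      proof (rule ccontr)
        assume "k \<noteq> 0"
        have "k \<in> I" using kg x I_def by blast
        have "inv x = e [^] (- k) \<otimes> inv g"
          using kg gE.mem_carrier ec by (simp add: int_pow_neg inv_mult)
        hence "- k \<in> I" using N.m_inv_closed[OF x] gE.m_inv_closed[OF kg(2)] I_def by auto
        thus False using False \<open>k \<in> I\<close> \<open>k \<noteq> 0\<close> by (metis linorder_neqE_linordered_idom neg_0_less_iff_less)
      qed
      thus "x \<in> generate G E" using kg gE.mem_carrier by simp
    qed
    thus ?thesis using E' by (metis inf.absorb1)
  next
    case True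
    define d where "d = (LEAST n::nat. n > 0 \<and> int n \<in> I)"
    have ex: "\<exists>n::nat. n > 0 \<and> int n \<in> I" using True by (metis zero_less_imp_eq_int)
    have d: "d > 0" "int d \<in> I" using LeastI_ex[OF ex] by (auto simp: d_def)
    have dmin: "d \<le> n" if "n > 0" "int n \<in> I" for n using that by (auto simp: d_def intro: Least_le)
    obtain g0 where g0: "g0 \<in> generate G E" "e [^] (int d) \<otimes> g0 \<in> N" using d(2) I_def by blast
    define y where "y = e [^] (int d) \<otimes> g0"
    have y: "y \<in> N" using g0 y_def by simp
    have yc: "y \<in> carrier G" using N.mem_carrier y by simp
    have "N = generate G (insert y E')"
    proof
      show "generate G (insert y E') \<subseteq> N"
        using y E' by (intro generate_subgroup_incl[OF _ insert.prems(2)]) blast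
      show "N \<subseteq> generate G (insert y E')"
      proof
        fix x assume x: "x \<in> N"
        obtain k g where kg: "x = e [^] (k::int) \<otimes> g" "g \<in> generate G E" using form[OF x] by blast
        define q where "q = k div int d"
        define r where "r = k mod int d"
        have k: "k = int d * q + r" by (simp add: q_def r_def)
        \<comment> \<open>Dividing the exponent by \<open>d\<close> and cancelling with a power of
          \<open>y\<close> leaves an exponent \<open>r < d\<close>, which the minimality of
          \<open>d\<close> forces to be 0.\<close>
        define x' where "x' = x \<otimes> y [^] (- q)"
        have yq: "y [^] (- q) \<in> N" using y insert.prems(2) by (simp add: subgroup_int_pow_closed)
        have x'N: "x' \<in> N" unfolding x'_def using x yq by (rule N.m_closed)
        have g0q: "g0 [^] (-q) \<in> generate G E" using g0 genE by (simp add: subgroup_int_pow_closed)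
        have gc: "g \<in> carrier G" "g0 \<in> carrier G" using kg g0 gE.mem_carrier by auto
        have x'r: "x' = e [^] r \<otimes> (g \<otimes> g0 [^] (- q))"
        proof -
          have "y [^] (- q) = e [^] (- (int d * q)) \<otimes> g0 [^] (-q)"
            unfolding y_def using gc ec by (simp add: int_pow_distrib int_pow_pow)
          moreover have "e [^] k = e [^] (int d * q) \<otimes> e [^] r" unfolding k using ec by (simp add: int_pow_mult)
          ultimately have "x' = e [^] (int d * q) \<otimes> e [^] r \<otimes> g \<otimes> (e [^] (- (int d * q)) \<otimes> g0 [^] (-q))"
            by (simp add: x'_def kg)
          also have "... = (e [^] (int d * q) \<otimes> e [^] (- (int d * q))) \<otimes> (e [^] r \<otimes> (g \<otimes> g0 [^] (- q)))"
            using ec gc by (simp add: m_ac)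
          also have "e [^] (int d * q) \<otimes> e [^] (- (int d * q)) = \<one>" using ec by (simp add: int_pow_neg)
          finally show ?thesis using ec gc by simp
        qed
        have gg: "g \<otimes> g0 [^] (- q) \<in> generate G E" using kg g0q by blast
        hence "r \<in> I" using x'r x'N I_def by blast
        moreover have "r \<ge> 0" "r < int d" using d by (auto simp: r_def)
        ultimately have "r = 0" using dmin[of "nat r"] by (cases "r = 0") auto
        hence "x' \<in> generate G E"
          using x'r gg gE.mem_carrier by simp
        hence "x' \<in> generate G E'" using x'N E' by blast
        hence a: "x' \<in> generate G (insert y E')" using mono_generate[of E' "insert y E'"] by blast
        have gs: "subgroup (generate G (insert y E')) G"
          using E' yc N.subset by (intro generate_is_subgroup) auto
        have "y \<in> generate G (insert y E')" by (simp add: generate.incl)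
        hence "y [^] q \<in> generate G (insert y E')" using gs by (simp add: subgroup_int_pow_closed)
        moreover have "x = x' \<otimes> y [^] q"
          unfolding x'_def using N.mem_carrier x yc by (simp add: m_assoc int_pow_neg)
        ultimately show "x \<in> generate G (insert y E')" using a subgroup.m_closed[OF gs] by blast
      qed
    qed
    thus ?thesis using y E' by (intro exI[of _ "insert y E'"]) auto
  qed
qed

section \<open>Additive subgroups generated by a set\<close>

context abelian_group
begin

abbreviation zspan :: "'a set => 'a set" where "zspan E \<equiv> generate (add_monoid G) E"

lemma zspan_subgroup: "E \<subseteq> carrier G ==> subgroup (zspan E) (add_monoid G)"
  by (rule add.generate_is_subgroup) simp

lemma zspan_carrier: "E \<subseteq> carrier G ==> x \<in> zspan E ==> x \<in> carrier G"
  using add.generate_in_carrier by simp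

lemma zspan_zero: "\<zero> \<in> zspan E" using generate.one[of "add_monoid G" E] by simp
lemma zspan_incl: "x \<in> E ==> x \<in> zspan E" by (rule generate.incl)
lemma zspan_add: "x \<in> zspan E ==> y \<in> zspan E ==> x \<oplus> y \<in> zspan E"
  using generate.eng[of x "add_monoid G" E y] by simp

lemma subgroupD:
  assumes "subgroup M (add_monoid G)"
  shows "\<zero> \<in> M" "M \<subseteq> carrier G" "!!x. x \<in> M ==> x \<in> carrier G" "!!x y. x \<in> M ==> y \<in> M ==> x \<oplus> y \<in> M" "!!x. x \<in> M ==> \<ominus> x \<in> M"
    "!!x y. x \<in> M ==> y \<in> M ==> x \<ominus> y \<in> M" "!!x k. x \<in> M ==> add_pow G (k::int) x \<in> M"
proof -
  interpret M: subgroup M "add_monoid G" by fact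
  show "\<zero> \<in> M" using M.one_closed by simp
  show "M \<subseteq> carrier G" using M.subset by simp
  thus "!!x. x \<in> M ==> x \<in> carrier G" by blast
  show a: "!!x y. x \<in> M ==> y \<in> M ==> x \<oplus> y \<in> M" using M.m_closed by simp
  show b: "!!x. x \<in> M ==> \<ominus> x \<in> M" using M.m_inv_closed by (simp add: a_inv_def)
  show "!!x y. x \<in> M ==> y \<in> M ==> x \<ominus> y \<in> M" using a b by (simp add: a_minus_def)
  show "!!x k. x \<in> M ==> add_pow G (k::int) x \<in> M" using add.subgroup_int_pow_closed[OF assms] by simp
qed

lemma subgroupI_add:
  assumes "M \<subseteq> carrier G" "\<zero> \<in> M" "!!x y. x \<in> M ==> y \<in> M ==> x \<oplus> y \<in> M" "!!x. x \<in> M ==> \<ominus> x \<in> M"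
  shows "subgroup M (add_monoid G)"
  by (rule add.subgroupI) (use assms in \<open>auto simp: a_inv_def\<close>)

lemma zspan_least: "subgroup M (add_monoid G) ==> E \<subseteq> M ==> zspan E \<subseteq> M"
  using add.generate_subgroup_incl by blast

lemma zspan_mono: "E \<subseteq> E' ==> zspan E \<subseteq> zspan E'"
  using add.mono_generate by blast

end

context ring
begin

lemma zspan_mult_closed:
  assumes "E \<subseteq> carrier R" "c \<in> carrier R" "subgroup M (add_monoid R)" "!!e. e \<in> E ==> c \<otimes> e \<in> M" "w \<in> zspan E"
  shows "c \<otimes> w \<in> M"
proof -
  have "subgroup {w \<in> carrier R. c \<otimes> w \<in> M} (add_monoid R)"
    using assms subgroupD[OF assms(3)] by (intro subgroupI_add) (auto simp: r_distr r_minus)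
  hence "zspan E \<subseteq> {w \<in> carrier R. c \<otimes> w \<in> M}"
    by (rule zspan_least) (use assms in auto)
  thus ?thesis using assms(5) by blast
qed

lemma zspan_mult_closed2:
  assumes "E \<subseteq> carrier R" "c \<in> carrier R" "subgroup M (add_monoid R)" "!!e. e \<in> E ==> e \<otimes> c \<in> M" "w \<in> zspan E"
  shows "w \<otimes> c \<in> M"
proof -
  have "subgroup {w \<in> carrier R. w \<otimes> c \<in> M} (add_monoid R)"
    using assms subgroupD[OF assms(3)] by (intro subgroupI_add) (auto simp: l_distr l_minus)
  hence "zspan E \<subseteq> {w \<in> carrier R. w \<otimes> c \<in> M}"
    by (rule zspan_least) (use assms in auto)
  thus ?thesis using assms(5) by blast
qed

section \<open>Integrality in terms of additive spans of powers\<close>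

abbreviation pows :: "'a => nat => 'a set" where "pows x n \<equiv> (%i::nat. x [^] i) ` {..<n}"

lemma pows_carrier: "x \<in> carrier R ==> pows x n \<subseteq> carrier R" by auto

lemma zspan_pows_mono: "m \<le> n ==> w \<in> zspan (pows x m) ==> w \<in> zspan (pows x n)"
  using zspan_mono[OF image_mono[of "{..<m}" "{..<n}" "%i. x [^] i"]] by auto

abbreviation zint :: "int => 'a" where "zint m \<equiv> [m] \<cdot> \<one>"

lemma zint_mult: "x \<in> carrier R ==> zint m \<otimes> x = [m] \<cdot> x"
  using add_pow_ldistr_int[of \<one> x m] by simp
lemma zint_add: "zint (m + n) = zint m \<oplus> zint n" by (simp add: add.int_pow_mult)
lemma zint_times: "zint (m * n) = zint m \<otimes> zint n"
  by (simp add: zint_mult add.int_pow_pow mult.commute)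
lemma zint_neg: "zint (- n) = \<ominus> zint n" by (simp add: add.int_pow_neg)
lemma zint_diff: "zint (m - n) = zint m \<ominus> zint n" using zint_add[of m "-n"] by (simp add: zint_neg a_minus_def)
lemma zint_0: "zint 0 = \<zero>" by (simp add: add_pow_def)
lemma zint_1: "zint 1 = \<one>" by simp
lemma zint_closed[simp, intro]: "zint m \<in> carrier R" by simp

text \<open>Coefficient lists may begin with zeros here, unlike those of \<open>polynomial\<close>,
  so that the values for all lists of one length form an additive subgroup. This turns polynomial
  relations into statements on spans.\<close>

lemma zspan_pows_eval:
  assumes "x \<in> carrier R"
  shows "zspan (pows x n) = {eval q x | q. set q \<subseteq> int_image R \<and> length q = n}"
proof (induction n)
  case 0
  have "generate (add_monoid R) {} = {\<zero>}" using add.generate_empty by simp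
  thus ?case by auto
next
  case (Suc n)
  have evc: "eval q x \<in> carrier R" if "set q \<subseteq> int_image R" for q
    using that assms by (intro eval_in_carrier) (auto simp: int_image_def)
  have s: "pows x (Suc n) = insert (x [^] n) (pows x n)" by (auto simp: lessThan_Suc)
  have sub: "zspan (pows x (Suc n)) \<subseteq> {add_pow R (k::int) (x [^] n) \<oplus> g | k g. g \<in> zspan (pows x n)}"
    unfolding s using add.generate_insert_subset[of "x [^] n" "pows x n"] assms by auto
  show ?case
  proof
    show "zspan (pows x (Suc n)) \<subseteq> {eval q x | q. set q \<subseteq> int_image R \<and> length q = Suc n}"
    proof
      fix w assume "w \<in> zspan (pows x (Suc n))"
      then obtain k :: int and g where w: "w = add_pow R k (x [^] n) \<oplus> g" "g \<in> zspan (pows x n)" using sub by blast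
      then obtain q where q: "g = eval q x" "set q \<subseteq> int_image R" "length q = n" using Suc by blast
      have "w = eval (zint k # q) x" using w q assms by (simp add: zint_mult)
      moreover have "set (zint k # q) \<subseteq> int_image R" using q by (auto simp: int_image_def)
      ultimately show "w \<in> {eval q x | q. set q \<subseteq> int_image R \<and> length q = Suc n}" using q
        by (metis (mono_tags, lifting) length_Cons mem_Collect_eq)
    qed
    show "{eval q x | q. set q \<subseteq> int_image R \<and> length q = Suc n} \<subseteq> zspan (pows x (Suc n))"
    proof clarify
      fix q assume q: "set q \<subseteq> int_image R" "length q = Suc n"
      then obtain c q' where q': "q = c # q'" "length q' = n" by (cases q) auto
      obtain m where m: "c = zint m" using q q' by (auto simp: int_image_def)
      have "eval q' x \<in> zspan (pows x n)" using Suc q q' by auto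
      hence 1: "eval q' x \<in> zspan (pows x (Suc n))"
        using zspan_pows_mono[of n "Suc n"] by simp
      have "x [^] n \<in> zspan (pows x (Suc n))" by (rule zspan_incl) auto
      hence "add_pow R m (x [^] n) \<in> zspan (pows x (Suc n))"
        using subgroupD(7)[OF zspan_subgroup[OF pows_carrier[OF assms]]] by blast
      hence "add_pow R m (x [^] n) \<oplus> eval q' x \<in> zspan (pows x (Suc n))" using 1 zspan_add by blast
      thus "eval q x \<in> zspan (pows x (Suc n))" using q' m assms by (simp add: zint_mult)
    qed
  qed
qed

text \<open>A monic relation solved for its top power. \<open>polynomial\<close> requires a nonzero
  leading coefficient, whence the assumption that \<one> differs from \<zero>.\<close>

lemma ring_of_integers_iff:
  assumes "\<one> \<noteq> \<zero>"
  shows "x \<in> ring_of_integers R \<longleftrightarrow> x \<in> carrier R \<and> (\<exists>n. x [^] n \<in> zspan (pows x n))"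
proof (cases "x \<in> carrier R")
  case False thus ?thesis by (simp add: ring_of_integers_def)
next
  case x: True
  show ?thesis
  proof
    assume "x \<in> ring_of_integers R"
    then obtain p where p: "polynomial (int_image R) p" "p \<noteq> []" "lead_coeff p = \<one>" "eval p x = \<zero>"
      by (auto simp: ring_of_integers_def)
    obtain q where q: "p = \<one> # q" using p(2,3) by (cases p) auto
    have qs: "set q \<subseteq> int_image R" using p(1) q by (auto simp: polynomial_def)
    have ec: "eval q x \<in> carrier R" using qs x by (intro eval_in_carrier) (auto simp: int_image_def)
    have "x [^] (length q) \<oplus> eval q x = \<zero>" using p(4) q x by simp
    hence "x [^] (length q) = \<ominus> eval q x" using x ec by (simp add: minus_equality)
    moreover have "eval q x \<in> zspan (pows x (length q))" using zspan_pows_eval[OF x] qs by blast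
    ultimately have "x [^] (length q) \<in> zspan (pows x (length q))"
      using subgroupD(5)[OF zspan_subgroup[OF pows_carrier[OF x]]] by metis
    thus "x \<in> carrier R \<and> (\<exists>n. x [^] n \<in> zspan (pows x n))" using x by blast
  next
    assume "x \<in> carrier R \<and> (\<exists>n. x [^] n \<in> zspan (pows x n))"
    then obtain n where "x [^] n \<in> zspan (pows x n)" by blast
    hence "\<ominus> (x [^] n) \<in> zspan (pows x n)" using subgroupD(5)[OF zspan_subgroup[OF pows_carrier[OF x]]] by blast
    then obtain q where q: "\<ominus> (x [^] n) = eval q x" "set q \<subseteq> int_image R" "length q = n"
      using zspan_pows_eval[OF x] by blast
    have "eval (\<one> # q) x = \<zero>" using q x by (simp add: q(1)[symmetric] r_neg)
    moreover have "polynomial (int_image R) (\<one> # q)"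
    proof -
      have "\<one> = zint 1" by simp
      hence "\<one> \<in> int_image R" unfolding int_image_def by blast
      thus ?thesis using q assms by (simp add: polynomial_def)
    qed
    ultimately show "x \<in> ring_of_integers R" using x unfolding ring_of_integers_def
      by (auto intro!: exI[of _ "\<one> # q"])
  qed
qed

text \<open>As \<one> lies in the module spanned by \<open>E\<close>, so do all powers of
  \<open>x\<close>, and their span is finitely generated by
  \<open>subgroup_finitely_generated\<close>. It is the ascending union of the spans of the first
  \<open>n\<close> powers, hence equal to one of them, and then the next power is a combination of
  lower ones.\<close>

lemma integral_criterion:
  assumes "\<one> \<noteq> \<zero>" "x \<in> carrier R" "finite E" "E \<subseteq> carrier R" "\<one> \<in> zspan E"
    and "!!e. e \<in> E ==> x \<otimes> e \<in> zspan E"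
  shows "x \<in> ring_of_integers R"
proof -
  let ?M = "zspan E"
  have M: "subgroup ?M (add_monoid R)" by (rule zspan_subgroup) fact
  have xp: "x [^] (i::nat) \<in> ?M" for i
  proof (induction i)
    case 0 thus ?case using assms by simp
  next
    case (Suc i)
    hence "x \<otimes> x [^] i \<in> ?M" using zspan_mult_closed[OF assms(4,2) M assms(6)] by blast
    thus ?case using assms(2) by (metis nat_pow_Suc2)
  qed
  let ?N = "zspan (range (%i::nat. x [^] i))"
  have N: "subgroup ?N (add_monoid R)" by (rule zspan_subgroup) (use assms in auto)
  have NM: "?N \<subseteq> ?M" by (rule zspan_least[OF M]) (use xp in auto)
  obtain E' where E': "finite E'" "E' \<subseteq> ?N" "?N = zspan E'"
    using add.subgroup_finitely_generated[of E ?N] N NM assms by auto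
  have U: "\<exists>n. w \<in> zspan (pows x n)" if "w \<in> ?N" for w
  proof -
    have "subgroup (\<Union>n. zspan (pows x n)) (add_monoid R)"
    proof (rule subgroupI_add)
      show "(\<Union>n. zspan (pows x n)) \<subseteq> carrier R" using zspan_carrier[OF pows_carrier[OF assms(2)]] by blast
      show "\<zero> \<in> (\<Union>n. zspan (pows x n))" using zspan_zero by blast
    next
      fix a b assume "a \<in> (\<Union>n. zspan (pows x n))" "b \<in> (\<Union>n. zspan (pows x n))"
      then obtain m n where "a \<in> zspan (pows x m)" "b \<in> zspan (pows x n)" by blast
      hence "a \<in> zspan (pows x (max m n))" "b \<in> zspan (pows x (max m n))"
        using zspan_pows_mono[of m "max m n"] zspan_pows_mono[of n "max m n"] by auto
      thus "a \<oplus> b \<in> (\<Union>n. zspan (pows x n))" using zspan_add by blast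
    next
      fix a assume "a \<in> (\<Union>n. zspan (pows x n))"
      thus "\<ominus> a \<in> (\<Union>n. zspan (pows x n))"
        using subgroupD(5)[OF zspan_subgroup[OF pows_carrier[OF assms(2)]]] by blast
    qed
    moreover have "range (%i::nat. x [^] i) \<subseteq> (\<Union>n. zspan (pows x n))"
      using zspan_incl[of _ "pows x (Suc _)"] by blast
    ultimately show ?thesis using zspan_least that by blast
  qed
  have "\<exists>n. E'' \<subseteq> zspan (pows x n)" if "finite E''" "E'' \<subseteq> ?N" for E''
    using that
  proof (induction E'' rule: finite_induct)
    case empty thus ?case by auto
  next
    case (insert e E'')
    then obtain m n where "E'' \<subseteq> zspan (pows x m)" "e \<in> zspan (pows x n)" using U[of e] by blast
    hence "insert e E'' \<subseteq> zspan (pows x (max m n))"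
      using zspan_pows_mono[of m "max m n" _ x] zspan_pows_mono[of n "max m n" _ x] by (auto 0 2)
    thus ?case by blast
  qed
  then obtain n where n: "E' \<subseteq> zspan (pows x n)" using E' by blast
  have "x [^] n \<in> ?N" by (rule zspan_incl) auto
  hence "x [^] n \<in> zspan E'" using E' by simp
  hence "x [^] n \<in> zspan (pows x n)"
    using zspan_least[OF zspan_subgroup[OF pows_carrier[OF assms(2)]] n] by blast
  thus ?thesis using ring_of_integers_iff[OF assms(1)] assms(2) by blast
qed

end

section \<open>Rings of integers of number fields\<close>

context field
begin

lemma inv_nz [simp]:
  assumes "x \<in> carrier R" "x \<noteq> \<zero>"
  shows "inv x \<in> carrier R" "x \<otimes> inv x = \<one>" "inv x \<otimes> x = \<one>" "inv x \<noteq> \<zero>"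
proof -
  have x: "x \<in> Units R" using assms by (simp add: field_Units)
  show "inv x \<in> carrier R" "x \<otimes> inv x = \<one>" "inv x \<otimes> x = \<one>" using x by auto
  thus "inv x \<noteq> \<zero>" using assms by auto
qed

lemma inv_mult_nz:
  assumes "x \<in> carrier R" "x \<noteq> \<zero>" "y \<in> carrier R" "y \<noteq> \<zero>"
  shows "inv (x \<otimes> y) = inv x \<otimes> inv y"
proof (rule comm_inv_char)
  have "x \<otimes> y \<otimes> (inv x \<otimes> inv y) = (x \<otimes> inv x) \<otimes> (y \<otimes> inv y)" using assms by (simp add: m_ac del: inv_nz(2,3))
  thus "x \<otimes> y \<otimes> (inv x \<otimes> inv y) = \<one>" using assms by simp
qed (use assms in auto)

end

locale numfield = field +
  assumes number_field: "number_field R"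
begin

abbreviation ZK :: "'a set" where "ZK \<equiv> ring_of_integers R"

lemma zint_eq_0_iff: "zint m = \<zero> \<longleftrightarrow> m = 0"
proof
  assume 0: "zint m = \<zero>"
  have nz: "add_pow R n \<one> \<noteq> \<zero>" if "n > 0" for n :: nat
    using number_field that by (simp add: number_field_def char_zero_def)
  show "m = 0"
  proof (rule ccontr)
    assume "m \<noteq> 0"
    then consider "m > 0" | "- m > 0" by linarith
    thus False
    proof cases
      case 1 thus ?thesis using nz[of "nat m"] 0 add_pow_int_ge[of m R \<one>] by simp
    next
      case 2
      have "zint (- m) = \<zero>" using 0 zint_neg[of m] by simp
      thus ?thesis using nz[of "nat (- m)"] 2 add_pow_int_ge[of "-m" R \<one>] by simp
    qed
  qed
qed (simp add: zint_0)

lemma pow_in_zspan: "i < n ==> x [^] (i::nat) \<in> zspan (pows x n)"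
  by (rule zspan_incl) auto

lemma ZK_carrier: "x \<in> ZK ==> x \<in> carrier R" by (simp add: ring_of_integers_def)

lemma ZK_I:
  assumes "x \<in> carrier R" "finite E" "E \<subseteq> carrier R" "\<one> \<in> zspan E" "!!e. e \<in> E ==> x \<otimes> e \<in> zspan E"
  shows "x \<in> ZK"
  using integral_criterion[OF one_not_zero assms] .

lemma ZK_D: "x \<in> ZK ==> \<exists>n>0. x [^] n \<in> zspan (pows x n)"
proof -
  assume x: "x \<in> ZK"
  then obtain n where n: "x [^] n \<in> zspan (pows x n)" using ring_of_integers_iff[OF one_not_zero] by blast
  have "n > 0"
  proof (rule ccontr)
    assume "\<not> n > 0"
    hence "x [^] n = \<one>" "pows x n = {}" by auto
    thus False using n add.generate_empty by simp
  qed
  thus ?thesis using n by blast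
qed

lemma ZK_one: "\<one> \<in> ZK"
  by (rule ZK_I[of _ "{\<one>}"]) (auto intro: zspan_incl)

abbreviation pows2 :: "'a => nat => 'a => nat => 'a set"
  where "pows2 x n y m \<equiv> (%(i::nat, j::nat). x [^] i \<otimes> y [^] j) ` ({..<n} \<times> {..<m})"

text \<open>The monomials in \<open>x\<close> and \<open>y\<close> below the degrees of their
  relations span a module stable under both elements, so that \<open>integral_criterion\<close>
  applies to sums and products alike.\<close>

lemma ZK_pair:
  assumes x: "x \<in> ZK" and y: "y \<in> ZK"
  obtains E where "finite E" "E \<subseteq> carrier R" "\<one> \<in> zspan E" "!!e. e \<in> E ==> x \<otimes> e \<in> zspan E"
    "!!e. e \<in> E ==> y \<otimes> e \<in> zspan E"
proof -
  note xc = ZK_carrier[OF x] and yc = ZK_carrier[OF y]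
  obtain n where n: "n > 0" "x [^] n \<in> zspan (pows x n)" using ZK_D[OF x] by blast
  obtain m where m: "m > 0" "y [^] m \<in> zspan (pows y m)" using ZK_D[OF y] by blast
  define E where "E = pows2 x n y m"
  have E: "finite E" "E \<subseteq> carrier R" unfolding E_def using xc yc by auto
  note M = zspan_subgroup[OF E(2)]
  have inc: "x [^] i \<otimes> y [^] j \<in> zspan E" if "i < n" "j < m" for i j
    by (rule zspan_incl) (use that in \<open>auto simp: E_def image_iff\<close>)
  have 1: "w \<otimes> y [^] j \<in> zspan E" if "w \<in> zspan (pows x n)" "j < m" for w j
    by (rule zspan_mult_closed2[OF pows_carrier[OF xc] _ M _ that(1)]) (use yc inc that in auto)
  have 2: "x [^] i \<otimes> w \<in> zspan E" if "w \<in> zspan (pows y m)" "i < n" for w i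
    by (rule zspan_mult_closed[OF pows_carrier[OF yc] _ M _ that(1)]) (use xc inc that in auto)
  show ?thesis
  proof (rule that[OF E])
    show "\<one> \<in> zspan E" using inc[OF n(1) m(1)] by simp
  next
    fix e assume "e \<in> E"
    then obtain i j where ij: "e = x [^] i \<otimes> y [^] j" "i < n" "j < m" by (auto simp: E_def)
    have "x [^] (Suc i) \<in> zspan (pows x n)"
      using n ij pow_in_zspan[of "Suc i" n x] by (cases "Suc i = n") auto
    hence "x [^] (Suc i) \<otimes> y [^] j \<in> zspan E" using 1 ij by blast
    thus "x \<otimes> e \<in> zspan E" using ij xc yc by (simp add: m_ac)
    have "y [^] (Suc j) \<in> zspan (pows y m)"
      using m ij pow_in_zspan[of "Suc j" m y] by (cases "Suc j = m") auto
    hence "x [^] i \<otimes> y [^] (Suc j) \<in> zspan E" using 2 ij by blast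
    thus "y \<otimes> e \<in> zspan E" using ij xc yc by (simp add: m_ac)
  qed
qed

lemma ZK_add: assumes x: "x \<in> ZK" and y: "y \<in> ZK" shows "x \<oplus> y \<in> ZK"
proof -
  obtain E where E: "finite E" "E \<subseteq> carrier R" "\<one> \<in> zspan E" "!!e. e \<in> E ==> x \<otimes> e \<in> zspan E"
    "!!e. e \<in> E ==> y \<otimes> e \<in> zspan E" using ZK_pair[OF x y] by blast
  note xc = ZK_carrier[OF x] and yc = ZK_carrier[OF y]
  show ?thesis
  proof (rule ZK_I[OF _ E(1-3)])
    fix e assume e: "e \<in> E"
    have "(x \<oplus> y) \<otimes> e = x \<otimes> e \<oplus> y \<otimes> e" using e E(2) xc yc by (intro l_distr) auto
    thus "(x \<oplus> y) \<otimes> e \<in> zspan E" using zspan_add[OF E(4)[OF e] E(5)[OF e]] by simp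
  qed (use xc yc in auto)
qed

lemma ZK_mult: assumes x: "x \<in> ZK" and y: "y \<in> ZK" shows "x \<otimes> y \<in> ZK"
proof -
  obtain E where E: "finite E" "E \<subseteq> carrier R" "\<one> \<in> zspan E" "!!e. e \<in> E ==> x \<otimes> e \<in> zspan E"
    "!!e. e \<in> E ==> y \<otimes> e \<in> zspan E" using ZK_pair[OF x y] by blast
  note xc = ZK_carrier[OF x] and yc = ZK_carrier[OF y]
  show ?thesis
  proof (rule ZK_I[OF _ E(1-3)])
    fix e assume e: "e \<in> E"
    have "x \<otimes> (y \<otimes> e) \<in> zspan E"
      by (rule zspan_mult_closed[OF E(2) xc zspan_subgroup[OF E(2)] E(4) E(5)[OF e]])
    thus "x \<otimes> y \<otimes> e \<in> zspan E" using e E(2) xc yc by (simp add: m_assoc subsetD)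
  qed (use xc yc in auto)
qed

lemma ZK_uminus: assumes x: "x \<in> ZK" shows "\<ominus> x \<in> ZK"
proof -
  have 1: "\<one> \<in> zspan {\<one>}" by (rule zspan_incl) simp
  have "\<ominus> \<one> \<in> ZK"
    by (rule ZK_I[of _ "{\<one>}"]) (use 1 subgroupD(5)[OF zspan_subgroup 1] in auto)
  hence "\<ominus> \<one> \<otimes> x \<in> ZK" using x by (rule ZK_mult)
  thus ?thesis using ZK_carrier[OF x] by (simp add: l_minus)
qed

lemma ZK_minus: "x \<in> ZK ==> y \<in> ZK ==> x \<ominus> y \<in> ZK"
  by (simp add: a_minus_def ZK_add ZK_uminus)

lemma ZK_zero: "\<zero> \<in> ZK" using ZK_minus[OF ZK_one ZK_one] by (simp add: r_neg a_minus_def)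

lemma ZK_pow: "x \<in> ZK ==> x [^] (n::nat) \<in> ZK"
  by (induction n) (auto simp: ZK_one ZK_mult)

lemma ZK_subgroup: "subgroup ZK (add_monoid R)"
  by (rule subgroupI_add) (auto simp: ZK_carrier ZK_zero ZK_add ZK_uminus)

lemma ZK_zint: "zint m \<in> ZK" using subgroupD(7)[OF ZK_subgroup ZK_one] .

lemma ZK_zspan: "E \<subseteq> ZK ==> x \<in> zspan E ==> x \<in> ZK"
  using zspan_least[OF ZK_subgroup] by blast

lemma ZK_subring: "subring ZK R"
  by (rule subringI) (auto simp: ZK_carrier ZK_one ZK_add ZK_uminus ZK_mult)

text \<open>With \<open>c\<close> the integral difference, the products of powers of
  \<open>z\<close> below \<open>n\<close> and powers of \<open>c\<close> below \<open>k\<close> span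
  a module stable under \<open>z\<close>: at the top, \<open>z [^] n\<close> is replaced by
  \<open>z [^] m \<oplus> c\<close>. Combined with \<open>ZK_pigeonhole\<close>, this proves
  integrality of an element whose powers have a common denominator.\<close>

lemma ZK_pow_diff:
  fixes m n :: nat
  assumes z: "z \<in> carrier R" and mn: "m < n" and c: "z [^] n \<ominus> z [^] m \<in> ZK"
  shows "z \<in> ZK"
proof -
  define c where "c = z [^] n \<ominus> z [^] m"
  have cc: "c \<in> ZK" "c \<in> carrier R" using c c_def z by auto
  have "z [^] n \<in> carrier R" "z [^] m \<in> carrier R" using z by auto
  hence zn: "z [^] n = z [^] m \<oplus> c" unfolding c_def by algebra
  obtain k where k: "k > 0" "c [^] k \<in> zspan (pows c k)" using ZK_D[OF cc(1)] by blast
  define E where "E = pows2 z n c k"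
  have E: "finite E" "E \<subseteq> carrier R" unfolding E_def using cc z by auto
  note M = zspan_subgroup[OF E(2)]
  have inc: "z [^] i \<otimes> c [^] j \<in> zspan E" if "i < n" "j < k" for i j
    by (rule zspan_incl) (use that in \<open>auto simp: E_def image_iff\<close>)
  have 2: "w \<in> zspan E" if "w \<in> zspan (pows c k)" for w
  proof -
    have "\<one> \<otimes> w \<in> zspan E"
      by (rule zspan_mult_closed[OF pows_carrier[OF cc(2)] _ M _ that(1)]) (use cc inc[of 0] mn in auto)
    thus ?thesis using zspan_carrier[OF pows_carrier[OF cc(2)] that] by simp
  qed
  show ?thesis
  proof (rule ZK_I[OF z E])
    show "\<one> \<in> zspan E" using inc[of 0 0] mn k by simp
  next
    fix e assume "e \<in> E"
    then obtain i j where ij: "e = z [^] i \<otimes> c [^] j" "i < n" "j < k" by (auto simp: E_def)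
    have ze: "z \<otimes> e = z [^] (Suc i) \<otimes> c [^] j" using ij z cc by (simp add: m_ac)
    show "z \<otimes> e \<in> zspan E"
    proof (cases "Suc i = n")
      case False
      hence "z [^] (Suc i) \<otimes> c [^] j \<in> zspan E" by (intro inc) (use ij in auto)
      thus ?thesis using ze by simp
    next
      case True
      hence "z \<otimes> e = (z [^] m \<oplus> c) \<otimes> c [^] j" using ze zn by metis
      also have "... = z [^] m \<otimes> c [^] j \<oplus> c [^] (Suc j)" using z cc by (simp add: l_distr m_comm[of "c [^] j"])
      finally have ze2: "z \<otimes> e = z [^] m \<otimes> c [^] j \<oplus> c [^] (Suc j)" .
      have "c [^] (Suc j) \<in> zspan (pows c k)"
        using k ij pow_in_zspan[of "Suc j" k c] by (cases "Suc j = k") auto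
      thus ?thesis unfolding ze2 using 2 inc[OF mn ij(3)] zspan_add by blast
    qed
  qed
qed

section \<open>Integer linear relations in a number field\<close>

lemma prime_field_fraction:
  assumes "q \<in> generate_field R {}"
  shows "q \<in> carrier R \<and> (\<exists>b a. b > 0 \<and> zint b \<otimes> q = zint a)"
  using assms
proof (induction rule: generate_field.induct)
  case one
  have "zint 1 \<otimes> \<one> = zint 1" by simp
  thus ?case by (metis one_closed zero_less_one)
next
  case (incl h) thus ?case by simp
next
  case (a_inv h)
  then obtain b a where "h \<in> carrier R" "b > 0" "zint b \<otimes> h = zint a" by blast
  hence "zint b \<otimes> (\<ominus> h) = zint (- a)" by (simp add: zint_neg r_minus del: add.int_pow_neg)
  thus ?case using \<open>b > 0\<close> \<open>h \<in> carrier R\<close> by blast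
next
  case (m_inv h)
  then obtain b a where h: "h \<in> carrier R" "b > 0" "zint b \<otimes> h = zint a" by blast
  have ih: "inv h \<in> carrier R" "h \<otimes> inv h = \<one>" using m_inv h by auto
  have a0: "a \<noteq> 0"
  proof
    assume "a = 0"
    hence "zint b \<otimes> h = \<zero>" using h(3) zint_0 by simp
    thus False using h m_inv zint_eq_0_iff[of b] integral[of "zint b" h] by auto
  qed
  have "zint a \<otimes> inv h = zint b \<otimes> (h \<otimes> inv h)" using h ih by (metis m_assoc zint_closed)
  hence eq: "zint a \<otimes> inv h = zint b" using ih by simp
  show ?case
  proof (cases "a > 0")
    case True thus ?thesis using eq ih by blast
  next
    case False
    have "zint (-a) \<otimes> inv h = zint (- b)" using eq ih by (simp only: zint_neg l_minus zint_closed)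
    thus ?thesis using False a0 ih by (metis linorder_neqE_linordered_idom neg_0_less_iff_less)
  qed
next
  case (eng_add h1 h2)
  then obtain b1 a1 b2 a2 where h: "h1 \<in> carrier R" "h2 \<in> carrier R" "b1 > 0" "b2 > 0"
    "zint b1 \<otimes> h1 = zint a1" "zint b2 \<otimes> h2 = zint a2" by blast
  have "zint (b1 * b2) \<otimes> (h1 \<oplus> h2) = zint b2 \<otimes> (zint b1 \<otimes> h1) \<oplus> zint b1 \<otimes> (zint b2 \<otimes> h2)"
    unfolding zint_times using h(1,2) zint_closed[of b1] zint_closed[of b2] by algebra
  also have "... = zint (b2 * a1 + b1 * a2)" by (simp only: h zint_add zint_times)
  finally show ?case using h by (metis add.m_closed mult_pos_pos)
next
  case (eng_mult h1 h2)
  then obtain b1 a1 b2 a2 where h: "h1 \<in> carrier R" "h2 \<in> carrier R" "b1 > 0" "b2 > 0"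
    "zint b1 \<otimes> h1 = zint a1" "zint b2 \<otimes> h2 = zint a2" by blast
  have "zint (b1 * b2) \<otimes> (h1 \<otimes> h2) = (zint b1 \<otimes> h1) \<otimes> (zint b2 \<otimes> h2)"
    unfolding zint_times using h(1,2) zint_closed[of b1] zint_closed[of b2] by algebra
  also have "... = zint (a1 * a2)" by (simp only: h zint_times)
  finally show ?case using h by (metis m_closed mult_pos_pos)
qed

definition icomb :: "int list => 'a list => 'a" where "icomb cs Us = combine (map zint cs) Us"

lemma icomb_simps [simp]: "icomb [] Us = \<zero>" "icomb cs [] = \<zero>"
  "icomb (c # cs) (u # Us) = zint c \<otimes> u \<oplus> icomb cs Us"
  by (simp_all add: icomb_def)

lemma icomb_closed: "set Us \<subseteq> carrier R ==> icomb cs Us \<in> carrier R"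
  unfolding icomb_def by (rule combine_in_carrier) auto

lemma common_denominator:
  assumes "set Ks \<subseteq> generate_field R {}"
  shows "\<exists>b>0. \<exists>cs. map (%k. zint b \<otimes> k) Ks = map zint cs"
  using assms
proof (induction Ks)
  case Nil thus ?case by (intro exI[of _ 1]) auto
next
  case (Cons k Ks)
  then obtain b cs where b: "b > 0" "map (%k. zint b \<otimes> k) Ks = map zint cs" by auto
  obtain b' a' where k: "k \<in> carrier R" "b' > 0" "zint b' \<otimes> k = zint a'"
    using prime_field_fraction[of k] Cons.prems by (metis list.set_intros(1) subsetD)
  have Kc: "set Ks \<subseteq> carrier R" using prime_field_fraction Cons.prems by auto
  have "map (%k. zint (b * b') \<otimes> k) Ks = map (%c. zint b' \<otimes> c) (map (%k. zint b \<otimes> k) Ks)"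
  proof -
    have "zint (b * b') \<otimes> k = zint b' \<otimes> (zint b \<otimes> k)" if "k \<in> carrier R" for k
      unfolding zint_times using that zint_closed[of b] zint_closed[of b'] by algebra
    thus ?thesis using Kc by auto
  qed
  also have "... = map zint (map (%c. b' * c) cs)" unfolding b by (simp add: zint_times del: add.int_pow_closed)
  finally have 1: "map (%k. zint (b * b') \<otimes> k) Ks = map zint (map (%c. b' * c) cs)" .
  have "zint (b * b') \<otimes> k = zint (b * a')"
    unfolding zint_times using k zint_closed[of b] zint_closed[of b'] by (metis m_assoc)
  hence "map (%k. zint (b * b') \<otimes> k) (k # Ks) = map zint (b * a' # map (%c. b' * c) cs)" using 1 by simp
  thus ?case using b k by (metis mult_pos_pos)
qed

text \<open>The number \<open>n\<close> is the degree of the field: more elements than that are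
  dependent over the prime field, and clearing denominators makes the coefficients integers.\<close>

lemma integer_relation:
  "\<exists>n. \<forall>Us. set Us \<subseteq> carrier R \<and> length Us > n -->
    (\<exists>cs. length cs = length Us \<and> icomb cs Us = \<zero> \<and> (\<exists>c\<in>set cs. c \<noteq> 0))"
proof -
  let ?Q = "generate_field R {}"
  have Q: "subfield ?Q R" by (rule generate_field_is_subfield) simp
  obtain n where n: "dimension n ?Q (carrier R)"
    using number_field unfolding number_field_def finite_dimension_def by blast
  show ?thesis
  proof (intro exI[of _ n] allI impI, elim conjE)
    fix Us assume Us: "set Us \<subseteq> carrier R" "length Us > n"
    have "dependent ?Q Us" using independent_length_le_dimension[OF Q n] Us by (metis not_less)
    then obtain Ks where Ks: "set Ks \<subseteq> ?Q" "combine Ks Us = \<zero>" "\<not> set (take (length Us) Ks) \<subseteq> {\<zero>}"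
      using trivial_combine_imp_independent[OF Q Us(1)] by blast
    \<comment> \<open>\<open>combine\<close> ignores the surplus entries of the longer list. Cutting
      \<open>Ks\<close> and padding it with zeros gives exactly one coefficient for each
      vector.\<close>
    define Ls where "Ls = take (length Us) Ks @ replicate (length Us - length Ks) \<zero>"
    have z: "\<zero> \<in> ?Q" by (rule zero_in_generate)
    have "set (take (length Us) Ks) \<subseteq> ?Q" using Ks(1) set_take_subset[of "length Us" Ks] by blast
    hence L: "set Ls \<subseteq> ?Q" "length Ls = length Us" unfolding Ls_def using z by auto
    have Lc: "set Ls \<subseteq> carrier R" using L prime_field_fraction by blast
    have L0: "combine Ls Us = \<zero>" using Ks(2) unfolding Ls_def combine_append_replicate[OF Us(1)] combine_take .
    have Lnz: "\<not> set Ls \<subseteq> {\<zero>}" using Ks(3) unfolding Ls_def by auto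
    obtain b cs where b: "b > 0" "map (%k. zint b \<otimes> k) Ls = map zint cs" using common_denominator[OF L(1)] by blast
    have "icomb cs Us = zint b \<otimes> combine Ls Us"
      using combine_r_distr[OF Lc Us(1) zint_closed[of b]] b(2) by (simp add: icomb_def)
    hence "icomb cs Us = \<zero>" using L0 by simp
    moreover have "length cs = length Us" using b(2) L(2) by (metis length_map)
    moreover have "\<exists>c\<in>set cs. c \<noteq> 0"
    proof (rule ccontr)
      assume "\<not> (\<exists>c\<in>set cs. c \<noteq> 0)"
      hence "set (map zint cs) \<subseteq> {\<zero>}" using zint_0 by auto
      hence *: "\<forall>k\<in>set Ls. zint b \<otimes> k = \<zero>" unfolding b(2)[symmetric] by auto
      have "k = \<zero>" if "k \<in> set Ls" for k
        using * that Lc integral[of "zint b" k] zint_eq_0_iff[of b] b(1) by auto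
      thus False using Lnz by blast
    qed
    ultimately show "\<exists>cs. length cs = length Us \<and> icomb cs Us = \<zero> \<and> (\<exists>c\<in>set cs. c \<noteq> 0)" by blast
  qed
qed

lemma icomb_scale:
  "set Us \<subseteq> carrier R ==> icomb (map (%c. k * c) cs) Us = zint k \<otimes> icomb cs Us"
proof -
  assume Us: "set Us \<subseteq> carrier R"
  have "map zint (map (%c. k * c) cs) = map ((\<otimes>) (zint k)) (map zint cs)"
    by (simp add: zint_times del: add.int_pow_closed)
  moreover have "set (map zint cs) \<subseteq> carrier R" by auto
  ultimately show ?thesis using combine_r_distr[OF _ Us zint_closed[of k], of "map zint cs"] by (metis icomb_def)
qed

lemma icomb_lincomb:
  assumes "set Us \<subseteq> carrier R"
  shows "icomb (map (%c. f c + k * g c) cs) Us = icomb (map f cs) Us \<oplus> zint k \<otimes> icomb (map g cs) Us"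
  using assms
proof (induction cs arbitrary: Us)
  case Nil thus ?case by simp
next
  case (Cons c cs)
  show ?case
  proof (cases Us)
    case Nil thus ?thesis by simp
  next
    case (Cons u Us')
    have c: "u \<in> carrier R" "set Us' \<subseteq> carrier R" using Cons.prems Cons by auto
    have cc: "icomb (map f cs) Us' \<in> carrier R" "icomb (map g cs) Us' \<in> carrier R"
      by (rule icomb_closed[OF c(2)])+
    have e: "zint (f c + k * g c) = zint (f c) \<oplus> zint k \<otimes> zint (g c)"
      by (simp only: zint_add zint_times)
    have "icomb (map (%c. f c + k * g c) (c # cs)) Us
      = (zint (f c) \<oplus> zint k \<otimes> zint (g c)) \<otimes> u \<oplus> (icomb (map f cs) Us' \<oplus> zint k \<otimes> icomb (map g cs) Us')"
      unfolding Cons using Cons.IH[OF c(2)] e by simp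
    also have "... = (zint (f c) \<otimes> u \<oplus> icomb (map f cs) Us') \<oplus> zint k \<otimes> (zint (g c) \<otimes> u \<oplus> icomb (map g cs) Us')"
    proof -
      have "(a \<oplus> b \<otimes> a') \<otimes> u \<oplus> (w \<oplus> b \<otimes> w') = (a \<otimes> u \<oplus> w) \<oplus> b \<otimes> (a' \<otimes> u \<oplus> w')"
        if "a \<in> carrier R" "a' \<in> carrier R" "b \<in> carrier R" "w \<in> carrier R" "w' \<in> carrier R" for a a' b w w'
        using that c(1) by algebra
      thus ?thesis using cc by simp
    qed
    finally show ?thesis unfolding Cons by simp
  qed
qed

lemma ZK_icomb: "set Us \<subseteq> ZK ==> icomb cs Us \<in> ZK"
proof (induction cs arbitrary: Us)
  case Nil thus ?case by (simp add: ZK_zero)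
next
  case (Cons c cs)
  thus ?case by (cases Us) (auto simp: ZK_zero ZK_add ZK_mult ZK_zint)
qed

text \<open>Dividing by \<open>p\<close> as long as all coefficients are divisible comes to an end,
  because the sum of their absolute values decreases.\<close>

lemma primitive_relation:
  assumes "length cs = length Us" "icomb cs Us = \<zero>" "\<exists>c\<in>set cs. c \<noteq> 0" "set Us \<subseteq> carrier R" "p > (1::int)"
  shows "\<exists>cs. length cs = length Us \<and> icomb cs Us = \<zero> \<and> (\<exists>c\<in>set cs. \<not> p dvd c)"
  using assms(1-3)
proof (induction "sum_list (map (%c. nat \<bar>c\<bar>) cs)" arbitrary: cs rule: less_induct)
  case less
  show ?case
  proof (cases "\<exists>c\<in>set cs. \<not> p dvd c")
    case True thus ?thesis using less by blast
  next
    case False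
    define ds where "ds = map (%c. c div p) cs"
    have cs: "cs = map (%c. p * c) ds" unfolding ds_def using False by (auto intro!: map_idI[symmetric])
    have "zint p \<otimes> icomb ds Us = \<zero>" using less(3) icomb_scale[OF assms(4), of p ds] cs by simp
    hence "icomb ds Us = \<zero>"
      using integral[of "zint p"] zint_eq_0_iff[of p] assms(5) icomb_closed[OF assms(4)] zint_closed[of p] by fastforce
    moreover have "\<exists>c\<in>set ds. c \<noteq> 0" using less(4) cs by auto
    moreover have "sum_list (map (%c. nat \<bar>c\<bar>) ds) < sum_list (map (%c. nat \<bar>c\<bar>) cs)"
    proof -
      have "sum_list (map (%c. nat \<bar>c\<bar>) ds) < sum_list (map (%c. nat \<bar>p * c\<bar>) ds)"
        if "\<exists>c\<in>set ds. c \<noteq> 0" for ds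
      proof -
        have le: "nat \<bar>c\<bar> \<le> nat \<bar>p * c\<bar>" for c
          by (rule nat_mono) (use assms(5) in \<open>simp add: abs_mult mult_le_cancel_right1\<close>)
        have lt: "nat \<bar>c\<bar> < nat \<bar>p * c\<bar>" if "c \<noteq> 0" for c
          using assms(5) that by (simp add: abs_mult)
        show ?thesis using that
        proof (induction ds)
          case (Cons d ds)
          have le_sum: "sum_list (map (%c. nat \<bar>c\<bar>) ds) \<le> sum_list (map (%c. nat \<bar>p * c\<bar>) ds)"
            by (rule sum_list_mono) (rule le)
          have a: ?case if "d \<noteq> 0"
          proof -
            have "nat \<bar>d\<bar> + (\<Sum>c\<leftarrow>ds. nat \<bar>c\<bar>) < nat \<bar>p * d\<bar> + (\<Sum>c\<leftarrow>ds. nat \<bar>p * c\<bar>)"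
              using lt[OF that] le_sum by (rule add_less_le_mono)
            thus ?thesis by simp
          qed
          have b: ?case if "d = 0"
          proof -
            have "\<exists>c\<in>set ds. c \<noteq> 0" using Cons.prems that by simp
            thus ?thesis using Cons.IH that by simp
          qed
          show ?case using a b by blast
        qed simp
      qed
      thus ?thesis using \<open>\<exists>c\<in>set ds. c \<noteq> 0\<close> unfolding cs by (simp add: comp_def)
    qed
    ultimately show ?thesis using less(1)[of ds] less(2) ds_def by simp
  qed
qed

section \<open>Finiteness of the residue rings\<close>

definition finite_quot :: "'a => bool" where
  "finite_quot s \<longleftrightarrow> (\<exists>T. finite T \<and> T \<subseteq> ZK \<and> (\<forall>x\<in>ZK. \<exists>t\<in>T. \<exists>y\<in>ZK. x = t \<oplus> s \<otimes> y))"

text \<open>A list that is linearly independent modulo \<open>p\<close> is no longer than the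
  degree, since an integer relation among more elements could be made primitive. So a longest such
  list \<open>Us\<close> exists, and its combinations with coefficients from 0 to
  \<open>p - 1\<close> represent all residues.\<close>

lemma finite_quot_prime:
  assumes "Factorial_Ring.prime (p::int)" "p > 0"
  shows "finite_quot (zint p)"
proof -
  have p1: "p > 1" using assms by (simp add: prime_gt_1_int)
  define ind where "ind = (%Us. set Us \<subseteq> ZK \<and> (\<forall>cs. length cs = length Us \<and> (\<exists>y\<in>ZK. icomb cs Us = zint p \<otimes> y) --> (\<forall>c\<in>set cs. p dvd c)))"
  obtain n where n: "!!Us. set Us \<subseteq> carrier R ==> length Us > n ==>
    (\<exists>cs. length cs = length Us \<and> icomb cs Us = \<zero> \<and> (\<exists>c\<in>set cs. c \<noteq> 0))" using integer_relation by blast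
  have bound: "length Us \<le> n" if "ind Us" for Us
  proof (rule ccontr)
    assume "\<not> length Us \<le> n"
    hence len: "n < length Us" by simp
    have Uc: "set Us \<subseteq> carrier R" using that ZK_carrier by (auto simp: ind_def)
    obtain cs where "length cs = length Us" "icomb cs Us = \<zero>" "\<exists>c\<in>set cs. c \<noteq> 0"
      using n[OF Uc len] by blast
    then obtain cs where cs: "length cs = length Us" "icomb cs Us = \<zero>" "\<exists>c\<in>set cs. \<not> p dvd c"
      using primitive_relation Uc p1 by blast
    hence "icomb cs Us = zint p \<otimes> \<zero>" by simp
    thus False using that cs ZK_zero unfolding ind_def by blast
  qed
  have ne: "ind []" by (simp add: ind_def)
  define Us where "Us = (ARG_MAX length Us. ind Us)"
  have U: "ind Us" "!!Vs. ind Vs ==> length Vs \<le> length Us"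
    using arg_max_nat_lemma[of ind "[]" length "Suc n", OF ne] bound unfolding Us_def by (auto simp: less_Suc_eq_le)
  have Uo: "set Us \<subseteq> ZK" and Uc: "set Us \<subseteq> carrier R" using U(1) ZK_carrier by (auto simp: ind_def)
  define T where "T = (%ds. icomb ds Us) ` {ds. set ds \<subseteq> {0..<p} \<and> length ds = length Us}"
  have "finite T" unfolding T_def by (rule finite_imageI) (rule finite_lists_length_eq, simp)
  moreover have "T \<subseteq> ZK" unfolding T_def using ZK_icomb[OF Uo] by auto
  moreover have "\<exists>t\<in>T. \<exists>y\<in>ZK. x = t \<oplus> zint p \<otimes> y" if x: "x \<in> ZK" for x
  proof -
    note xc = ZK_carrier[OF x]
    \<comment> \<open>Maximality yields a relation modulo \<open>p\<close> between \<open>x\<close>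
      and \<open>Us\<close>. The coefficient of \<open>x\<close> is prime to \<open>p\<close>, since
      otherwise \<open>Us\<close> itself would be dependent.\<close>
    have "\<not> ind (x # Us)" using U(2)[of "x # Us"] by auto
    then obtain cs y where cs: "length cs = Suc (length Us)" "y \<in> ZK" "icomb cs (x # Us) = zint p \<otimes> y" "\<exists>c\<in>set cs. \<not> p dvd c"
      unfolding ind_def using x Uo by auto
    obtain c ds where cd: "cs = c # ds" "length ds = length Us" using cs(1) by (cases cs) auto
    note yc = ZK_carrier[OF cs(2)] and dc = icomb_closed[OF Uc, of ds]
    have eq: "zint c \<otimes> x \<oplus> icomb ds Us = zint p \<otimes> y" using cs(3) cd by simp
    have npc: "\<not> p dvd c"
    proof
      assume "p dvd c"
      then obtain k where k: "c = p * k" by blast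
      have "icomb ds Us = zint p \<otimes> y \<ominus> zint c \<otimes> x"
        unfolding eq[symmetric] using xc dc zint_closed[of c] by algebra
      also have "... = zint p \<otimes> (y \<ominus> zint k \<otimes> x)"
        unfolding k zint_times using xc yc zint_closed[of p] zint_closed[of k] by algebra
      finally have "icomb ds Us = zint p \<otimes> (y \<ominus> zint k \<otimes> x)" .
      moreover have "y \<ominus> zint k \<otimes> x \<in> ZK" by (intro ZK_minus ZK_mult ZK_zint cs x)
      ultimately have "\<forall>c\<in>set ds. p dvd c" using U(1) cd(2) unfolding ind_def by blast
      thus False using cs(4) cd \<open>p dvd c\<close> by auto
    qed
    \<comment> \<open>By Bezout, \<open>v\<close> inverts \<open>c\<close> modulo \<open>p\<close>,
      which solves the relation for \<open>x\<close>. The coefficients are then reduced modulo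
      \<open>p\<close>, their quotients going into the multiple of \<open>p\<close>.\<close>
    have "coprime p c" using assms(1) npc by (simp add: prime_imp_coprime)
    then obtain u v where uv: "u * p + v * c = 1" by (metis coprime_iff_gcd_eq_1 bezout_int)
    have cv: "zint v \<otimes> zint c = \<one> \<ominus> zint u \<otimes> zint p"
    proof -
      have "v * c = 1 - u * p" using uv by simp
      hence "zint (v * c) = zint (1 - u * p)" by simp
      thus ?thesis unfolding zint_diff zint_times zint_1 .
    qed
    define ds' where "ds' = map (%d. (- v) * d) ds"
    have d': "icomb ds' Us = zint (- v) \<otimes> icomb ds Us" unfolding ds'_def by (rule icomb_scale[OF Uc])
    have "icomb ds' Us = icomb (map (%d. d mod p + p * (d div p)) ds') Us" by simp
    also have "... = icomb (map (%d. d mod p) ds') Us \<oplus> zint p \<otimes> icomb (map (%d. d div p) ds') Us"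
      by (rule icomb_lincomb[OF Uc])
    finally have red: "icomb ds' Us = icomb (map (%d. d mod p) ds') Us \<oplus> zint p \<otimes> icomb (map (%d. d div p) ds') Us" .
    let ?t = "icomb (map (%d. d mod p) ds') Us" and ?w = "icomb (map (%d. d div p) ds') Us"
    have tw: "?t \<in> carrier R" "?w \<in> carrier R" by (rule icomb_closed[OF Uc])+
    have "x = zint v \<otimes> zint c \<otimes> x \<oplus> zint p \<otimes> (zint u \<otimes> x)"
      unfolding cv using xc zint_closed[of u] zint_closed[of p] by algebra
    also have "zint v \<otimes> zint c \<otimes> x = zint v \<otimes> (zint p \<otimes> y \<ominus> icomb ds Us)"
    proof -
      have "zint c \<otimes> x = zint p \<otimes> y \<ominus> icomb ds Us"
        unfolding eq[symmetric] using xc dc zint_closed[of c] by algebra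
      thus ?thesis using xc zint_closed by (metis m_assoc)
    qed
    also have "zint v \<otimes> (zint p \<otimes> y \<ominus> icomb ds Us) = icomb ds' Us \<oplus> zint p \<otimes> (zint v \<otimes> y)"
      unfolding d' zint_neg using yc dc zint_closed[of v] zint_closed[of p] by algebra
    finally have "x = ?t \<oplus> zint p \<otimes> (?w \<oplus> zint v \<otimes> y \<oplus> zint u \<otimes> x)"
    proof -
      have gen: "(t \<oplus> a \<otimes> w) \<oplus> a \<otimes> (v \<otimes> y) \<oplus> a \<otimes> (u \<otimes> x) = t \<oplus> a \<otimes> (w \<oplus> v \<otimes> y \<oplus> u \<otimes> x)"
        if "t \<in> carrier R" "a \<in> carrier R" "w \<in> carrier R" "u \<in> carrier R" "v \<in> carrier R" for t a w u v
        using that xc yc by algebra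
      show "x = icomb ds' Us \<oplus> zint p \<otimes> (zint v \<otimes> y) \<oplus> zint p \<otimes> (zint u \<otimes> x) ==> ?thesis"
        unfolding red by (erule trans) (rule gen[OF tw(1) zint_closed tw(2) zint_closed zint_closed])
    qed
    moreover have "?w \<oplus> zint v \<otimes> y \<oplus> zint u \<otimes> x \<in> ZK"
      by (intro ZK_add ZK_mult ZK_zint ZK_icomb Uo cs x)
    moreover have "?t \<in> T"
      unfolding T_def using p1 cd ds'_def by (intro imageI) (auto simp: pos_mod_bound)
    ultimately show ?thesis by blast
  qed
  ultimately show ?thesis unfolding finite_quot_def by blast
qed

lemma finite_quot_mult:
  assumes "finite_quot a" "finite_quot b" "a \<in> ZK" "b \<in> ZK"
  shows "finite_quot (a \<otimes> b)"
proof -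
  obtain T where T: "finite T" "T \<subseteq> ZK" "!!x. x \<in> ZK ==> \<exists>t\<in>T. \<exists>y\<in>ZK. x = t \<oplus> a \<otimes> y"
    using assms(1) unfolding finite_quot_def by blast
  obtain T' where T': "finite T'" "T' \<subseteq> ZK" "!!x. x \<in> ZK ==> \<exists>t\<in>T'. \<exists>y\<in>ZK. x = t \<oplus> b \<otimes> y"
    using assms(2) unfolding finite_quot_def by blast
  let ?T = "(%(t, t'). t \<oplus> a \<otimes> t') ` (T \<times> T')"
  have "finite ?T" using T T' by auto
  moreover have "?T \<subseteq> ZK" using T T' assms by (auto intro!: ZK_add ZK_mult)
  moreover have "\<exists>t\<in>?T. \<exists>y\<in>ZK. x = t \<oplus> a \<otimes> b \<otimes> y" if x: "x \<in> ZK" for x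
  proof -
    obtain t y where t: "t \<in> T" "y \<in> ZK" "x = t \<oplus> a \<otimes> y" using T(3)[OF x] by blast
    obtain t' y' where t': "t' \<in> T'" "y' \<in> ZK" "y = t' \<oplus> b \<otimes> y'" using T'(3)[OF t(2)] by blast
    have cs: "t \<in> carrier R" "t' \<in> carrier R" "y' \<in> carrier R" "a \<in> carrier R" "b \<in> carrier R"
      using ZK_carrier t t' T T' assms by auto
    have "x = (t \<oplus> a \<otimes> t') \<oplus> a \<otimes> b \<otimes> y'" unfolding t t' using cs by algebra
    moreover have "t \<oplus> a \<otimes> t' \<in> ?T" using t t' by (intro image_eqI[of _ _ "(t, t')"]) auto
    ultimately show ?thesis using t'(2) by blast
  qed
  ultimately show ?thesis unfolding finite_quot_def by (intro exI[of _ ?T] conjI ballI)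
qed

lemma finite_quot_nat: "n > 0 ==> finite_quot (zint (int n))"
proof (induction n rule: less_induct)
  case (less n)
  show ?case
  proof (cases "n = 1")
    case True
    have "\<exists>t\<in>{\<zero>}. \<exists>y\<in>ZK. x = t \<oplus> \<one> \<otimes> y" if "x \<in> ZK" for x
      using that ZK_carrier[OF that] by (intro bexI[of _ \<zero>] bexI[of _ x]) auto
    hence "finite_quot \<one>" unfolding finite_quot_def
      by (intro exI[of _ "{\<zero>}"] conjI ballI) (auto simp: ZK_zero)
    thus ?thesis using True zint_1 by simp
  next
    case False
    then obtain p where p: "Factorial_Ring.prime p" "p dvd n" using prime_factor_nat by blast
    then obtain k where k: "n = p * k" by blast
    have "k < n" "k > 0" using k less.prems p(1) prime_gt_1_nat by auto
    hence "finite_quot (zint (int k))" using less by blast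
    moreover have "finite_quot (zint (int p))" by (rule finite_quot_prime) (use p prime_gt_0_nat in auto)
    ultimately have "finite_quot (zint (int p) \<otimes> zint (int k))" using finite_quot_mult ZK_zint by blast
    thus ?thesis by (simp only: k of_nat_mult zint_times)
  qed
qed

text \<open>In a relation of least degree for \<open>s\<close> the constant term \<open>k\<close> is
  nonzero, since otherwise \<open>s\<close> could be cancelled. All other terms are multiples of
  \<open>s\<close>, so \<open>s\<close> divides \<open>k\<close>.\<close>

lemma ZK_divides_int:
  assumes s: "s \<in> ZK" "s \<noteq> \<zero>"
  shows "\<exists>n>0. \<exists>t\<in>ZK. s \<otimes> t = zint (int n)"
proof -
  note sc = ZK_carrier[OF s(1)]
  define n where "n = (LEAST n. s [^] n \<in> zspan (pows s n))"
  have ex: "\<exists>n. s [^] n \<in> zspan (pows s n)" using ZK_D[OF s(1)] by blast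
  have n: "s [^] n \<in> zspan (pows s n)" unfolding n_def using LeastI_ex[OF ex] .
  have nmin: "n \<le> m" if "s [^] m \<in> zspan (pows s m)" for m unfolding n_def using that by (rule Least_le)
  have "n > 0"
  proof (rule ccontr)
    assume "\<not> n > 0"
    thus False using n add.generate_empty by simp
  qed
  then obtain m where m: "n = Suc m" using gr0_implies_Suc by blast
  \<comment> \<open>This splits off the constant term: the remaining powers are \<open>s\<close>
    times the first \<open>m\<close> powers.\<close>
  have "pows s (Suc m) = insert \<one> ((%w. s \<otimes> w) ` pows s m)"
  proof -
    have "{..<Suc m} = insert 0 (Suc ` {..<m})" by (rule lessThan_Suc_eq_insert_0)
    hence "pows s (Suc m) = insert (s [^] (0::nat)) ((%i. s [^] Suc i) ` {..<m})"
      by (simp only: image_insert image_image)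
    also have "(%i. s [^] Suc i) = (%i::nat. s \<otimes> s [^] i)" using sc nat_pow_Suc2 by blast
    finally show ?thesis by (simp only: image_image nat_pow_0)
  qed
  hence "s [^] n \<in> zspan (insert \<one> ((%w. s \<otimes> w) ` pows s m))" using n m by simp
  moreover have "(%w. s \<otimes> w) ` pows s m \<subseteq> carrier R" using sc by auto
  ultimately obtain k :: int and g where kg: "s [^] n = zint k \<oplus> g" "g \<in> zspan ((%w. s \<otimes> w) ` pows s m)"
    using subsetD[OF add.generate_insert_subset[of \<one> "(%w. s \<otimes> w) ` pows s m"]] one_closed
    by blast
  have "zspan ((%w. s \<otimes> w) ` pows s m) \<subseteq> (%w. s \<otimes> w) ` zspan (pows s m)"
  proof (rule zspan_least)
    note P = subgroupD[OF zspan_subgroup[OF pows_carrier[OF sc, of m]]]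
    show "subgroup ((%w. s \<otimes> w) ` zspan (pows s m)) (add_monoid R)"
    proof (rule subgroupI_add)
      show "(\<otimes>) s ` zspan (pows s m) \<subseteq> carrier R" using P(2) sc by blast
      show "\<zero> \<in> (\<otimes>) s ` zspan (pows s m)" using sc by (intro image_eqI[OF _ P(1)]) simp
    next
      fix x y assume "x \<in> (\<otimes>) s ` zspan (pows s m)" "y \<in> (\<otimes>) s ` zspan (pows s m)"
      then obtain a b where "a \<in> zspan (pows s m)" "b \<in> zspan (pows s m)" "x = s \<otimes> a" "y = s \<otimes> b" by blast
      thus "x \<oplus> y \<in> (\<otimes>) s ` zspan (pows s m)"
        using P(4)[of a b] by (intro image_eqI[of _ _ "a \<oplus> b"]) (simp_all only: r_distr[OF P(3) P(3) sc])
    next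
      fix x assume "x \<in> (\<otimes>) s ` zspan (pows s m)"
      then obtain a where "a \<in> zspan (pows s m)" "x = s \<otimes> a" by blast
      thus "\<ominus> x \<in> (\<otimes>) s ` zspan (pows s m)"
        using P(5)[of a] by (intro image_eqI[of _ _ "\<ominus> a"]) (simp_all only: r_minus[OF sc P(3)])
    qed
    show "(\<otimes>) s ` pows s m \<subseteq> (\<otimes>) s ` zspan (pows s m)" by (rule image_mono) (auto intro: pow_in_zspan)
  qed
  then obtain w where w: "w \<in> zspan (pows s m)" "g = s \<otimes> w" using kg by blast
  have wo: "w \<in> ZK" by (rule ZK_zspan[OF _ w(1)]) (use ZK_pow s in auto)
  note wc = ZK_carrier[OF wo]
  define t where "t = s [^] m \<ominus> w"
  have t: "t \<in> ZK" unfolding t_def by (intro ZK_minus ZK_pow s wo)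
  have st: "s \<otimes> t = zint k"
  proof -
    have sm: "s [^] m \<in> carrier R" using sc by simp
    have "s [^] n = s \<otimes> s [^] m" unfolding m using sc by (simp add: m_comm)
    moreover have "s \<otimes> t = s \<otimes> s [^] m \<ominus> s \<otimes> w" unfolding t_def using sc wc sm by algebra
    ultimately have "s \<otimes> t = s [^] n \<ominus> s \<otimes> w" by simp
    also have "... = zint k" unfolding kg(1) w(2) using sc wc zint_closed[of k] by algebra
    finally show ?thesis .
  qed
  have "k \<noteq> 0"
  proof
    assume "k = 0"
    hence "s \<otimes> t = \<zero>" using st zint_0 by simp
    hence "t = \<zero>" using s sc t ZK_carrier integral by blast
    hence "s [^] m = w" unfolding t_def using sc wc by (simp add: r_right_minus_eq)
    hence "n \<le> m" using nmin[of m] w by simp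
    thus False using m by simp
  qed
  then consider "k > 0" | "- k > 0" by linarith
  thus ?thesis
  proof cases
    case 1
    hence "s \<otimes> t = zint (int (nat k))" using st by simp
    thus ?thesis using t 1 by (metis zero_less_nat_eq)
  next
    case 2
    have "s \<otimes> (\<ominus> t) = zint (- k)" unfolding zint_neg st[symmetric] using sc t ZK_carrier by (simp add: r_minus)
    hence "s \<otimes> (\<ominus> t) = zint (int (nat (- k)))" using 2 by simp
    thus ?thesis using ZK_uminus[OF t] 2 by (metis zero_less_nat_eq)
  qed
qed

text \<open>Representatives modulo a multiple of \<open>s\<close> also serve modulo
  \<open>s\<close>, and \<open>s\<close> divides a positive integer.\<close>

lemma finite_quot:
  assumes s: "s \<in> ZK" "s \<noteq> \<zero>"
  shows "finite_quot s"
proof -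
  obtain n t where nt: "n > 0" "t \<in> ZK" "s \<otimes> t = zint (int n)" using ZK_divides_int[OF s] by blast
  obtain T where T: "finite T" "T \<subseteq> ZK" "!!x. x \<in> ZK ==> \<exists>t\<in>T. \<exists>y\<in>ZK. x = t \<oplus> zint (int n) \<otimes> y"
    using finite_quot_nat[OF nt(1)] unfolding finite_quot_def by blast
  have "\<exists>t\<in>T. \<exists>y\<in>ZK. x = t \<oplus> s \<otimes> y" if x: "x \<in> ZK" for x
  proof -
    obtain t' y where "t' \<in> T" "y \<in> ZK" "x = t' \<oplus> zint (int n) \<otimes> y" using T(3)[OF x] by blast
    hence *: "t' \<in> T" "t \<otimes> y \<in> ZK" "x = t' \<oplus> s \<otimes> t \<otimes> y" "y \<in> carrier R"
      using nt(2) ZK_carrier by (auto simp: ZK_mult nt(3))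
    moreover have "s \<otimes> t \<otimes> y = s \<otimes> (t \<otimes> y)" using *(4) nt(2) s(1) ZK_carrier by (intro m_assoc) auto
    ultimately show ?thesis by auto
  qed
  thus ?thesis unfolding finite_quot_def by (intro exI[of _ T] conjI ballI T)
qed

text \<open>This is how finiteness enters most later arguments: applied to the powers of an element,
  possibly times a constant, it relates two distinct exponents modulo \<open>s\<close>.\<close>

lemma ZK_pigeonhole:
  assumes s: "s \<in> ZK" "s \<noteq> \<zero>" and f: "!!n::nat. f n \<in> ZK"
  shows "\<exists>m n. m < n \<and> (\<exists>y\<in>ZK. f n \<ominus> f m = s \<otimes> y)"
proof -
  obtain T where T: "finite T" "T \<subseteq> ZK" "!!x. x \<in> ZK ==> \<exists>t\<in>T. \<exists>y\<in>ZK. x = t \<oplus> s \<otimes> y"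
    using finite_quot[OF s] unfolding finite_quot_def by blast
  obtain t y where ty: "!!n. t n \<in> T" "!!n. y n \<in> ZK" "!!n. f n = t n \<oplus> s \<otimes> y n"
    using T(3)[OF f] by metis
  have "\<not> inj t" using T(1) ty(1) by (meson finite_subset image_subsetI range_inj_infinite)
  then obtain m n where mn: "m \<noteq> n" "t m = t n" by (auto simp: inj_on_def)
  have d: "f n \<ominus> f m = s \<otimes> (y n \<ominus> y m)" if "t m = t n" for m n
  proof -
    have "t n \<in> carrier R" "y n \<in> carrier R" "y m \<in> carrier R" "s \<in> carrier R"
      using subsetD[OF T(2) ty(1)] ty(2) ZK_carrier s by auto
    thus ?thesis unfolding ty(3) that by algebra
  qed
  show ?thesis
  proof (cases "m < n")
    case True thus ?thesis using d[OF mn(2)] ty ZK_minus by blast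
  next
    case False thus ?thesis using d[OF mn(2)[symmetric]] ty ZK_minus mn(1) by (metis linorder_neqE_nat)
  qed
qed

text \<open>The leading coefficient of an integer polynomial relation for \<open>k\<close> is a
  denominator: its product \<open>y\<close> with \<open>k\<close> satisfies a monic
  relation.\<close>

lemma fraction:
  assumes k: "k \<in> carrier R"
  shows "\<exists>s\<in>ZK. s \<noteq> \<zero> \<and> s \<otimes> k \<in> ZK"
proof -
  obtain n where n: "!!Us. set Us \<subseteq> carrier R ==> length Us > n ==>
    (\<exists>cs. length cs = length Us \<and> icomb cs Us = \<zero> \<and> (\<exists>c\<in>set cs. c \<noteq> 0))" using integer_relation by blast
  have "set (exp_base k (Suc n)) \<subseteq> carrier R" "length (exp_base k (Suc n)) > n"
    using k by (auto simp: exp_base_def)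
  then obtain cs where cs: "length cs = Suc n" "icomb cs (exp_base k (Suc n)) = \<zero>" "\<exists>c\<in>set cs. c \<noteq> 0"
    using n[of "exp_base k (Suc n)"] by (auto simp: exp_base_def)
  have ev: "eval (map zint cs) k = \<zero>" using combine_eq_eval[of "map zint cs" k] cs by (simp add: icomb_def)
  \<comment> \<open>The relation found may begin with zeros; these are dropped to reach a nonzero
    leading coefficient \<open>c\<close>.\<close>
  have "\<exists>c cs'. c \<noteq> 0 \<and> eval (map zint (c # cs')) k = \<zero>" using ev cs(3)
  proof (induction cs)
    case (Cons c cs)
    show ?case
    proof (cases "c = 0")
      case True
      have "set (map zint cs) \<subseteq> carrier R" by auto
      hence "eval (map zint cs) k \<in> carrier R" using k by (rule eval_in_carrier)
      hence "eval (map zint cs) k = \<zero>" using Cons.prems(1) True k zint_0 by simp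
      thus ?thesis using Cons True by auto
    next
      case False thus ?thesis using Cons.prems by blast
    qed
  qed simp
  then obtain c cs' where c: "c \<noteq> 0" "eval (map zint (c # cs')) k = \<zero>" by blast
  define EV where "EV = (%ds. eval (map zint ds) k)"
  have EV_closed: "EV ds \<in> carrier R" for ds
    unfolding EV_def by (rule eval_in_carrier[OF _ k]) auto
  have EV_Cons: "EV (d # ds) = zint d \<otimes> k [^] length ds \<oplus> EV ds" for d ds by (simp add: EV_def)
  define z where "z = zint c"
  have z: "z \<in> carrier R" "z \<noteq> \<zero>" "z \<in> ZK" using c zint_eq_0_iff zint_closed ZK_zint by (auto simp: z_def simp del: add.int_pow_closed)
  define y where "y = z \<otimes> k"
  have yc: "y \<in> carrier R" using z k y_def by simp
  \<comment> \<open>Multiplied by \<open>z [^] length ds\<close>, the value \<open>EV ds\<close> of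
    a polynomial at \<open>k\<close> becomes a value at \<open>y\<close> with one factor
    \<open>z\<close> to spare. Cancelling this factor in the full relation leaves \<open>y\<close>
    with leading coefficient \<one>.\<close>
  have claim: "\<exists>w\<in>zspan (pows y (length ds)). z [^] (length ds) \<otimes> EV ds = z \<otimes> w" for ds
  proof (induction ds)
    case Nil thus ?case using zspan_zero[of "{}"] z by (auto simp: EV_def intro!: bexI[of _ \<zero>])
  next
    case (Cons d ds)
    then obtain w where w: "w \<in> zspan (pows y (length ds))" "z [^] (length ds) \<otimes> EV ds = z \<otimes> w" by blast
    have wc: "w \<in> carrier R" using zspan_carrier[OF pows_carrier[OF yc]] w(1) by blast
    have sub: "subgroup (zspan (pows y (length (d # ds)))) (add_monoid R)" by (rule zspan_subgroup[OF pows_carrier[OF yc]])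
    let ?w = "add_pow R d (y [^] length ds) \<oplus> add_pow R c w"
    have 1: "y [^] length ds \<in> zspan (pows y (length (d # ds)))" by (rule zspan_incl) auto
    have 2: "w \<in> zspan (pows y (length (d # ds)))" using zspan_pows_mono[of "length ds" "length (d # ds)"] w(1) by simp
    have W: "?w \<in> zspan (pows y (length (d # ds)))" using subgroupD(4)[OF sub subgroupD(7)[OF sub 1] subgroupD(7)[OF sub 2]] .
    note ec = EV_closed[of ds]
    have zp: "z [^] length ds \<in> carrier R" "k [^] length ds \<in> carrier R" using z k by auto
    have "z [^] (length (d # ds)) \<otimes> EV (d # ds)
       = z \<otimes> z [^] length ds \<otimes> (zint d \<otimes> k [^] length ds \<oplus> EV ds)"
      unfolding EV_Cons using z by (simp add: m_comm)
    also have "... = z \<otimes> (zint d \<otimes> (z [^] length ds \<otimes> k [^] length ds)) \<oplus> z \<otimes> (z [^] (length ds) \<otimes> EV ds)"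
      using z(1) zp ec zint_closed[of d] by algebra
    also have "... = z \<otimes> (zint d \<otimes> y [^] length ds \<oplus> z \<otimes> w)"
      unfolding w(2) y_def nat_pow_distrib[OF z(1) k] using z(1) zp wc zint_closed[of d] by algebra
    also have "zint d \<otimes> y [^] length ds \<oplus> z \<otimes> w = ?w"
      unfolding z_def using wc yc by (simp add: zint_mult)
    finally show ?case using W by blast
  qed
  obtain w where w: "w \<in> zspan (pows y (length cs'))" "z [^] (length cs') \<otimes> EV cs' = z \<otimes> w"
    using claim[of cs'] by blast
  have wc: "w \<in> carrier R" using zspan_carrier[OF pows_carrier[OF yc]] w(1) by blast
  note ec = EV_closed[of cs']
  have zp: "z [^] length cs' \<in> carrier R" "k [^] length cs' \<in> carrier R" using z k by auto
  have "z [^] (length cs') \<otimes> (z \<otimes> k [^] length cs' \<oplus> EV cs') = \<zero>" using c(2) z by (simp add: z_def EV_Cons[symmetric]) (simp add: EV_def)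
  hence "z \<otimes> (z [^] (length cs') \<otimes> k [^] length cs') \<oplus> z \<otimes> w = \<zero>"
    unfolding w(2)[symmetric] using z(1) zp ec by algebra
  hence "z \<otimes> (y [^] length cs' \<oplus> w) = \<zero>"
    unfolding y_def nat_pow_distrib[OF z(1) k] using z(1) zp wc by algebra
  hence "y [^] length cs' \<oplus> w = \<zero>" using z yc wc integral[of z "y [^] length cs' \<oplus> w"] by auto
  hence "y [^] length cs' = \<ominus> w" using yc wc by (simp add: minus_equality)
  hence "y [^] length cs' \<in> zspan (pows y (length cs'))"
    using subgroupD(5)[OF zspan_subgroup[OF pows_carrier[OF yc]] w(1)] by simp
  hence "y \<in> ZK" using ring_of_integers_iff[OF one_not_zero] yc by blast
  thus ?thesis using z y_def by blast
qed

end

section \<open>Localization at a prime\<close>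

context numfield
begin

lemma cring_ZK: "cring (integer_ring R)"
  using subcringI'[OF ZK_subring] subcring_iff[of ZK] ZK_carrier by blast

text \<open>Ideals of the ring of integers, restated with the operations of the field, so that
  identities proved in the field apply to them directly.\<close>

definition zideal :: "'a set => bool" where
  "zideal I \<longleftrightarrow> I \<subseteq> ZK \<and> \<zero> \<in> I \<and> (\<forall>x\<in>I. \<forall>y\<in>I. x \<oplus> y \<in> I) \<and> (\<forall>a\<in>ZK. \<forall>x\<in>I. a \<otimes> x \<in> I)"

lemma zidealD:
  assumes "zideal I"
  shows "I \<subseteq> ZK" "\<zero> \<in> I" "!!x y. x \<in> I ==> y \<in> I ==> x \<oplus> y \<in> I" "!!a x. a \<in> ZK ==> x \<in> I ==> a \<otimes> x \<in> I"
    "!!x. x \<in> I ==> \<ominus> x \<in> I" "!!x y. x \<in> I ==> y \<in> I ==> x \<ominus> y \<in> I" "!!x. x \<in> I ==> x \<in> ZK"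
proof -
  show 1: "I \<subseteq> ZK" "\<zero> \<in> I" "!!x y. x \<in> I ==> y \<in> I ==> x \<oplus> y \<in> I" "!!a x. a \<in> ZK ==> x \<in> I ==> a \<otimes> x \<in> I"
    using assms by (auto simp: zideal_def)
  show 2: "!!x. x \<in> I ==> \<ominus> x \<in> I"
  proof -
    fix x assume x: "x \<in> I"
    have "\<ominus> \<one> \<otimes> x \<in> I" by (rule 1(4)[OF ZK_uminus[OF ZK_one] x])
    moreover have "x \<in> carrier R" using 1(1) x ZK_carrier by blast
    ultimately show "\<ominus> x \<in> I" by (simp add: l_minus)
  qed
  show "!!x y. x \<in> I ==> y \<in> I ==> x \<ominus> y \<in> I" using 1(3) 2 by (simp add: a_minus_def)
  show "!!x. x \<in> I ==> x \<in> ZK" using 1(1) by blast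
qed

lemma ideal_zideal: "ideal I (integer_ring R) \<longleftrightarrow> zideal I"
proof
  interpret Z: cring "integer_ring R" by (rule cring_ZK)
  assume "ideal I (integer_ring R)"
  then interpret I: ideal I "integer_ring R" .
  show "zideal I" unfolding zideal_def
    using I.a_subset I.zero_closed I.a_closed I.I_l_closed by simp
next
  interpret Z: cring "integer_ring R" by (rule cring_ZK)
  assume I: "zideal I"
  note D = zidealD[OF I]
  show "ideal I (integer_ring R)"
  proof (rule idealI)
    show "ring (integer_ring R)" by (rule Z.ring_axioms)
    show "subgroup I (add_monoid (integer_ring R))"
    proof (rule Z.add.subgroupI)
      show "I \<subseteq> carrier (integer_ring R)" using D(1) by simp
      show "I \<noteq> {}" using D(2) by blast
      show "\<ominus>\<^bsub>integer_ring R\<^esub> a \<in> I" if "a \<in> I" for a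
      proof -
        have c: "a \<in> ZK" "\<ominus> a \<in> ZK" "\<ominus> a \<in> I" using that D(5,7) by auto
        have "\<ominus>\<^bsub>integer_ring R\<^esub> a = \<ominus> a"
          by (rule Z.minus_equality) (use c ZK_carrier in \<open>auto simp: l_neg\<close>)
        thus ?thesis using c by simp
      qed
      show "a \<oplus>\<^bsub>integer_ring R\<^esub> b \<in> I" if "a \<in> I" "b \<in> I" for a b using D(3) that by simp
    qed
    show "x \<otimes>\<^bsub>integer_ring R\<^esub> a \<in> I" if "a \<in> I" "x \<in> carrier (integer_ring R)" for a x
      using D(4) that by simp
    show "a \<otimes>\<^bsub>integer_ring R\<^esub> x \<in> I" if "a \<in> I" "x \<in> carrier (integer_ring R)" for a x
      using D(4)[of x a] D(7)[of a] that ZK_carrier by (simp add: m_comm)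
  qed
qed

lemma finite_primes_iff:
  "P \<in> finite_primes R \<longleftrightarrow> zideal P \<and> \<one> \<notin> P \<and> (\<forall>a\<in>ZK. \<forall>b\<in>ZK. a \<otimes> b \<in> P --> a \<in> P \<or> b \<in> P) \<and> (\<exists>s\<in>P. s \<noteq> \<zero>)"
proof
  interpret Z: cring "integer_ring R" by (rule cring_ZK)
  assume "P \<in> finite_primes R"
  hence P: "primeideal P (integer_ring R)" "P \<noteq> {\<zero>}" by (auto simp: finite_primes_def)
  interpret PI: primeideal P "integer_ring R" by (rule P(1))
  have z: "zideal P" using PI.ideal_axioms ideal_zideal by blast
  note D = zidealD[OF z]
  have "\<one> \<notin> P"
  proof
    assume "\<one> \<in> P"
    hence "ZK \<subseteq> P" using D(4)[of _ \<one>] ZK_carrier by fastforce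
    hence "carrier (integer_ring R) = P" using D(1) by simp
    thus False using PI.I_notcarr by blast
  qed
  moreover have "\<forall>a\<in>ZK. \<forall>b\<in>ZK. a \<otimes> b \<in> P --> a \<in> P \<or> b \<in> P" using PI.I_prime by simp
  moreover have "\<exists>s\<in>P. s \<noteq> \<zero>" using P(2) D(2) by blast
  ultimately show "zideal P \<and> \<one> \<notin> P \<and> (\<forall>a\<in>ZK. \<forall>b\<in>ZK. a \<otimes> b \<in> P --> a \<in> P \<or> b \<in> P) \<and> (\<exists>s\<in>P. s \<noteq> \<zero>)"
    using z by blast
next
  interpret Z: cring "integer_ring R" by (rule cring_ZK)
  assume a: "zideal P \<and> \<one> \<notin> P \<and> (\<forall>a\<in>ZK. \<forall>b\<in>ZK. a \<otimes> b \<in> P --> a \<in> P \<or> b \<in> P) \<and> (\<exists>s\<in>P. s \<noteq> \<zero>)"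
  have "primeideal P (integer_ring R)"
  proof (rule primeidealI)
    show "ideal P (integer_ring R)" using a ideal_zideal by blast
    show "cring (integer_ring R)" by (rule cring_ZK)
    show "carrier (integer_ring R) \<noteq> P" using a ZK_one by auto
    show "a \<in> P \<or> b \<in> P" if "a \<in> carrier (integer_ring R)" "b \<in> carrier (integer_ring R)"
      "a \<otimes>\<^bsub>integer_ring R\<^esub> b \<in> P" for a b using a that by simp
  qed
  thus "P \<in> finite_primes R" using a by (auto simp: finite_primes_def)
qed

lemma reps:
  assumes "s \<in> ZK" "s \<noteq> \<zero>"
  obtains T where "finite T" "T \<subseteq> ZK" "!!x. x \<in> ZK ==> \<exists>t\<in>T. \<exists>y\<in>ZK. x = t \<oplus> s \<otimes> y"
  using finite_quot[OF assms] unfolding finite_quot_def by meson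

text \<open>An ideal containing \<open>s\<close> is a union of residue classes modulo
  \<open>s\<close>.\<close>

lemma zideal_rep:
  assumes "zideal I" "s \<in> I" "x = t \<oplus> s \<otimes> y" "t \<in> ZK" "y \<in> ZK"
  shows "x \<in> I \<longleftrightarrow> t \<in> I"
proof -
  note D = zidealD[OF assms(1)]
  have c: "t \<in> carrier R" "s \<in> carrier R" "y \<in> carrier R" using assms D(7) ZK_carrier by auto
  have sy: "s \<otimes> y \<in> I" using D(4)[OF assms(5,2)] c m_comm by simp
  have "t = x \<ominus> s \<otimes> y" unfolding assms(3) using c by algebra
  thus ?thesis using D(3)[of t "s \<otimes> y"] D(6)[of x "s \<otimes> y"] sy assms(3) by auto
qed

text \<open>A prime containing \<open>s\<close> is determined by its intersection with a finite set
  \<open>T\<close> of representatives modulo \<open>s\<close>.\<close>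

lemma finite_primes_containing:
  assumes s: "s \<in> ZK" "s \<noteq> \<zero>"
  shows "finite {P \<in> finite_primes R. s \<in> P}"
proof -
  obtain T where T: "finite T" "T \<subseteq> ZK" "!!x. x \<in> ZK ==> \<exists>t\<in>T. \<exists>y\<in>ZK. x = t \<oplus> s \<otimes> y"
    using reps[OF s] by blast
  let ?A = "{P \<in> finite_primes R. s \<in> P}"
  have sub: "P \<subseteq> Q" if "P \<in> ?A" "Q \<in> ?A" "P \<inter> T = Q \<inter> T" for P Q
  proof
    fix x assume x: "x \<in> P"
    have z: "zideal P" "zideal Q" using that finite_primes_iff by auto
    have "x \<in> ZK" using x zidealD(7)[OF z(1)] by blast
    then obtain t y where t: "t \<in> T" "y \<in> ZK" "x = t \<oplus> s \<otimes> y" using T(3) by blast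
    have tz: "t \<in> ZK" using t T by blast
    have "t \<in> P" using zideal_rep[OF z(1) _ t(3) tz t(2)] x that by blast
    hence "t \<in> Q" using that(3) t(1) by blast
    thus "x \<in> Q" using zideal_rep[OF z(2) _ t(3) tz t(2)] that by blast
  qed
  have "inj_on (%P. P \<inter> T) ?A"
  proof (rule inj_onI, rule subset_antisym)
    fix P Q assume "P \<in> ?A" "Q \<in> ?A" "P \<inter> T = Q \<inter> T"
    thus "P \<subseteq> Q" "Q \<subseteq> P" using sub[of P Q] sub[of Q P] by simp_all
  qed
  moreover have "finite ((%P. P \<inter> T) ` ?A)" by (rule finite_subset[of _ "Pow T"]) (use T(1) in auto)
  ultimately show ?thesis using finite_imageD by blast
qed

text \<open>Ideals containing \<open>s\<close> are determined by the representatives they contain,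
  and there are finitely many of these. So some proper ideal above \<open>I\<close> contains the
  largest number of them; it is maximal and therefore prime.\<close>

lemma ideal_in_prime:
  assumes I: "zideal I" "\<one> \<notin> I" "s \<in> I" "s \<noteq> \<zero>"
  shows "\<exists>P\<in>finite_primes R. I \<subseteq> P"
proof -
  have sz: "s \<in> ZK" using zidealD(7)[OF I(1)] I by blast
  obtain T where T: "finite T" "T \<subseteq> ZK" "!!x. x \<in> ZK ==> \<exists>t\<in>T. \<exists>y\<in>ZK. x = t \<oplus> s \<otimes> y"
    using reps[OF sz I(4)] by blast
  define good where "good = (%J. zideal J \<and> \<one> \<notin> J \<and> I \<subseteq> J)"
  define P where "P = (ARG_MAX (%J. card (J \<inter> T)) J. good J)"
  have "good I" using I by (simp add: good_def)
  moreover have "\<forall>J. good J --> card (J \<inter> T) < Suc (card T)"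
    using T(1) by (simp add: card_mono less_Suc_eq_le)
  ultimately have P: "good P" "!!J. good J ==> card (J \<inter> T) \<le> card (P \<inter> T)"
    using arg_max_nat_lemma[of good I "%J. card (J \<inter> T)"] unfolding P_def by blast+
  have zP: "zideal P" "\<one> \<notin> P" "I \<subseteq> P" using P(1) by (auto simp: good_def)
  note D = zidealD[OF zP(1)]
  have sP: "s \<in> P" using I zP by blast
  have "a \<in> P \<or> b \<in> P" if ab: "a \<in> ZK" "b \<in> ZK" "a \<otimes> b \<in> P" for a b
  proof (rule ccontr)
    assume n: "\<not> (a \<in> P \<or> b \<in> P)"
    \<comment> \<open>\<open>J\<close> is generated by \<open>P\<close> and \<open>a\<close>. If it
      is proper, the class of \<open>a\<close> gives it more representatives than \<open>P\<close>;
      if it contains \<one>, multiplication by \<open>b\<close> puts \<open>b\<close> into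
      \<open>P\<close>.\<close>
    define J where "J = {j \<oplus> a \<otimes> r | j r. j \<in> P \<and> r \<in> ZK}"
    note ac = ZK_carrier[OF ab(1)] and bc = ZK_carrier[OF ab(2)]
    have Dc: "x \<in> carrier R" if "x \<in> P" for x using that D(7) ZK_carrier by blast
    have JI: "j \<oplus> a \<otimes> r \<in> J" if "j \<in> P" "r \<in> ZK" for j r using that by (auto simp: J_def)
    have PJ: "P \<subseteq> J"
    proof
      fix j assume j: "j \<in> P"
      thus "j \<in> J" using JI[OF j ZK_zero] ac Dc[OF j] by simp
    qed
    have aJ: "a \<in> J" using JI[OF D(2) ZK_one] ac by simp
    have "zideal J" unfolding zideal_def
    proof (intro conjI ballI)
      show "J \<subseteq> ZK" using D(7) ab by (auto simp: J_def intro!: ZK_add ZK_mult)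
      show "\<zero> \<in> J" using PJ D(2) by blast
    next
      fix x y assume "x \<in> J" "y \<in> J"
      then obtain j r j' r' where "j \<in> P" "r \<in> ZK" "x = j \<oplus> a \<otimes> r" "j' \<in> P" "r' \<in> ZK" "y = j' \<oplus> a \<otimes> r'" by (auto simp: J_def)
      moreover from this have "x \<oplus> y = (j \<oplus> j') \<oplus> a \<otimes> (r \<oplus> r')" using Dc ZK_carrier ac
        by (simp add: r_distr a_ac)
      ultimately show "x \<oplus> y \<in> J" using JI D(3) ZK_add by metis
    next
      fix c x assume c: "c \<in> ZK" and "x \<in> J"
      then obtain j r where jr: "j \<in> P" "r \<in> ZK" "x = j \<oplus> a \<otimes> r" by (auto simp: J_def)
      hence "c \<otimes> x = c \<otimes> j \<oplus> a \<otimes> (c \<otimes> r)" using Dc[of j] ZK_carrier c ac by (simp add: r_distr m_lcomm)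
      thus "c \<otimes> x \<in> J" using JI[OF D(4)[OF c jr(1)] ZK_mult[OF c jr(2)]] by simp
    qed
    moreover have "\<one> \<notin> J"
    proof
      assume "\<one> \<in> J"
      then obtain j r where jr: "j \<in> P" "r \<in> ZK" "\<one> = j \<oplus> a \<otimes> r" by (auto simp: J_def)
      have c: "j \<in> carrier R" "r \<in> carrier R" using Dc jr ZK_carrier by auto
      have "b = (j \<oplus> a \<otimes> r) \<otimes> b" using bc by (simp only: jr(3)[symmetric] l_one)
      also have "... = b \<otimes> j \<oplus> r \<otimes> (a \<otimes> b)" using c ac bc by algebra
      finally have "b \<in> P" using D(3)[OF D(4)[OF ab(2) jr(1)] D(4)[OF jr(2) ab(3)]] by simp
      thus False using n by blast
    qed
    ultimately have gJ: "good J" using zP PJ by (auto simp: good_def)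
    obtain t y where t: "t \<in> T" "y \<in> ZK" "a = t \<oplus> s \<otimes> y" using T(3)[OF ab(1)] by blast
    have tz: "t \<in> ZK" using t T by blast
    have "t \<in> J" using zideal_rep[OF \<open>zideal J\<close> _ t(3) tz t(2)] aJ sP PJ by blast
    moreover have "t \<notin> P" using zideal_rep[OF zP(1) sP t(3) tz t(2)] n by blast
    ultimately have "P \<inter> T \<subset> J \<inter> T" using PJ t(1) by blast
    hence "card (P \<inter> T) < card (J \<inter> T)" using T(1) by (intro psubset_card_mono) auto
    thus False using P(2)[OF gJ] by simp
  qed
  hence "P \<in> finite_primes R" using finite_primes_iff zP sP I(4) by blast
  thus ?thesis using zP by blast
qed

end

section \<open>The discrete valuation at a prime\<close>

locale number_prime = numfield +
  fixes P :: "'a set"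
  assumes P_prime: "P \<in> finite_primes R"
begin

lemma P_zideal: "zideal P" and one_notin_P: "\<one> \<notin> P"
  and P_primeD: "!!a b. a \<in> ZK ==> b \<in> ZK ==> a \<otimes> b \<in> P ==> a \<in> P \<or> b \<in> P"
  and P_nontrivial: "\<exists>s\<in>P. s \<noteq> \<zero>"
  using P_prime finite_primes_iff by auto

lemmas P_props = zidealD[OF P_zideal]

lemma P_carrier: "x \<in> P ==> x \<in> carrier R" using P_props(7) ZK_carrier by blast

abbreviation S :: "'a set" where "S \<equiv> ZK - P"

lemma S_mult: "s \<in> S ==> t \<in> S ==> s \<otimes> t \<in> S" using P_primeD ZK_mult by blast
lemma S_one: "\<one> \<in> S" using ZK_one one_notin_P by blast
lemma S_nz: "s \<in> S ==> s \<noteq> \<zero>" using P_props(2) by blast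
lemma S_carrier: "s \<in> S ==> s \<in> carrier R" using ZK_carrier by blast

abbreviation V :: "nat => 'a set" where "V n \<equiv> val_ge R P n"

definition Ppow :: "nat => 'a set" where "Ppow n = P [^]\<^bsub>ideals_set (integer_ring R)\<^esub> n"

lemma Ppow_0: "Ppow 0 = ZK" by (simp add: Ppow_def ideals_set_def)
lemma Ppow_Suc: "Ppow (Suc n) = ideal_prod (integer_ring R) (Ppow n) P" by (simp add: Ppow_def ideals_set_def)

lemma Ppow_ideal: "zideal (Ppow n)"
proof (induction n)
  case 0
  thus ?case unfolding Ppow_0 zideal_def using ZK_zero ZK_add ZK_mult by blast
next
  case (Suc n)
  interpret Z: cring "integer_ring R" by (rule cring_ZK)
  show ?case unfolding Ppow_Suc using Z.ideal_prod_is_ideal Suc P_zideal ideal_zideal by blast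
qed

text \<open>Clearing denominators turns the fractions of \<open>val_ge\<close> into a condition free
  of inverses.\<close>

lemma V_iff_Ppow: "x \<in> V n \<longleftrightarrow> x \<in> carrier R \<and> (\<exists>s\<in>S. s \<otimes> x \<in> Ppow n)"
proof
  assume "x \<in> V n"
  then obtain a s where as: "x = a \<otimes> inv s" "a \<in> Ppow n" "s \<in> S" unfolding val_ge_def Ppow_def by blast
  have c: "a \<in> carrier R" "s \<in> carrier R" "s \<noteq> \<zero>"
    using as zidealD(7)[OF Ppow_ideal] ZK_carrier S_nz by auto
  have "s \<otimes> x = a \<otimes> (s \<otimes> inv s)" unfolding as(1) using c by (simp add: m_lcomm del: inv_nz(2,3))
  hence "s \<otimes> x = a" using c by simp
  hence "s \<otimes> x \<in> Ppow n" using as(2) by simp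
  thus "x \<in> carrier R \<and> (\<exists>s\<in>S. s \<otimes> x \<in> Ppow n)" using as(1,3) c by auto
next
  assume "x \<in> carrier R \<and> (\<exists>s\<in>S. s \<otimes> x \<in> Ppow n)"
  then obtain s where s: "x \<in> carrier R" "s \<in> S" "s \<otimes> x \<in> Ppow n" by blast
  have c: "s \<in> carrier R" "s \<noteq> \<zero>" using s S_nz S_carrier by auto
  have "(s \<otimes> x) \<otimes> inv s = x \<otimes> (s \<otimes> inv s)" using c s by (simp add: m_ac del: inv_nz(2,3))
  hence "x = (s \<otimes> x) \<otimes> inv s" using c s by simp
  thus "x \<in> V n" unfolding val_ge_def using s(2,3) Ppow_def by blast
qed

lemma V_carrier: "x \<in> V n ==> x \<in> carrier R" using V_iff_Ppow by blast

lemma V0_iff: "x \<in> V 0 \<longleftrightarrow> x \<in> carrier R \<and> (\<exists>s\<in>S. s \<otimes> x \<in> ZK)"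
  using V_iff_Ppow[of x 0] Ppow_0 by simp

lemma ZK_V0: "x \<in> ZK ==> x \<in> V 0"
  unfolding V0_iff using S_one ZK_carrier by (auto intro!: bexI[of _ \<one>])

lemma V0_add: "x \<in> V 0 ==> y \<in> V 0 ==> x \<oplus> y \<in> V 0"
proof -
  assume "x \<in> V 0" "y \<in> V 0"
  then obtain s t where s: "s \<in> S" "s \<otimes> x \<in> ZK" "x \<in> carrier R" and t: "t \<in> S" "t \<otimes> y \<in> ZK" "y \<in> carrier R"
    unfolding V0_iff by blast
  have c: "s \<in> carrier R" "t \<in> carrier R" "s \<in> ZK" "t \<in> ZK" using s t S_carrier by auto
  have "s \<otimes> t \<otimes> (x \<oplus> y) = t \<otimes> (s \<otimes> x) \<oplus> s \<otimes> (t \<otimes> y)" using c s(3) t(3) by algebra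
  hence "s \<otimes> t \<otimes> (x \<oplus> y) \<in> ZK" using s t c by (simp add: ZK_add ZK_mult)
  thus ?thesis unfolding V0_iff using S_mult s t by blast
qed

lemma V0_mult: "x \<in> V 0 ==> y \<in> V 0 ==> x \<otimes> y \<in> V 0"
proof -
  assume "x \<in> V 0" "y \<in> V 0"
  then obtain s t where s: "s \<in> S" "s \<otimes> x \<in> ZK" "x \<in> carrier R" and t: "t \<in> S" "t \<otimes> y \<in> ZK" "y \<in> carrier R"
    unfolding V0_iff by blast
  have c: "s \<in> carrier R" "t \<in> carrier R" "s \<in> ZK" "t \<in> ZK" using s t S_carrier by auto
  have "s \<otimes> t \<otimes> (x \<otimes> y) = (s \<otimes> x) \<otimes> (t \<otimes> y)" using c s(3) t(3) by algebra
  hence "s \<otimes> t \<otimes> (x \<otimes> y) \<in> ZK" using s t c by (simp add: ZK_mult)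
  thus ?thesis unfolding V0_iff using S_mult s t by blast
qed

lemma V0_uminus: assumes "x \<in> V 0" shows "\<ominus> x \<in> V 0"
proof -
  have "\<ominus> \<one> \<otimes> x \<in> V 0" by (rule V0_mult[OF ZK_V0[OF ZK_uminus[OF ZK_one]] assms])
  thus ?thesis using V_carrier[OF assms] by (simp add: l_minus)
qed

lemma S_inv: "u \<in> S ==> inv u \<in> V 0"
  unfolding V0_iff using S_carrier[of u] S_nz[of u] ZK_one by (auto intro!: bexI[of _ u])

text \<open>Two powers of \<open>x\<close> agree modulo \<open>s\<close>, so \<open>s\<close>
  divides a power of \<open>x\<close> times some \<open>x [^] Suc d \<ominus> \<one>\<close>. The
  second factor lies outside \<open>P\<close> and becomes invertible in the localization.\<close>

lemma P_power_divisible: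
  assumes x: "x \<in> P" and s: "s \<in> ZK" "s \<noteq> \<zero>"
  shows "\<exists>m::nat. \<exists>r\<in>V 0. x [^] m = s \<otimes> r"
proof -
  note xc = P_carrier[OF x] and xz = P_props(7)[OF x]
  obtain m n :: nat and y where mn: "m < n" "y \<in> ZK" "x [^] n \<ominus> x [^] m = s \<otimes> y"
    using ZK_pigeonhole[OF s, of "%n. x [^] n"] ZK_pow[OF xz] by blast
  obtain d where d: "n = m + Suc d" using mn(1) less_imp_Suc_add by auto
  define u where "u = x [^] (Suc d) \<ominus> \<one>"
  have xd: "x [^] (Suc d) \<in> P" using P_props(4)[OF ZK_pow[OF xz] x] by simp
  have uz: "u \<in> ZK" unfolding u_def using xd P_props(7) ZK_one ZK_minus by blast
  have "u \<notin> P"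
  proof
    assume "u \<in> P"
    hence "x [^] (Suc d) \<ominus> u \<in> P" using xd P_props(6) by blast
    moreover have "x [^] (Suc d) \<in> carrier R" using xc by simp
    hence "x [^] (Suc d) \<ominus> u = \<one>" unfolding u_def by algebra
    ultimately show False using one_notin_P by simp
  qed
  hence uS: "u \<in> S" using uz by blast
  have c: "x [^] m \<in> carrier R" "x [^] (Suc d) \<in> carrier R" "u \<in> carrier R" "u \<noteq> \<zero>" "y \<in> carrier R" "s \<in> carrier R" "inv u \<in> carrier R"
    using xc uS S_carrier S_nz mn ZK_carrier s by auto
  have "x [^] m \<otimes> u = x [^] m \<otimes> x [^] (Suc d) \<ominus> x [^] m" unfolding u_def using c(1,2) by algebra
  also have "x [^] m \<otimes> x [^] (Suc d) = x [^] n" unfolding d using xc by (rule nat_pow_mult)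
  finally have e: "x [^] m \<otimes> u = s \<otimes> y" using mn(3) by simp
  have "x [^] m = x [^] m \<otimes> (u \<otimes> inv u)" using c by simp
  also have "... = (x [^] m \<otimes> u) \<otimes> inv u" using c by (intro m_assoc[symmetric])
  also have "... = s \<otimes> (y \<otimes> inv u)" unfolding e using c by (intro m_assoc)
  finally have "x [^] m = s \<otimes> (y \<otimes> inv u)" .
  thus ?thesis using V0_mult[OF ZK_V0[OF mn(2)] S_inv[OF uS]] by blast
qed

text \<open>The element \<open>z\<close> built below carries \<open>P\<close> into the integers
  although it is not in \<open>V 0\<close>, so it acts as a local inverse of \<open>P\<close>. If it
  mapped \<open>P\<close> into \<open>P\<close>, it would be integral. Hence some
  \<open>z \<otimes> p\<close> with \<open>p\<close> in \<open>P\<close> lies outside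
  \<open>P\<close>; dividing by this local unit shows that \<open>p\<close> divides all of
  \<open>P\<close>.\<close>

lemma uniformizer_exists: "\<exists>p\<in>P. p \<noteq> \<zero> \<and> (\<forall>x\<in>P. \<exists>r\<in>V 0. x = p \<otimes> r)"
proof -
  obtain s where s: "s \<in> P" "s \<noteq> \<zero>" using P_nontrivial by blast
  have sz: "s \<in> ZK" and sc: "s \<in> carrier R" using s P_props(7) P_carrier by auto
  obtain T where T: "finite T" "T \<subseteq> ZK" "!!x. x \<in> ZK ==> \<exists>t\<in>T. \<exists>y\<in>ZK. x = t \<oplus> s \<otimes> y"
    using reps[OF sz s(2)] by blast
  \<comment> \<open>\<open>A y\<close> is the annihilator of \<open>y\<close> modulo
    \<open>s\<close> in the localization. Membership depends only on the residue modulo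
    \<open>s\<close>, so these ideals can be compared on the finite set \<open>T\<close>.\<close>
  define A where "A = (%y. {x \<in> ZK. \<exists>r\<in>V 0. x \<otimes> y = s \<otimes> r})"
  have A1: "\<one> \<in> A y \<longleftrightarrow> (\<exists>r\<in>V 0. y = s \<otimes> r)" if "y \<in> ZK" for y
    using that ZK_carrier ZK_one by (auto simp: A_def)
  have Amult: "x \<in> A (a \<otimes> y)" if "x \<in> A y" "a \<in> ZK" "y \<in> ZK" for x y a
  proof -
    obtain r where r: "r \<in> V 0" "x \<otimes> y = s \<otimes> r" "x \<in> ZK" using \<open>x \<in> A y\<close> by (auto simp: A_def)
    have "x \<otimes> (a \<otimes> y) = a \<otimes> (x \<otimes> y)" using that r ZK_carrier by (simp add: m_lcomm)
    also have "... = s \<otimes> (a \<otimes> r)" unfolding r(2) using that r V_carrier ZK_carrier sc by (simp add: m_lcomm)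
    finally show ?thesis using r that V0_mult ZK_V0 by (auto simp: A_def)
  qed
  have Arep: "x \<in> A y \<longleftrightarrow> t \<in> A y" if "x = t \<oplus> s \<otimes> w" "t \<in> ZK" "w \<in> ZK" "y \<in> ZK" for x t w y
  proof -
    have c: "t \<in> carrier R" "w \<in> carrier R" "y \<in> carrier R" using that ZK_carrier by auto
    have xz: "x \<in> ZK" using that sz by (simp add: ZK_add ZK_mult)
    have wy: "w \<otimes> y \<in> V 0" using that ZK_mult ZK_V0 by blast
    have xy: "x \<otimes> y = t \<otimes> y \<oplus> s \<otimes> (w \<otimes> y)" unfolding that(1) using c sc by algebra
    have ty: "t \<otimes> y = x \<otimes> y \<ominus> s \<otimes> (w \<otimes> y)" unfolding that(1) using c sc by algebra
    show ?thesis
    proof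
      assume "x \<in> A y"
      then obtain r where r: "r \<in> V 0" "x \<otimes> y = s \<otimes> r" by (auto simp: A_def)
      note rc = V_carrier[OF r(1)]
      have "t \<otimes> y = s \<otimes> (r \<oplus> \<ominus> (w \<otimes> y))" unfolding ty r(2) using rc c sc by algebra
      thus "t \<in> A y" using that V0_add[OF r(1) V0_uminus[OF wy]] by (auto simp: A_def)
    next
      assume "t \<in> A y"
      then obtain r where r: "r \<in> V 0" "t \<otimes> y = s \<otimes> r" by (auto simp: A_def)
      note rc = V_carrier[OF r(1)]
      have "x \<otimes> y = s \<otimes> (r \<oplus> w \<otimes> y)" unfolding xy r(2) using rc c sc by algebra
      thus "x \<in> A y" using xz V0_add[OF r(1) wy] by (auto simp: A_def)
    qed
  qed
  define good where "good = (%y. y \<in> ZK \<and> \<one> \<notin> A y)"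
  have "good \<one>" unfolding good_def
  proof
    show "\<one> \<notin> A \<one>"
    proof
      assume "\<one> \<in> A \<one>"
      then obtain r where r: "r \<in> V 0" "\<one> = s \<otimes> r" using A1 ZK_one by blast
      then obtain u where u: "u \<in> S" "u \<otimes> r \<in> ZK" "r \<in> carrier R" unfolding V0_iff by blast
      have "u = u \<otimes> (s \<otimes> r)" using S_carrier[OF u(1)] by (simp only: r(2)[symmetric] r_one)
      also have "... = (u \<otimes> r) \<otimes> s" using u S_carrier sc by (simp add: m_ac)
      finally have "u \<in> P" using P_props(4)[OF u(2) s(1)] by simp
      thus False using u by blast
    qed
  qed (rule ZK_one)
  \<comment> \<open>Among the classes that are nonzero modulo \<open>s\<close>, \<open>y\<close> has
    the largest annihilator. As in the theory of associated primes, this annihilator contains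
    \<open>P\<close>.\<close>
  define y where "y = (ARG_MAX (%y. card (A y \<inter> T)) y. good y)"
  have "\<forall>y. good y --> card (A y \<inter> T) < Suc (card T)"
    using T(1) by (simp add: card_mono less_Suc_eq_le)
  hence y: "good y" "!!y'. good y' ==> card (A y' \<inter> T) \<le> card (A y \<inter> T)"
    using arg_max_nat_lemma[of good \<one> "%y. card (A y \<inter> T)"] \<open>good \<one>\<close> unfolding y_def by blast+
  have yz: "y \<in> ZK" "\<one> \<notin> A y" using y(1) by (auto simp: good_def)
  note yc = ZK_carrier[OF yz(1)]
  have PA: "x \<in> A y" if x: "x \<in> P" for x
  proof (rule ccontr)
    \<comment> \<open>Multiplying \<open>y\<close> by the last power of \<open>x\<close> that leaves
      it indivisible by \<open>s\<close> produces a class that \<open>x\<close> annihilates too,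
      against the maximality of \<open>A y\<close>.\<close>
    assume nx: "x \<notin> A y"
    note xc = P_carrier[OF x] and xz = P_props(7)[OF x]
    obtain m :: nat and r where m: "r \<in> V 0" "x [^] m = s \<otimes> r" using P_power_divisible[OF x sz s(2)] by blast
    define Q where "Q = (%k::nat. \<one> \<in> A (x [^] k \<otimes> y))"
    have "x [^] m \<otimes> y = s \<otimes> (r \<otimes> y)" unfolding m using V_carrier[OF m(1)] yc sc by (simp add: m_assoc)
    hence "Q m" unfolding Q_def
      using A1[OF ZK_mult[OF ZK_pow[OF xz] yz(1)]] V0_mult[OF m(1) ZK_V0[OF yz(1)]] by blast
    define k where "k = (LEAST k. Q k)"
    have Qk: "Q k" unfolding k_def using \<open>Q m\<close> by (rule LeastI)
    have "\<not> Q 0" unfolding Q_def using yz yc by simp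
    then obtain j where j: "k = Suc j" using Qk by (cases k) auto
    have nQj: "\<not> Q j" using not_less_Least[of j Q] j unfolding k_def by simp
    define y' where "y' = x [^] j \<otimes> y"
    have xjz: "x [^] j \<in> ZK" using ZK_pow[OF xz] .
    have y'z: "y' \<in> ZK" unfolding y'_def using ZK_mult[OF xjz yz(1)] .
    have gy': "good y'" unfolding good_def using y'z nQj Q_def y'_def by simp
    have xy': "x \<otimes> y' = x [^] k \<otimes> y" unfolding y'_def j using xc yc by (simp add: m_ac)
    have "x \<in> A y'" using Qk A1[OF ZK_mult[OF ZK_pow[OF xz, of k] yz(1)]] xz unfolding Q_def A_def xy'[symmetric] by blast
    have sub: "A y \<subseteq> A y'" unfolding y'_def using Amult xjz yz by blast
    obtain t w where t: "t \<in> T" "w \<in> ZK" "x = t \<oplus> s \<otimes> w" using T(3)[OF xz] by blast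
    have tz: "t \<in> ZK" using t T by blast
    have "t \<in> A y'" using Arep[OF t(3) tz t(2) y'z] \<open>x \<in> A y'\<close> by blast
    moreover have "t \<notin> A y" using Arep[OF t(3) tz t(2) yz(1)] nx by blast
    ultimately have "A y \<inter> T \<subset> A y' \<inter> T" using sub t(1) by blast
    hence "card (A y \<inter> T) < card (A y' \<inter> T)" using T(1) by (intro psubset_card_mono) auto
    thus False using y(2)[OF gy'] by simp
  qed
  \<comment> \<open>A common denominator \<open>U\<close> outside \<open>P\<close> is found for the
    finitely many representatives; modulo \<open>s\<close> it then serves all of
    \<open>P\<close>.\<close>
  have clear: "\<exists>U\<in>S. \<forall>t\<in>T'. \<exists>c\<in>ZK. U \<otimes> t \<otimes> y = s \<otimes> c" if "finite T'" "T' \<subseteq> A y" for T'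
    using that
  proof (induction T' rule: finite_induct)
    case empty thus ?case using S_one by blast
  next
    case (insert t T')
    then obtain U where U: "U \<in> S" "!!t. t \<in> T' ==> \<exists>c\<in>ZK. U \<otimes> t \<otimes> y = s \<otimes> c" by blast
    obtain r where r: "r \<in> V 0" "t \<otimes> y = s \<otimes> r" "t \<in> ZK" using insert by (auto simp: A_def)
    then obtain u where u: "u \<in> S" "u \<otimes> r \<in> ZK" "r \<in> carrier R" unfolding V0_iff by blast
    note Uc = S_carrier[OF U(1)] and uc = S_carrier[OF u(1)]
    have 1: "\<exists>c\<in>ZK. (u \<otimes> U) \<otimes> t' \<otimes> y = s \<otimes> c" if "t' \<in> T'" for t'
    proof -
      obtain c where c: "c \<in> ZK" "U \<otimes> t' \<otimes> y = s \<otimes> c" using U(2) \<open>t' \<in> T'\<close> by blast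
      have t'c: "t' \<in> carrier R" using \<open>t' \<in> T'\<close> insert.prems ZK_carrier by (auto simp: A_def)
      have "(u \<otimes> U) \<otimes> t' \<otimes> y = u \<otimes> (U \<otimes> t' \<otimes> y)" using t'c Uc uc yc by (simp add: m_assoc)
      also have "... = s \<otimes> (u \<otimes> c)" unfolding c(2) using ZK_carrier[OF c(1)] uc sc by (simp add: m_lcomm)
      finally show ?thesis using ZK_mult c(1) u(1) by blast
    qed
    have "(u \<otimes> U) \<otimes> t \<otimes> y = (u \<otimes> U) \<otimes> (t \<otimes> y)"
      using ZK_carrier[OF r(3)] Uc uc yc by (intro m_assoc m_closed)
    also have "... = s \<otimes> (U \<otimes> (u \<otimes> r))" unfolding r(2) using Uc uc sc u(3) by algebra
    finally have "\<exists>c\<in>ZK. (u \<otimes> U) \<otimes> t \<otimes> y = s \<otimes> c" using ZK_mult u(2) U(1) by blast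
    thus ?case using 1 S_mult[OF u(1) U(1)] by blast
  qed
  obtain U where U: "U \<in> S" "!!t. t \<in> T \<inter> A y ==> \<exists>c\<in>ZK. U \<otimes> t \<otimes> y = s \<otimes> c"
    using clear[of "T \<inter> A y"] T(1) by blast
  note Uc = S_carrier[OF U(1)] and Un = S_nz[OF U(1)]
  have Up: "\<exists>c\<in>ZK. U \<otimes> p \<otimes> y = s \<otimes> c" if p: "p \<in> P" for p
  proof -
    obtain t w where t: "t \<in> T" "w \<in> ZK" "p = t \<oplus> s \<otimes> w" using T(3)[OF P_props(7)[OF p]] by blast
    have tz: "t \<in> ZK" using t T by blast
    have "t \<in> A y" using Arep[OF t(3) tz t(2) yz(1)] PA[OF p] by blast
    then obtain c where c: "c \<in> ZK" "U \<otimes> t \<otimes> y = s \<otimes> c" using U(2) t(1) by blast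
    have cc: "t \<in> carrier R" "w \<in> carrier R" "c \<in> carrier R" using tz t c ZK_carrier by auto
    have "U \<otimes> p \<otimes> y = U \<otimes> t \<otimes> y \<oplus> s \<otimes> (U \<otimes> w \<otimes> y)" unfolding t(3) using cc Uc yc sc by algebra
    also have "... = s \<otimes> (c \<oplus> U \<otimes> w \<otimes> y)" unfolding c(2) using cc Uc yc sc by algebra
    finally show ?thesis using c t yz U(1) by (auto intro!: bexI[of _ "c \<oplus> U \<otimes> w \<otimes> y"] ZK_add ZK_mult)
  qed
  define z where "z = U \<otimes> y \<otimes> inv s"
  have zc: "z \<in> carrier R" unfolding z_def using Uc yc sc s(2) by simp
  have szz: "s \<otimes> z = U \<otimes> y"
  proof -
    have "s \<otimes> z = U \<otimes> y \<otimes> (s \<otimes> inv s)" unfolding z_def using Uc yc sc s(2) by (simp add: m_ac del: inv_nz(2,3))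
    thus ?thesis using Uc yc sc s(2) by simp
  qed
  have zP: "z \<otimes> p \<in> ZK" if p: "p \<in> P" for p
  proof -
    obtain c where c: "c \<in> ZK" "U \<otimes> p \<otimes> y = s \<otimes> c" using Up[OF p] by blast
    note pc = P_carrier[OF p]
    have "s \<otimes> (z \<otimes> p) = (s \<otimes> z) \<otimes> p" using sc zc pc by (simp add: m_assoc)
    also have "... = s \<otimes> c" unfolding szz c(2)[symmetric] using Uc yc pc by (simp add: m_ac)
    finally have "z \<otimes> p = c" using m_lcancel[OF s(2) sc] zc pc ZK_carrier[OF c(1)] by simp
    thus ?thesis using c by simp
  qed
  have zV: "z \<notin> V 0"
  proof
    assume z0: "z \<in> V 0"
    have "y = (U \<otimes> y) \<otimes> inv U"
    proof -
      have "(U \<otimes> y) \<otimes> inv U = y \<otimes> (U \<otimes> inv U)" using Uc yc Un by (simp add: m_ac del: inv_nz(2,3))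
      thus ?thesis using Uc Un yc by simp
    qed
    also have "... = s \<otimes> (z \<otimes> inv U)" unfolding szz[symmetric] using sc zc Uc Un by (simp add: m_assoc)
    finally have "\<one> \<in> A y" using A1[OF yz(1)] V0_mult[OF z0 S_inv[OF U(1)]] by blast
    thus False using yz by blast
  qed
  \<comment> \<open>If \<open>z\<close> maps \<open>P\<close> into itself, all
    \<open>z [^] n \<otimes> s\<close> are integers. Two of them agree modulo \<open>s\<close>, so a
    difference of two powers of \<open>z\<close> is integral, and \<open>ZK_pow_diff\<close> makes
    \<open>z\<close> integral.\<close>
  have "\<exists>p\<in>P. z \<otimes> p \<notin> P"
  proof (rule ccontr)
    assume "\<not> (\<exists>p\<in>P. z \<otimes> p \<notin> P)"
    hence zPP: "z \<otimes> p \<in> P" if "p \<in> P" for p using that by blast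
    have zn: "z [^] n \<otimes> s \<in> P" for n :: nat
    proof (induction n)
      case 0 thus ?case using s sc by simp
    next
      case (Suc n)
      have "z [^] Suc n \<otimes> s = z \<otimes> (z [^] n \<otimes> s)" using zc sc by (simp add: m_ac)
      thus ?case using zPP[OF Suc] by simp
    qed
    obtain m n :: nat and w where mn: "m < n" "w \<in> ZK" "z [^] n \<otimes> s \<ominus> z [^] m \<otimes> s = s \<otimes> w"
      using ZK_pigeonhole[OF sz s(2), of "%n. z [^] n \<otimes> s"] zn P_props(7) by blast
    have c: "z [^] n \<in> carrier R" "z [^] m \<in> carrier R" "w \<in> carrier R" using zc ZK_carrier mn by auto
    have "s \<otimes> (z [^] n \<ominus> z [^] m) = z [^] n \<otimes> s \<ominus> z [^] m \<otimes> s" using c sc by algebra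
    hence "z [^] n \<ominus> z [^] m = w" using mn(3) m_lcancel[OF s(2) sc] c by simp
    hence "z \<in> ZK" using ZK_pow_diff[OF zc mn(1)] mn(2) by simp
    thus False using zV ZK_V0 by blast
  qed
  then obtain p where p: "p \<in> P" "z \<otimes> p \<notin> P" by blast
  define u where "u = z \<otimes> p"
  note pc = P_carrier[OF p(1)]
  have u: "u \<in> S" using p zP u_def by blast
  note uc = S_carrier[OF u] and un = S_nz[OF u]
  have "p \<noteq> \<zero>" using un zc unfolding u_def by auto
  moreover have "\<exists>r\<in>V 0. x = p \<otimes> r" if x: "x \<in> P" for x
  proof -
    note xc = P_carrier[OF x]
    have "p \<otimes> (z \<otimes> x \<otimes> inv u) = x \<otimes> (u \<otimes> inv u)" unfolding u_def using pc zc xc uc un inv_nz(1)[OF uc un] u_def by (simp add: m_ac del: inv_nz)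
    hence "x = p \<otimes> (z \<otimes> x \<otimes> inv u)" using xc uc un by simp
    thus ?thesis using V0_mult[OF ZK_V0[OF zP[OF x]] S_inv[OF u]] by blast
  qed
  ultimately show ?thesis using p(1) by blast
qed

definition unif :: 'a where "unif = (SOME p. p \<in> P \<and> p \<noteq> \<zero> \<and> (\<forall>x\<in>P. \<exists>r\<in>V 0. x = p \<otimes> r))"

lemma unif: "unif \<in> P" "unif \<noteq> \<zero>" "!!x. x \<in> P ==> \<exists>r\<in>V 0. x = unif \<otimes> r"
proof -
  have "unif \<in> P \<and> unif \<noteq> \<zero> \<and> (\<forall>x\<in>P. \<exists>r\<in>V 0. x = unif \<otimes> r)"
    unfolding unif_def by (rule someI_ex) (use uniformizer_exists in blast)
  thus "unif \<in> P" "unif \<noteq> \<zero>" "!!x. x \<in> P ==> \<exists>r\<in>V 0. x = unif \<otimes> r" by auto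
qed

lemma unif_carrier [simp]: "unif \<in> carrier R" using unif(1) P_carrier by blast
lemma unif_pow_closed: "unif [^] (n::nat) \<in> carrier R" by simp
lemma Ppow_unif: "x \<in> Ppow n ==> \<exists>r\<in>V 0. x = unif [^] n \<otimes> r"
proof (induction n arbitrary: x)
  case 0
  hence "x \<in> ZK" by (simp add: Ppow_0)
  thus ?case using ZK_V0[of x] ZK_carrier[of x] by (intro bexI[of _ x]) auto
next
  case (Suc n)
  have "x \<in> ideal_prod (integer_ring R) (Ppow n) P" using Suc.prems Ppow_Suc by simp
  thus ?case
  proof (induction rule: ideal_prod.induct)
    case (prod i j)
    obtain r where r: "r \<in> V 0" "i = unif [^] n \<otimes> r" using Suc.IH prod by blast
    obtain r' where r': "r' \<in> V 0" "j = unif \<otimes> r'" using unif(3) prod by blast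
    have "i \<otimes> j = unif [^] Suc n \<otimes> (r \<otimes> r')" unfolding r(2) r'(2)
      using V_carrier[OF r(1)] V_carrier[OF r'(1)] by (simp add: m_ac)
    thus ?case using V0_mult[OF r(1) r'(1)] by auto
  next
    case (sum s1 s2)
    then obtain r r' where r: "r \<in> V 0" "s1 = unif [^] Suc n \<otimes> r" and r': "r' \<in> V 0" "s2 = unif [^] Suc n \<otimes> r'" by blast
    have "s1 \<oplus> s2 = unif [^] Suc n \<otimes> (r \<oplus> r')" unfolding r(2) r'(2)
      using V_carrier[OF r(1)] V_carrier[OF r'(1)] unif_pow_closed[of "Suc n"] by (simp only: r_distr)
    thus ?case using V0_add[OF r(1) r'(1)] by auto
  qed
qed

lemma unif_pow_Ppow: "unif [^] n \<in> Ppow n"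
proof (induction n)
  case 0 thus ?case by (simp add: Ppow_0 ZK_one)
next
  case (Suc n)
  have "unif [^] n \<otimes>\<^bsub>integer_ring R\<^esub> unif \<in> ideal_prod (integer_ring R) (Ppow n) P"
    using Suc unif(1) by (rule ideal_prod.prod)
  thus ?case by (simp add: Ppow_Suc)
qed

lemma V_iff: "x \<in> V n \<longleftrightarrow> (\<exists>r\<in>V 0. x = unif [^] n \<otimes> r)"
proof
  assume "x \<in> V n"
  then obtain s where s: "x \<in> carrier R" "s \<in> S" "s \<otimes> x \<in> Ppow n" using V_iff_Ppow by blast
  obtain r where r: "r \<in> V 0" "s \<otimes> x = unif [^] n \<otimes> r" using Ppow_unif[OF s(3)] by blast
  have c: "s \<in> carrier R" "s \<noteq> \<zero>" "r \<in> carrier R" using s S_carrier S_nz V_carrier r by auto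
  have "x = (s \<otimes> x) \<otimes> inv s"
  proof -
    have "(s \<otimes> x) \<otimes> inv s = x \<otimes> (s \<otimes> inv s)" using c s by (simp add: m_ac del: inv_nz(2,3))
    thus ?thesis using c s by simp
  qed
  also have "... = unif [^] n \<otimes> (r \<otimes> inv s)" unfolding r(2) using c unif_pow_closed by (simp add: m_assoc)
  finally show "\<exists>r\<in>V 0. x = unif [^] n \<otimes> r" using V0_mult[OF r(1) S_inv[OF s(2)]] by blast
next
  assume "\<exists>r\<in>V 0. x = unif [^] n \<otimes> r"
  then obtain r where r: "r \<in> V 0" "x = unif [^] n \<otimes> r" by blast
  then obtain s where s: "s \<in> S" "s \<otimes> r \<in> ZK" "r \<in> carrier R" unfolding V0_iff by blast
  have "s \<otimes> x = (s \<otimes> r) \<otimes> unif [^] n" unfolding r(2) using s S_carrier unif_pow_closed by (simp add: m_ac)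
  hence "s \<otimes> x \<in> Ppow n" using zidealD(4)[OF Ppow_ideal s(2) unif_pow_Ppow] by simp
  thus "x \<in> V n" unfolding V_iff_Ppow using s r(2) by auto
qed

lemma V_I: "r \<in> V 0 ==> unif [^] n \<otimes> r \<in> V n" using V_iff by blast

lemma V_zero: "\<zero> \<in> V n"
  using V_I[OF ZK_V0[OF ZK_zero], of n] by simp

lemma V_add: "x \<in> V n ==> y \<in> V n ==> x \<oplus> y \<in> V n"
proof -
  assume "x \<in> V n" "y \<in> V n"
  then obtain r r' where r: "r \<in> V 0" "x = unif [^] n \<otimes> r" and r': "r' \<in> V 0" "y = unif [^] n \<otimes> r'" using V_iff by blast
  have "x \<oplus> y = unif [^] n \<otimes> (r \<oplus> r')" unfolding r(2) r'(2)
    using V_carrier[OF r(1)] V_carrier[OF r'(1)] unif_pow_closed by (simp only: r_distr)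
  thus ?thesis using V_I[OF V0_add[OF r(1) r'(1)]] by simp
qed

lemma V_mult: "x \<in> V m ==> y \<in> V n ==> x \<otimes> y \<in> V (m + n)"
proof -
  assume "x \<in> V m" "y \<in> V n"
  then obtain r r' where r: "r \<in> V 0" "x = unif [^] m \<otimes> r" and r': "r' \<in> V 0" "y = unif [^] n \<otimes> r'" using V_iff by metis
  have "x \<otimes> y = (unif [^] m \<otimes> unif [^] n) \<otimes> (r \<otimes> r')" unfolding r(2) r'(2)
    using V_carrier[OF r(1)] V_carrier[OF r'(1)] unif_pow_closed[of m] unif_pow_closed[of n] by algebra
  also have "unif [^] m \<otimes> unif [^] n = unif [^] (m + n)" by (simp add: nat_pow_mult)
  finally show ?thesis using V_I[OF V0_mult[OF r(1) r'(1)]] by simp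
qed

lemma V_one: "\<one> \<in> V 0" by (rule ZK_V0[OF ZK_one])

lemma V_uminus: "x \<in> V n ==> \<ominus> x \<in> V n"
  using V_mult[OF V0_uminus[OF V_one], of x n] V_carrier[of x n] by (simp add: l_minus)

lemma V_minus: "x \<in> V n ==> y \<in> V n ==> x \<ominus> y \<in> V n"
  by (simp add: a_minus_def V_add V_uminus)

lemma V_mono: "m \<le> n ==> x \<in> V n ==> x \<in> V m"
proof -
  assume mn: "m \<le> n" and "x \<in> V n"
  then obtain r where r: "r \<in> V 0" "x = unif [^] n \<otimes> r" using V_iff by blast
  have u: "unif [^] (n - m) \<in> V 0"
    using P_props(7)[OF unif(1)] ZK_pow ZK_V0 by blast
  have "unif [^] n = unif [^] m \<otimes> unif [^] (n - m)" using mn by (simp add: nat_pow_mult)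
  hence "x = unif [^] m \<otimes> (unif [^] (n - m) \<otimes> r)"
    unfolding r(2) using V_carrier[OF r(1)] by (simp add: m_assoc)
  thus ?thesis using V_I[OF V0_mult[OF u r(1)]] by simp
qed

lemma P_V1: "x \<in> P ==> x \<in> V 1"
  using unif(3)[of x] V_I[of _ 1] by auto

text \<open>By its recursion \<open>Ppow 1\<close> is the product of the unit ideal with
  \<open>P\<close>, so it lies in \<open>P\<close>; primality then removes the factor
  \<open>s\<close>.\<close>

lemma V1_P: "x \<in> ZK ==> x \<in> V 1 ==> x \<in> P"
proof -
  assume xz: "x \<in> ZK" and "x \<in> V 1"
  then obtain s where s: "s \<in> S" "s \<otimes> x \<in> Ppow 1" using V_iff_Ppow by blast
  interpret Z: cring "integer_ring R" by (rule cring_ZK)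
  have "Ppow 1 = ideal_prod (integer_ring R) ZK P" using Ppow_Suc[of 0] Ppow_0 by simp
  moreover have "ideal_prod (integer_ring R) ZK P \<subseteq> P"
    using Z.ideal_prod_inter[of ZK P] Z.oneideal ideal_zideal P_zideal by auto
  ultimately have "s \<otimes> x \<in> P" using s by blast
  thus "x \<in> P" using P_primeD[of s x] s xz by blast
qed

lemma one_notin_V1: "\<one> \<notin> V 1" using V1_P[OF ZK_one] one_notin_P by blast

lemma V_unit0: assumes r: "r \<in> V 0" "r \<notin> V 1" shows "r \<noteq> \<zero>" "inv r \<in> V 0"
proof -
  show rn: "r \<noteq> \<zero>" using r V_zero by blast
  obtain s where s: "s \<in> S" "s \<otimes> r \<in> ZK" "r \<in> carrier R" using r(1) unfolding V0_iff by blast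
  note sc = S_carrier[OF s(1)] and sn = S_nz[OF s(1)]
  have "s \<otimes> r \<notin> P"
  proof
    assume "s \<otimes> r \<in> P"
    hence "inv s \<otimes> (s \<otimes> r) \<in> V 1" using V_mult[OF S_inv[OF s(1)] P_V1] by simp
    moreover have "inv s \<otimes> (s \<otimes> r) = r" using sc sn s(3) by (simp add: m_assoc[symmetric])
    ultimately show False using r by simp
  qed
  hence a: "s \<otimes> r \<in> S" using s by blast
  have "inv r = s \<otimes> inv (s \<otimes> r)"
    using inv_mult_nz[OF sc sn s(3) rn] sc sn s(3) rn by (simp add: m_assoc[symmetric])
  thus "inv r \<in> V 0" using V0_mult[OF ZK_V0 S_inv[OF a]] s(1) by simp
qed

lemma V_unit: assumes d: "d \<in> V 1" shows "\<one> \<oplus> d \<noteq> \<zero>" "inv (\<one> \<oplus> d) \<in> V 0"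
proof -
  have "d \<in> V 0" using V_mono[of 0 1] d by simp
  hence 0: "\<one> \<oplus> d \<in> V 0" using V0_add V_one by blast
  have "\<one> \<oplus> d \<notin> V 1"
  proof
    assume "\<one> \<oplus> d \<in> V 1"
    hence "(\<one> \<oplus> d) \<ominus> d \<in> V 1" using d V_minus by blast
    moreover have "(\<one> \<oplus> d) \<ominus> d = \<one>" using V_carrier[OF d] by algebra
    ultimately show False using one_notin_V1 by simp
  qed
  thus "\<one> \<oplus> d \<noteq> \<zero>" "inv (\<one> \<oplus> d) \<in> V 0" using V_unit0 0 by auto
qed

text \<open>Write \<open>k\<close> as an integer divided by \<open>t\<close>. Some
  \<open>unif [^] m\<close> is divisible by \<open>t\<close>, so multiplication by \<open>k\<close>
  lowers the index by at most \<open>m\<close>.\<close>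

lemma V_scale: assumes k: "k \<in> carrier R" shows "\<exists>c. \<forall>n. \<forall>x\<in>V (n + c). k \<otimes> x \<in> V n"
proof -
  obtain t where t: "t \<in> ZK" "t \<noteq> \<zero>" "t \<otimes> k \<in> ZK" using fraction[OF k] by blast
  obtain m :: nat and r where m: "r \<in> V 0" "unif [^] m = t \<otimes> r" using P_power_divisible[OF unif(1) t(1,2)] by blast
  have kc: "t \<in> carrier R" "r \<in> carrier R" using t ZK_carrier V_carrier m by auto
  have "k \<otimes> unif [^] m = (t \<otimes> k) \<otimes> r" unfolding m(2) using kc k by (simp add: m_ac)
  hence 1: "k \<otimes> unif [^] m \<in> V 0" using V0_mult[OF ZK_V0[OF t(3)] m(1)] by simp
  have "k \<otimes> x \<in> V n" if "x \<in> V (n + m)" for x n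
  proof -
    obtain r where r: "r \<in> V 0" "x = unif [^] (n + m) \<otimes> r" using \<open>x \<in> V (n + m)\<close> V_iff by blast
    have e: "unif [^] (n + m) = unif [^] n \<otimes> unif [^] m" by (simp add: nat_pow_mult)
    have "k \<otimes> x = unif [^] n \<otimes> (k \<otimes> unif [^] m \<otimes> r)" unfolding r(2) e
      using k V_carrier[OF r(1)] unif_pow_closed[of n] unif_pow_closed[of m] by algebra
    thus ?thesis using V_I[OF V0_mult[OF 1 r(1)]] by simp
  qed
  thus ?thesis by blast
qed

text \<open>For nonzero \<open>x\<close>, multiplication by its inverse loses only a bounded index,
  so \<one> would end up in \<open>V 1\<close>.\<close>

lemma V_Inter: assumes "!!n. x \<in> V n" shows "x = \<zero>"
proof (rule ccontr)
  assume xn: "x \<noteq> \<zero>"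
  have xc: "x \<in> carrier R" using assms V_carrier by blast
  obtain c where "\<forall>n. \<forall>y\<in>V (n + c). inv x \<otimes> y \<in> V n" using V_scale[of "inv x"] xc xn by auto
  hence "inv x \<otimes> x \<in> V 1" using assms by blast
  thus False using xc xn one_notin_V1 by simp
qed

text \<open>If \<open>x\<close> is not in \<open>V 0\<close>, the least power of \<open>unif\<close>
  that carries it there turns it into a unit of \<open>V 0\<close>, since one factor less does not
  suffice.\<close>

lemma V_inverse: assumes x: "x \<in> carrier R" "x \<notin> V 1" shows "x \<noteq> \<zero>" "inv x \<in> V 0"
proof -
  show xn: "x \<noteq> \<zero>" using x V_zero by blast
  show "inv x \<in> V 0"
  proof (cases "x \<in> V 0")
    case True thus ?thesis using V_unit0(2) x(2) by blast
  next
    case False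
    obtain c where "!!n y. y \<in> V (n + c) ==> x \<otimes> y \<in> V n" using V_scale[OF x(1)] by blast
    hence "x \<otimes> unif [^] c \<in> V 0" using V_I[OF V_one, of c] by simp
    then obtain m where m: "x \<otimes> unif [^] Suc m \<in> V 0" "x \<otimes> unif [^] m \<notin> V 0"
      using ex_least_nat_less[of "%c. x \<otimes> unif [^] c \<in> V 0" c] False x(1) by auto
    define w where "w = x \<otimes> unif [^] Suc m"
    have wc: "w \<in> carrier R" using x(1) by (simp add: w_def)
    have w: "w = unif \<otimes> (x \<otimes> unif [^] m)" unfolding w_def using x(1) by (simp add: m_ac)
    have "w \<notin> V 1"
    proof
      assume "w \<in> V 1"
      then obtain r where "r \<in> V 0" "w = unif \<otimes> r" using V_iff[of w 1] by auto
      thus False using m(2) m_lcancel[of unif "x \<otimes> unif [^] m" r] unif(2) V_carrier w x(1) by auto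
    qed
    hence wi: "w \<noteq> \<zero>" "inv w \<in> V 0" using V_unit0 m(1) by (auto simp: w_def)
    have "unif [^] Suc m \<in> V 0" using V_mono[OF _ V_I[OF V_one]] unif_pow_closed by (metis le0 r_one)
    hence "unif [^] Suc m \<otimes> inv w \<in> V 0" using V0_mult wi by blast
    moreover have "x \<otimes> (unif [^] Suc m \<otimes> inv w) = w \<otimes> inv w"
      unfolding w_def[symmetric] using x(1) wc wi(1) unif_pow_closed by (metis inv_nz(1) m_assoc w_def)
    hence "inv x = unif [^] Suc m \<otimes> inv w" using comm_inv_char[OF x(1)] wi wc unif_pow_closed[of "Suc m"] by (simp del: nat_pow_Suc)
    ultimately show ?thesis by simp
  qed
qed

text \<open>If the quotient \<open>e\<close> were outside \<open>V 1\<close>, its inverse would be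
  in \<open>V 0\<close>, and \<open>k = inv e \<otimes> d\<close> would be as small as
  \<open>d\<close>. In the completion this bounds the relative error of an approximation.\<close>

lemma V_div: assumes k: "k \<in> carrier R" "k \<notin> V n" and d: "d \<in> V (Suc n)"
  shows "k \<noteq> \<zero>" "inv k \<otimes> d \<in> V 1"
proof -
  show kn: "k \<noteq> \<zero>" using k V_zero by blast
  note dc = V_carrier[OF d]
  define e where "e = inv k \<otimes> d"
  have ec: "e \<in> carrier R" and ke: "k \<otimes> e = d" using k kn dc by (auto simp: e_def m_assoc[symmetric])
  show "inv k \<otimes> d \<in> V 1"
  proof (rule ccontr)
    assume "\<not> ?thesis"
    hence i: "e \<noteq> \<zero>" "inv e \<in> V 0" using V_inverse[OF ec] by (auto simp: e_def)
    have "inv e \<otimes> d = k" unfolding ke[symmetric] using k(1) ec i(1) by (simp add: m_lcomm[of "inv e"])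
    hence "k \<in> V (Suc n)" using V_mult[OF i(2) d] by simp
    thus False using V_mono[of n "Suc n"] k(2) by simp
  qed
qed

end

section \<open>Strong approximation in a number field\<close>

context number_prime
begin

text \<open>The nonzero residues modulo \<open>P\<close> form a finite group: two powers of
  \<open>x\<close> agree modulo a nonzero element of \<open>P\<close>, and powers of
  \<open>x\<close> can be cancelled modulo \<open>P\<close>.\<close>

lemma S_power_one:
  assumes x: "x \<in> S" shows "\<exists>d. x [^] Suc d \<ominus> \<one> \<in> P"
proof -
  obtain s where s: "s \<in> P" "s \<noteq> \<zero>" using P_nontrivial by blast
  have sz: "s \<in> ZK" using s P_props(7) by blast
  have xz: "x \<in> ZK" and xc: "x \<in> carrier R" using x ZK_carrier by auto
  obtain m n :: nat and y where mn: "m < n" "y \<in> ZK" "x [^] n \<ominus> x [^] m = s \<otimes> y"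
    using ZK_pigeonhole[OF sz s(2), of "%n. x [^] n"] ZK_pow[OF xz] by blast
  obtain d where d: "n = m + Suc d" using mn(1) less_imp_Suc_add by auto
  have c: "x [^] m \<in> carrier R" "x [^] Suc d \<in> carrier R" using xc by auto
  have "x [^] m \<otimes> (x [^] Suc d \<ominus> \<one>) = x [^] m \<otimes> x [^] Suc d \<ominus> x [^] m" using c by algebra
  also have "x [^] m \<otimes> x [^] Suc d = x [^] n" unfolding d using xc by (rule nat_pow_mult)
  finally have "x [^] m \<otimes> (x [^] Suc d \<ominus> \<one>) = y \<otimes> s"
    using mn(3) ZK_carrier[OF mn(2)] P_carrier[OF s(1)] by (simp add: m_comm)
  hence "x [^] m \<otimes> (x [^] Suc d \<ominus> \<one>) \<in> P" using P_props(4)[OF mn(2) s(1)] by simp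
  moreover have "x [^] m \<notin> P"
  proof -
    have "x [^] m \<in> S" by (induction m) (use S_one S_mult x in auto)
    thus ?thesis by blast
  qed
  ultimately show ?thesis using P_primeD ZK_pow[OF xz] ZK_minus ZK_one by blast
qed

lemma V1_pow: "x \<in> V 1 ==> x [^] (n::nat) \<in> V n"
proof (induction n)
  case 0 thus ?case using V_one by simp
next
  case (Suc n)
  thus ?case using V_mult[of "x [^] n" n x 1] by simp
qed

end

context numfield
begin

lemma number_prime_I: "P \<in> finite_primes R ==> number_prime R P"
  by (intro number_prime.intro number_prime_axioms.intro numfield_axioms)

text \<open>An element of \<open>Q\<close> outside \<open>P\<close> has a power congruent to \<one>
  modulo \<open>P\<close>. The other case cannot occur: if \<open>Q\<close> lay in \<open>P\<close>,
  an element of \<open>P\<close> outside \<open>Q\<close> would have a power congruent to \<one>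
  modulo \<open>Q\<close>, which would put \<one> into \<open>P\<close>.\<close>

lemma separate_primes:
  assumes P: "P \<in> finite_primes R" and Q: "Q \<in> finite_primes R" and PQ: "P \<noteq> Q"
  shows "\<exists>q\<in>Q. \<one> \<ominus> q \<in> P"
proof -
  interpret P: number_prime R P by (rule number_prime_I[OF P])
  interpret Q: number_prime R Q by (rule number_prime_I[OF Q])
  show ?thesis
  proof (cases "Q \<subseteq> P")
    case False
    then obtain x where x: "x \<in> Q" "x \<notin> P" by blast
    have xz: "x \<in> ZK" using Q.P_props(7) x by blast
    obtain d where d: "x [^] Suc d \<ominus> \<one> \<in> P" using P.S_power_one x xz by blast
    have "x [^] Suc d \<in> Q" using Q.P_props(4)[OF ZK_pow[OF xz] x(1)] by simp
    moreover have c: "x [^] Suc d \<in> carrier R" using ZK_carrier[OF xz] by simp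
    have "\<one> \<ominus> x [^] Suc d = \<ominus> (x [^] Suc d \<ominus> \<one>)" using c by algebra
    hence "\<one> \<ominus> x [^] Suc d \<in> P" using P.P_props(5)[OF d] by simp
    ultimately show ?thesis by blast
  next
    case True
    then obtain x where x: "x \<in> P" "x \<notin> Q" using PQ by blast
    have xz: "x \<in> ZK" using P.P_props(7) x by blast
    obtain d where d: "x [^] Suc d \<ominus> \<one> \<in> Q" using Q.S_power_one x xz by blast
    have "x [^] Suc d \<in> P" using P.P_props(4)[OF ZK_pow[OF xz] x(1)] by simp
    hence "x [^] Suc d \<ominus> (x [^] Suc d \<ominus> \<one>) \<in> P" using d True P.P_props(6) by blast
    moreover have c: "x [^] Suc d \<in> carrier R" using ZK_carrier[OF xz] by simp
    have "x [^] Suc d \<ominus> (x [^] Suc d \<ominus> \<one>) = \<one>" using c by algebra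
    ultimately show ?thesis using P.one_notin_P by simp
  qed
qed

text \<open>With \<open>q\<close> in \<open>Q\<close> and \<open>\<one> \<ominus> q\<close> in
  \<open>P\<close>, the witness is \<open>\<one> \<ominus> (\<one> \<ominus> q [^] M) [^] M\<close>.
  The inner power makes it divisible by \<open>q [^] M\<close>; the outer one makes its complement
  the \<open>M\<close>-th power of an element of \<open>P\<close>.\<close>

lemma separate_primes_pow:
  assumes P: "P \<in> finite_primes R" and Q: "Q \<in> finite_primes R" and PQ: "P \<noteq> Q"
  shows "\<exists>e\<in>ZK. e \<in> val_ge R Q M \<and> \<one> \<ominus> e \<in> val_ge R P M"
proof -
  interpret P: number_prime R P by (rule number_prime_I[OF P])
  interpret Q: number_prime R Q by (rule number_prime_I[OF Q])
  obtain q where q: "q \<in> Q" "\<one> \<ominus> q \<in> P" using separate_primes[OF assms] by blast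
  have qz: "q \<in> ZK" and qc: "q \<in> carrier R" using Q.P_props(7)[OF q(1)] ZK_carrier by auto
  have 1: "\<one> \<ominus> q [^] n \<in> P" for n :: nat
  proof (induction n)
    case 0
    have "\<one> \<ominus> q [^] (0::nat) = \<zero>" by (simp add: a_minus_def r_neg)
    thus ?case using P.P_props(2) by (simp add: a_minus_def r_neg)
  next
    case (Suc n)
    have c: "q [^] n \<in> carrier R" using qc by simp
    have "\<one> \<ominus> q [^] Suc n = \<one> \<ominus> q [^] n \<otimes> q" by simp
    also have "... = (\<one> \<ominus> q [^] n) \<oplus> q [^] n \<otimes> (\<one> \<ominus> q)" using c qc by algebra
    finally show ?case using P.P_props(3)[OF Suc P.P_props(4)[OF ZK_pow[OF qz] q(2)]] by simp
  qed
  define w where "w = q [^] M"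
  have w: "w \<in> ZK" "w \<in> carrier R" "w \<in> val_ge R Q M"
    unfolding w_def using ZK_pow[OF qz] qc Q.V1_pow[OF Q.P_V1[OF q(1)]] by auto
  have w1: "\<one> \<ominus> w \<in> carrier R" "\<one> \<ominus> w \<in> ZK" using w ZK_minus ZK_one by auto
  have 2: "\<one> \<ominus> (\<one> \<ominus> w) [^] n \<in> val_ge R Q M" for n :: nat
  proof (induction n)
    case 0
    have "\<one> \<ominus> (\<one> \<ominus> w) [^] (0::nat) = \<zero>" by (simp add: a_minus_def r_neg)
    thus ?case using Q.V_zero by (simp add: a_minus_def r_neg)
  next
    case (Suc n)
    define v where "v = (\<one> \<ominus> w) [^] n"
    have v: "v \<in> carrier R" "v \<in> ZK" unfolding v_def using w1 ZK_pow by auto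
    have "\<one> \<ominus> (\<one> \<ominus> w) [^] Suc n = \<one> \<ominus> v \<otimes> (\<one> \<ominus> w)" by (simp add: v_def)
    also have "... = (\<one> \<ominus> v) \<oplus> v \<otimes> w" using v w by algebra
    finally show ?case using Q.V_add[of "\<one> \<ominus> v" M "v \<otimes> w"] Suc Q.V_mult[OF Q.ZK_V0[OF v(2)] w(3)] by (simp add: v_def)
  qed
  define e where "e = \<one> \<ominus> (\<one> \<ominus> w) [^] M"
  have e: "e \<in> ZK" unfolding e_def using w1 ZK_pow ZK_minus ZK_one by auto
  have c: "(\<one> \<ominus> w) [^] M \<in> carrier R" using w1 by simp
  have "\<one> \<ominus> e = (\<one> \<ominus> w) [^] M" unfolding e_def using c by algebra
  moreover have "(\<one> \<ominus> w) [^] M \<in> val_ge R P M" using P.V1_pow[OF P.P_V1] 1[of M] w_def by simp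
  ultimately show ?thesis using e 2[of M] e_def by (metis (no_types, lifting))
qed

lemma separate_prime_set:
  assumes P: "P \<in> finite_primes R" and T: "finite T" "T \<subseteq> finite_primes R" "P \<notin> T"
  shows "\<exists>e\<in>ZK. (\<forall>Q\<in>T. e \<in> val_ge R Q M) \<and> \<one> \<ominus> e \<in> val_ge R P M"
  using T
proof (induction T rule: finite_induct)
  case empty
  interpret P: number_prime R P by (rule number_prime_I[OF P])
  have "\<one> \<ominus> \<one> = \<zero>" by (simp add: a_minus_def r_neg)
  hence "\<one> \<ominus> \<one> \<in> val_ge R P M" using P.V_zero by (simp add: a_minus_def r_neg)
  thus ?case using ZK_one by (intro bexI[of _ \<one>]) auto
next
  case (insert Q T)
  interpret P: number_prime R P by (rule number_prime_I[OF P])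
  obtain e where e: "e \<in> ZK" "!!Q. Q \<in> T ==> e \<in> val_ge R Q M" "\<one> \<ominus> e \<in> val_ge R P M" using insert by blast
  obtain e' where e': "e' \<in> ZK" "e' \<in> val_ge R Q M" "\<one> \<ominus> e' \<in> val_ge R P M"
    using separate_primes_pow[OF P, of Q] insert.prems by blast
  have c: "e \<in> carrier R" "e' \<in> carrier R" using e e' ZK_carrier by auto
  have "\<one> \<ominus> e \<otimes> e' = (\<one> \<ominus> e) \<oplus> e \<otimes> (\<one> \<ominus> e')" using c by algebra
  hence "\<one> \<ominus> e \<otimes> e' \<in> val_ge R P M"
    using P.V_add[OF e(3)] P.V_mult[OF P.ZK_V0[OF e(1)] e'(3)] by simp
  moreover have "e \<otimes> e' \<in> val_ge R Q' M" if Q': "Q' \<in> insert Q T" for Q'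
  proof -
    interpret Q': number_prime R Q' by (rule number_prime_I) (use insert.prems Q' in blast)
    show ?thesis
    proof (cases "Q' = Q")
      case True thus ?thesis using Q'.V_mult[OF Q'.ZK_V0[OF e(1)], of e' M] e' by simp
    next
      case False
      hence "e \<in> val_ge R Q' M" using e Q' by blast
      hence "e' \<otimes> e \<in> val_ge R Q' M" using Q'.V_mult[OF Q'.ZK_V0[OF e'(1)], of e M] by simp
      thus ?thesis using c by (simp add: m_comm)
    qed
  qed
  ultimately show ?case using ZK_mult[OF e(1) e'(1)] by blast
qed

text \<open>The approximation is \<open>k \<otimes> e\<close> with \<open>e\<close> integral, near
  \<one> at \<open>P\<close> and near \<zero> at the other primes of \<open>T\<close> and at the
  other primes containing the denominator \<open>t\<close> of \<open>k\<close>. At the remaining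
  primes \<open>k\<close> is integral by itself.\<close>

lemma approximation_single:
  assumes P: "P \<in> finite_primes R" and T: "finite T" "T \<subseteq> finite_primes R" and k: "k \<in> carrier R"
  shows "\<exists>x\<in>carrier R. x \<ominus> k \<in> val_ge R P n \<and> (\<forall>Q\<in>T - {P}. x \<in> val_ge R Q n) \<and> (\<forall>Q\<in>finite_primes R - {P}. x \<in> val_ge R Q 0)"
proof -
  interpret P: number_prime R P by (rule number_prime_I[OF P])
  obtain t where t: "t \<in> ZK" "t \<noteq> \<zero>" "t \<otimes> k \<in> ZK" using fraction[OF k] by blast
  define T' where "T' = (T \<union> {Q \<in> finite_primes R. t \<in> Q}) - {P}"
  have T': "finite T'" "T' \<subseteq> finite_primes R" "P \<notin> T'" unfolding T'_def using T finite_primes_containing[OF t(1,2)] by auto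
  have "\<exists>c. \<forall>n. \<forall>x\<in>val_ge R Q (n + c). k \<otimes> x \<in> val_ge R Q n" if "Q \<in> finite_primes R" for Q
    using number_prime.V_scale[OF number_prime_I[OF that] k] .
  then obtain c where c: "!!Q n x. Q \<in> finite_primes R ==> x \<in> val_ge R Q (n + c Q) ==> k \<otimes> x \<in> val_ge R Q n" by metis
  \<comment> \<open>Multiplication by \<open>k\<close> loses at most \<open>c Q\<close> at the prime
    \<open>Q\<close>; the maximum covers all primes concerned.\<close>
  define M where "M = n + Max (c ` insert P T')"
  have M: "k \<otimes> x \<in> val_ge R Q n" if "x \<in> val_ge R Q M" "Q \<in> insert P T'" for x Q
  proof -
    have "c Q \<le> Max (c ` insert P T')" using T'(1) that(2) by (intro Max_ge) auto
    hence "n + c Q \<le> M" unfolding M_def by simp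
    moreover have Q: "Q \<in> finite_primes R" using that(2) T' P by blast
    ultimately have "x \<in> val_ge R Q (n + c Q)" using number_prime.V_mono[OF number_prime_I[OF Q]] that(1) by blast
    thus ?thesis using c[OF Q] by blast
  qed
  obtain e where e: "e \<in> ZK" "!!Q. Q \<in> T' ==> e \<in> val_ge R Q M" "\<one> \<ominus> e \<in> val_ge R P M"
    using separate_prime_set[OF P T'] by blast
  note ec = ZK_carrier[OF e(1)]
  have "k \<otimes> e \<ominus> k = \<ominus> (k \<otimes> (\<one> \<ominus> e))" using ec k by algebra
  hence 1: "k \<otimes> e \<ominus> k \<in> val_ge R P n" using P.V_uminus M[OF e(3)] by simp
  have 2: "k \<otimes> e \<in> val_ge R Q n" if "Q \<in> T'" for Q using M e that by blast
  have 3: "k \<otimes> e \<in> val_ge R Q 0" if Q: "Q \<in> finite_primes R - {P}" for Q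
  proof -
    interpret Q: number_prime R Q by (rule number_prime_I) (use Q in blast)
    show ?thesis
    proof (cases "Q \<in> T'")
      case True
      thus ?thesis using 2 Q.V_mono[of 0 n] by blast
    next
      case False
      hence "t \<in> Q.S" using Q t by (auto simp: T'_def)
      hence "k \<in> val_ge R Q 0" using Q.V0_iff t k by blast
      thus ?thesis using Q.V_mult[of k 0 e 0] Q.ZK_V0[OF e(1)] by simp
    qed
  qed
  have "T - {P} \<subseteq> T'" by (auto simp: T'_def)
  show ?thesis
  proof (intro bexI[of _ "k \<otimes> e"] conjI ballI)
    show "k \<otimes> e \<in> val_ge R Q n" if "Q \<in> T - {P}" for Q using 2 \<open>T - {P} \<subseteq> T'\<close> that by blast
    show "k \<otimes> e \<in> carrier R" using k ec by simp
    show "k \<otimes> e \<ominus> k \<in> val_ge R P n" by (rule 1)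
    show "k \<otimes> e \<in> val_ge R Q 0" if "Q \<in> finite_primes R - {P}" for Q using that by (rule 3)
  qed
qed

text \<open>An approximation \<open>x\<close> for \<open>T\<close> is corrected at a new prime
  \<open>P\<close> by an element near \<open>k P \<ominus> x\<close> there, near \<zero> at the
  primes of \<open>T\<close>, and integral elsewhere, so nothing achieved before is spoiled.\<close>

theorem strong_approximation:
  assumes "finite T" "T \<subseteq> finite_primes R" "!!P. P \<in> T ==> k P \<in> carrier R"
  shows "\<exists>x\<in>carrier R. (\<forall>P\<in>T. x \<ominus> k P \<in> val_ge R P n) \<and> (\<forall>Q\<in>finite_primes R - T. x \<in> val_ge R Q 0)"
  using assms
proof (induction T rule: finite_induct)
  case empty
  have "\<zero> \<in> val_ge R Q 0" if "Q \<in> finite_primes R" for Q using number_prime.V_zero[OF number_prime_I[OF that]] .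
  thus ?case by (intro bexI[of _ \<zero>]) auto
next
  case (insert P T)
  have P: "P \<in> finite_primes R" and T: "T \<subseteq> finite_primes R" using insert.prems by auto
  obtain x where x: "x \<in> carrier R" "!!Q. Q \<in> T ==> x \<ominus> k Q \<in> val_ge R Q n" "!!Q. Q \<in> finite_primes R - T ==> x \<in> val_ge R Q 0"
    using insert.IH insert.prems by blast
  have kP: "k P \<in> carrier R" using insert.prems by blast
  obtain y where yc: "y \<in> carrier R" and y0: "y \<ominus> (k P \<ominus> x) \<in> val_ge R P n \<and> (\<forall>Q\<in>T - {P}. y \<in> val_ge R Q n)
    \<and> (\<forall>Q\<in>finite_primes R - {P}. y \<in> val_ge R Q 0)"
    using approximation_single[OF P insert.hyps(1) T minus_closed[OF kP x(1)]] by (rule bexE)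
  note y = yc conjunct1[OF y0] bspec[OF conjunct1[OF conjunct2[OF y0]]] bspec[OF conjunct2[OF conjunct2[OF y0]]]
  have "(x \<oplus> y) \<ominus> k P = y \<ominus> (k P \<ominus> x)" using x(1) y(1) kP by algebra
  hence 1: "(x \<oplus> y) \<ominus> k P \<in> val_ge R P n" using y by simp
  have 2: "(x \<oplus> y) \<ominus> k Q \<in> val_ge R Q n" if Q: "Q \<in> T" for Q
  proof -
    interpret Q: number_prime R Q by (rule number_prime_I) (use Q T in blast)
    have kQ: "k Q \<in> carrier R" using insert.prems Q by blast
    have "(x \<oplus> y) \<ominus> k Q = (x \<ominus> k Q) \<oplus> y" using x(1) y(1) kQ by algebra
    moreover have "Q \<in> T - {P}" using Q insert.hyps by blast
    ultimately show ?thesis using Q.V_add[OF x(2)[OF Q] y(3)] by simp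
  qed
  have 3: "x \<oplus> y \<in> val_ge R Q 0" if Q: "Q \<in> finite_primes R - insert P T" for Q
  proof -
    interpret Q: number_prime R Q by (rule number_prime_I) (use Q in blast)
    show ?thesis using Q.V_add[OF x(3) y(4)] Q by blast
  qed
  show ?case using 1 2 3 x(1) y(1) by (intro bexI[of _ "x \<oplus> y"]) auto
qed

end

section \<open>Tensor products\<close>

locale tens = H: ring H + L: cring L
  for H :: "('a, 'm) ring_scheme" (structure) and K :: "'a set" and \<phi> :: "'a => 'c" and L :: "('c, 'k) ring_scheme" +
  assumes K_subring: "subring K H"
    and K_central: "!!k x. k \<in> K ==> x \<in> carrier H ==> k \<otimes> x = x \<otimes> k"
    and phi: "!!k. k \<in> K ==> \<phi> k \<in> carrier L" "\<phi> \<one> = \<one>\<^bsub>L\<^esub>"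
      "!!k l. k \<in> K ==> l \<in> K ==> \<phi> (k \<oplus> l) = \<phi> k \<oplus>\<^bsub>L\<^esub> \<phi> l"
      "!!k l. k \<in> K ==> l \<in> K ==> \<phi> (k \<otimes> l) = \<phi> k \<otimes>\<^bsub>L\<^esub> \<phi> l"
begin

abbreviation FR where "FR \<equiv> free_pair_ring H L"
abbreviation fr_mult (infixl "\<bullet>" 70) where "f \<bullet> g \<equiv> f \<otimes>\<^bsub>FR\<^esub> g"
abbreviation TI where "TI \<equiv> tensor_ideal H K \<phi> L"
abbreviation TR where "TR \<equiv> tensor_ring H K \<phi> L"
abbreviation rels where "rels \<equiv> tensor_relations H K \<phi> L"
abbreviation pt :: "'a => 'c => (('a \<times> 'c) \<Rightarrow>\<^sub>0 int) set" where "pt \<equiv> pure_tensor H K \<phi> L"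

lemma K_carrier [simp]: "k \<in> K ==> k \<in> carrier H" using subringE(1)[OF K_subring] by blast

sublocale FR: ring FR by (rule free_pair_ring_is_ring) unfold_locales

lemma FR_iff: "f \<in> carrier FR \<longleftrightarrow> Poly_Mapping.keys f \<subseteq> carrier H \<times> carrier L" by (simp add: free_pair_ring_def)

lemma FR_zero: "\<zero>\<^bsub>FR\<^esub> = 0" and FR_add: "f \<oplus>\<^bsub>FR\<^esub> g = f + g" and FR_one: "\<one>\<^bsub>FR\<^esub> = frag_of (\<one>, \<one>\<^bsub>L\<^esub>)"
  by (simp_all add: free_pair_ring_def)

lemma FR_of [simp]: "frag_of (a, l) \<in> carrier FR \<longleftrightarrow> a \<in> carrier H \<and> l \<in> carrier L" by (simp add: FR_iff)

lemma FR_of_mult: "frag_of (a, l) \<bullet> frag_of (b, m) = frag_of (a \<otimes> b, l \<otimes>\<^bsub>L\<^esub> m)"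
  by (simp add: free_pair_ring_def)

lemma FR_minus_closed: "f \<in> carrier FR ==> g \<in> carrier FR ==> f - g \<in> carrier FR"
  unfolding FR_iff using keys_diff[of f g] by blast

lemma FR_plus_closed: "f \<in> carrier FR ==> g \<in> carrier FR ==> f + g \<in> carrier FR"
  using FR.add.m_closed[of f g] by (simp add: FR_add)

lemma FR_uminus: "f \<in> carrier FR ==> \<ominus>\<^bsub>FR\<^esub> f = - f"
proof -
  assume f: "f \<in> carrier FR"
  have "- f \<in> carrier FR" using f by (simp add: FR_iff)
  thus ?thesis using f by (intro FR.minus_equality) (auto simp: FR_add FR_zero)
qed

lemma FR_minus: "f \<in> carrier FR ==> g \<in> carrier FR ==> f \<ominus>\<^bsub>FR\<^esub> g = f - g"
  by (simp add: a_minus_def FR_uminus FR_add)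

lemma FR_minus_l: "f \<in> carrier FR ==> g \<in> carrier FR ==> h \<in> carrier FR ==> (f - g) \<bullet> h = f \<bullet> h - g \<bullet> h"
  by (simp add: FR_minus[symmetric] a_minus_def FR.l_distr FR.l_minus)

lemma FR_minus_r: "f \<in> carrier FR ==> g \<in> carrier FR ==> h \<in> carrier FR ==> h \<bullet> (f - g) = h \<bullet> f - h \<bullet> g"
  by (simp add: FR_minus[symmetric] a_minus_def FR.r_distr FR.r_minus)

lemma FR_induct [consumes 1, case_names zero of diff]:
  assumes "f \<in> carrier FR" "Q 0" "!!a l. a \<in> carrier H ==> l \<in> carrier L ==> Q (frag_of (a, l))"
    "!!f g. f \<in> carrier FR ==> g \<in> carrier FR ==> Q f ==> Q g ==> Q (f - g)"
  shows "Q f"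
proof -
  have "f \<in> carrier FR \<and> Q f"
  proof (rule frag_induction[of f "carrier H \<times> carrier L"])
    show "Poly_Mapping.keys f \<subseteq> carrier H \<times> carrier L" using assms(1) by (simp add: FR_iff)
    show "0 \<in> carrier FR \<and> Q 0" using assms(2) by (simp add: FR_iff)
    show "frag_of p \<in> carrier FR \<and> Q (frag_of p)" if "p \<in> carrier H \<times> carrier L" for p
      using that assms(3) by (cases p) simp
    show "a - b \<in> carrier FR \<and> Q (a - b)" if "a \<in> carrier FR \<and> Q a" "b \<in> carrier FR \<and> Q b" for a b
      using that assms(4) FR_minus_closed by simp
  qed
  thus ?thesis by simp
qed

lemma rels_FR: "rels \<subseteq> carrier FR"
  unfolding tensor_relations_def using phi(1) by (auto intro!: FR_minus_closed)

lemma TI_ideal: "ideal TI FR"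
  unfolding tensor_ideal_def by (rule FR.genideal_ideal[OF rels_FR])

lemma rels_TI: "rels \<subseteq> TI" unfolding tensor_ideal_def by (rule FR.genideal_self[OF rels_FR])

lemma TI_least: "ideal I FR ==> rels \<subseteq> I ==> TI \<subseteq> I" unfolding tensor_ideal_def by (rule FR.genideal_minimal)

lemma TI_induct [consumes 1, case_names rel diff left right]:
  assumes "f \<in> TI" "!!r. r \<in> rels ==> Q r"
    "!!f g. f \<in> carrier FR ==> g \<in> carrier FR ==> Q f ==> Q g ==> Q (f - g)"
    "!!f x. f \<in> carrier FR ==> x \<in> carrier FR ==> Q f ==> Q (x \<bullet> f)"
    "!!f x. f \<in> carrier FR ==> x \<in> carrier FR ==> Q f ==> Q (f \<bullet> x)"
  shows "Q f"
proof -
  define I where "I = {f \<in> carrier FR. Q f}"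
  have gsub: "f - g \<in> I" if "f \<in> I" "g \<in> I" for f g
    using that assms(3) FR_minus_closed by (simp add: I_def)
  \<comment> \<open>This relation collapses to a negated generator. It shows that \<open>I\<close>
    is inhabited, after which closure under differences provides zero.\<close>
  have "frag_of (\<zero>, \<zero>\<^bsub>L\<^esub> \<oplus>\<^bsub>L\<^esub> \<zero>\<^bsub>L\<^esub>) - frag_of (\<zero>, \<zero>\<^bsub>L\<^esub>) - frag_of (\<zero>, \<zero>\<^bsub>L\<^esub>) \<in> rels"
    unfolding tensor_relations_def by blast
  hence "- frag_of (\<zero>, \<zero>\<^bsub>L\<^esub>) \<in> I" using assms(2) rels_FR by (auto simp: I_def)
  hence z: "0 \<in> I" using gsub[of "- frag_of (\<zero>, \<zero>\<^bsub>L\<^esub>)" "- frag_of (\<zero>, \<zero>\<^bsub>L\<^esub>)"] by simp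
  have "ideal I FR"
  proof (rule idealI)
    show "subgroup I (add_monoid FR)"
    proof (rule FR.add.subgroupI)
      show "I \<subseteq> carrier FR" by (auto simp: I_def)
      show "I \<noteq> {}" using z by blast
      show "\<ominus>\<^bsub>FR\<^esub> x \<in> I" if "x \<in> I" for x
        using gsub[OF z that] FR_uminus[of x] that by (simp add: I_def)
      show "x \<oplus>\<^bsub>FR\<^esub> y \<in> I" if "x \<in> I" "y \<in> I" for x y
        using gsub[OF that(1) gsub[OF z that(2)]] by (simp add: FR_add)
    qed
  qed (use assms(4,5) FR.ring_axioms in \<open>auto simp: I_def\<close>)
  moreover have "rels \<subseteq> I" using rels_FR assms(2) by (auto simp: I_def)
  ultimately have "TI \<subseteq> I" by (rule TI_least)
  thus ?thesis using assms(1) by (auto simp: I_def)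
qed

definition cl where "cl f = TI +>\<^bsub>FR\<^esub> f"

lemma TR_ring: "ring TR" unfolding tensor_ring_def by (rule ideal.quotient_is_ring[OF TI_ideal])

sublocale TR: ring TR by (rule TR_ring)

lemma cl_hom: "cl \<in> ring_hom FR TR"
  unfolding tensor_ring_def cl_def[abs_def] by (rule ideal.rcos_ring_hom[OF TI_ideal])

sublocale cl: ring_hom_ring FR TR cl by (rule ring_hom_ringI2[OF FR.ring_axioms TR_ring cl_hom])

lemma cl_eq_iff: "f \<in> carrier FR ==> g \<in> carrier FR ==> cl f = cl g \<longleftrightarrow> f - g \<in> TI"
  using FR.quotient_eq_iff_same_a_r_cos[OF TI_ideal, of f g] by (simp add: cl_def FR_minus)

lemma TR_E: assumes "x \<in> carrier TR" obtains f where "f \<in> carrier FR" "x = cl f"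
proof -
  have "x \<in> a_rcosets\<^bsub>FR\<^esub> TI" using assms by (simp add: tensor_ring_def FactRing_def)
  thus ?thesis using that by (auto simp: A_RCOSETS_def' cl_def)
qed

lemma cl_minus: "f \<in> carrier FR ==> g \<in> carrier FR ==> cl (f - g) = cl f \<ominus>\<^bsub>TR\<^esub> cl g"
  by (simp add: FR_minus[symmetric] a_minus_def)

lemma pt_cl: "pt a l = cl (frag_of (a, l))" by (simp add: pure_tensor_def cl_def)

lemma pt_closed [simp]: "a \<in> carrier H ==> l \<in> carrier L ==> pt a l \<in> carrier TR" by (simp add: pt_cl)

lemma pt_add_left:
  assumes "a \<in> carrier H" "b \<in> carrier H" "l \<in> carrier L"
  shows "pt (a \<oplus> b) l = pt a l \<oplus>\<^bsub>TR\<^esub> pt b l"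
proof -
  have "frag_of (a \<oplus> b, l) - frag_of (a, l) - frag_of (b, l) \<in> TI"
    using assms rels_TI unfolding tensor_relations_def by blast
  hence "cl (frag_of (a \<oplus> b, l)) = cl (frag_of (a, l) \<oplus>\<^bsub>FR\<^esub> frag_of (b, l))"
    using assms cl_eq_iff[of "frag_of (a \<oplus> b, l)" "frag_of (a, l) \<oplus>\<^bsub>FR\<^esub> frag_of (b, l)"] by (simp add: FR_add FR_plus_closed diff_diff_eq)
  thus ?thesis using assms by (simp add: pt_cl)
qed

lemma pt_add_right:
  assumes "a \<in> carrier H" "l \<in> carrier L" "m \<in> carrier L"
  shows "pt a (l \<oplus>\<^bsub>L\<^esub> m) = pt a l \<oplus>\<^bsub>TR\<^esub> pt a m"
proof -
  have "frag_of (a, l \<oplus>\<^bsub>L\<^esub> m) - frag_of (a, l) - frag_of (a, m) \<in> TI"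
    using assms rels_TI unfolding tensor_relations_def by blast
  hence "cl (frag_of (a, l \<oplus>\<^bsub>L\<^esub> m)) = cl (frag_of (a, l) \<oplus>\<^bsub>FR\<^esub> frag_of (a, m))"
    using assms cl_eq_iff[of "frag_of (a, l \<oplus>\<^bsub>L\<^esub> m)" "frag_of (a, l) \<oplus>\<^bsub>FR\<^esub> frag_of (a, m)"] by (simp add: FR_add FR_plus_closed diff_diff_eq)
  thus ?thesis using assms by (simp add: pt_cl)
qed

lemma pt_balanced:
  assumes "a \<in> carrier H" "k \<in> K" "l \<in> carrier L"
  shows "pt (a \<otimes> k) l = pt a (\<phi> k \<otimes>\<^bsub>L\<^esub> l)"
proof -
  have "frag_of (a \<otimes> k, l) - frag_of (a, \<phi> k \<otimes>\<^bsub>L\<^esub> l) \<in> TI"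
    using assms rels_TI unfolding tensor_relations_def by blast
  thus ?thesis
    using assms phi(1) cl_eq_iff[of "frag_of (a \<otimes> k, l)" "frag_of (a, \<phi> k \<otimes>\<^bsub>L\<^esub> l)"] by (simp add: pt_cl)
qed

lemma pt_mult:
  assumes "a \<in> carrier H" "b \<in> carrier H" "l \<in> carrier L" "m \<in> carrier L"
  shows "pt a l \<otimes>\<^bsub>TR\<^esub> pt b m = pt (a \<otimes> b) (l \<otimes>\<^bsub>L\<^esub> m)"
  using cl.hom_mult[of "frag_of (a, l)" "frag_of (b, m)"] assms by (simp add: pt_cl FR_of_mult)

lemma pt_one: "pt \<one> \<one>\<^bsub>L\<^esub> = \<one>\<^bsub>TR\<^esub>" using cl.hom_one by (simp add: pt_cl FR_one)

lemma pt_zero_left: "l \<in> carrier L ==> pt \<zero> l = \<zero>\<^bsub>TR\<^esub>"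
  using pt_add_left[of "\<zero>" "\<zero>" l] TR.add.r_cancel_one'[of "pt \<zero> l" "pt \<zero> l"] by simp

lemma pt_zero_right: "a \<in> carrier H ==> pt a \<zero>\<^bsub>L\<^esub> = \<zero>\<^bsub>TR\<^esub>"
  using pt_add_right[of a "\<zero>\<^bsub>L\<^esub>" "\<zero>\<^bsub>L\<^esub>"] TR.add.r_cancel_one'[of "pt a \<zero>\<^bsub>L\<^esub>" "pt a \<zero>\<^bsub>L\<^esub>"] by simp

lemma pt_uminus_left: "a \<in> carrier H ==> l \<in> carrier L ==> pt (\<ominus> a) l = \<ominus>\<^bsub>TR\<^esub> pt a l"
  using pt_add_left[of "\<ominus> a" a l] pt_zero_left by (intro TR.minus_equality[symmetric]) (simp_all add: H.l_neg)

lemma pt_uminus_right: "a \<in> carrier H ==> l \<in> carrier L ==> pt a (\<ominus>\<^bsub>L\<^esub> l) = \<ominus>\<^bsub>TR\<^esub> pt a l"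
  using pt_add_right[of a "\<ominus>\<^bsub>L\<^esub> l" l] pt_zero_right by (intro TR.minus_equality[symmetric]) (simp_all add: L.l_neg)

lemma TR_induct [consumes 1, case_names zero of diff]:
  assumes "x \<in> carrier TR" "Q \<zero>\<^bsub>TR\<^esub>" "!!a l. a \<in> carrier H ==> l \<in> carrier L ==> Q (pt a l)"
    "!!x y. x \<in> carrier TR ==> y \<in> carrier TR ==> Q x ==> Q y ==> Q (x \<ominus>\<^bsub>TR\<^esub> y)"
  shows "Q x"
proof -
  obtain f where f: "f \<in> carrier FR" "x = cl f" using TR_E[OF assms(1)] .
  have "Q (cl f)" using f(1)
  proof (induction rule: FR_induct)
    case zero thus ?case using assms(2) cl.hom_zero by (simp add: FR_zero)
  next
    case (of a l) thus ?case using assms(3) by (simp add: pt_cl)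
  next
    case (diff f g) thus ?case using assms(4)[of "cl f" "cl g"] cl_minus by simp
  qed
  thus ?thesis using f by simp
qed

lemma relsE:
  assumes "r \<in> rels"
  obtains (1) a a' l where "r = frag_of (a \<oplus> a', l) - frag_of (a, l) - frag_of (a', l)" "a \<in> carrier H" "a' \<in> carrier H" "l \<in> carrier L"
    | (2) a l l' where "r = frag_of (a, l \<oplus>\<^bsub>L\<^esub> l') - frag_of (a, l) - frag_of (a, l')" "a \<in> carrier H" "l \<in> carrier L" "l' \<in> carrier L"
    | (3) a k l where "r = frag_of (a \<otimes> k, l) - frag_of (a, \<phi> k \<otimes>\<^bsub>L\<^esub> l)" "a \<in> carrier H" "k \<in> K" "l \<in> carrier L"
  using assms unfolding tensor_relations_def by blast

text \<open>The additive subgroup generated by the relations is already a two-sided ideal.\<close>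

lemma rels_mult:
  assumes "r \<in> rels" "b \<in> carrier H" "m \<in> carrier L"
  shows "frag_of (b, m) \<bullet> r \<in> rels" "r \<bullet> frag_of (b, m) \<in> rels"
proof -
  have c: "\<phi> k \<otimes>\<^bsub>L\<^esub> (m \<otimes>\<^bsub>L\<^esub> l) = m \<otimes>\<^bsub>L\<^esub> (\<phi> k \<otimes>\<^bsub>L\<^esub> l)" if "k \<in> K" "l \<in> carrier L" for k l
    using phi(1)[OF that(1)] that(2) assms(3) L.m_lcomm by simp
  have c': "\<phi> k \<otimes>\<^bsub>L\<^esub> (l \<otimes>\<^bsub>L\<^esub> m) = (\<phi> k \<otimes>\<^bsub>L\<^esub> l) \<otimes>\<^bsub>L\<^esub> m" if "k \<in> K" "l \<in> carrier L" for k l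
    using phi(1)[OF that(1)] that(2) assms(3) L.m_assoc by simp
  have d': "(a \<otimes> k) \<otimes> b = (a \<otimes> b) \<otimes> k" if "k \<in> K" "a \<in> carrier H" for k a
    using K_central[OF that(1) assms(2)] that assms(2) by (simp add: H.m_assoc)
  from assms(1) have "frag_of (b, m) \<bullet> r \<in> rels \<and> r \<bullet> frag_of (b, m) \<in> rels"
  proof (cases rule: relsE)
    case (1 a a' l)
    have "frag_of (b, m) \<bullet> r = frag_of (b \<otimes> a \<oplus> b \<otimes> a', m \<otimes>\<^bsub>L\<^esub> l) - frag_of (b \<otimes> a, m \<otimes>\<^bsub>L\<^esub> l) - frag_of (b \<otimes> a', m \<otimes>\<^bsub>L\<^esub> l)"
      "r \<bullet> frag_of (b, m) = frag_of (a \<otimes> b \<oplus> a' \<otimes> b, l \<otimes>\<^bsub>L\<^esub> m) - frag_of (a \<otimes> b, l \<otimes>\<^bsub>L\<^esub> m) - frag_of (a' \<otimes> b, l \<otimes>\<^bsub>L\<^esub> m)"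
      using 1 assms(2,3) by (simp_all add: FR_minus_r FR_minus_l FR_minus_closed FR_of_mult H.r_distr H.l_distr)
    moreover have "b \<otimes> a \<in> carrier H" "b \<otimes> a' \<in> carrier H" "a \<otimes> b \<in> carrier H" "a' \<otimes> b \<in> carrier H"
      "m \<otimes>\<^bsub>L\<^esub> l \<in> carrier L" "l \<otimes>\<^bsub>L\<^esub> m \<in> carrier L" using 1 assms by auto
    ultimately show "frag_of (b, m) \<bullet> r \<in> rels \<and> r \<bullet> frag_of (b, m) \<in> rels" unfolding tensor_relations_def by blast
  next
    case (2 a l l')
    have "frag_of (b, m) \<bullet> r = frag_of (b \<otimes> a, m \<otimes>\<^bsub>L\<^esub> l \<oplus>\<^bsub>L\<^esub> m \<otimes>\<^bsub>L\<^esub> l') - frag_of (b \<otimes> a, m \<otimes>\<^bsub>L\<^esub> l) - frag_of (b \<otimes> a, m \<otimes>\<^bsub>L\<^esub> l')"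
      "r \<bullet> frag_of (b, m) = frag_of (a \<otimes> b, l \<otimes>\<^bsub>L\<^esub> m \<oplus>\<^bsub>L\<^esub> l' \<otimes>\<^bsub>L\<^esub> m) - frag_of (a \<otimes> b, l \<otimes>\<^bsub>L\<^esub> m) - frag_of (a \<otimes> b, l' \<otimes>\<^bsub>L\<^esub> m)"
      using 2 assms(2,3) by (simp_all add: FR_minus_r FR_minus_l FR_minus_closed FR_of_mult L.r_distr L.l_distr)
    moreover have "b \<otimes> a \<in> carrier H" "a \<otimes> b \<in> carrier H"
      "m \<otimes>\<^bsub>L\<^esub> l \<in> carrier L" "l \<otimes>\<^bsub>L\<^esub> m \<in> carrier L" "m \<otimes>\<^bsub>L\<^esub> l' \<in> carrier L" "l' \<otimes>\<^bsub>L\<^esub> m \<in> carrier L" using 2 assms by auto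
    ultimately show "frag_of (b, m) \<bullet> r \<in> rels \<and> r \<bullet> frag_of (b, m) \<in> rels" unfolding tensor_relations_def by blast
  next
    case (3 a k l)
    have "frag_of (b, m) \<bullet> r = frag_of ((b \<otimes> a) \<otimes> k, m \<otimes>\<^bsub>L\<^esub> l) - frag_of (b \<otimes> a, \<phi> k \<otimes>\<^bsub>L\<^esub> (m \<otimes>\<^bsub>L\<^esub> l))"
      "r \<bullet> frag_of (b, m) = frag_of ((a \<otimes> b) \<otimes> k, l \<otimes>\<^bsub>L\<^esub> m) - frag_of (a \<otimes> b, \<phi> k \<otimes>\<^bsub>L\<^esub> (l \<otimes>\<^bsub>L\<^esub> m))"
      unfolding c[OF 3(3,4)] c'[OF 3(3,4)]
      using 3 assms(2,3) phi(1)[OF 3(3)] by (simp_all add: FR_minus_r FR_minus_l FR_of_mult H.m_assoc K_central[OF 3(3) assms(2)])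
    moreover have "b \<otimes> a \<in> carrier H" "a \<otimes> b \<in> carrier H"
      "m \<otimes>\<^bsub>L\<^esub> l \<in> carrier L" "l \<otimes>\<^bsub>L\<^esub> m \<in> carrier L" using 3 assms by auto
    ultimately show "frag_of (b, m) \<bullet> r \<in> rels \<and> r \<bullet> frag_of (b, m) \<in> rels" unfolding tensor_relations_def using 3(3) by blast
  qed
  thus "frag_of (b, m) \<bullet> r \<in> rels" "r \<bullet> frag_of (b, m) \<in> rels" by auto
qed

text \<open>The tensor ideal is generated as a ring ideal, so products of relations with arbitrary
  elements must be controlled. The claim is therefore proved for all additive maps vanishing on
  relations at once: composing such a map with multiplication by a pair gives another one, by
  \<open>rels_mult\<close>.\<close>

lemma TI_vanish:
  assumes f: "f \<in> TI" and h: "!!f. f \<in> carrier FR ==> h f \<in> carrier L"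
    "!!f g. f \<in> carrier FR ==> g \<in> carrier FR ==> h (f - g) = h f \<ominus>\<^bsub>L\<^esub> h g"
    and hr: "!!r. r \<in> rels ==> h r = \<zero>\<^bsub>L\<^esub>"
  shows "h f = \<zero>\<^bsub>L\<^esub>"
proof -
  define good where "good h \<longleftrightarrow> (\<forall>f\<in>carrier FR. h f \<in> carrier L \<and> (\<forall>g\<in>carrier FR. h (f - g) = h f \<ominus>\<^bsub>L\<^esub> h g)) \<and> (\<forall>r\<in>rels. h r = \<zero>\<^bsub>L\<^esub>)" for h
  have hzero: "h 0 = \<zero>\<^bsub>L\<^esub>" if "good h" for h
    using that FR.zero_closed unfolding good_def FR_zero by (metis L.r_neg a_minus_def diff_self)
  have gsub: "h (f - g) = \<zero>\<^bsub>L\<^esub>" if "good h" "f \<in> carrier FR" "g \<in> carrier FR" "h f = \<zero>\<^bsub>L\<^esub>" "h g = \<zero>\<^bsub>L\<^esub>" for h f g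
  proof -
    have "h (f - g) = h f \<ominus>\<^bsub>L\<^esub> h g" using that(1-3) unfolding good_def by blast
    thus ?thesis using that(4,5) by (simp add: a_minus_def)
  qed
  have gl: "good (%f. h (frag_of (b, m) \<bullet> f))" and gr: "good (%f. h (f \<bullet> frag_of (b, m)))"
    if "good h" "b \<in> carrier H" "m \<in> carrier L" for h b m
    using that rels_mult unfolding good_def by (simp_all add: FR_minus_l FR_minus_r)
  have ml: "h (x \<bullet> f) = \<zero>\<^bsub>L\<^esub> \<and> h (f \<bullet> x) = \<zero>\<^bsub>L\<^esub>"
    if f: "f \<in> carrier FR" "!!h. good h ==> h f = \<zero>\<^bsub>L\<^esub>" and x: "x \<in> carrier FR" and g: "good h" for f x h
    using x
  proof (induction rule: FR_induct)
    case zero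
    have "0 \<bullet> f = 0" "f \<bullet> 0 = 0" using FR.l_null[OF f(1)] FR.r_null[OF f(1)] by (simp_all add: FR_zero)
    thus ?case using hzero[OF g] by simp
  next
    case (of b m)
    show ?case by (intro conjI f(2)[OF gl[OF g of]] f(2)[OF gr[OF g of]])
  next
    case (diff x y)
    thus ?case using gsub[OF g] f(1) by (simp add: FR_minus_l FR_minus_r)
  qed
  have "\<forall>h. good h --> h f = \<zero>\<^bsub>L\<^esub>" using f
  proof (induction rule: TI_induct)
    case (rel r) thus ?case by (simp add: good_def)
  next
    case (diff f g) thus ?case using gsub by blast
  qed (use ml in blast)+
  moreover have "good h" unfolding good_def using h hr by blast
  ultimately show ?thesis by blast
qed

text \<open>A \<open>K\<close>-linear form on \<open>H\<close> induces an additive map from the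
  tensor product to \<open>L\<close>, defined on the free abelian group by its universal property.
  This is the means of showing that a pure tensor does not vanish.\<close>

lemma pt_separated:
  assumes lam: "!!a. a \<in> carrier H ==> lam a \<in> K" "!!a b. a \<in> carrier H ==> b \<in> carrier H ==> lam (a \<oplus> b) = lam a \<oplus> lam b"
    "!!a k. a \<in> carrier H ==> k \<in> K ==> lam (a \<otimes> k) = lam a \<otimes> k"
    and al: "a \<in> carrier H" "l \<in> carrier L" and z: "pt a l = \<zero>\<^bsub>TR\<^esub>"
  shows "\<phi> (lam a) \<otimes>\<^bsub>L\<^esub> l = \<zero>\<^bsub>L\<^esub>"
proof -
  define \<beta> where "\<beta> p = \<phi> (lam (fst p)) \<otimes>\<^bsub>L\<^esub> snd p" for p
  have "\<beta> ` (carrier H \<times> carrier L) \<subseteq> carrier (add_monoid L)" using lam(1) phi(1) by (auto simp: \<beta>_def)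
  then obtain h where h: "h \<in> hom (free_Abelian_group (carrier H \<times> carrier L)) (add_monoid L)"
    "!!x. x \<in> carrier H \<times> carrier L ==> h (frag_of x) = \<beta> x"
    using comm_group.free_Abelian_group_universal[OF L.a_comm_group] by metis
  have hc: "h f \<in> carrier L" if "f \<in> carrier FR" for f using h(1) that by (auto simp: hom_def FR_iff free_Abelian_group_def)
  have ha: "h (f + g) = h f \<oplus>\<^bsub>L\<^esub> h g" if "f \<in> carrier FR" "g \<in> carrier FR" for f g
    using h(1) that by (auto simp: hom_def FR_iff free_Abelian_group_def)
  have hm: "h (f - g) = h f \<ominus>\<^bsub>L\<^esub> h g" if "f \<in> carrier FR" "g \<in> carrier FR" for f g
  proof -
    have "h f = h (f - g) \<oplus>\<^bsub>L\<^esub> h g" using ha[OF FR_minus_closed[OF that] that(2)] by simp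
    moreover have "h (f - g) \<oplus>\<^bsub>L\<^esub> h g \<ominus>\<^bsub>L\<^esub> h g = h (f - g)"
      using hc[OF FR_minus_closed[OF that]] hc[OF that(2)] by algebra
    ultimately show ?thesis by simp
  qed
  have "h (frag_of (a, l)) = \<zero>\<^bsub>L\<^esub>"
  proof (rule TI_vanish[OF _ hc hm])
    have "cl (frag_of (a, l)) = cl 0" using z cl.hom_zero by (simp add: pt_cl FR_zero)
    thus "frag_of (a, l) \<in> TI" using cl_eq_iff[of "frag_of (a, l)" 0] al FR.zero_closed by (simp add: FR_zero)
    fix r assume "r \<in> rels"
    thus "h r = \<zero>\<^bsub>L\<^esub>"
    proof (cases rule: relsE)
      case (1 a a' l)
      have "h r = \<beta> (a \<oplus> a', l) \<ominus>\<^bsub>L\<^esub> \<beta> (a, l) \<ominus>\<^bsub>L\<^esub> \<beta> (a', l)" using 1 by (simp add: hm h(2) FR_minus_closed)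
      also have "... = (\<phi> (lam a) \<oplus>\<^bsub>L\<^esub> \<phi> (lam a')) \<otimes>\<^bsub>L\<^esub> l \<ominus>\<^bsub>L\<^esub> \<phi> (lam a) \<otimes>\<^bsub>L\<^esub> l \<ominus>\<^bsub>L\<^esub> \<phi> (lam a') \<otimes>\<^bsub>L\<^esub> l"
        unfolding \<beta>_def using 1 by (simp add: lam phi)
      also have "... = \<zero>\<^bsub>L\<^esub>" using 1 phi(1)[OF lam(1)[OF 1(2)]] phi(1)[OF lam(1)[OF 1(3)]] by algebra
      finally show ?thesis .
    next
      case (2 a l l')
      have "h r = \<beta> (a, l \<oplus>\<^bsub>L\<^esub> l') \<ominus>\<^bsub>L\<^esub> \<beta> (a, l) \<ominus>\<^bsub>L\<^esub> \<beta> (a, l')" using 2 by (simp add: hm h(2) FR_minus_closed)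
      also have "... = \<phi> (lam a) \<otimes>\<^bsub>L\<^esub> (l \<oplus>\<^bsub>L\<^esub> l') \<ominus>\<^bsub>L\<^esub> \<phi> (lam a) \<otimes>\<^bsub>L\<^esub> l \<ominus>\<^bsub>L\<^esub> \<phi> (lam a) \<otimes>\<^bsub>L\<^esub> l'"
        unfolding \<beta>_def by simp
      also have "... = \<zero>\<^bsub>L\<^esub>" using 2 phi(1)[OF lam(1)[OF 2(2)]] by algebra
      finally show ?thesis .
    next
      case (3 a k l)
      have "h r = \<beta> (a \<otimes> k, l) \<ominus>\<^bsub>L\<^esub> \<beta> (a, \<phi> k \<otimes>\<^bsub>L\<^esub> l)" using 3 phi(1) by (simp add: hm h(2))
      also have "... = (\<phi> (lam a) \<otimes>\<^bsub>L\<^esub> \<phi> k) \<otimes>\<^bsub>L\<^esub> l \<ominus>\<^bsub>L\<^esub> \<phi> (lam a) \<otimes>\<^bsub>L\<^esub> (\<phi> k \<otimes>\<^bsub>L\<^esub> l)"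
        unfolding \<beta>_def using 3 by (simp add: lam phi)
      also have "... = \<zero>\<^bsub>L\<^esub>" using 3 phi(1)[OF lam(1)[OF 3(2)]] phi(1)[OF 3(3)] by algebra
      finally show ?thesis .
    qed
  qed
  thus ?thesis using h(2)[of "(a, l)"] al by (simp add: \<beta>_def)
qed

context
  fixes \<sigma> :: "'a => 'a"
  assumes sig: "involution H K \<sigma>"
begin

lemma sig_simps:
  "a \<in> carrier H ==> \<sigma> a \<in> carrier H" "a \<in> carrier H ==> b \<in> carrier H ==> \<sigma> (a \<oplus> b) = \<sigma> a \<oplus> \<sigma> b"
  "a \<in> carrier H ==> b \<in> carrier H ==> \<sigma> (a \<otimes> b) = \<sigma> b \<otimes> \<sigma> a" "a \<in> carrier H ==> \<sigma> (\<sigma> a) = a"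
  "k \<in> K ==> a \<in> carrier H ==> \<sigma> (a \<otimes> k) = \<sigma> a \<otimes> k"
proof -
  show 1: "\<sigma> a \<in> carrier H" if "a \<in> carrier H" for a using that sig unfolding involution_def by blast
  show "k \<in> K ==> a \<in> carrier H ==> \<sigma> (a \<otimes> k) = \<sigma> a \<otimes> k"
    using sig unfolding involution_def by (metis K_central 1)
qed (use sig in \<open>auto simp: involution_def\<close>)

definition fmap :: "(('a \<times> 'c) \<Rightarrow>\<^sub>0 int) => (('a \<times> 'c) \<Rightarrow>\<^sub>0 int)"
  where "fmap = frag_extend (%(a, l). frag_of (\<sigma> a, l))"

lemma fmap_of: "fmap (frag_of (a, l)) = frag_of (\<sigma> a, l)" and fmap_minus: "fmap (f - g) = fmap f - fmap g"
  by (simp_all add: fmap_def frag_extend_diff)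

lemma fmap_zero: "fmap 0 = 0" using fmap_minus[of 0 0] by simp

lemma fmap_closed: "f \<in> carrier FR ==> fmap f \<in> carrier FR"
proof (induction rule: FR_induct)
  case zero thus ?case using FR.zero_closed by (simp add: fmap_zero FR_zero)
qed (simp_all add: fmap_of fmap_minus FR_minus_closed sig_simps)

text \<open>\<open>\<sigma>\<close> reverses products in \<open>H\<close>, and since
  \<open>L\<close> is commutative, the factors in \<open>L\<close> may be reversed along with
  them.\<close>

lemma fmap_mult: "f \<in> carrier FR ==> g \<in> carrier FR ==> fmap (f \<bullet> g) = fmap g \<bullet> fmap f"
proof (induction arbitrary: g rule: FR_induct)
  case zero
  have "0 \<bullet> g = 0" "fmap g \<bullet> 0 = 0" using FR.l_null[OF zero] FR.r_null[OF fmap_closed[OF zero]] by (simp_all add: FR_zero)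
  thus ?case by (simp add: fmap_zero)
next
  case (of a l)
  from of(3) show ?case
  proof (induction rule: FR_induct)
    case zero
    have "frag_of (a, l) \<bullet> 0 = 0" "0 \<bullet> frag_of (\<sigma> a, l) = 0"
      using FR.r_null[of "frag_of (a, l)"] FR.l_null[of "frag_of (\<sigma> a, l)"] of sig_simps(1)[of a] by (simp_all add: FR_zero)
    thus ?case by (simp add: fmap_zero fmap_of)
  next
    case (of b m)
    thus ?case using \<open>a \<in> carrier H\<close> \<open>l \<in> carrier L\<close> by (simp add: FR_of_mult fmap_of sig_simps L.m_comm)
  next
    case (diff f g)
    thus ?case using of by (simp add: FR_minus_l FR_minus_r fmap_minus fmap_of fmap_closed sig_simps)
  qed
next
  case (diff x y)
  thus ?case by (simp add: FR_minus_l FR_minus_r fmap_minus fmap_closed)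
qed

lemma fmap_rels: "r \<in> rels ==> fmap r \<in> rels"
proof -
  assume "r \<in> rels"
    thus ?thesis
  proof (cases rule: relsE)
    case (1 a a' l)
    have "fmap r = frag_of (\<sigma> a \<oplus> \<sigma> a', l) - frag_of (\<sigma> a, l) - frag_of (\<sigma> a', l)"
      using 1 by (simp add: fmap_minus fmap_of sig_simps)
    thus ?thesis using 1(4) sig_simps(1)[OF 1(2)] sig_simps(1)[OF 1(3)] unfolding tensor_relations_def by blast
  next
    case (2 a l l')
    have "fmap r = frag_of (\<sigma> a, l \<oplus>\<^bsub>L\<^esub> l') - frag_of (\<sigma> a, l) - frag_of (\<sigma> a, l')"
      using 2 by (simp add: fmap_minus fmap_of)
    thus ?thesis using 2(3,4) sig_simps(1)[OF 2(2)] unfolding tensor_relations_def by blast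
  next
    case (3 a k l)
    have "fmap r = frag_of (\<sigma> a \<otimes> k, l) - frag_of (\<sigma> a, \<phi> k \<otimes>\<^bsub>L\<^esub> l)"
      using 3 by (simp add: fmap_minus fmap_of sig_simps(5) del: sig_simps(3))
    thus ?thesis using 3(3,4) sig_simps(1)[OF 3(2)] unfolding tensor_relations_def by blast
  qed
qed

lemma fmap_TI: "f \<in> TI ==> fmap f \<in> TI"
proof -
  interpret TI: ideal TI FR by (rule TI_ideal)
  have sub: "f - g \<in> TI" if "f \<in> TI" "g \<in> TI" for f g
    using that TI.a_closed[of f "\<ominus>\<^bsub>FR\<^esub> g"] TI.a_inv_closed[of g] FR_uminus[of g] TI.a_subset by (auto simp: FR_add)
  show "f \<in> TI ==> fmap f \<in> TI"
  proof (induction rule: TI_induct)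
    case (rel r) thus ?case using fmap_rels rels_TI by blast
  qed (auto simp: fmap_minus fmap_mult fmap_closed sub TI.I_l_closed TI.I_r_closed)
qed

abbreviation tmap where "tmap \<equiv> tensor_map H K \<phi> L \<sigma>"

text \<open>\<open>fmap\<close> preserves the tensor ideal, so the union in
  \<open>tensor_map\<close> runs over copies of a single coset.\<close>

lemma tmap_cl: "f \<in> carrier FR ==> tmap (cl f) = cl (fmap f)"
proof -
  assume f: "f \<in> carrier FR"
  interpret TI: ideal TI FR by (rule TI_ideal)
  have self: "f \<in> cl f" using TI.a_rcos_self[OF f] by (simp add: cl_def)
  have "cl (fmap g) = cl (fmap f)" if "g \<in> cl f" for g
  proof -
    have g: "g \<in> carrier FR" using that f TI.a_subset FR.add.m_closed[of _ f] by (auto simp: cl_def a_r_coset_def')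
    have "cl g = cl f" using TI.a_repr_independence'[of g f] that f by (simp add: cl_def)
    hence "fmap (g - f) \<in> TI" using cl_eq_iff[OF g f] fmap_TI by simp
    thus ?thesis using cl_eq_iff[OF fmap_closed[OF g] fmap_closed[OF f]] by (simp add: fmap_minus)
  qed
  hence "(%g. cl (fmap g)) ` cl f = {cl (fmap f)}" using self by blast
  moreover have "tmap (cl f) = \<Union> ((%g. cl (fmap g)) ` cl f)" unfolding tensor_map_def fmap_def cl_def ..
  ultimately show ?thesis by simp
qed

lemma tmap_pt: "a \<in> carrier H ==> l \<in> carrier L ==> tmap (pt a l) = pt (\<sigma> a) l"
  by (simp add: pt_cl tmap_cl fmap_of)

lemma tmap_closed: "x \<in> carrier TR ==> tmap x \<in> carrier TR"
  by (erule TR_E) (simp add: tmap_cl fmap_closed)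

lemma tmap_minus: assumes "x \<in> carrier TR" "y \<in> carrier TR" shows "tmap (x \<ominus>\<^bsub>TR\<^esub> y) = tmap x \<ominus>\<^bsub>TR\<^esub> tmap y"
proof -
  obtain f where f: "f \<in> carrier FR" "x = cl f" using TR_E[OF assms(1)] .
  obtain g where g: "g \<in> carrier FR" "y = cl g" using TR_E[OF assms(2)] .
  have "tmap (cl (f - g)) = cl (fmap f - fmap g)" using f g by (simp only: tmap_cl FR_minus_closed fmap_minus)
  also have "... = tmap x \<ominus>\<^bsub>TR\<^esub> tmap y" using f g by (simp only: cl_minus fmap_closed tmap_cl)
  finally show ?thesis using f g by (simp only: cl_minus)
qed

lemma tmap_add: assumes "x \<in> carrier TR" "y \<in> carrier TR" shows "tmap (x \<oplus>\<^bsub>TR\<^esub> y) = tmap x \<oplus>\<^bsub>TR\<^esub> tmap y"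
proof -
  have "tmap x = tmap (x \<oplus>\<^bsub>TR\<^esub> y) \<ominus>\<^bsub>TR\<^esub> tmap y"
    using tmap_minus[of "x \<oplus>\<^bsub>TR\<^esub> y" y] assms by (simp add: a_minus_def TR.add.m_assoc TR.r_neg)
  moreover have "tmap (x \<oplus>\<^bsub>TR\<^esub> y) \<in> carrier TR" "tmap y \<in> carrier TR" using assms tmap_closed by auto
  ultimately show ?thesis by (simp add: a_minus_def TR.add.m_assoc TR.l_neg)
qed

lemma tmap_mult: assumes "x \<in> carrier TR" "y \<in> carrier TR" shows "tmap (x \<otimes>\<^bsub>TR\<^esub> y) = tmap y \<otimes>\<^bsub>TR\<^esub> tmap x"
proof -
  obtain f where f: "f \<in> carrier FR" "x = cl f" using TR_E[OF assms(1)] .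
  obtain g where g: "g \<in> carrier FR" "y = cl g" using TR_E[OF assms(2)] .
  note fg = f(1) g(1) f(2) g(2)
  have "tmap (x \<otimes>\<^bsub>TR\<^esub> y) = tmap (cl (f \<bullet> g))" using fg by simp
  also have "... = cl (fmap g \<bullet> fmap f)" using fg by (simp only: tmap_cl FR.m_closed fmap_mult)
  also have "... = tmap y \<otimes>\<^bsub>TR\<^esub> tmap x" using fg by (simp add: tmap_cl fmap_closed)
  finally show ?thesis .
qed

lemma tmap_tmap: "x \<in> carrier TR ==> tmap (tmap x) = x"
proof (induction rule: TR_induct)
  case zero
  have "tmap \<zero>\<^bsub>TR\<^esub> = \<zero>\<^bsub>TR\<^esub>" using tmap_cl[OF FR.zero_closed] cl.hom_zero by (simp add: fmap_zero FR_zero)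
  thus ?case by simp
qed (simp_all add: tmap_pt tmap_minus tmap_closed sig_simps)

end

end

section \<open>The completion of a number field at a prime\<close>

context number_prime
begin

abbreviation CS :: "(nat => 'a) set" where "CS \<equiv> cauchy_seqs R P"
abbreviation NS :: "(nat => 'a) set" where "NS \<equiv> null_seqs R P"
abbreviation CR :: "(nat => 'a) ring" where "CR \<equiv> cauchy_ring R P"
abbreviation KP :: "((nat => 'a) set) ring" where "KP \<equiv> completion R P"

lemma CR_simps [simp]: "carrier CR = CS" "x \<otimes>\<^bsub>CR\<^esub> y = (%i. x i \<otimes> y i)" "x \<oplus>\<^bsub>CR\<^esub> y = (%i. x i \<oplus> y i)"
  "\<one>\<^bsub>CR\<^esub> = (%i. \<one>)" "\<zero>\<^bsub>CR\<^esub> = (%i. \<zero>)"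
  by (simp_all add: cauchy_ring_def)

lemma CS_iff: "x \<in> CS \<longleftrightarrow> (\<forall>i. x i \<in> carrier R) \<and> (\<forall>n. \<exists>M. \<forall>i\<ge>M. \<forall>j\<ge>M. x i \<ominus> x j \<in> V n)"
  by (simp add: cauchy_seqs_def)

lemma NS_iff: "x \<in> NS \<longleftrightarrow> (\<forall>i. x i \<in> carrier R) \<and> (\<forall>n. \<exists>M. \<forall>i\<ge>M. x i \<in> V n)"
  by (simp add: null_seqs_def)

lemma CS_carrier: "x \<in> CS ==> x i \<in> carrier R" by (simp add: CS_iff)

lemma CS_E: assumes "x \<in> CS" obtains M where "!!i j. i \<ge> M ==> j \<ge> M ==> x i \<ominus> x j \<in> V n"
  using assms CS_iff by meson

text \<open>Boundedness of a Cauchy sequence, phrased through the filtration: late terms differ from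
  \<open>x M\<close> by elements of \<open>V 0\<close>, so multiplication by them loses no more
  index than multiplication by \<open>x M\<close>.\<close>

lemma CS_bounded:
  assumes "x \<in> CS" shows "\<exists>M c. \<forall>i\<ge>M. \<forall>n. \<forall>y\<in>V (n + c). x i \<otimes> y \<in> V n"
proof -
  obtain M where M: "!!i j. i \<ge> M ==> j \<ge> M ==> x i \<ominus> x j \<in> V 0" using CS_E[OF assms, of 0] by blast
  note xc = CS_carrier[OF assms]
  obtain c where c: "!!n y. y \<in> V (n + c) ==> x M \<otimes> y \<in> V n" using V_scale[OF xc] by blast
  have "x i \<otimes> y \<in> V n" if "i \<ge> M" "y \<in> V (n + c)" for i n y
  proof -
    have yc: "y \<in> carrier R" using V_carrier that by blast
    have "x i \<otimes> y = x M \<otimes> y \<oplus> (x i \<ominus> x M) \<otimes> y" using xc[of i] xc[of M] yc by algebra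
    moreover have "(x i \<ominus> x M) \<otimes> y \<in> V (n + c)" using V_mult[OF M[OF that(1) order.refl] that(2)] by simp
    ultimately show ?thesis using c[OF that(2)] V_mono[of n "n + c"] V_add by simp
  qed
  thus ?thesis by blast
qed

lemma NS_CS: "x \<in> NS ==> x \<in> CS"
  unfolding NS_iff CS_iff by (meson V_minus)

lemma NS_carrier: "x \<in> NS ==> x i \<in> carrier R" by (simp add: NS_iff)

lemma CS_const: "k \<in> carrier R ==> (%i. k) \<in> CS"
  using V_zero by (simp add: CS_iff a_minus_def r_neg)

lemma CS_add: assumes "x \<in> CS" "y \<in> CS" shows "(%i. x i \<oplus> y i) \<in> CS"
  unfolding CS_iff
proof (intro conjI allI)
  show "x i \<oplus> y i \<in> carrier R" for i using assms CS_carrier by simp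
  fix n
  obtain M where M: "!!i j. i \<ge> M ==> j \<ge> M ==> x i \<ominus> x j \<in> V n" using CS_E[OF assms(1)] by blast
  obtain M' where M': "!!i j. i \<ge> M' ==> j \<ge> M' ==> y i \<ominus> y j \<in> V n" using CS_E[OF assms(2)] by blast
  have "(x i \<oplus> y i) \<ominus> (x j \<oplus> y j) \<in> V n" if "i \<ge> max M M'" "j \<ge> max M M'" for i j
  proof -
    have "(x i \<oplus> y i) \<ominus> (x j \<oplus> y j) = (x i \<ominus> x j) \<oplus> (y i \<ominus> y j)"
      using CS_carrier[OF assms(1), of i] CS_carrier[OF assms(1), of j] CS_carrier[OF assms(2), of i] CS_carrier[OF assms(2), of j] by algebra
    thus ?thesis using V_add M M' that by simp
  qed
  thus "\<exists>M. \<forall>i\<ge>M. \<forall>j\<ge>M. x i \<oplus> y i \<ominus> (x j \<oplus> y j) \<in> V n" by blast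
qed

lemma CS_mult: assumes "x \<in> CS" "y \<in> CS" shows "(%i. x i \<otimes> y i) \<in> CS"
  unfolding CS_iff
proof (intro conjI allI)
  show "x i \<otimes> y i \<in> carrier R" for i using assms CS_carrier by simp
  fix n
  obtain Mx cx where cx: "!!i n z. i \<ge> Mx ==> z \<in> V (n + cx) ==> x i \<otimes> z \<in> V n" using CS_bounded[OF assms(1)] by blast
  obtain My cy where cy: "!!i n z. i \<ge> My ==> z \<in> V (n + cy) ==> y i \<otimes> z \<in> V n" using CS_bounded[OF assms(2)] by blast
  \<comment> \<open>The losses are crossed: a difference of terms of \<open>x\<close> gets
    multiplied by a term of \<open>y\<close>, and conversely.\<close>
  obtain M where M: "!!i j. i \<ge> M ==> j \<ge> M ==> x i \<ominus> x j \<in> V (n + cy)" using CS_E[OF assms(1)] by blast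
  obtain M' where M': "!!i j. i \<ge> M' ==> j \<ge> M' ==> y i \<ominus> y j \<in> V (n + cx)" using CS_E[OF assms(2)] by blast
  have "(x i \<otimes> y i) \<ominus> (x j \<otimes> y j) \<in> V n" if h: "i \<ge> M + M' + Mx + My" "j \<ge> M + M' + Mx + My" for i j
  proof -
    have "(x i \<otimes> y i) \<ominus> (x j \<otimes> y j) = x i \<otimes> (y i \<ominus> y j) \<oplus> y j \<otimes> (x i \<ominus> x j)"
      using CS_carrier[OF assms(1), of i] CS_carrier[OF assms(1), of j] CS_carrier[OF assms(2), of i] CS_carrier[OF assms(2), of j] by algebra
    thus ?thesis using V_add[OF cx[OF _ M'] cy[OF _ M], of i i j j i j] h by simp
  qed
  thus "\<exists>M. \<forall>i\<ge>M. \<forall>j\<ge>M. x i \<otimes> y i \<ominus> (x j \<otimes> y j) \<in> V n" by blast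
qed

lemma CS_uminus: "x \<in> CS ==> (%i. \<ominus> x i) \<in> CS"
  using CS_mult[OF CS_const[of "\<ominus> \<one>"], of x] CS_carrier[of x] by (simp add: l_minus)

lemma CR_cring: "cring CR"
proof (rule cringI)
  show "abelian_group CR"
  proof (rule abelian_groupI)
    fix x assume "x \<in> carrier CR"
    thus "\<exists>y\<in>carrier CR. y \<oplus>\<^bsub>CR\<^esub> x = \<zero>\<^bsub>CR\<^esub>"
      using CS_uminus[of x] CS_carrier[of x] by (intro bexI[of _ "%i. \<ominus> x i"]) (auto simp: l_neg)
  qed (auto simp: CS_add CS_const CS_carrier a_ac)
  show "Group.comm_monoid CR"
    by (rule Group.comm_monoidI) (auto simp: CS_mult CS_const CS_carrier m_ac)
qed (auto simp: CS_carrier l_distr)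

lemma CR_uminus: "x \<in> CS ==> \<ominus>\<^bsub>CR\<^esub> x = (%i. \<ominus> x i)"
proof -
  assume x: "x \<in> CS"
  interpret C: cring CR by (rule CR_cring)
  show ?thesis by (rule C.minus_equality) (use x CS_uminus CS_carrier in \<open>auto simp: l_neg\<close>)
qed

lemma CR_minus: "x \<in> CS ==> y \<in> CS ==> x \<ominus>\<^bsub>CR\<^esub> y = (%i. x i \<ominus> y i)"
  by (simp add: a_minus_def CR_uminus)

lemma NS_mult: assumes "x \<in> CS" "y \<in> NS" shows "(%i. x i \<otimes> y i) \<in> NS"
  unfolding NS_iff
proof (intro conjI allI)
  show "x i \<otimes> y i \<in> carrier R" for i using assms CS_carrier NS_carrier by simp
  fix n
  obtain Mx cx where cx: "!!i n z. i \<ge> Mx ==> z \<in> V (n + cx) ==> x i \<otimes> z \<in> V n" using CS_bounded[OF assms(1)] by blast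
  obtain M where M: "!!i. i \<ge> M ==> y i \<in> V (n + cx)" using assms(2) NS_iff by meson
  have "x i \<otimes> y i \<in> V n" if "i \<ge> max Mx M" for i using cx M that by simp
  thus "\<exists>M. \<forall>i\<ge>M. x i \<otimes> y i \<in> V n" by blast
qed

lemma NS_add: assumes "x \<in> NS" "y \<in> NS" shows "(%i. x i \<oplus> y i) \<in> NS"
  unfolding NS_iff
proof (intro conjI allI)
  show "x i \<oplus> y i \<in> carrier R" for i using assms NS_carrier by simp
  fix n
  obtain M where M: "!!i. i \<ge> M ==> x i \<in> V n" using assms(1) NS_iff by meson
  obtain M' where M': "!!i. i \<ge> M' ==> y i \<in> V n" using assms(2) NS_iff by meson
  have "x i \<oplus> y i \<in> V n" if "i \<ge> max M M'" for i using V_add M M' that by simp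
  thus "\<exists>M. \<forall>i\<ge>M. x i \<oplus> y i \<in> V n" by blast
qed

lemma NS_ideal: "ideal NS CR"
proof -
  interpret C: cring CR by (rule CR_cring)
  have z: "(%i. \<zero>) \<in> NS" using V_zero by (simp add: NS_iff)
  show ?thesis
  proof (rule idealI)
    show "ring CR" by (rule C.ring_axioms)
    show "subgroup NS (add_monoid CR)"
    proof (rule C.add.subgroupI)
      show "NS \<subseteq> carrier CR" using NS_CS by auto
      show "NS \<noteq> {}" using z by blast
      show "\<ominus>\<^bsub>CR\<^esub> x \<in> NS" if "x \<in> NS" for x
        using NS_mult[OF CS_const[of "\<ominus> \<one>"] that] NS_carrier[OF that] CR_uminus[OF NS_CS[OF that]] by (simp add: l_minus)
      show "x \<oplus>\<^bsub>CR\<^esub> y \<in> NS" if "x \<in> NS" "y \<in> NS" for x y using NS_add[OF that] by simp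
    qed
    show "x \<otimes>\<^bsub>CR\<^esub> a \<in> NS" if "a \<in> NS" "x \<in> carrier CR" for a x using NS_mult that by simp
    show "a \<otimes>\<^bsub>CR\<^esub> x \<in> NS" if "a \<in> NS" "x \<in> carrier CR" for a x
      using NS_mult[of x a] that NS_carrier[OF that(1)] CS_carrier[of x] by (simp add: m_comm)
  qed
qed

lemma KP_cring: "cring KP"
  unfolding completion_def by (rule ideal.quotient_is_cring[OF NS_ideal CR_cring])

definition cl :: "(nat => 'a) => (nat => 'a) set" where "cl x = NS +>\<^bsub>CR\<^esub> x"

lemma cl_hom: "cl \<in> ring_hom CR KP"
  unfolding completion_def using ideal.rcos_ring_hom[OF NS_ideal] by (simp add: cl_def[abs_def])

lemma cl_ops:
  assumes "x \<in> CS" "y \<in> CS"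
  shows "cl (%i. x i \<oplus> y i) = cl x \<oplus>\<^bsub>KP\<^esub> cl y" "cl (%i. x i \<otimes> y i) = cl x \<otimes>\<^bsub>KP\<^esub> cl y"
    "cl (%i. \<ominus> x i) = \<ominus>\<^bsub>KP\<^esub> cl x" "cl (%i. x i \<ominus> y i) = cl x \<ominus>\<^bsub>KP\<^esub> cl y"
proof -
  interpret C: cring CR by (rule CR_cring)
  interpret K: cring KP by (rule KP_cring)
  interpret h: ring_hom_ring CR KP cl by (rule ring_hom_ringI2[OF C.ring_axioms K.ring_axioms cl_hom])
  show "cl (%i. x i \<oplus> y i) = cl x \<oplus>\<^bsub>KP\<^esub> cl y" using h.hom_add[of x y] assms by simp
  show "cl (%i. x i \<otimes> y i) = cl x \<otimes>\<^bsub>KP\<^esub> cl y" using h.hom_mult[of x y] assms by simp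
  show "cl (%i. \<ominus> x i) = \<ominus>\<^bsub>KP\<^esub> cl x" using h.hom_a_inv[of x] assms by (simp add: CR_uminus)
  show "cl (%i. x i \<ominus> y i) = cl x \<ominus>\<^bsub>KP\<^esub> cl y"
    using h.hom_add[of x "\<ominus>\<^bsub>CR\<^esub> y"] h.hom_a_inv[of y] CS_uminus[OF assms(2)] assms by (simp add: CR_uminus a_minus_def)
qed

lemma cl_closed: "x \<in> CS ==> cl x \<in> carrier KP"
  using ring_hom_closed[OF cl_hom] by simp

lemma cl_one: "\<one>\<^bsub>KP\<^esub> = cl (%i. \<one>)" using ring_hom_one[OF cl_hom] by simp

lemma cl_zero: "\<zero>\<^bsub>KP\<^esub> = cl (%i. \<zero>)"
proof -
  interpret C: cring CR by (rule CR_cring)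
  interpret K: cring KP by (rule KP_cring)
  interpret h: ring_hom_ring CR KP cl by (rule ring_hom_ringI2[OF C.ring_axioms K.ring_axioms cl_hom])
  show ?thesis using h.hom_zero by simp
qed

lemma KP_E: assumes "c \<in> carrier KP" obtains x where "x \<in> CS" "c = cl x"
proof -
  have "c \<in> a_rcosets\<^bsub>CR\<^esub> NS" using assms by (simp add: completion_def FactRing_def)
  thus ?thesis using that by (auto simp: A_RCOSETS_def' cl_def)
qed

lemma cl_eq_iff: assumes "x \<in> CS" "y \<in> CS" shows "cl x = cl y \<longleftrightarrow> (%i. x i \<ominus> y i) \<in> NS"
proof -
  interpret I: ideal NS CR by (rule NS_ideal)
  show ?thesis
    unfolding cl_def using I.quotient_eq_iff_same_a_r_cos[OF NS_ideal, of x y] assms CR_minus[OF assms] by simp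
qed

lemma cl_self: "x \<in> CS ==> x \<in> cl x"
proof -
  assume x: "x \<in> CS"
  interpret I: ideal NS CR by (rule NS_ideal)
  show ?thesis unfolding cl_def using I.a_rcos_self[of x] x by simp
qed

lemma mem_cl: "x \<in> CS ==> y \<in> cl x ==> y \<in> CS \<and> cl y = cl x"
proof -
  assume x: "x \<in> CS" and y: "y \<in> cl x"
  interpret I: ideal NS CR by (rule NS_ideal)
  have 1: "y \<in> CS" using y x I.a_rcosetsI NS_CS CS_add by (auto simp: cl_def a_r_coset_def')
  moreover have "cl y = cl x" using I.a_repr_independence'[of y x] x y by (simp add: cl_def)
  ultimately show ?thesis by blast
qed

abbreviation toK :: "'a => (nat => 'a) set" where "toK \<equiv> to_completion R P"

lemma toK_cl: "toK k = cl (%i. k)" by (simp add: to_completion_def cl_def)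

lemma toK_closed: "k \<in> carrier R ==> toK k \<in> carrier KP" by (simp add: toK_cl cl_closed CS_const)

lemma toK_ops:
  assumes "k \<in> carrier R" "l \<in> carrier R"
  shows "toK (k \<oplus> l) = toK k \<oplus>\<^bsub>KP\<^esub> toK l" "toK (k \<otimes> l) = toK k \<otimes>\<^bsub>KP\<^esub> toK l"
    "toK (\<ominus> k) = \<ominus>\<^bsub>KP\<^esub> toK k" "toK (k \<ominus> l) = toK k \<ominus>\<^bsub>KP\<^esub> toK l" "toK \<one> = \<one>\<^bsub>KP\<^esub>" "toK \<zero> = \<zero>\<^bsub>KP\<^esub>"
  using cl_ops[OF CS_const[OF assms(1)] CS_const[OF assms(2)]] by (simp_all add: toK_cl cl_one cl_zero)

section \<open>The filtration of the completion\<close>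

definition BB :: "nat => (nat => 'a) set set" where "BB n = {cl x | x. x \<in> CS \<and> (\<forall>i. x i \<in> V n)}"

lemma BB_carrier: "c \<in> BB n ==> c \<in> carrier KP" using cl_closed by (auto simp: BB_def)

lemma completion_integers_BB: "completion_integers R P = BB 0"
proof (intro equalityI subsetI)
  fix c assume "c \<in> completion_integers R P"
  then obtain x where c: "c \<in> carrier KP" "x \<in> c" "\<forall>i. x i \<in> V 0" by (auto simp: completion_integers_def)
  obtain y where y: "y \<in> CS" "c = cl y" using KP_E[OF c(1)] .
  have "x \<in> CS" "cl x = c" using mem_cl[OF y(1)] c y by auto
  thus "c \<in> BB 0" using c by (auto simp: BB_def)
next
  fix c assume "c \<in> BB 0"
  then obtain x where "x \<in> CS" "\<forall>i. x i \<in> V 0" "c = cl x" by (auto simp: BB_def)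
  thus "c \<in> completion_integers R P" using cl_self[of x] cl_closed[of x] by (auto simp: completion_integers_def)
qed

lemma BB_eventually:
  assumes x: "x \<in> CS" and M: "!!i. i \<ge> M ==> x i \<in> V n" shows "cl x \<in> BB n"
proof -
  \<comment> \<open>Reindexing repeats the term \<open>x M\<close> in place of the earlier ones, so
    that every term satisfies the bound while the class is unchanged.\<close>
  define y where "y = (%i. x (max i M))"
  have y: "y \<in> CS" unfolding CS_iff
  proof (intro conjI allI)
    show "y i \<in> carrier R" for i using x CS_carrier by (simp add: y_def)
    fix n
    obtain M' where M': "!!i j. i \<ge> M' ==> j \<ge> M' ==> x i \<ominus> x j \<in> V n" using CS_E[OF x] by blast
    have "y i \<ominus> y j \<in> V n" if "i \<ge> M'" "j \<ge> M'" for i j using M'[of "max i M" "max j M"] that by (simp add: y_def)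
    thus "\<exists>M. \<forall>i\<ge>M. \<forall>j\<ge>M. y i \<ominus> y j \<in> V n" by blast
  qed
  have "x i \<ominus> y i = \<zero>" if "i \<ge> M" for i using that CS_carrier[OF x] by (simp add: y_def max_def a_minus_def r_neg)
  hence "\<forall>i\<ge>M. x i \<ominus> y i \<in> V n" for n using V_zero by simp
  hence "(%i. x i \<ominus> y i) \<in> NS" unfolding NS_iff using CS_carrier[OF x] CS_carrier[OF y] by (meson minus_closed)
  hence "cl x = cl y" using cl_eq_iff[OF x y] by simp
  moreover have "\<forall>i. y i \<in> V n" using M by (simp add: y_def)
  ultimately show ?thesis using y by (auto simp: BB_def)
qed

lemma BB_eventually_rev:
  assumes x: "x \<in> CS" and "cl x \<in> BB n" shows "\<exists>M. \<forall>i\<ge>M. x i \<in> V n"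
proof -
  obtain y where y: "y \<in> CS" "!!i. y i \<in> V n" "cl x = cl y" using assms(2) by (auto simp: BB_def)
  hence "(%i. x i \<ominus> y i) \<in> NS" using cl_eq_iff[OF x y(1)] by simp
  then obtain M where M: "!!i. i \<ge> M ==> x i \<ominus> y i \<in> V n" using NS_iff by meson
  have "x i \<in> V n" if "i \<ge> M" for i
  proof -
    have "x i = (x i \<ominus> y i) \<oplus> y i" using CS_carrier[OF x, of i] CS_carrier[OF y(1), of i] by algebra
    moreover have "(x i \<ominus> y i) \<oplus> y i \<in> V n" by (rule V_add[OF M[OF that] y(2)])
    ultimately show ?thesis by simp
  qed
  thus ?thesis by blast
qed

lemma toK_BB: "k \<in> carrier R ==> toK k \<in> BB n \<longleftrightarrow> k \<in> V n"
  using BB_eventually[OF CS_const, of k 0 n] BB_eventually_rev[OF CS_const, of k n] by (auto simp: toK_cl)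

lemma BB_zero: "\<zero>\<^bsub>KP\<^esub> \<in> BB n" using toK_BB[OF zero_closed] V_zero toK_ops(6)[OF one_closed one_closed] by simp
lemma BB_one: "\<one>\<^bsub>KP\<^esub> \<in> BB 0" using toK_BB[OF one_closed] V_one toK_ops(5)[OF one_closed one_closed] by simp

lemma BB_add: "b \<in> BB n ==> c \<in> BB n ==> b \<oplus>\<^bsub>KP\<^esub> c \<in> BB n"
proof -
  assume "b \<in> BB n" "c \<in> BB n"
  then obtain x y where x: "x \<in> CS" "!!i. x i \<in> V n" "b = cl x" and y: "y \<in> CS" "!!i. y i \<in> V n" "c = cl y" by (auto simp: BB_def)
  show ?thesis unfolding x(3) y(3) cl_ops(1)[OF x(1) y(1), symmetric]
    unfolding BB_def using CS_add[OF x(1) y(1)] V_add[OF x(2) y(2)] by blast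
qed

lemma BB_mult: "b \<in> BB m ==> c \<in> BB n ==> b \<otimes>\<^bsub>KP\<^esub> c \<in> BB (m + n)"
proof -
  assume "b \<in> BB m" "c \<in> BB n"
  then obtain x y where x: "x \<in> CS" "!!i. x i \<in> V m" "b = cl x" and y: "y \<in> CS" "!!i. y i \<in> V n" "c = cl y" by (auto simp: BB_def)
  show ?thesis unfolding x(3) y(3) cl_ops(2)[OF x(1) y(1), symmetric]
    unfolding BB_def using CS_mult[OF x(1) y(1)] V_mult[OF x(2) y(2)] by blast
qed

lemma BB_uminus: "b \<in> BB n ==> \<ominus>\<^bsub>KP\<^esub> b \<in> BB n"
proof -
  assume "b \<in> BB n"
  then obtain x where x: "x \<in> CS" "!!i. x i \<in> V n" "b = cl x" by (auto simp: BB_def)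
  show ?thesis unfolding x(3) cl_ops(3)[OF x(1) x(1), symmetric]
    unfolding BB_def using CS_uminus[OF x(1)] V_uminus[OF x(2)] by blast
qed

lemma BB_mono: "m \<le> n ==> b \<in> BB n ==> b \<in> BB m"
  unfolding BB_def using V_mono by blast

lemma BB_dense: assumes "c \<in> carrier KP" shows "\<exists>k\<in>carrier R. toK k \<ominus>\<^bsub>KP\<^esub> c \<in> BB n"
proof -
  obtain x where x: "x \<in> CS" "c = cl x" using KP_E[OF assms] .
  obtain M where M: "!!i j. i \<ge> M ==> j \<ge> M ==> x i \<ominus> x j \<in> V n" using CS_E[OF x(1)] by blast
  have xM: "x M \<in> carrier R" using CS_carrier x by blast
  have "toK (x M) \<ominus>\<^bsub>KP\<^esub> c = cl (%i. x M \<ominus> x i)" unfolding x(2) toK_cl using cl_ops(4)[OF CS_const[OF xM] x(1)] by simp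
  also have "... \<in> BB n"
  proof (rule BB_eventually)
    show "(%i. x M \<ominus> x i) \<in> CS" using CS_add[OF CS_const[OF xM] CS_uminus[OF x(1)]] by (simp add: a_minus_def)
    show "x M \<ominus> x i \<in> V n" if "i \<ge> M" for i using M that by simp
  qed
  finally show ?thesis using xM by blast
qed

lemma BB_Inter: assumes "c \<in> carrier KP" "!!n. c \<in> BB n" shows "c = \<zero>\<^bsub>KP\<^esub>"
proof -
  obtain x where x: "x \<in> CS" "c = cl x" using KP_E[OF assms(1)] .
  have "x \<in> NS" unfolding NS_iff using BB_eventually_rev[OF x(1)] assms(2) x(2) CS_carrier[OF x(1)] by simp
  moreover have "(%i. x i \<ominus> \<zero>) = x" using CS_carrier[OF x(1)] by (auto simp: a_minus_def)
  ultimately have "cl x = cl (%i. \<zero>)" using cl_eq_iff[OF x(1) CS_const[OF zero_closed]] by simp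
  thus ?thesis using x(2) cl_zero by simp
qed

lemma BB_scale: assumes "l \<in> carrier KP" shows "\<exists>c. \<forall>n. \<forall>b\<in>BB (n + c). l \<otimes>\<^bsub>KP\<^esub> b \<in> BB n"
proof -
  obtain x where x: "x \<in> CS" "l = cl x" using KP_E[OF assms] .
  obtain M c where c: "!!i n y. i \<ge> M ==> y \<in> V (n + c) ==> x i \<otimes> y \<in> V n" using CS_bounded[OF x(1)] by blast
  have "l \<otimes>\<^bsub>KP\<^esub> b \<in> BB n" if "b \<in> BB (n + c)" for b n
  proof -
    obtain y where y: "y \<in> CS" "!!i. y i \<in> V (n + c)" "b = cl y" using \<open>b \<in> BB (n + c)\<close> by (auto simp: BB_def)
    show ?thesis unfolding x(2) y(3) cl_ops(2)[OF x(1) y(1), symmetric]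
      by (rule BB_eventually[OF CS_mult[OF x(1) y(1)], of M]) (rule c[OF _ y(2)])
  qed
  thus ?thesis by blast
qed

text \<open>The inverse is taken termwise. It is Cauchy because \<open>y i \<ominus> y j = y i
  \<otimes> y j \<otimes> (x j \<ominus> x i)\<close>, where \<open>y i\<close> and
  \<open>y j\<close> are in \<open>V 0\<close>.\<close>

lemma BB_unit:
  assumes "d \<in> BB 1"
  shows "\<exists>e\<in>BB 0. (\<one>\<^bsub>KP\<^esub> \<oplus>\<^bsub>KP\<^esub> d) \<otimes>\<^bsub>KP\<^esub> e = \<one>\<^bsub>KP\<^esub>"
proof -
  obtain x where x: "x \<in> CS" "!!i. x i \<in> V 1" "d = cl x" using assms by (auto simp: BB_def)
  note xc = CS_carrier[OF x(1)]
  have u: "\<one> \<oplus> x i \<noteq> \<zero>" "inv (\<one> \<oplus> x i) \<in> V 0" for i using V_unit[OF x(2)] by auto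
  have uc: "\<one> \<oplus> x i \<in> carrier R" for i using xc by simp
  define y where "y = (%i. inv (\<one> \<oplus> x i))"
  have yc: "y i \<in> carrier R" "y i \<in> V 0" for i using u uc by (auto simp: y_def)
  have yu: "y i \<otimes> (\<one> \<oplus> x i) = \<one>" "(\<one> \<oplus> x i) \<otimes> y i = \<one>" for i unfolding y_def using inv_nz[OF uc u(1)] by auto
  have y: "y \<in> CS" unfolding CS_iff
  proof (intro conjI allI)
    show "y i \<in> carrier R" for i by (rule yc)
    fix n
    obtain M where M: "!!i j. i \<ge> M ==> j \<ge> M ==> x i \<ominus> x j \<in> V n" using CS_E[OF x(1)] by blast
    have "y i \<ominus> y j \<in> V n" if "i \<ge> M" "j \<ge> M" for i j
    proof -
      have "y i \<ominus> y j = y i \<otimes> ((\<one> \<oplus> x j) \<otimes> y j) \<ominus> (y i \<otimes> (\<one> \<oplus> x i)) \<otimes> y j" unfolding yu using yc by simp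
      also have "... = (y i \<otimes> y j) \<otimes> (x j \<ominus> x i)" using yc(1)[of i] yc(1)[of j] xc[of i] xc[of j] by algebra
      finally show ?thesis using V_mult[OF V_mult[OF yc(2) yc(2)] M[OF that(2,1)], of i j] by simp
    qed
    thus "\<exists>M. \<forall>i\<ge>M. \<forall>j\<ge>M. y i \<ominus> y j \<in> V n" by blast
  qed
  have 1: "\<one>\<^bsub>KP\<^esub> \<oplus>\<^bsub>KP\<^esub> d = cl (%i. \<one> \<oplus> x i)" unfolding cl_one x(3) using cl_ops(1)[OF CS_const[OF one_closed] x(1)] by simp
  have "(\<one>\<^bsub>KP\<^esub> \<oplus>\<^bsub>KP\<^esub> d) \<otimes>\<^bsub>KP\<^esub> cl y = cl (%i. (\<one> \<oplus> x i) \<otimes> y i)"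
    unfolding 1 using cl_ops(2)[OF CS_add[OF CS_const[OF one_closed] x(1)] y] by simp
  also have "... = \<one>\<^bsub>KP\<^esub>" unfolding yu cl_one ..
  finally show ?thesis using y yc(2) by (auto simp: BB_def)
qed

lemma KP_one_nz: "\<one>\<^bsub>KP\<^esub> \<noteq> \<zero>\<^bsub>KP\<^esub>"
  using toK_BB[OF one_closed, of 1] one_notin_V1 BB_zero[of 1] toK_ops(5)[OF one_closed one_closed] by auto

text \<open>A nonzero \<open>c\<close> lies outside some \<open>BB n\<close>. An element
  \<open>k\<close> of the number field that agrees with \<open>c\<close> modulo
  \<open>BB (Suc n)\<close> has relative error in \<open>BB 1\<close>, so \<open>c\<close> is
  \<open>k\<close> times a unit near \<one>, and \<open>BB_unit\<close> applies.\<close>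

lemma KP_field: "field KP"
proof -
  interpret K: cring KP by (rule KP_cring)
  show ?thesis
  proof (rule K.cring_fieldI)
    show "Units KP = carrier KP - {\<zero>\<^bsub>KP\<^esub>}"
    proof (intro equalityI subsetI)
      fix u assume u: "u \<in> Units KP"
      have "u \<noteq> \<zero>\<^bsub>KP\<^esub>"
      proof
        assume "u = \<zero>\<^bsub>KP\<^esub>"
        hence "\<one>\<^bsub>KP\<^esub> = \<zero>\<^bsub>KP\<^esub>" using K.Units_r_inv[OF u] K.l_null[OF K.Units_inv_closed[OF u]] by simp
        thus False using KP_one_nz by simp
      qed
      thus "u \<in> carrier KP - {\<zero>\<^bsub>KP\<^esub>}" using u K.Units_closed by blast
    next
      fix c assume "c \<in> carrier KP - {\<zero>\<^bsub>KP\<^esub>}"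
      hence c: "c \<in> carrier KP" "c \<noteq> \<zero>\<^bsub>KP\<^esub>" by auto
      obtain n where n: "c \<notin> BB n" using BB_Inter[OF c(1)] c(2) by blast
      obtain k where k: "k \<in> carrier R" "toK k \<ominus>\<^bsub>KP\<^esub> c \<in> BB (Suc n)" using BB_dense[OF c(1)] by blast
      define b where "b = toK k \<ominus>\<^bsub>KP\<^esub> c"
      have b: "b \<in> BB (Suc n)" "b \<in> carrier KP" using k BB_carrier by (auto simp: b_def)
      have kc: "toK k \<in> carrier KP" using toK_closed[OF k(1)] .
      have cb: "c = toK k \<oplus>\<^bsub>KP\<^esub> \<ominus>\<^bsub>KP\<^esub> b" unfolding b_def using kc c(1) by algebra
      have "k \<notin> V n"
      proof
        assume "k \<in> V n"
        hence "toK k \<in> BB n" using toK_BB[OF k(1)] by simp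
        hence "c \<in> BB n" using cb BB_add[OF _ BB_uminus[OF BB_mono[OF _ b(1)]]] by simp
        thus False using n by blast
      qed
      note kd = V_div[OF k(1) this]
      have kn: "k \<noteq> \<zero>" using \<open>k \<notin> V n\<close> V_zero by blast
      have ik: "inv k \<in> carrier R" "inv k \<otimes> k = \<one>" using k kn by auto
      define l where "l = toK (inv k)"
      have lc: "l \<in> carrier KP" using toK_closed[OF ik(1)] by (simp add: l_def)
      have lb: "l \<otimes>\<^bsub>KP\<^esub> b \<in> BB 1"
      proof -
        obtain y where y: "y \<in> CS" "!!i. y i \<in> V (Suc n)" "b = cl y" using b(1) by (auto simp: BB_def)
        have "l \<otimes>\<^bsub>KP\<^esub> b = cl (%i. inv k \<otimes> y i)" unfolding l_def toK_cl y(3) using cl_ops(2)[OF CS_const[OF ik(1)] y(1)] by simp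
        thus ?thesis using CS_mult[OF CS_const[OF ik(1)] y(1)] kd(2)[OF y(2)] by (auto simp: BB_def)
      qed
      have "l \<otimes>\<^bsub>KP\<^esub> c = l \<otimes>\<^bsub>KP\<^esub> toK k \<oplus>\<^bsub>KP\<^esub> \<ominus>\<^bsub>KP\<^esub> (l \<otimes>\<^bsub>KP\<^esub> b)" unfolding cb using lc kc b(2) by algebra
      also have "l \<otimes>\<^bsub>KP\<^esub> toK k = \<one>\<^bsub>KP\<^esub>" unfolding l_def toK_ops(2)[OF ik(1) k(1), symmetric] ik(2) toK_ops(5)[OF one_closed one_closed] ..
      finally have lc1: "l \<otimes>\<^bsub>KP\<^esub> c = \<one>\<^bsub>KP\<^esub> \<oplus>\<^bsub>KP\<^esub> \<ominus>\<^bsub>KP\<^esub> (l \<otimes>\<^bsub>KP\<^esub> b)" .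
      obtain e where e: "e \<in> BB 0" "(l \<otimes>\<^bsub>KP\<^esub> c) \<otimes>\<^bsub>KP\<^esub> e = \<one>\<^bsub>KP\<^esub>" unfolding lc1 using BB_unit[OF BB_uminus[OF lb]] by blast
      have ec: "e \<in> carrier KP" using e BB_carrier by blast
      have "c \<otimes>\<^bsub>KP\<^esub> (l \<otimes>\<^bsub>KP\<^esub> e) = (l \<otimes>\<^bsub>KP\<^esub> c) \<otimes>\<^bsub>KP\<^esub> e" using c lc ec by algebra
      hence "c \<otimes>\<^bsub>KP\<^esub> (l \<otimes>\<^bsub>KP\<^esub> e) = \<one>\<^bsub>KP\<^esub>" "(l \<otimes>\<^bsub>KP\<^esub> e) \<otimes>\<^bsub>KP\<^esub> c = \<one>\<^bsub>KP\<^esub>" using e K.m_comm[of c "l \<otimes>\<^bsub>KP\<^esub> e"] c lc ec by auto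
      thus "c \<in> Units KP" using c lc ec by (auto simp: Units_def)
    qed
  qed
qed

end

section \<open>Quaternion algebras with an adapted basis\<close>

text \<open>Spanning is assumed, and independence is derived in \<open>q_zero\<close> from
  anticommutation and the invertibility of two. This suits the completed algebra, where spanning can
  be read off from pure tensors.\<close>

locale qalg = ring R for R (structure) +
  fixes L :: "'a set" and i j :: 'a
  assumes L_subfield: "subfield L R"
    and central: "!!k x. k \<in> L ==> x \<in> carrier R ==> k \<otimes> x = x \<otimes> k"
    and ij_closed [simp]: "i \<in> carrier R" "j \<in> carrier R"
    and ii: "i \<otimes> i \<in> L" "i \<otimes> i \<noteq> \<zero>" and jj: "j \<otimes> j \<in> L" "j \<otimes> j \<noteq> \<zero>"
    and anti: "j \<otimes> i = \<ominus> (i \<otimes> j)"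
    and span: "!!x. x \<in> carrier R ==> \<exists>a\<in>L. \<exists>b\<in>L. \<exists>c\<in>L. \<exists>d\<in>L. x = a \<oplus> b \<otimes> i \<oplus> c \<otimes> j \<oplus> d \<otimes> (i \<otimes> j)"
    and two: "\<one> \<oplus> \<one> \<noteq> \<zero>"
begin

lemma L_closed [simp]:
  "\<zero> \<in> L" "\<one> \<in> L" "!!a b. a \<in> L ==> b \<in> L ==> a \<oplus> b \<in> L" "!!a b. a \<in> L ==> b \<in> L ==> a \<otimes> b \<in> L"
  "!!a. a \<in> L ==> \<ominus> a \<in> L" "!!a b. a \<in> L ==> b \<in> L ==> a \<ominus> b \<in> L"
  using subringE[OF subfieldE(1)[OF L_subfield]] by (auto simp: a_minus_def)

lemma L_carrier [simp]: "a \<in> L ==> a \<in> carrier R"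
  using subfieldE(3)[OF L_subfield] by blast

lemma L_inv:
  assumes "a \<in> L" "a \<noteq> \<zero>"
  shows "inv a \<in> L" "a \<otimes> inv a = \<one>" "inv a \<otimes> a = \<one>"
  using subfield_m_inv[OF L_subfield, of a] assms by auto

lemma L_cancel: "a \<in> L ==> a \<noteq> \<zero> ==> x \<in> carrier R ==> a \<otimes> x = \<zero> ==> x = \<zero>"
proof -
  assume a: "a \<in> L" "a \<noteq> \<zero>" "x \<in> carrier R" "a \<otimes> x = \<zero>"
  have "inv a \<otimes> (a \<otimes> x) = x" using L_inv[OF a(1,2)] a(1,3) by (simp add: m_assoc[symmetric])
  thus ?thesis using a L_inv[OF a(1,2)] by simp
qed

lemma L_comm: "a \<in> L ==> b \<in> L ==> a \<otimes> b = b \<otimes> a" by (rule central) auto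

lemma double_zero: "x \<oplus> x = \<zero> ==> x \<in> carrier R ==> x = \<zero>"
  using L_cancel[of "\<one> \<oplus> \<one>" x] two by (simp add: l_distr)

lemma term_mult:
  "a \<in> L ==> b \<in> L ==> x \<in> carrier R ==> y \<in> carrier R ==> (a \<otimes> x) \<otimes> (b \<otimes> y) = (a \<otimes> b) \<otimes> (x \<otimes> y)"
  using central[of b x] by (simp add: m_assoc[symmetric]) (simp add: m_assoc)

abbreviation A where "A \<equiv> i \<otimes> i"
abbreviation B where "B \<equiv> j \<otimes> j"
abbreviation k where "k \<equiv> i \<otimes> j"

lemma table:
  "i \<otimes> k = A \<otimes> j" "k \<otimes> i = \<ominus> (A \<otimes> j)" "k \<otimes> j = B \<otimes> i" "j \<otimes> k = \<ominus> (B \<otimes> i)" "k \<otimes> k = \<ominus> (A \<otimes> B)"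
proof -
  show "i \<otimes> k = A \<otimes> j" by (simp add: m_assoc)
  show 1: "k \<otimes> i = \<ominus> (A \<otimes> j)" by (simp add: m_assoc anti r_minus)
  show 2: "k \<otimes> j = B \<otimes> i" using central[OF jj(1), of i] by (simp add: m_assoc)
  have "j \<otimes> k = (j \<otimes> i) \<otimes> j" by (simp add: m_assoc)
  also have "... = \<ominus> (k \<otimes> j)" by (simp only: anti l_minus ij_closed m_closed)
  finally show "j \<otimes> k = \<ominus> (B \<otimes> i)" using 2 by simp
  have "k \<otimes> k = (k \<otimes> i) \<otimes> j" by (simp add: m_assoc)
  also have "... = \<ominus> (A \<otimes> B)" unfolding 1 by (simp add: l_minus m_assoc)
  finally show "k \<otimes> k = \<ominus> (A \<otimes> B)" .
qed

definition q :: "'a => 'a => 'a => 'a => 'a" where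
  "q a b c d = a \<oplus> b \<otimes> i \<oplus> c \<otimes> j \<oplus> d \<otimes> k"

lemma q_closed [simp]: "a \<in> L ==> b \<in> L ==> c \<in> L ==> d \<in> L ==> q a b c d \<in> carrier R"
  by (simp add: q_def)

lemma q_exists:
  assumes "x \<in> carrier R"
  obtains a b c d where "a \<in> L" "b \<in> L" "c \<in> L" "d \<in> L" "x = q a b c d"
  using span[OF assms] unfolding q_def by blast

lemma q_add:
  assumes "a \<in> L" "b \<in> L" "c \<in> L" "d \<in> L" "a' \<in> L" "b' \<in> L" "c' \<in> L" "d' \<in> L"
  shows "q a b c d \<oplus> q a' b' c' d' = q (a \<oplus> a') (b \<oplus> b') (c \<oplus> c') (d \<oplus> d')"
proof -
  note c = assms[THEN L_carrier]
  show ?thesis unfolding q_def using c ij_closed by algebra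
qed

lemma q_uminus:
  assumes "a \<in> L" "b \<in> L" "c \<in> L" "d \<in> L"
  shows "\<ominus> q a b c d = q (\<ominus> a) (\<ominus> b) (\<ominus> c) (\<ominus> d)"
proof -
  note c = assms[THEN L_carrier]
  show ?thesis unfolding q_def using c ij_closed by algebra
qed

lemma q_scale:
  assumes "l \<in> L" "a \<in> L" "b \<in> L" "c \<in> L" "d \<in> L"
  shows "l \<otimes> q a b c d = q (l \<otimes> a) (l \<otimes> b) (l \<otimes> c) (l \<otimes> d)"
proof -
  note c = assms[THEN L_carrier]
  show ?thesis unfolding q_def using c ij_closed by algebra
qed

lemma L_left: "l \<in> L ==> x \<in> carrier R ==> y \<in> carrier R ==> x \<otimes> (l \<otimes> y) = l \<otimes> (x \<otimes> y)"
  using central[of l x] by (metis L_carrier m_assoc)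

lemma complex_mult:
  assumes "a \<in> L" "b \<in> L" "a' \<in> L" "b' \<in> L"
  shows "(a \<oplus> b \<otimes> i) \<otimes> (a' \<oplus> b' \<otimes> i) = (a \<otimes> a' \<oplus> b \<otimes> b' \<otimes> A) \<oplus> (a \<otimes> b' \<oplus> b \<otimes> a') \<otimes> i"
proof -
  note cc = assms[THEN L_carrier]
  have 1: "i \<otimes> a' = a' \<otimes> i" "i \<otimes> (b' \<otimes> i) = b' \<otimes> A" using central[OF assms(3)] L_left[OF assms(4)] by auto
  have "(a \<oplus> b \<otimes> i) \<otimes> (a' \<oplus> b' \<otimes> i) = (a \<otimes> a' \<oplus> b \<otimes> (i \<otimes> (b' \<otimes> i))) \<oplus> (a \<otimes> b' \<otimes> i \<oplus> b \<otimes> (i \<otimes> a'))"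
    using cc ij_closed(1) by algebra
  thus ?thesis unfolding 1 using cc ij_closed(1) by algebra
qed

lemma j_complex:
  assumes "a \<in> L" "b \<in> L"
  shows "j \<otimes> (a \<oplus> b \<otimes> i) = (a \<oplus> \<ominus> b \<otimes> i) \<otimes> j"
proof -
  note cc = assms[THEN L_carrier]
  have "j \<otimes> (a \<oplus> b \<otimes> i) = a \<otimes> j \<oplus> b \<otimes> (j \<otimes> i)"
    using cc central[OF assms(1), of j] L_left[OF assms(2), of j i] by (simp add: r_distr)
  thus ?thesis unfolding anti using cc ij_closed by algebra
qed

text \<open>The algebra is the sum of \<open>L(i)\<close> and \<open>L(i) j\<close>, and moving
  \<open>j\<close> past an element of \<open>L(i)\<close> conjugates it, by
  \<open>j_complex\<close>. Grouping the coordinates in pairs reduces the product to four products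
  in \<open>L(i)\<close>.\<close>

lemma q_mult:
  assumes "a \<in> L" "b \<in> L" "c \<in> L" "d \<in> L" "a' \<in> L" "b' \<in> L" "c' \<in> L" "d' \<in> L"
  shows "q a b c d \<otimes> q a' b' c' d' =
    q ((a \<otimes> a' \<oplus> b \<otimes> b' \<otimes> A) \<oplus> (c \<otimes> c' \<oplus> d \<otimes> \<ominus> d' \<otimes> A) \<otimes> B)
      ((a \<otimes> b' \<oplus> b \<otimes> a') \<oplus> (c \<otimes> \<ominus> d' \<oplus> d \<otimes> c') \<otimes> B)
      ((a \<otimes> c' \<oplus> b \<otimes> d' \<otimes> A) \<oplus> (c \<otimes> a' \<oplus> d \<otimes> \<ominus> b' \<otimes> A))
      ((a \<otimes> d' \<oplus> b \<otimes> c') \<oplus> (c \<otimes> \<ominus> b' \<oplus> d \<otimes> a'))"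
proof -
  note cc = assms[THEN L_carrier]
  have qP: "q a b c d = (a \<oplus> b \<otimes> i) \<oplus> (c \<oplus> d \<otimes> i) \<otimes> j" if "a \<in> L" "b \<in> L" "c \<in> L" "d \<in> L" for a b c d
    unfolding q_def using that[THEN L_carrier] ij_closed by algebra
  define p where "p = a \<oplus> b \<otimes> i"
  define r where "r = c \<oplus> d \<otimes> i"
  define p' where "p' = a' \<oplus> b' \<otimes> i"
  define r' where "r' = c' \<oplus> d' \<otimes> i"
  define pc where "pc = a' \<oplus> \<ominus> b' \<otimes> i"
  define rc where "rc = c' \<oplus> \<ominus> d' \<otimes> i"
  have clo: "p \<in> carrier R" "r \<in> carrier R" "p' \<in> carrier R" "r' \<in> carrier R" "pc \<in> carrier R" "rc \<in> carrier R"
    using cc by (auto simp: p_def r_def p'_def r'_def pc_def rc_def)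
  have jp: "j \<otimes> p' = pc \<otimes> j" "j \<otimes> r' = rc \<otimes> j"
    unfolding p'_def r'_def pc_def rc_def using j_complex assms by auto
  have "(p \<oplus> r \<otimes> j) \<otimes> (p' \<oplus> r' \<otimes> j) = (p \<otimes> p' \<oplus> r \<otimes> (j \<otimes> r') \<otimes> j) \<oplus> (p \<otimes> r' \<otimes> j \<oplus> r \<otimes> (j \<otimes> p'))"
    using clo ij_closed by algebra
  also have "... = (p \<otimes> p' \<oplus> (r \<otimes> rc) \<otimes> B) \<oplus> (p \<otimes> r' \<oplus> r \<otimes> pc) \<otimes> j"
    unfolding jp using clo ij_closed by algebra
  finally have main: "(p \<oplus> r \<otimes> j) \<otimes> (p' \<oplus> r' \<otimes> j) = (p \<otimes> p' \<oplus> (r \<otimes> rc) \<otimes> B) \<oplus> (p \<otimes> r' \<oplus> r \<otimes> pc) \<otimes> j" .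
  have Pa: "(x \<oplus> y \<otimes> i) \<oplus> (x' \<oplus> y' \<otimes> i) = (x \<oplus> x') \<oplus> (y \<oplus> y') \<otimes> i"
    if "x \<in> L" "y \<in> L" "x' \<in> L" "y' \<in> L" for x y x' y'
    using that[THEN L_carrier] ij_closed by algebra
  have PB: "(x \<oplus> y \<otimes> i) \<otimes> B = x \<otimes> B \<oplus> (y \<otimes> B) \<otimes> i" if "x \<in> L" "y \<in> L" for x y
  proof -
    have "y \<otimes> i \<otimes> B = y \<otimes> (B \<otimes> i)" using central[OF jj(1), of i] that by (simp add: m_assoc)
    thus ?thesis using that by (simp add: l_distr m_assoc)
  qed
  note LL = assms ii(1) jj(1) L_closed(3,4,5)
  have e1: "p \<otimes> p' \<oplus> (r \<otimes> rc) \<otimes> B = ((a \<otimes> a' \<oplus> b \<otimes> b' \<otimes> A) \<oplus> (c \<otimes> c' \<oplus> d \<otimes> \<ominus> d' \<otimes> A) \<otimes> B)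
     \<oplus> ((a \<otimes> b' \<oplus> b \<otimes> a') \<oplus> (c \<otimes> \<ominus> d' \<oplus> d \<otimes> c') \<otimes> B) \<otimes> i"
    unfolding p_def p'_def r_def rc_def
    by (simp only: complex_mult PB Pa LL)
  have e2: "p \<otimes> r' \<oplus> r \<otimes> pc = ((a \<otimes> c' \<oplus> b \<otimes> d' \<otimes> A) \<oplus> (c \<otimes> a' \<oplus> d \<otimes> \<ominus> b' \<otimes> A))
     \<oplus> ((a \<otimes> d' \<oplus> b \<otimes> c') \<oplus> (c \<otimes> \<ominus> b' \<oplus> d \<otimes> a')) \<otimes> i"
    unfolding p_def r'_def r_def pc_def
    by (simp only: complex_mult Pa LL)
  have "q a b c d \<otimes> q a' b' c' d' = (p \<oplus> r \<otimes> j) \<otimes> (p' \<oplus> r' \<otimes> j)"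
    using assms by (simp only: qP p_def r_def p'_def r'_def)
  also have "... = q ((a \<otimes> a' \<oplus> b \<otimes> b' \<otimes> A) \<oplus> (c \<otimes> c' \<oplus> d \<otimes> \<ominus> d' \<otimes> A) \<otimes> B)
      ((a \<otimes> b' \<oplus> b \<otimes> a') \<oplus> (c \<otimes> \<ominus> d' \<oplus> d \<otimes> c') \<otimes> B)
      ((a \<otimes> c' \<oplus> b \<otimes> d' \<otimes> A) \<oplus> (c \<otimes> a' \<oplus> d \<otimes> \<ominus> b' \<otimes> A))
      ((a \<otimes> d' \<oplus> b \<otimes> c') \<oplus> (c \<otimes> \<ominus> b' \<oplus> d \<otimes> a'))"
    unfolding main e1 e2 by (subst qP) (simp_all only: LL)
  finally show ?thesis .
qed

text \<open>Adding the products with \<open>j\<close> from the left and from the right cancels the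
  term in \<open>i\<close> and leaves \<open>p \<otimes> j\<close> twice.\<close>

lemma two_term: assumes p: "p \<in> L" "r \<in> L" "p \<oplus> r \<otimes> i = \<zero>" shows "p = \<zero>" "r = \<zero>"
proof -
  have pc: "p \<in> carrier R" "r \<in> carrier R" using p by auto
  have "j \<otimes> (p \<oplus> r \<otimes> i) = p \<otimes> j \<oplus> r \<otimes> (j \<otimes> i)"
    using pc central[OF p(1), of j] central[OF p(2), of j] by (simp add: r_distr) (simp add: m_assoc[symmetric])
  moreover have "(p \<oplus> r \<otimes> i) \<otimes> j = p \<otimes> j \<oplus> r \<otimes> k" using pc by (simp add: l_distr m_assoc)
  ultimately have "j \<otimes> (p \<oplus> r \<otimes> i) \<oplus> (p \<oplus> r \<otimes> i) \<otimes> j = p \<otimes> j \<oplus> p \<otimes> j"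
    unfolding anti using pc ij_closed by (simp only:) algebra
  hence "p \<otimes> j \<oplus> p \<otimes> j = \<zero>" using p(3) by simp
  hence "p \<otimes> j = \<zero>" by (rule double_zero) (use pc in auto)
  hence "p \<otimes> j \<otimes> j = \<zero>" by simp
  hence "B \<otimes> p = \<zero>" using central[OF p(1), of B] pc by (simp add: m_assoc)
  thus p0: "p = \<zero>" using L_cancel[OF jj pc(1)] by simp
  hence "r \<otimes> i = \<zero>" using p(3) pc by simp
  hence "r \<otimes> i \<otimes> i = \<zero>" by simp
  hence "A \<otimes> r = \<zero>" using central[OF p(2), of A] pc by (simp add: m_assoc)
  thus "r = \<zero>" using L_cancel[OF ii pc(2)] by simp
qed

text \<open>The sum of the two products with \<open>i\<close> cancels the terms in \<open>j\<close>
  and \<open>k\<close> and leaves twice those in \<one> and \<open>i\<close>. The rest is brought to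
  the form of \<open>two_term\<close> by a factor \<open>j\<close> on the right.\<close>

lemma q_zero: assumes "a \<in> L" "b \<in> L" "c \<in> L" "d \<in> L" "q a b c d = \<zero>"
  shows "a = \<zero>" "b = \<zero>" "c = \<zero>" "d = \<zero>"
proof -
  note cc = assms(1-4)[THEN L_carrier]
  have l: "i \<otimes> q a b c d = a \<otimes> i \<oplus> b \<otimes> A \<oplus> c \<otimes> k \<oplus> d \<otimes> (A \<otimes> j)"
  proof -
    have "i \<otimes> q a b c d = i \<otimes> a \<oplus> i \<otimes> (b \<otimes> i) \<oplus> i \<otimes> (c \<otimes> j) \<oplus> i \<otimes> (d \<otimes> k)"
      unfolding q_def using cc ij_closed by algebra
    also have "... = a \<otimes> i \<oplus> b \<otimes> A \<oplus> c \<otimes> k \<oplus> d \<otimes> (i \<otimes> k)"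
      using central[OF assms(1), of i] assms by (simp only: L_left ij_closed m_closed)
    finally show ?thesis unfolding table .
  qed
  have r: "q a b c d \<otimes> i = a \<otimes> i \<oplus> b \<otimes> A \<oplus> c \<otimes> \<ominus> k \<oplus> d \<otimes> \<ominus> (A \<otimes> j)"
  proof -
    have "q a b c d \<otimes> i = a \<otimes> i \<oplus> b \<otimes> A \<oplus> c \<otimes> (j \<otimes> i) \<oplus> d \<otimes> (k \<otimes> i)"
      unfolding q_def using cc ij_closed by algebra
    thus ?thesis unfolding anti table .
  qed
  have "i \<otimes> q a b c d \<oplus> q a b c d \<otimes> i = (b \<otimes> A \<oplus> b \<otimes> A) \<oplus> (a \<oplus> a) \<otimes> i"
    unfolding l r using cc ij_closed by algebra
  hence 1: "(b \<otimes> A \<oplus> b \<otimes> A) \<oplus> (a \<oplus> a) \<otimes> i = \<zero>" using assms(5) by simp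
  have z: "b \<otimes> A \<oplus> b \<otimes> A = \<zero>" "a \<oplus> a = \<zero>" using two_term[OF _ _ 1] assms ii(1) by auto
  from z(1) have "b \<otimes> A = \<zero>" by (rule double_zero) (use cc in auto)
  hence "A \<otimes> b = \<zero>" using L_comm[OF assms(2) ii(1)] by simp
  thus b: "b = \<zero>" using L_cancel[OF ii cc(2)] by simp
  show a: "a = \<zero>" using z(2) cc(1) by (rule double_zero)
  have "c \<otimes> j \<oplus> d \<otimes> k = \<zero>" using assms(5) a b cc by (simp add: q_def)
  moreover have "(c \<otimes> j \<oplus> d \<otimes> k) \<otimes> j = c \<otimes> B \<oplus> d \<otimes> B \<otimes> i"
  proof -
    have "(c \<otimes> j \<oplus> d \<otimes> k) \<otimes> j = c \<otimes> B \<oplus> d \<otimes> (k \<otimes> j)" using cc ij_closed by algebra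
    thus ?thesis unfolding table using cc by (simp add: m_assoc)
  qed
  ultimately have 2: "c \<otimes> B \<oplus> d \<otimes> B \<otimes> i = \<zero>" by simp
  have "c \<otimes> B = \<zero>" "d \<otimes> B = \<zero>" using two_term[OF _ _ 2] assms jj by auto
  hence "B \<otimes> c = \<zero>" "B \<otimes> d = \<zero>" using L_comm[OF _ jj(1)] assms by auto
  thus "c = \<zero>" "d = \<zero>" using L_cancel[OF jj cc(3)] L_cancel[OF jj cc(4)] by simp_all
qed

lemma q_inject:
  assumes "a \<in> L" "b \<in> L" "c \<in> L" "d \<in> L" "a' \<in> L" "b' \<in> L" "c' \<in> L" "d' \<in> L" "q a b c d = q a' b' c' d'"
  shows "a = a'" "b = b'" "c = c'" "d = d'"
proof -
  have "q a b c d \<oplus> \<ominus> q a' b' c' d' = \<zero>" using assms by (simp add: r_neg)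
  hence 0: "q (a \<oplus> \<ominus> a') (b \<oplus> \<ominus> b') (c \<oplus> \<ominus> c') (d \<oplus> \<ominus> d') = \<zero>"
    using assms(1-8) by (simp add: q_uminus q_add)
  have *: "u = v" if "u \<oplus> \<ominus> v = \<zero>" "u \<in> L" "v \<in> L" for u v
    using that by (metis L_carrier a_inv_closed minus_equality minus_minus)
  show "a = a'" "b = b'" "c = c'" "d = d'"
    by (intro *[OF q_zero(1)[OF _ _ _ _ 0]] *[OF q_zero(2)[OF _ _ _ _ 0]] *[OF q_zero(3)[OF _ _ _ _ 0]] *[OF q_zero(4)[OF _ _ _ _ 0]]; use assms in simp)+
qed

end

section \<open>Conjugation, reduced norm and fixed elements\<close>

locale quat = qalg +
  fixes \<sigma> :: "'a => 'a"
  assumes invol: "involution R L \<sigma>" and sigma_i: "\<sigma> i = i" and sigma_j: "\<sigma> j = j"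
begin

lemma sigma_closed [simp]: "x \<in> carrier R ==> \<sigma> x \<in> carrier R"
  and sigma_add: "x \<in> carrier R ==> y \<in> carrier R ==> \<sigma> (x \<oplus> y) = \<sigma> x \<oplus> \<sigma> y"
  and sigma_scale: "l \<in> L ==> x \<in> carrier R ==> \<sigma> (l \<otimes> x) = l \<otimes> \<sigma> x"
  and sigma_mult: "x \<in> carrier R ==> y \<in> carrier R ==> \<sigma> (x \<otimes> y) = \<sigma> y \<otimes> \<sigma> x"
  and sigma_sigma [simp]: "x \<in> carrier R ==> \<sigma> (\<sigma> x) = x"
  using invol by (auto simp: involution_def)

lemma sigma_one [simp]: "\<sigma> \<one> = \<one>"
proof -
  have "\<sigma> \<one> = \<sigma> \<one> \<otimes> \<sigma> (\<sigma> \<one>)" by simp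
  also have "... = \<sigma> (\<sigma> \<one> \<otimes> \<one>)" by (simp only: sigma_mult sigma_closed one_closed)
  also have "... = \<one>" by simp
  finally show ?thesis .
qed

lemma sigma_L [simp]: "l \<in> L ==> \<sigma> l = l" using sigma_scale[of l \<one>] by simp
lemma sigma_zero [simp]: "\<sigma> \<zero> = \<zero>" by simp
lemma sigma_uminus: "x \<in> carrier R ==> \<sigma> (\<ominus> x) = \<ominus> \<sigma> x"
  using sigma_scale[of "\<ominus> \<one>" x] by (simp add: l_minus)
lemma sigma_minus: "x \<in> carrier R ==> y \<in> carrier R ==> \<sigma> (x \<ominus> y) = \<sigma> x \<ominus> \<sigma> y"
  by (simp add: a_minus_def sigma_add sigma_uminus)
lemma sigma_k: "\<sigma> k = \<ominus> k" by (simp add: sigma_mult sigma_i sigma_j anti)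

lemma sigma_q: "a \<in> L ==> b \<in> L ==> c \<in> L ==> d \<in> L ==> \<sigma> (q a b c d) = q a b c (\<ominus> d)"
  by (simp add: q_def sigma_add sigma_scale sigma_i sigma_j sigma_k r_minus l_minus)

lemma unit_if:
  assumes "x \<in> carrier R" "y \<in> carrier R" "x \<otimes> y = \<one>" "y \<otimes> x = \<one>"
  shows "x \<in> Units R" "inv x = y"
  using assms inv_char by (auto simp: Units_def)

lemma AB_nz: "A \<otimes> B \<in> L" "A \<otimes> B \<noteq> \<zero>"
  using ii jj L_cancel[of A B] by auto

lemma k_unit: "k \<in> Units R"
proof -
  define l where "l = inv (\<ominus> (A \<otimes> B))"
  have nz: "\<ominus> (A \<otimes> B) \<in> L" "\<ominus> (A \<otimes> B) \<noteq> \<zero>" using AB_nz by auto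
  note l = L_inv[OF nz, folded l_def]
  have "k \<otimes> (l \<otimes> k) = l \<otimes> (k \<otimes> k)" using l(1) by (intro L_left) auto
  moreover have "(l \<otimes> k) \<otimes> k = l \<otimes> (k \<otimes> k)" using l(1) by (intro m_assoc) auto
  ultimately have "k \<otimes> (l \<otimes> k) = \<one>" "(l \<otimes> k) \<otimes> k = \<one>" using l(3) table(5) by auto
  thus ?thesis using l(1) by (intro unit_if[of k "l \<otimes> k"]) auto
qed

text \<open>Quaternion conjugation: \<open>\<sigma>\<close> fixes \<open>i\<close> and
  \<open>j\<close> and negates \<open>k\<close>, while conjugation by \<open>k\<close> negates
  \<open>i\<close> and \<open>j\<close>. In this form it is visibly an anti-automorphism.\<close>

definition cj :: "'a => 'a" where "cj x = inv k \<otimes> \<sigma> x \<otimes> k"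

lemma kinv: "inv k \<in> carrier R" "k \<otimes> inv k = \<one>" "inv k \<otimes> k = \<one>" using k_unit by auto

lemma kcancel: "x \<in> carrier R ==> k \<otimes> (inv k \<otimes> x) = x" "x \<in> carrier R ==> inv k \<otimes> (k \<otimes> x) = x"
  using kinv by (simp_all add: m_assoc[symmetric] del: m_assoc)

lemma cj_closed [simp]: "x \<in> carrier R ==> cj x \<in> carrier R" using kinv by (simp add: cj_def)

lemma cj_add: "x \<in> carrier R ==> y \<in> carrier R ==> cj (x \<oplus> y) = cj x \<oplus> cj y"
  using kinv by (simp add: cj_def sigma_add r_distr l_distr)

lemma cj_mult:
  assumes "x \<in> carrier R" "y \<in> carrier R" shows "cj (x \<otimes> y) = cj y \<otimes> cj x"
proof -
  have gen: "(u \<otimes> y \<otimes> v) \<otimes> (u \<otimes> x \<otimes> v) = u \<otimes> (y \<otimes> x) \<otimes> v"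
    if "u \<in> carrier R" "v \<in> carrier R" "x \<in> carrier R" "y \<in> carrier R" "v \<otimes> u = \<one>" for u v x y
  proof -
    have "(u \<otimes> y \<otimes> v) \<otimes> (u \<otimes> x \<otimes> v) = u \<otimes> y \<otimes> (v \<otimes> u) \<otimes> x \<otimes> v" using that(1-4) by algebra
    thus ?thesis using that by (simp add: m_assoc)
  qed
  show ?thesis unfolding cj_def sigma_mult[OF assms] by (rule gen[symmetric]) (use assms kinv in auto)
qed

lemma cj_L [simp]: "l \<in> L ==> cj l = l"
proof -
  assume l: "l \<in> L"
  have "cj l = inv k \<otimes> (k \<otimes> l)" unfolding cj_def using l kinv central[OF l, of k] by (simp add: m_assoc[of "inv k"])
  also have "... = l" using l by (subst kcancel) auto
  finally show ?thesis .
qed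

lemma cj_eqI: "x \<in> carrier R ==> y \<in> carrier R ==> \<sigma> x \<otimes> k = k \<otimes> y ==> cj x = y"
  unfolding cj_def using kinv kcancel by (simp add: m_assoc[of "inv k"])

lemma cj_i: "cj i = \<ominus> i" by (rule cj_eqI) (auto simp: sigma_i table r_minus)
lemma cj_j: "cj j = \<ominus> j" by (rule cj_eqI) (auto simp: sigma_j table r_minus)
lemma cj_k: "cj k = \<ominus> k" by (rule cj_eqI) (auto simp: sigma_k l_minus r_minus)

lemma cj_scale: "l \<in> L ==> x \<in> carrier R ==> cj (l \<otimes> x) = l \<otimes> cj x"
  using central[of l "cj x"] by (simp add: cj_mult)

lemma cj_q: "a \<in> L ==> b \<in> L ==> c \<in> L ==> d \<in> L ==> cj (q a b c d) = q a (\<ominus> b) (\<ominus> c) (\<ominus> d)"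
  by (simp add: q_def cj_add cj_scale cj_i cj_j cj_k r_minus l_minus)

lemma cj_cj [simp]: "x \<in> carrier R ==> cj (cj x) = x"
  by (rule q_exists[of x]) (auto simp: cj_q)

lemma cj_fixed: assumes "x \<in> carrier R" "cj x = x" shows "x \<in> L"
proof -
  obtain a b c d where x: "a \<in> L" "b \<in> L" "c \<in> L" "d \<in> L" "x = q a b c d" using q_exists[OF assms(1)] .
  have e: "q a (\<ominus> b) (\<ominus> c) (\<ominus> d) = q a b c d" using assms(2) x by (simp add: cj_q)
  have z: "u = \<zero>" if "\<ominus> u = u" "u \<in> L" for u
    using that double_zero[of u] r_neg[of u] by simp
  have "b = \<zero>" "c = \<zero>" "d = \<zero>" using q_inject[OF _ _ _ _ _ _ _ _ e] x(1-4) z by auto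
  thus ?thesis using x by (simp add: q_def)
qed

text \<open>The reduced norm, a multiplicative map to the field \<open>L\<close> that detects
  units.\<close>

definition nrm :: "'a => 'a" where "nrm x = x \<otimes> cj x"

lemma nrm_L [simp]: "x \<in> carrier R ==> nrm x \<in> L"
  unfolding nrm_def by (rule cj_fixed) (auto simp: cj_mult)

lemma trace_L: "x \<in> carrier R ==> x \<oplus> cj x \<in> L"
  by (rule cj_fixed) (auto simp: cj_add a_comm)

lemma nrm_comm: assumes x: "x \<in> carrier R" shows "cj x \<otimes> x = nrm x"
proof -
  define t where "t = x \<oplus> cj x"
  have t: "t \<in> L" "t \<in> carrier R" unfolding t_def using trace_L[OF x] by auto
  have c: "cj x = t \<ominus> x" unfolding t_def using x cj_closed[OF x] by algebra
  show ?thesis unfolding nrm_def c using x t(2) central[OF t(1) x] by (simp add: a_minus_def l_distr r_distr l_minus r_minus)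
qed

lemma nrm_mult: assumes "x \<in> carrier R" "y \<in> carrier R" shows "nrm (x \<otimes> y) = nrm x \<otimes> nrm y"
proof -
  have "nrm (x \<otimes> y) = x \<otimes> nrm y \<otimes> cj x" unfolding nrm_def cj_mult[OF assms] using assms by (simp add: m_assoc)
  also have "... = nrm x \<otimes> nrm y" using central[OF nrm_L[OF assms(2)] cj_closed[OF assms(1)]] assms(1) nrm_L[OF assms(2)]
    by (simp add: nrm_def[of x] m_assoc)
  finally show ?thesis .
qed

lemma nrm_one: "nrm \<one> = \<one>" by (simp add: nrm_def)

lemma nrm_unit: assumes "x \<in> carrier R" "nrm x \<noteq> \<zero>" shows "x \<in> Units R" "inv x = inv (nrm x) \<otimes> cj x"
proof -
  note n = L_inv[OF nrm_L[OF assms(1)] assms(2)]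
  have "x \<otimes> (inv (nrm x) \<otimes> cj x) = inv (nrm x) \<otimes> nrm x"
    using central[OF n(1) assms(1)] assms n(1) by (simp add: nrm_def[of x] m_assoc[symmetric])
  moreover have "(inv (nrm x) \<otimes> cj x) \<otimes> x = inv (nrm x) \<otimes> nrm x"
    using assms n(1) nrm_comm[OF assms(1)] by (simp add: m_assoc)
  ultimately show "x \<in> Units R" "inv x = inv (nrm x) \<otimes> cj x"
    using n assms by (intro unit_if; simp)+
qed

lemma one_nz: "\<one> \<noteq> \<zero>" using two by auto

lemma unit_nrm: assumes "x \<in> Units R" shows "nrm x \<noteq> \<zero>"
proof
  assume 0: "nrm x = \<zero>"
  have "nrm x \<otimes> nrm (inv x) = \<one>"
    using nrm_mult[OF Units_closed[OF assms] Units_inv_closed[OF assms]] Units_r_inv[OF assms] nrm_one by simp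
  thus False using 0 one_nz assms by simp
qed

text \<open>Up to nonzero factors, the traces of \<open>y\<close>, \<open>y \<otimes> i\<close> and
  \<open>y \<otimes> j\<close> are the coordinates of \<open>y\<close> at \<one>, \<open>i\<close>
  and \<open>j\<close>.\<close>

lemma trace_zero_k:
  assumes y: "y \<in> carrier R" and t: "!!x. x \<in> {\<one>, i, j} ==> y \<otimes> x \<oplus> cj (y \<otimes> x) = \<zero>"
  shows "\<exists>d\<in>L. y = d \<otimes> k"
proof -
  obtain a b c d where x: "a \<in> L" "b \<in> L" "c \<in> L" "d \<in> L" "y = q a b c d" using q_exists[OF y] .
  note cc = x(1-4)[THEN L_carrier]
  have tr: "q a b c d \<oplus> cj (q a b c d) = a \<oplus> a" if "a \<in> L" "b \<in> L" "c \<in> L" "d \<in> L" for a b c d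
    using that by (simp add: cj_q q_add r_neg) (simp add: q_def)
  have "a \<oplus> a = \<zero>" using t[of \<one>] y tr[OF x(1-4)] x(5) by simp
  hence a: "a = \<zero>" using cc(1) by (rule double_zero)
  have yi: "y \<otimes> i = q (b \<otimes> A) a (\<ominus> (d \<otimes> A)) (\<ominus> c)"
  proof -
    have "y \<otimes> i = q a b c d \<otimes> q \<zero> \<one> \<zero> \<zero>" unfolding x(5) by (simp add: q_def[of \<zero> \<one>])
    also have "... = q (b \<otimes> A) a (\<ominus> (d \<otimes> A)) (\<ominus> c)" using x(1-4) by (simp add: q_mult r_minus l_minus)
    finally show ?thesis .
  qed
  have yj: "y \<otimes> j = q (c \<otimes> B) (d \<otimes> B) a b"
  proof -
    have "y \<otimes> j = q a b c d \<otimes> q \<zero> \<zero> \<one> \<zero>" unfolding x(5) by (simp add: q_def[of \<zero> \<zero>])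
    also have "... = q (c \<otimes> B) (d \<otimes> B) a b" using x(1-4) by (simp add: q_mult a_minus_def)
    finally show ?thesis .
  qed
  have "b \<otimes> A \<oplus> b \<otimes> A = \<zero>" using t[of i] tr[of "b \<otimes> A" a "\<ominus> (d \<otimes> A)" "\<ominus> c"] x(1-4) ii(1) unfolding yi by simp
  hence "b \<otimes> A = \<zero>" by (rule double_zero) (use cc in auto)
  hence b: "b = \<zero>" using L_cancel[OF ii cc(2)] L_comm[OF x(2) ii(1)] by simp
  have "c \<otimes> B \<oplus> c \<otimes> B = \<zero>" using t[of j] tr[of "c \<otimes> B" "d \<otimes> B" a b] x(1-4) jj(1) unfolding yj by simp
  hence "c \<otimes> B = \<zero>" by (rule double_zero) (use cc in auto)
  hence c: "c = \<zero>" using L_cancel[OF jj cc(3)] L_comm[OF x(3) jj(1)] by simp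
  show ?thesis using x(4,5) a b c cc by (auto simp: q_def)
qed

abbreviation Fix :: "'a set" where "Fix \<equiv> fixed_points R \<sigma>"

lemma Fix_iff: "x \<in> Fix \<longleftrightarrow> x \<in> carrier R \<and> \<sigma> x = x" by (simp add: fixed_points_def)

lemma Fix_basic: "\<zero> \<in> Fix" "\<one> \<in> Fix" "i \<in> Fix" "j \<in> Fix" "l \<in> L ==> l \<in> Fix"
  "x \<in> Fix ==> \<ominus> x \<in> Fix" "x \<in> Fix ==> y \<in> Fix ==> x \<oplus> y \<in> Fix"
  by (auto simp: Fix_iff sigma_i sigma_j sigma_uminus sigma_add)

lemma Fix_coordinates: assumes "x \<in> Fix" shows "\<exists>a\<in>L. \<exists>b\<in>L. \<exists>c\<in>L. x = q a b c \<zero>"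
proof -
  obtain a b c d where x: "a \<in> L" "b \<in> L" "c \<in> L" "d \<in> L" "x = q a b c d"
    using q_exists[of x] assms unfolding Fix_iff by metis
  have "q a b c (\<ominus> d) = q a b c d" using assms x by (simp add: Fix_iff sigma_q)
  hence "\<ominus> d = d" using q_inject(4) x by (meson L_closed(5))
  hence "d \<oplus> d = \<zero>" using r_neg[of d] x by simp
  hence "d = \<zero>" by (rule double_zero) (use x in simp)
  thus ?thesis using x by blast
qed

text \<open>Otherwise the norm of \<open>a \<oplus> b \<otimes> x\<close>, a quadratic polynomial in
  \<open>x\<close>, vanishes on all fixed elements. Its values at \<zero> and at plus and minus
  \<one> give \<open>nrm a = nrm b = \<zero>\<close>; then the trace terms make
  \<open>cj a \<otimes> b\<close> a multiple of \<open>k\<close>, and as its norm is zero, it is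
  zero. Multiplying the determinant condition by \<open>cj b\<close> now yields
  \<open>b = \<zero>\<close>, so \<open>a\<close> would be right invertible in spite of its
  norm.\<close>

lemma invertible_combination:
  assumes c: "a \<in> carrier R" "b \<in> carrier R" "c \<in> carrier R" "d \<in> carrier R"
    and det: "a \<otimes> \<sigma> d \<ominus> b \<otimes> \<sigma> c = \<one>"
  shows "\<exists>x\<in>Fix. a \<oplus> b \<otimes> x \<in> Units R"
proof (rule ccontr)
  assume "\<not> ?thesis"
  hence n0: "nrm (a \<oplus> b \<otimes> x) = \<zero>" if "x \<in> Fix" for x
    using nrm_unit(1)[of "a \<oplus> b \<otimes> x"] that c by (auto simp: Fix_iff)
  have na: "nrm a = \<zero>" using n0[OF Fix_basic(1)] c by simp
  have ex: "nrm (a \<oplus> b \<otimes> x) = nrm a \<oplus> (cj a \<otimes> b \<otimes> x \<oplus> cj (cj a \<otimes> b \<otimes> x)) \<oplus> nrm (b \<otimes> x)" if x: "x \<in> carrier R" for x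
  proof -
    have cx: "cj x \<in> carrier R" "cj a \<in> carrier R" "cj b \<in> carrier R" using x c by auto
    have bx: "b \<otimes> x \<in> carrier R" using c x by simp
    have "nrm (a \<oplus> b \<otimes> x) = cj (a \<oplus> b \<otimes> x) \<otimes> (a \<oplus> b \<otimes> x)" using nrm_comm c x by simp
    also have "... = (cj a \<oplus> cj x \<otimes> cj b) \<otimes> (a \<oplus> b \<otimes> x)" using c x by (simp add: cj_add cj_mult)
    also have "... = cj a \<otimes> a \<oplus> (cj a \<otimes> b \<otimes> x \<oplus> cj x \<otimes> (cj b \<otimes> a)) \<oplus> (cj x \<otimes> cj b) \<otimes> (b \<otimes> x)"
      using cx c(1,2) x by algebra
    also have "cj x \<otimes> (cj b \<otimes> a) = cj (cj a \<otimes> b \<otimes> x)" using c x by (simp add: cj_mult)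
    also have "(cj x \<otimes> cj b) \<otimes> (b \<otimes> x) = nrm (b \<otimes> x)" using nrm_comm[OF bx] c x by (simp add: cj_mult)
    also have "cj a \<otimes> a = nrm a" by (rule nrm_comm[OF c(1)])
    finally show ?thesis .
  qed
  define y where "y = cj a \<otimes> b"
  have yc: "y \<in> carrier R" using c y_def by simp
  have ex': "(y \<otimes> x \<oplus> cj (y \<otimes> x)) \<oplus> nrm (b \<otimes> x) = \<zero>" if "x \<in> Fix" for x
    using n0[OF that] ex[of x] that na c by (simp add: Fix_iff y_def)
  have nb: "nrm b = \<zero>"
  proof -
    \<comment> \<open>The two signs of \<one> separate the trace term, which is linear, from the
      quadratic term \<open>nrm b\<close>.\<close>
    define t where "t = y \<oplus> cj y"
    have tc: "t \<in> carrier R" using yc t_def by simp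
    have 1: "t \<oplus> nrm b = \<zero>" using ex'[OF Fix_basic(2)] yc c by (simp add: t_def)
    have cm: "cj (\<ominus> y) = \<ominus> cj y" using cj_scale[of "\<ominus> \<one>" y] yc by (simp add: l_minus)
    have nm: "nrm (\<ominus> b) = nrm b" using nrm_mult[of b "\<ominus> \<one>"] c by (simp add: r_minus nrm_def[of "\<ominus> \<one>"] l_minus)
    have "(\<ominus> y \<oplus> \<ominus> cj y) \<oplus> nrm b = \<zero>"
      using ex'[OF Fix_basic(6)[OF Fix_basic(2)]] yc c by (simp add: r_minus cm nm)
    hence 2: "\<ominus> t \<oplus> nrm b = \<zero>" using yc by (simp add: t_def minus_add)
    have "nrm b \<oplus> nrm b = (t \<oplus> nrm b) \<oplus> (\<ominus> t \<oplus> nrm b)" using tc L_carrier[OF nrm_L[OF c(2)]] by algebra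
    also have "... = \<zero>" unfolding 1 2 by simp
    finally show ?thesis by (rule double_zero) (use c in auto)
  qed
  have "y \<otimes> x \<oplus> cj (y \<otimes> x) = \<zero>" if "x \<in> {\<one>, i, j}" for x
  proof -
    have x: "x \<in> Fix" using that Fix_basic by auto
    hence xc: "x \<in> carrier R" by (simp add: Fix_iff)
    have "nrm (b \<otimes> x) = \<zero>" using nrm_mult[OF c(2) xc] nb nrm_L[OF xc] by simp
    thus ?thesis using ex'[OF x] yc xc by simp
  qed
  then obtain l where l: "l \<in> L" "y = l \<otimes> k" using trace_zero_k[OF yc] by blast
  have "nrm y = \<zero>" unfolding y_def using nrm_mult[of "cj a" b] c nb by simp
  moreover have "nrm y = (l \<otimes> l) \<otimes> (A \<otimes> B)"
  proof -
    have "nrm y = (l \<otimes> k) \<otimes> (l \<otimes> \<ominus> k)" unfolding nrm_def l(2) using l(1) by (simp add: cj_scale cj_k)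
    also have "... = (l \<otimes> l) \<otimes> (k \<otimes> \<ominus> k)" using l(1) by (intro term_mult) auto
    also have "k \<otimes> \<ominus> k = A \<otimes> B" using table(5) by (simp add: r_minus)
    finally show ?thesis .
  qed
  ultimately have "(A \<otimes> B) \<otimes> (l \<otimes> l) = \<zero>" using L_comm[OF AB_nz(1), of "l \<otimes> l"] l(1) by simp
  hence "l \<otimes> l = \<zero>" using L_cancel[OF AB_nz, of "l \<otimes> l"] l(1) by simp
  hence "l = \<zero>" using L_cancel[of l l] l(1) by auto
  hence y0: "cj a \<otimes> b = \<zero>" using l(2) y_def by simp
  have "cj b \<otimes> a = \<zero>" using arg_cong[OF y0, of cj] c cj_L[OF L_closed(1)] by (simp add: cj_mult)
  moreover have "cj b \<otimes> b = \<zero>" using nrm_comm[OF c(2)] nb by simp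
  moreover have "cj b \<otimes> (a \<otimes> \<sigma> d \<ominus> b \<otimes> \<sigma> c) = (cj b \<otimes> a) \<otimes> \<sigma> d \<ominus> (cj b \<otimes> b) \<otimes> \<sigma> c"
  proof -
    have cs: "cj b \<in> carrier R" "\<sigma> d \<in> carrier R" "\<sigma> c \<in> carrier R" using c by auto
    show ?thesis using cs c(1,2) by algebra
  qed
  ultimately have "cj b = \<zero>" using det c by simp
  hence "b = \<zero>" using cj_cj[OF c(2)] cj_L[OF L_closed(1)] by simp
  hence "a \<otimes> \<sigma> d = \<one>" using det c by (simp add: a_minus_def)
  hence "nrm a \<otimes> nrm (\<sigma> d) = \<one>" using nrm_mult[of a "\<sigma> d"] c nrm_one by simp
  thus False using na c one_nz by simp
qed

text \<open>For a fixed left factor with coordinates \<open>u, v, w\<close>, the product with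
  \<open>a\<close> is fixed as soon as its \<open>k\<close> coordinate vanishes, which is one linear
  equation. The norm form cannot vanish on the whole plane of solutions, so the factor can be chosen
  to be a unit. This reduces diagonal matrices to those with fixed entries.\<close>

lemma unit_factor:
  assumes a: "a \<in> Units R"
  shows "\<exists>u\<in>Fix \<inter> Units R. u \<otimes> a \<in> Fix"
proof -
  have ac: "a \<in> carrier R" using a by (rule Units_closed)
  obtain a0 b0 c0 d0 where x: "a0 \<in> L" "b0 \<in> L" "c0 \<in> L" "d0 \<in> L" "a = q a0 b0 c0 d0" using q_exists[OF ac] .
  note cc = x(1-4)[THEN L_carrier]
  have fixI: "q a b c \<zero> \<in> Fix" if "a \<in> L" "b \<in> L" "c \<in> L" for a b c
    using that by (simp add: Fix_iff sigma_q)
  have prod_fix: "q u v w \<zero> \<otimes> a \<in> Fix" if uvw: "u \<in> L" "v \<in> L" "w \<in> L" and z: "u \<otimes> d0 \<oplus> v \<otimes> c0 \<ominus> w \<otimes> b0 = \<zero>" for u v w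
  proof -
    note uc = uvw[THEN L_carrier]
    have "(u \<otimes> d0 \<oplus> v \<otimes> c0) \<oplus> (w \<otimes> \<ominus> b0 \<oplus> \<zero> \<otimes> a0) = u \<otimes> d0 \<oplus> v \<otimes> c0 \<ominus> w \<otimes> b0"
      using uc cc by algebra
    hence e: "(u \<otimes> d0 \<oplus> v \<otimes> c0) \<oplus> (w \<otimes> \<ominus> b0 \<oplus> \<zero> \<otimes> a0) = \<zero>" using z by simp
    show ?thesis unfolding x(5) q_mult[OF uvw L_closed(1) x(1-4)] e by (rule fixI) (use uvw x(1-4) ii jj in auto)
  qed
  have nq: "nrm (q u v w \<zero>) = u \<otimes> u \<ominus> v \<otimes> v \<otimes> A \<ominus> w \<otimes> w \<otimes> B" if "u \<in> L" "v \<in> L" "w \<in> L" for u v w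
  proof -
    note uc = that[THEN L_carrier]
    have z: "(u \<otimes> \<ominus> v \<oplus> v \<otimes> u) \<oplus> (w \<otimes> \<ominus> (\<ominus> \<zero>) \<oplus> \<zero> \<otimes> \<ominus> w) \<otimes> B = \<zero>"
      "(u \<otimes> \<ominus> w \<oplus> v \<otimes> \<ominus> \<zero> \<otimes> A) \<oplus> (w \<otimes> u \<oplus> \<zero> \<otimes> \<ominus> (\<ominus> v) \<otimes> A) = \<zero>"
      "(u \<otimes> \<ominus> \<zero> \<oplus> v \<otimes> \<ominus> w) \<oplus> (w \<otimes> \<ominus> (\<ominus> v) \<oplus> \<zero> \<otimes> u) = \<zero>"
      using uc by (simp_all add: r_minus l_neg L_comm[OF that(2,1)] L_comm[OF that(3,1)] L_comm[OF that(3,2)])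
    have "nrm (q u v w \<zero>) = q ((u \<otimes> u \<oplus> v \<otimes> \<ominus> v \<otimes> A) \<oplus> (w \<otimes> \<ominus> w \<oplus> \<zero> \<otimes> \<ominus> (\<ominus> \<zero>) \<otimes> A) \<otimes> B) \<zero> \<zero> \<zero>"
      unfolding nrm_def using that by (simp only: cj_q q_mult z L_closed)
    also have "... = u \<otimes> u \<ominus> v \<otimes> v \<otimes> A \<ominus> w \<otimes> w \<otimes> B" unfolding q_def using uc ij_closed by algebra
    finally show ?thesis .
  qed
  show ?thesis
  proof (cases "d0 = \<zero>")
    case True
    have "\<one> \<otimes> a \<in> Fix" using fixI[OF x(1-3)] x(5) True ac by simp
    thus ?thesis using Fix_basic(2) by (intro bexI[of _ \<one>]) auto
  next
    case d0: False
    have "\<exists>u\<in>L. \<exists>v\<in>L. \<exists>w\<in>L. u \<otimes> d0 \<oplus> v \<otimes> c0 \<ominus> w \<otimes> b0 = \<zero> \<and> nrm (q u v w \<zero>) \<noteq> \<zero>"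
    proof (rule ccontr)
      assume "\<not> ?thesis"
      hence z: "nrm (q u v w \<zero>) = \<zero>" if "u \<in> L" "v \<in> L" "w \<in> L" "u \<otimes> d0 \<oplus> v \<otimes> c0 \<ominus> w \<otimes> b0 = \<zero>" for u v w
        using that by blast
      \<comment> \<open>Three vectors of the plane, the third being the sum of the first two. If the
        norm form vanished at all of them, so would its polar form, giving
        \<open>c0 \<otimes> b0 = \<zero>\<close>; but the first two values equate the squares of
        \<open>c0\<close> and \<open>b0\<close> with that of \<open>d0\<close> times
        \<open>A\<close> and \<open>B\<close>.\<close>
      have d1: "c0 \<otimes> d0 \<oplus> (\<ominus> d0) \<otimes> c0 \<ominus> \<zero> \<otimes> b0 = \<zero>" unfolding L_comm[OF x(3,4)] using cc by algebra
      have d2: "b0 \<otimes> d0 \<oplus> \<zero> \<otimes> c0 \<ominus> d0 \<otimes> b0 = \<zero>" unfolding L_comm[OF x(2,4)] using cc by algebra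
      have d3: "(c0 \<oplus> b0) \<otimes> d0 \<oplus> (\<ominus> d0) \<otimes> c0 \<ominus> d0 \<otimes> b0 = \<zero>"
        unfolding l_distr[OF cc(3,2,4)] L_comm[OF x(3,4)] L_comm[OF x(2,4)] using cc by algebra
      have e1: "c0 \<otimes> c0 \<ominus> (d0 \<otimes> d0) \<otimes> A = \<zero>"
        using z[OF x(3) L_closed(5)[OF x(4)] L_closed(1) d1] unfolding nq[OF x(3) L_closed(5)[OF x(4)] L_closed(1)]
        using cc by (simp add: l_minus r_minus a_minus_def)
      have e2: "b0 \<otimes> b0 \<ominus> (d0 \<otimes> d0) \<otimes> B = \<zero>"
        using z[OF x(2) L_closed(1) x(4) d2] unfolding nq[OF x(2) L_closed(1) x(4)] using cc by (simp add: a_minus_def)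
      have e3: "(c0 \<oplus> b0) \<otimes> (c0 \<oplus> b0) \<ominus> (d0 \<otimes> d0) \<otimes> A \<ominus> (d0 \<otimes> d0) \<otimes> B = \<zero>"
        using z[OF L_closed(3)[OF x(3,2)] L_closed(5)[OF x(4)] x(4) d3]
        unfolding nq[OF L_closed(3)[OF x(3,2)] L_closed(5)[OF x(4)] x(4)] using cc by (simp add: l_minus r_minus)
      have dd: "d0 \<otimes> d0 \<in> L" "d0 \<otimes> d0 \<noteq> \<zero>" using x(4) d0 L_cancel[of d0 d0] by auto
      have "(c0 \<oplus> b0) \<otimes> (c0 \<oplus> b0) \<ominus> (d0 \<otimes> d0) \<otimes> A \<ominus> (d0 \<otimes> d0) \<otimes> B =
         (c0 \<otimes> c0 \<ominus> (d0 \<otimes> d0) \<otimes> A) \<oplus> (b0 \<otimes> b0 \<ominus> (d0 \<otimes> d0) \<otimes> B) \<oplus> (c0 \<otimes> b0 \<oplus> b0 \<otimes> c0)"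
        using cc ij_closed by algebra
      hence "c0 \<otimes> b0 \<oplus> c0 \<otimes> b0 = \<zero>" unfolding e1 e2 e3 L_comm[OF x(2,3)] using cc by simp
      hence "c0 \<otimes> b0 = \<zero>" by (rule double_zero) (use cc in auto)
      then consider "c0 = \<zero>" | "b0 = \<zero>" using L_cancel[OF x(3) _ cc(2)] by blast
      thus False
      proof cases
        case 1
        hence "(d0 \<otimes> d0) \<otimes> A = \<zero>" using e1 cc by (simp add: a_minus_def)
        thus False using L_cancel[OF dd, of A] ii by simp
      next
        case 2
        hence "(d0 \<otimes> d0) \<otimes> B = \<zero>" using e2 cc by (simp add: a_minus_def)
        thus False using L_cancel[OF dd, of B] jj by simp
      qed
    qed
    then obtain u v w where u: "u \<in> L" "v \<in> L" "w \<in> L" "u \<otimes> d0 \<oplus> v \<otimes> c0 \<ominus> w \<otimes> b0 = \<zero>" "nrm (q u v w \<zero>) \<noteq> \<zero>" by blast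
    thus ?thesis using prod_fix[OF u(1-4)] fixI[OF u(1-3)] nrm_unit(1)[OF _ u(5)]
      by (intro bexI[of _ "q u v w \<zero>"]) auto
  qed
qed

end

section \<open>Adapted bases\<close>

context qalg
begin

definition pure :: "'a => bool" where "pure u \<longleftrightarrow> (\<exists>b\<in>L. \<exists>c\<in>L. \<exists>d\<in>L. u = q \<zero> b c d)"

text \<open>On pure elements this is the polar form of the quadratic form
  \<open>u \<otimes> u\<close>; orthogonality below refers to it.\<close>

abbreviation acm :: "'a => 'a => 'a" where "acm u v \<equiv> u \<otimes> v \<oplus> v \<otimes> u"

lemma pureE:
  assumes "pure u" obtains b c d where "b \<in> L" "c \<in> L" "d \<in> L" "u = q \<zero> b c d"
  using assms unfolding pure_def by blast

lemma pure_closed [simp]: "pure u ==> u \<in> carrier R" by (erule pureE) simp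

lemma pure_q: "b \<in> L ==> c \<in> L ==> d \<in> L ==> pure (q \<zero> b c d)" unfolding pure_def by blast

lemma pure_add: "pure u ==> pure v ==> pure (u \<oplus> v)" by (elim pureE) (simp add: q_add pure_q)
lemma pure_uminus: "pure u ==> pure (\<ominus> u)" by (elim pureE) (simp add: q_uminus pure_q)
lemma pure_minus: "pure u ==> pure v ==> pure (u \<ominus> v)" by (simp add: a_minus_def pure_add pure_uminus)
lemma pure_scale: "l \<in> L ==> pure u ==> pure (l \<otimes> u)" by (elim pureE) (simp add: q_scale pure_q)

lemma pure_decomposition: assumes "h \<in> carrier R" obtains t u where "t \<in> L" "pure u" "h = t \<oplus> u"
proof -
  obtain a b c d where h: "a \<in> L" "b \<in> L" "c \<in> L" "d \<in> L" "h = q a b c d" using q_exists[OF assms] .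
  have "q a b c d = a \<oplus> q \<zero> b c d" unfolding q_def using h(1-4) by (simp add: a_assoc)
  thus ?thesis using that h pure_q by blast
qed

lemma pure_L: assumes "pure u" "u \<in> L" shows "u = \<zero>"
proof -
  obtain b c d where u: "b \<in> L" "c \<in> L" "d \<in> L" "u = q \<zero> b c d" using assms pureE by blast
  have "q u \<zero> \<zero> \<zero> = q \<zero> b c d" using assms(2) u by (simp add: q_def)
  thus ?thesis using q_inject(1)[of u \<zero> \<zero> \<zero> \<zero> b c d] assms(2) u by simp
qed

lemma n_L: "l \<in> L ==> x \<in> carrier R ==> y \<in> carrier R ==> acm (l \<otimes> x) y = l \<otimes> acm x y"
  using L_left[of l y x] by (simp add: m_assoc r_distr)

lemma n_add: "x \<in> carrier R ==> y \<in> carrier R ==> z \<in> carrier R ==> acm (x \<oplus> y) z = acm x z \<oplus> acm y z"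
  by algebra

lemma n_comm: "x \<in> carrier R ==> y \<in> carrier R ==> acm x y = acm y x" by (simp add: a_comm)

lemma q_acm: assumes "b \<in> L" "c \<in> L" "d \<in> L" "v \<in> carrier R"
  shows "acm (q \<zero> b c d) v = b \<otimes> acm i v \<oplus> c \<otimes> acm j v \<oplus> d \<otimes> acm k v"
proof -
  have bi: "b \<otimes> i \<in> carrier R" "c \<otimes> j \<in> carrier R" "d \<otimes> k \<in> carrier R" using assms by auto
  have e: "q \<zero> b c d = b \<otimes> i \<oplus> c \<otimes> j \<oplus> d \<otimes> k" using bi by (simp add: q_def)
  show ?thesis unfolding e using n_add[of "b \<otimes> i \<oplus> c \<otimes> j" "d \<otimes> k" v] n_add[of "b \<otimes> i" "c \<otimes> j" v] bi assms(4)
      n_L[OF assms(1), of i v] n_L[OF assms(2), of j v] n_L[OF assms(3), of k v] by simp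
qed

lemma acm_basis: "acm i j = \<zero>" "acm i k = \<zero>" "acm j k = \<zero>" "acm j i = \<zero>" "acm k i = \<zero>" "acm k j = \<zero>"
  using anti table by (simp_all add: r_neg l_neg)

lemma k_sq: "k \<otimes> k \<in> L" unfolding table(5) using ii jj by simp

lemma pure_n: assumes "pure u" "pure v" shows "acm u v \<in> L"
proof -
  obtain b c d where u: "b \<in> L" "c \<in> L" "d \<in> L" "u = q \<zero> b c d" using assms pureE by blast
  obtain b' c' d' where v: "b' \<in> L" "c' \<in> L" "d' \<in> L" "v = q \<zero> b' c' d'" using assms pureE by blast
  have "acm x v \<in> L" if "x \<in> {i, j, k}" for x
  proof -
    have x: "x \<in> carrier R" using that by auto
    have "acm v x \<in> L" unfolding v(4) q_acm[OF v(1-3) x] using that v(1-3) k_sq ii jj by (auto simp: acm_basis)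
    thus ?thesis using n_comm[OF x pure_closed[OF assms(2)]] by simp
  qed
  thus ?thesis unfolding u(4) q_acm[OF u(1-3) pure_closed[OF assms(2)]] using u(1-3) by simp
qed

lemma L_halve: assumes x: "x \<in> carrier R" and "x \<oplus> x \<in> L" shows "x \<in> L"
proof -
  have t: "\<one> \<oplus> \<one> \<in> L" by simp
  note ti = L_inv[OF t two]
  have "inv (\<one> \<oplus> \<one>) \<otimes> (x \<oplus> x) = inv (\<one> \<oplus> \<one>) \<otimes> ((\<one> \<oplus> \<one>) \<otimes> x)" using x by (simp add: l_distr)
  also have "... = x" using ti x by (simp add: m_assoc[symmetric])
  finally show ?thesis using ti(1) assms(2) L_closed(4) by metis
qed

lemma pure_sq: assumes "pure u" shows "u \<otimes> u \<in> L"
  by (rule L_halve[OF m_closed[OF pure_closed[OF assms] pure_closed[OF assms]] pure_n[OF assms assms]])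

text \<open>For \<open>h = t \<oplus> u\<close> the mixed part of the square is
  \<open>(t \<oplus> t) \<otimes> u\<close>, a pure element that has to be scalar and hence zero.
  Purity is thus tied to squares, which every involution respects; this gives
  \<open>si_pure\<close>.\<close>

lemma pure_or_scalar: assumes h: "h \<in> carrier R" "h \<otimes> h \<in> L" shows "pure h \<or> h \<in> L"
proof -
  obtain t u where tu: "t \<in> L" "pure u" "h = t \<oplus> u" using pure_decomposition[OF h(1)] .
  note uc = pure_closed[OF tu(2)] and tc = L_carrier[OF tu(1)]
  have "(t \<oplus> t) \<otimes> u = h \<otimes> h \<ominus> (t \<otimes> t \<oplus> u \<otimes> u) \<oplus> (t \<otimes> u \<ominus> u \<otimes> t)" unfolding tu(3) using uc tc by algebra
  also have "t \<otimes> u \<ominus> u \<otimes> t = \<zero>" using central[OF tu(1) uc] uc tc by (simp add: a_minus_def r_neg)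
  also have "h \<otimes> h \<ominus> (t \<otimes> t \<oplus> u \<otimes> u) \<oplus> \<zero> \<in> L" by (intro L_closed h(2) tu(1) pure_sq[OF tu(2)])
  finally have "(t \<oplus> t) \<otimes> u \<in> L" .
  hence z: "(t \<oplus> t) \<otimes> u = \<zero>" using pure_L pure_scale[of "t \<oplus> t" u] tu by simp
  show ?thesis
  proof (cases "t = \<zero>")
    case True thus ?thesis using tu uc by simp
  next
    case False
    hence "t \<oplus> t \<noteq> \<zero>" using double_zero[of t] tc by blast
    hence "u = \<zero>" using L_cancel[of "t \<oplus> t" u] z tu uc by simp
    thus ?thesis using tu tc by simp
  qed
qed

lemma pure_basis: "pure i" "pure j" "pure k"
proof -
  have "q \<zero> \<one> \<zero> \<zero> = i" "q \<zero> \<zero> \<one> \<zero> = j" "q \<zero> \<zero> \<zero> \<one> = k" by (simp_all add: q_def)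
  thus "pure i" "pure j" "pure k" using pure_q[of \<one> \<zero> \<zero>] pure_q[of \<zero> \<one> \<zero>] pure_q[of \<zero> \<zero> \<one>] by simp_all
qed

text \<open>The vectors \<open>i\<close>, \<open>j\<close> and \<open>k\<close> are orthogonal with
  nonzero squares.\<close>

lemma pure_nondegenerate: assumes u: "pure u" and z: "!!v. pure v ==> acm u v = \<zero>" shows "u = \<zero>"
proof -
  obtain b c d where bcd: "b \<in> L" "c \<in> L" "d \<in> L" "u = q \<zero> b c d" using u pureE by blast
  note x = q_acm[OF bcd(1-3), folded bcd(4)]
  have nz: "a = \<zero>" if "a \<in> L" "a \<otimes> (y \<oplus> y) = \<zero>" "y \<in> L" "y \<noteq> \<zero>" for a y
  proof -
    have "y \<oplus> y \<noteq> \<zero>" using double_zero[of y] that by auto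
    thus ?thesis using L_cancel[of "y \<oplus> y" a] L_comm[of a "y \<oplus> y"] that by simp
  qed
  have "b \<otimes> (A \<oplus> A) = \<zero>" using x[of i] z[OF pure_basis(1)] bcd by (simp add: acm_basis)
  hence b: "b = \<zero>" using nz[OF bcd(1) _ ii] by simp
  have "c \<otimes> (B \<oplus> B) = \<zero>" using x[of j] z[OF pure_basis(2)] bcd by (simp add: acm_basis)
  hence c: "c = \<zero>" using nz[OF bcd(2) _ jj] by simp
  have kk: "k \<otimes> k \<in> L" "k \<otimes> k \<noteq> \<zero>"
  proof -
    show "k \<otimes> k \<in> L" unfolding table(5) using ii jj by simp
    show "k \<otimes> k \<noteq> \<zero>"
    proof
      assume "k \<otimes> k = \<zero>"
      hence "A \<otimes> B = \<zero>" unfolding table(5) using minus_minus[of "A \<otimes> B"] by simp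
      thus False using L_cancel[OF ii, of B] jj by auto
    qed
  qed
  have "d \<otimes> (k \<otimes> k \<oplus> k \<otimes> k) = \<zero>" using x[of k] z[OF pure_basis(3)] bcd by (simp add: acm_basis)
  hence "d = \<zero>" using nz[OF bcd(3) _ kk] by simp
  thus ?thesis using b c bcd(4) by (simp add: q_def)
qed

end

context qalg
begin

definition anticommuting :: "'a => 'a => bool" where "anticommuting x y \<longleftrightarrow> x \<in> carrier R \<and> y \<in> carrier R \<and> acm x y = \<zero>"

lemma half: assumes "l \<in> L" shows "\<exists>m\<in>L. m \<oplus> m = l"
proof -
  have t: "\<one> \<oplus> \<one> \<in> L" by simp
  note ti = L_inv[OF t two]
  have "inv (\<one> \<oplus> \<one>) \<otimes> l \<oplus> inv (\<one> \<oplus> \<one>) \<otimes> l = (inv (\<one> \<oplus> \<one>) \<otimes> (\<one> \<oplus> \<one>)) \<otimes> l"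
    using ti(1)[THEN L_carrier] L_carrier[OF assms] one_closed by algebra
  thus ?thesis using ti assms by (intro bexI[of _ "inv (\<one> \<oplus> \<one>) \<otimes> l"]) auto
qed

text \<open>A Gram-Schmidt step: \<open>c\<close> is half of \<open>acm u x\<close> divided by
  \<open>x \<otimes> x\<close>.\<close>

lemma projection:
  assumes x: "pure x" "x \<otimes> x \<noteq> \<zero>" and u: "pure u"
  shows "\<exists>c\<in>L. \<exists>w. pure w \<and> acm x w = \<zero> \<and> u = c \<otimes> x \<oplus> w"
proof -
  define e where "e = x \<otimes> x"
  have e: "e \<in> L" "e \<noteq> \<zero>" using pure_sq[OF x(1)] x(2) by (auto simp: e_def)
  note ei = L_inv[OF e]
  have "acm u x \<in> L" using pure_n u x by blast
  then obtain m where m: "m \<in> L" "m \<oplus> m = acm u x" using half by blast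
  define c where "c = inv e \<otimes> m"
  have c: "c \<in> L" unfolding c_def using ei m by simp
  define w where "w = u \<ominus> c \<otimes> x"
  have w: "pure w" unfolding w_def using pure_minus[OF u pure_scale[OF c x(1)]] .
  note cl = pure_closed[OF x(1)] pure_closed[OF u] pure_closed[OF w] L_carrier[OF c]
  have uw: "u = c \<otimes> x \<oplus> w" unfolding w_def using cl by algebra
  have "c \<otimes> e = m"
    using L_comm[OF c e(1)] ei e m unfolding c_def by (simp add: m_assoc[symmetric])
  hence "c \<otimes> (e \<oplus> e) = m \<oplus> m" using e c by (simp add: r_distr)
  moreover have "acm u x = c \<otimes> (e \<oplus> e) \<oplus> acm w x"
    unfolding uw n_add[OF m_closed[OF cl(4,1)] cl(3,1)] n_L[OF c cl(1,1)] e_def ..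
  ultimately have "acm u x = acm u x \<oplus> acm w x" using m(2) by simp
  hence "acm w x = \<zero>" using cl add.r_cancel_one'[of "acm u x" "acm w x"] by simp
  thus ?thesis using c w uw cl n_comm by metis
qed

lemma unit_cancel: assumes "x \<in> carrier R" "x \<otimes> x \<in> L" "x \<otimes> x \<noteq> \<zero>" "y \<in> carrier R" "x \<otimes> y = \<zero>" shows "y = \<zero>"
proof -
  have "(x \<otimes> x) \<otimes> y = \<zero>" using assms by (simp add: m_assoc)
  thus ?thesis using L_cancel assms by blast
qed

lemma anticommuting_pair:
  assumes x: "pure x" "x \<otimes> x \<noteq> \<zero>" and y: "pure y" "y \<otimes> y \<noteq> \<zero>" and xy: "acm x y = \<zero>"
  shows "y \<otimes> x = \<ominus> (x \<otimes> y)" "pure (x \<otimes> y)" "(x \<otimes> y) \<otimes> (x \<otimes> y) \<noteq> \<zero>" "acm x (x \<otimes> y) = \<zero>" "acm y (x \<otimes> y) = \<zero>"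
proof -
  note c = pure_closed[OF x(1)] pure_closed[OF y(1)]
  show a: "y \<otimes> x = \<ominus> (x \<otimes> y)" using xy c minus_equality[of "y \<otimes> x" "x \<otimes> y"] by (simp add: a_comm)
  show x1: "acm x (x \<otimes> y) = \<zero>"
  proof -
    have "acm x (x \<otimes> y) = x \<otimes> (acm x y)" using c by algebra
    thus ?thesis using xy c by simp
  qed
  show "acm y (x \<otimes> y) = \<zero>"
  proof -
    have "acm y (x \<otimes> y) = (acm x y) \<otimes> y" using c by algebra
    thus ?thesis using xy c by simp
  qed
  have sq: "(x \<otimes> y) \<otimes> (x \<otimes> y) = \<ominus> ((x \<otimes> x) \<otimes> (y \<otimes> y))"
  proof -
    have "(x \<otimes> y) \<otimes> (x \<otimes> y) = x \<otimes> (acm x y) \<otimes> y \<ominus> (x \<otimes> x) \<otimes> (y \<otimes> y)" using c by algebra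
    thus ?thesis using xy c by (simp add: a_minus_def)
  qed
  have l: "(x \<otimes> x) \<otimes> (y \<otimes> y) \<in> L" "x \<otimes> x \<in> L" "y \<otimes> y \<in> L" using pure_sq x y by auto
  show s: "(x \<otimes> y) \<otimes> (x \<otimes> y) \<noteq> \<zero>"
  proof
    assume "(x \<otimes> y) \<otimes> (x \<otimes> y) = \<zero>"
    hence "(x \<otimes> x) \<otimes> (y \<otimes> y) = \<zero>" unfolding sq using minus_minus[of "(x \<otimes> x) \<otimes> (y \<otimes> y)"] c by simp
    hence "y \<otimes> y = \<zero>" by (rule L_cancel[OF l(2) x(2) m_closed[OF c(2,2)]])
    thus False using y(2) by contradiction
  qed
  have "pure (x \<otimes> y) \<or> x \<otimes> y \<in> L" by (rule pure_or_scalar) (use c l sq in auto)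
  moreover have "x \<otimes> y \<notin> L"
  proof
    assume m: "x \<otimes> y \<in> L"
    have "acm x (x \<otimes> y) = (x \<otimes> y) \<otimes> (x \<oplus> x)" using central[OF m c(1)] c by (simp add: r_distr)
    hence "(x \<otimes> y) \<otimes> (x \<oplus> x) = \<zero>" using x1 by simp
    moreover have "x \<otimes> y \<noteq> \<zero>" using s c by auto
    ultimately have "x \<oplus> x = \<zero>" using L_cancel[OF m] c by simp
    thus False using double_zero[of x] c x by auto
  qed
  ultimately show "pure (x \<otimes> y)" by blast
qed

text \<open>Twice the product \<open>(x \<otimes> y) \<otimes> u\<close> is a combination of the
  three anticommutators, and \<open>x \<otimes> y\<close> can be cancelled.\<close>

lemma orthogonal_to_basis:
  assumes x: "pure x" "x \<otimes> x \<noteq> \<zero>" and y: "pure y" "y \<otimes> y \<noteq> \<zero>" and xy: "acm x y = \<zero>"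
    and u: "pure u" "acm x u = \<zero>" "acm y u = \<zero>" "acm (x \<otimes> y) u = \<zero>"
  shows "u = \<zero>"
proof -
  note c = pure_closed[OF x(1)] pure_closed[OF y(1)] pure_closed[OF u(1)]
  have "(x \<otimes> y) \<otimes> u \<oplus> (x \<otimes> y) \<otimes> u = acm (x \<otimes> y) u \<oplus> x \<otimes> acm y u \<ominus> (acm x u) \<otimes> y" using c by algebra
  hence "(x \<otimes> y) \<otimes> u \<oplus> (x \<otimes> y) \<otimes> u = \<zero>" using u c by (simp add: a_minus_def)
  hence "(x \<otimes> y) \<otimes> u = \<zero>" by (rule double_zero) (use c in simp)
  thus ?thesis
    using unit_cancel[of "x \<otimes> y" u] anticommuting_pair(2,3)[OF x y xy] pure_sq c by blast
qed

text \<open>After Gram-Schmidt steps along \<open>x\<close>, \<open>y\<close> and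
  \<open>x \<otimes> y\<close>, the remainder is orthogonal to all three and so vanishes.\<close>

lemma anticommuting_pair_spans:
  assumes x: "pure x" "x \<otimes> x \<noteq> \<zero>" and y: "pure y" "y \<otimes> y \<noteq> \<zero>" and xy: "acm x y = \<zero>" and h: "h \<in> carrier R"
  shows "\<exists>a\<in>L. \<exists>b\<in>L. \<exists>c\<in>L. \<exists>d\<in>L. h = a \<oplus> b \<otimes> x \<oplus> c \<otimes> y \<oplus> d \<otimes> (x \<otimes> y)"
proof -
  note z = anticommuting_pair[OF x y xy]
  obtain a u where u: "a \<in> L" "pure u" "h = a \<oplus> u" using pure_decomposition[OF h] .
  obtain b v where v: "b \<in> L" "pure v" "acm x v = \<zero>" "u = b \<otimes> x \<oplus> v" using projection[OF x u(2)] by blast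
  obtain c w where w: "c \<in> L" "pure w" "acm y w = \<zero>" "v = c \<otimes> y \<oplus> w" using projection[OF y v(2)] by blast
  obtain d e where e: "d \<in> L" "pure e" "acm (x \<otimes> y) e = \<zero>" "w = d \<otimes> (x \<otimes> y) \<oplus> e" using projection[OF z(2,3) w(2)] by blast
  note cl = pure_closed[OF x(1)] pure_closed[OF y(1)] pure_closed[OF v(2)] pure_closed[OF w(2)] pure_closed[OF e(2)]
  have sum: "acm p s = \<zero>" if "acm p r = \<zero>" "acm p t = \<zero>" "r = l \<otimes> t' \<oplus> s" "t = t'" "l \<in> L" "p \<in> carrier R" "t' \<in> carrier R" "s \<in> carrier R" for p r s t t' l
  proof -
    have "acm r p = l \<otimes> acm t' p \<oplus> acm s p" unfolding that(3) using n_add[of "l \<otimes> t'" s p] n_L[OF that(5), of t' p] that by simp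
    thus ?thesis using that n_comm[of p r] n_comm[of p t'] n_comm[of p s] by simp
  qed
  have xw: "acm x w = \<zero>" using sum[OF v(3) xy w(4) refl w(1)] cl by simp
  have xe: "acm x e = \<zero>" using sum[OF xw z(4) e(4) refl e(1)] cl by simp
  have ye: "acm y e = \<zero>" using sum[OF w(3) z(5) e(4) refl e(1)] cl by simp
  have "e = \<zero>" by (rule orthogonal_to_basis[OF x y xy e(2) xe ye e(3)])
  hence "h = a \<oplus> b \<otimes> x \<oplus> c \<otimes> y \<oplus> d \<otimes> (x \<otimes> y)" unfolding u(3) v(4) w(4) e(4) using cl u(1) v(1) w(1) e(1) by (simp add: a_assoc)
  thus ?thesis using u(1) v(1) w(1) e(1) by blast
qed

section \<open>Diagonalising an involution on the pure quaternions\<close>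

context
  fixes \<sigma> assumes sig: "involution R L \<sigma>"
begin

lemma si: "x \<in> carrier R ==> \<sigma> x \<in> carrier R" "x \<in> carrier R ==> y \<in> carrier R ==> \<sigma> (x \<oplus> y) = \<sigma> x \<oplus> \<sigma> y"
  "l \<in> L ==> x \<in> carrier R ==> \<sigma> (l \<otimes> x) = l \<otimes> \<sigma> x"
  "x \<in> carrier R ==> y \<in> carrier R ==> \<sigma> (x \<otimes> y) = \<sigma> y \<otimes> \<sigma> x" "x \<in> carrier R ==> \<sigma> (\<sigma> x) = x"
  using sig by (auto simp: involution_def)

lemma si_L: "l \<in> L ==> \<sigma> l = l"
proof -
  assume l: "l \<in> L"
  have "\<sigma> \<one> = \<sigma> \<one> \<otimes> \<sigma> (\<sigma> \<one>)" using si(1,5)[of \<one>] by simp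
  also have "... = \<sigma> (\<sigma> \<one> \<otimes> \<one>)" using si(4)[of "\<sigma> \<one>" \<one>] si(1)[of \<one>] si(5)[of \<one>] by simp
  also have "... = \<one>" using si(1,5)[of \<one>] by simp
  finally show ?thesis using si(3)[OF l one_closed] l by simp
qed

lemma si_uminus: "x \<in> carrier R ==> \<sigma> (\<ominus> x) = \<ominus> \<sigma> x"
  using si(3)[of "\<ominus> \<one>" x] si(1)[of x] by (simp add: l_minus)

lemma si_pure: "pure u ==> pure (\<sigma> u)"
proof -
  assume u: "pure u"
  note uc = pure_closed[OF u]
  have "\<sigma> u \<otimes> \<sigma> u \<in> L" using si(4)[OF uc uc] si_L[OF pure_sq[OF u]] pure_sq[OF u] by simp
  then consider "pure (\<sigma> u)" | "\<sigma> u \<in> L" using pure_or_scalar[OF si(1)[OF uc]] by blast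
  thus ?thesis
  proof cases
    case 2
    hence "u \<in> L" using si_L[OF 2] si(5)[OF uc] by simp
    hence "u = \<zero>" using pure_L[OF u] by blast
    thus ?thesis using u si_L[of \<zero>] by simp
  qed
qed

lemma si_n: "x \<in> carrier R ==> y \<in> carrier R ==> acm x y \<in> L ==> acm (\<sigma> x) (\<sigma> y) = acm x y"
  using si_L[of "acm x y"] si(2)[of "x \<otimes> y" "y \<otimes> x"] si(4)[of x y] si(4)[of y x] si(1)[of x] si(1)[of y] by (simp add: a_comm)

lemma sq_add: "x \<in> carrier R ==> y \<in> carrier R ==> (x \<oplus> y) \<otimes> (x \<oplus> y) = x \<otimes> x \<oplus> y \<otimes> y \<oplus> acm x y"
  by algebra

text \<open>Otherwise polarisation makes the fixed pure elements totally isotropic. As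
  \<open>\<sigma>\<close> is an isometry, \<open>acm v w\<close> for fixed \<open>v\<close> is half
  the value at \<open>w \<oplus> \<sigma> w\<close>, which is zero, so \<open>v\<close> lies in the
  radical. But \<open>u \<oplus> \<sigma> u\<close> is fixed and nonzero.\<close>

lemma fixed_anisotropic:
  assumes "\<exists>u. pure u \<and> u \<oplus> \<sigma> u \<noteq> \<zero>"
  shows "\<exists>x. pure x \<and> \<sigma> x = x \<and> x \<otimes> x \<noteq> \<zero>"
proof (rule ccontr)
  assume "\<not> ?thesis"
  hence iso: "!!x. pure x ==> \<sigma> x = x ==> x \<otimes> x = \<zero>" by blast
  have sym: "pure (w \<oplus> \<sigma> w) \<and> \<sigma> (w \<oplus> \<sigma> w) = w \<oplus> \<sigma> w" if "pure w" for w
    using pure_add[OF that si_pure[OF that]] pure_closed[OF that] si by (simp add: a_comm)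
  have orth: "acm v w = \<zero>" if v: "pure v" "\<sigma> v = v" and w: "pure w" "\<sigma> w = w" for v w
    using iso[OF v] iso[OF w] iso[OF pure_add[OF v(1) w(1)]] si(2)[of v w] sq_add[of v w] v w by simp
  have zero: "v = \<zero>" if v: "pure v" "\<sigma> v = v" for v
  proof (rule pure_nondegenerate[OF v(1)])
    fix w assume w: "pure w"
    note c = pure_closed[OF v(1)] pure_closed[OF w] si(1)[OF pure_closed[OF w]]
    have "acm v (\<sigma> w) = acm v w" using si_n[OF c(1,2) pure_n[OF v(1) w]] v(2) by simp
    moreover have "acm v (w \<oplus> \<sigma> w) = acm v w \<oplus> acm v (\<sigma> w)" using c by algebra
    moreover have "acm v (w \<oplus> \<sigma> w) = \<zero>" using orth[OF v] sym[OF w] by blast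
    ultimately have "acm v w \<oplus> acm v w = \<zero>" by simp
    thus "acm v w = \<zero>" by (rule double_zero) (use c in simp)
  qed
  show False using assms zero sym by blast
qed

text \<open>Otherwise every \<open>y\<close> orthogonal to \<open>x\<close> has square zero: twice
  \<open>y\<close> is the sum of \<open>p\<close> and \<open>m\<close>, which are isotropic
  eigenvectors orthogonal to each other. The complement of \<open>x\<close> is then totally
  isotropic, hence zero, and all pure elements are multiples of \<open>x\<close>; but
  \<open>i\<close> and \<open>j\<close> do not commute.\<close>

lemma eigenvector:
  assumes x: "pure x" "\<sigma> x = x" "x \<otimes> x \<noteq> \<zero>"
  shows "\<exists>y. pure y \<and> acm x y = \<zero> \<and> (\<sigma> y = y \<or> \<sigma> y = \<ominus> y) \<and> y \<otimes> y \<noteq> \<zero>"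
proof (rule ccontr)
  assume "\<not> ?thesis"
  hence iso: "!!y. pure y ==> acm x y = \<zero> ==> \<sigma> y = y \<or> \<sigma> y = \<ominus> y ==> y \<otimes> y = \<zero>" by blast
  note xc = pure_closed[OF x(1)]
  have nadd: "acm x (y \<oplus> z) = \<zero>" if "acm x y = \<zero>" "acm x z = \<zero>" "y \<in> carrier R" "z \<in> carrier R" for y z
  proof -
    have "acm x (y \<oplus> z) = acm x y \<oplus> acm x z" using xc that(3,4) by algebra
    thus ?thesis using that by simp
  qed
  have nneg: "acm x (\<ominus> y) = \<zero>" if "acm x y = \<zero>" "y \<in> carrier R" for y
  proof -
    have "acm x (\<ominus> y) = \<ominus> acm x y" using xc that(2) by algebra
    thus ?thesis using that by simp
  qed
  have W: "y \<otimes> y = \<zero>" if y: "pure y" "acm x y = \<zero>" for y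
  proof -
    define p where "p = y \<oplus> \<sigma> y"
    define m where "m = y \<oplus> \<ominus> \<sigma> y"
    have sy: "pure (\<sigma> y)" "acm x (\<sigma> y) = \<zero>" using si_pure[OF y(1)] si_n[of x y] pure_n[OF x(1) y(1)] x(2) xc y by auto
    note c = pure_closed[OF y(1)] pure_closed[OF sy(1)]
    have p: "pure p" "acm x p = \<zero>" "\<sigma> p = p" unfolding p_def using pure_add[OF y(1) sy(1)] nadd[OF y(2) sy(2) c] c si by (auto simp: a_comm)
    have m: "pure m" "acm x m = \<zero>" "\<sigma> m = \<ominus> m" unfolding m_def
      using pure_add[OF y(1) pure_uminus[OF sy(1)]] nadd[OF y(2) nneg[OF sy(2) c(2)]] c si by (auto simp: si_uminus minus_add a_comm)
    have pc: "p \<in> carrier R" "m \<in> carrier R" using p m by auto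
    have "acm p m = acm (\<sigma> p) (\<sigma> m)" using si_n[OF pc pure_n[OF p(1) m(1)]] by simp
    also have "... = \<ominus> acm p m" unfolding p(3) m(3) using pc by algebra
    finally have "acm p m \<oplus> acm p m = \<zero>" using pc r_neg[of "acm p m"] by simp
    hence pm: "acm p m = \<zero>" by (rule double_zero) (use pc in simp)
    have "(p \<oplus> m) \<otimes> (p \<oplus> m) = \<zero>" using sq_add[OF pc] iso[OF p(1,2)] iso[OF m(1,2)] p(3) m(3) pm by simp
    moreover have "p \<oplus> m = y \<oplus> y" unfolding p_def m_def using c by algebra
    ultimately have "(y \<oplus> y) \<otimes> (y \<oplus> y) = \<zero>" by simp
    moreover have "(y \<oplus> y) \<otimes> (y \<oplus> y) = (y \<otimes> y \<oplus> y \<otimes> y) \<oplus> (y \<otimes> y \<oplus> y \<otimes> y)" using c by algebra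
    ultimately have "y \<otimes> y \<oplus> y \<otimes> y = \<zero>" using double_zero[of "y \<otimes> y \<oplus> y \<otimes> y"] c by simp
    thus ?thesis by (rule double_zero) (use c in simp)
  qed
  have zero: "y = \<zero>" if y: "pure y" "acm x y = \<zero>" for y
  proof (rule pure_nondegenerate[OF y(1)])
    fix u assume u: "pure u"
    obtain c w where w: "c \<in> L" "pure w" "acm x w = \<zero>" "u = c \<otimes> x \<oplus> w" using projection[OF x(1,3) u] by blast
    have cl: "y \<in> carrier R" "w \<in> carrier R" using y w by auto
    have yw: "acm y w = \<zero>" using W[OF y] W[OF w(2,3)] W[OF pure_add[OF y(1) w(2)] nadd[OF y(2) w(3) cl]] sq_add[OF cl] cl by simp
    have "acm u y = c \<otimes> acm x y \<oplus> acm w y" unfolding w(4) using n_add[of "c \<otimes> x" w y] n_L[OF w(1), of x y] w(1) xc cl by simp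
    hence "acm u y = \<zero>" using y(2) yw n_comm[OF cl] w(1) by simp
    thus "acm y u = \<zero>" using n_comm[of y u] cl u by simp
  qed
  have mult: "\<exists>c\<in>L. u = c \<otimes> x" if u: "pure u" for u
  proof -
    obtain c w where w: "c \<in> L" "pure w" "acm x w = \<zero>" "u = c \<otimes> x \<oplus> w" using projection[OF x(1,3) u] by blast
    thus ?thesis using zero[OF w(2,3)] xc by auto
  qed
  obtain a b where ab: "a \<in> L" "b \<in> L" "i = a \<otimes> x" "j = b \<otimes> x" using mult pure_basis by metis
  have "j \<otimes> i = i \<otimes> j" unfolding ab(3,4) using term_mult[of a b x x] term_mult[of b a x x] L_comm ab(1,2) xc by simp
  hence "k \<oplus> k = \<zero>" using anti r_neg[of k] by simp
  hence k0: "k = \<zero>" by (rule double_zero) simp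
  have "A \<otimes> j = \<zero>" using table(1) k0 by simp
  hence "j = \<zero>" using L_cancel[OF ii] by simp
  thus False using jj by simp
qed

text \<open>If the second eigenvector \<open>y\<close> is negated by \<open>\<sigma>\<close>, the
  product \<open>x \<otimes> y\<close> is fixed and takes its place. The scalars \<open>s\<close>
  and \<open>t\<close> stay free so that the squares of the basis vectors can later be made
  integral.\<close>

theorem adapted_basis:
  assumes "\<exists>u. pure u \<and> u \<oplus> \<sigma> u \<noteq> \<zero>"
  shows "\<exists>x y. x \<in> carrier R \<and> y \<in> carrier R \<and> x \<otimes> x \<in> L \<and> y \<otimes> y \<in> L \<and>
    (\<forall>s\<in>L - {\<zero>}. \<forall>t\<in>L - {\<zero>}. quat R L (s \<otimes> x) (t \<otimes> y) \<sigma>)"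
proof -
  obtain x where x: "pure x" "\<sigma> x = x" "x \<otimes> x \<noteq> \<zero>" using fixed_anisotropic[OF assms] by blast
  obtain y where y: "pure y" "acm x y = \<zero>" "\<sigma> y = y \<or> \<sigma> y = \<ominus> y" "y \<otimes> y \<noteq> \<zero>" using eigenvector[OF x] by blast
  note xc = pure_closed[OF x(1)] and yc = pure_closed[OF y(1)]
  note z = anticommuting_pair[OF x(1,3) y(1,4,2)]
  have "\<exists>y. pure y \<and> acm x y = \<zero> \<and> \<sigma> y = y \<and> y \<otimes> y \<noteq> \<zero>"
  proof (cases "\<sigma> y = y")
    case True thus ?thesis using y by blast
  next
    case False
    hence "\<sigma> y = \<ominus> y" using y by blast
    hence "\<sigma> (x \<otimes> y) = x \<otimes> y" using si(4)[OF xc yc] x(2) z(1) xc yc by (simp add: l_minus)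
    thus ?thesis using z(2-4) by blast
  qed
  then obtain y where y: "pure y" "acm x y = \<zero>" "\<sigma> y = y" "y \<otimes> y \<noteq> \<zero>" by blast
  have sc: "pure (s \<otimes> z) \<and> (s \<otimes> z) \<otimes> (s \<otimes> z) \<noteq> \<zero>" if "s \<in> L" "s \<noteq> \<zero>" "pure z" "z \<otimes> z \<noteq> \<zero>" for s z
  proof -
    have e: "(s \<otimes> z) \<otimes> (s \<otimes> z) = s \<otimes> (s \<otimes> (z \<otimes> z))" using term_mult[of s s z z] that by (simp add: m_assoc)
    have "s \<otimes> (s \<otimes> (z \<otimes> z)) \<noteq> \<zero>" using L_cancel[OF that(1,2), of "s \<otimes> (z \<otimes> z)"] L_cancel[OF that(1,2), of "z \<otimes> z"] that by auto
    thus ?thesis unfolding e using pure_scale[OF that(1,3)] by simp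
  qed
  have "quat R L (s \<otimes> x) (t \<otimes> y) \<sigma>" if st: "s \<in> L" "s \<noteq> \<zero>" "t \<in> L" "t \<noteq> \<zero>" for s t
  proof -
    have c: "x \<in> carrier R" "y \<in> carrier R" "t \<otimes> y \<in> carrier R" using x y st by auto
    note u = conjunct1[OF sc[OF st(1,2) x(1,3)]] conjunct2[OF sc[OF st(1,2) x(1,3)]]
    note v = conjunct1[OF sc[OF st(3,4) y(1,4)]] conjunct2[OF sc[OF st(3,4) y(1,4)]]
    have "acm (s \<otimes> x) (t \<otimes> y) = s \<otimes> acm x (t \<otimes> y)" by (rule n_L[OF st(1) c(1,3)])
    also have "acm x (t \<otimes> y) = t \<otimes> acm y x" using n_comm[OF c(1,3)] n_L[OF st(3) c(2,1)] by simp
    also have "acm y x = \<zero>" using n_comm[OF c(1,2)] y(2) by simp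
    finally have uv: "acm (s \<otimes> x) (t \<otimes> y) = \<zero>" using st by simp
    have "qalg R L (s \<otimes> x) (t \<otimes> y)"
    proof (rule qalg.intro[OF ring_axioms], rule qalg_axioms.intro[OF L_subfield central])
      show "(t \<otimes> y) \<otimes> (s \<otimes> x) = \<ominus> ((s \<otimes> x) \<otimes> (t \<otimes> y))" by (rule anticommuting_pair(1)[OF u v uv])
      show "\<exists>a\<in>L. \<exists>b\<in>L. \<exists>c\<in>L. \<exists>d\<in>L. h = a \<oplus> b \<otimes> (s \<otimes> x) \<oplus> c \<otimes> (t \<otimes> y) \<oplus> d \<otimes> ((s \<otimes> x) \<otimes> (t \<otimes> y))"
        if "h \<in> carrier R" for h by (rule anticommuting_pair_spans[OF u v uv that])
      show "(s \<otimes> x) \<otimes> (s \<otimes> x) \<in> L" "(t \<otimes> y) \<otimes> (t \<otimes> y) \<in> L" by (rule pure_sq[OF u(1)], rule pure_sq[OF v(1)])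
    qed (use u v two in auto)
    moreover have "\<sigma> (s \<otimes> x) = s \<otimes> x" "\<sigma> (t \<otimes> y) = t \<otimes> y" using si(3) st c x(2) y(3) by auto
    ultimately show ?thesis using sig by (simp add: quat_def quat_axioms_def)
  qed
  thus ?thesis using pure_sq[OF x(1)] pure_sq[OF y(1)] pure_closed[OF x(1)] pure_closed[OF y(1)] by blast
qed

end

end

section \<open>The group \<open>SL\<close> over a quaternion algebra\<close>

lemma mat2_mult_assoc:
  fixes R (structure)
  assumes "ring R" "M \<in> mat2_set (carrier R)" "N \<in> mat2_set (carrier R)" "Q \<in> mat2_set (carrier R)"
  shows "mat2_mult R (mat2_mult R M N) Q = mat2_mult R M (mat2_mult R N Q)"
proof -
  interpret ring R by fact
  show ?thesis using assms(2-4)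
    by (cases M; cases N; cases Q) (simp add: mat2_set_def, intro conjI; algebra)
qed

context quat
begin

abbreviation M2 :: "'a mat2 set" where "M2 \<equiv> mat2_set (carrier R)"
abbreviation mm :: "'a mat2 => 'a mat2 => 'a mat2" (infixl "\<odot>" 70) where "M \<odot> N \<equiv> mat2_mult R M N"
abbreviation I2 :: "'a mat2" where "I2 \<equiv> (\<one>, \<zero>, \<zero>, \<one>)"

lemma M2_iff [simp]: "(a, b, c, d) \<in> mat2_set S \<longleftrightarrow> a \<in> S \<and> b \<in> S \<and> c \<in> S \<and> d \<in> S"
  by (simp add: mat2_set_def)

lemma mm_closed [simp]: "M \<in> M2 ==> N \<in> M2 ==> M \<odot> N \<in> M2"
  by (cases M; cases N) simp
lemma mm_assoc: "M \<in> M2 ==> N \<in> M2 ==> Q \<in> M2 ==> M \<odot> N \<odot> Q = M \<odot> (N \<odot> Q)"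
  by (rule mat2_mult_assoc[OF ring_axioms])
lemma mm_one [simp]: "M \<in> M2 ==> I2 \<odot> M = M" "M \<in> M2 ==> M \<odot> I2 = M"
  by (cases M, simp)+
lemma I2_M2: "I2 \<in> M2" by simp

text \<open>The formula for the inverse of a two by two matrix of determinant one, with
  \<open>\<sigma>\<close> applied to the entries.\<close>

fun star :: "'a mat2 => 'a mat2" where "star (a, b, c, d) = (\<sigma> d, \<ominus> \<sigma> b, \<ominus> \<sigma> c, \<sigma> a)"

lemma star_closed [simp]: "M \<in> M2 ==> star M \<in> M2" by (cases M) simp

lemma star_star [simp]: "M \<in> M2 ==> star (star M) = M" by (cases M) (simp add: sigma_uminus)

lemma star_mult: "M \<in> M2 ==> N \<in> M2 ==> star (M \<odot> N) = star N \<odot> star M"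
  by (cases M; cases N) (simp add: sigma_add sigma_mult l_minus r_minus minus_add a_comm)

abbreviation cnj :: "'a mat2 => 'a mat2 => 'a mat2" where "cnj g x \<equiv> g \<odot> x \<odot> star g"

abbreviation SL :: "'a mat2 set" where "SL \<equiv> carrier (SL2_inv R \<sigma>)"

text \<open>The off-diagonal entries of \<open>M \<odot> star M\<close> express the two symmetry
  conditions and the first diagonal entry the determinant condition; the last entry is the image of
  the first under \<open>\<sigma>\<close>.\<close>

lemma SL_iff: "M \<in> SL \<longleftrightarrow> M \<in> M2 \<and> M \<odot> star M = I2"
proof (cases M)
  case (fields a b c d)
  show ?thesis
  proof (cases "M \<in> M2")
    case False thus ?thesis by (auto simp: SL2_inv_def)
  next
    case True
    hence c: "a \<in> carrier R" "b \<in> carrier R" "c \<in> carrier R" "d \<in> carrier R" using fields by auto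
    have e: "\<ominus> x \<oplus> y = \<zero> \<longleftrightarrow> y = x" if "x \<in> carrier R" "y \<in> carrier R" for x y
      using that by (metis a_comm a_inv_closed l_neg minus_equality minus_minus)
    have 1: "a \<otimes> \<sigma> b \<in> Fix \<longleftrightarrow> a \<otimes> (\<ominus> \<sigma> b) \<oplus> b \<otimes> \<sigma> a = \<zero>"
      using c e[of "a \<otimes> \<sigma> b" "b \<otimes> \<sigma> a"] by (simp add: Fix_iff sigma_mult r_minus)
    have 2: "c \<otimes> \<sigma> d \<in> Fix \<longleftrightarrow> c \<otimes> \<sigma> d \<oplus> d \<otimes> (\<ominus> \<sigma> c) = \<zero>"
      using c e[of "d \<otimes> \<sigma> c" "c \<otimes> \<sigma> d"] by (auto simp: Fix_iff sigma_mult r_minus a_comm)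
    have 3: "a \<otimes> \<sigma> d \<oplus> b \<otimes> (\<ominus> \<sigma> c) = a \<otimes> \<sigma> d \<ominus> b \<otimes> \<sigma> c" using c by (simp add: r_minus a_minus_def)
    have 4: "c \<otimes> (\<ominus> \<sigma> b) \<oplus> d \<otimes> \<sigma> a = \<sigma> (a \<otimes> \<sigma> d \<ominus> b \<otimes> \<sigma> c)"
      using c by (simp add: sigma_add sigma_uminus sigma_mult r_minus a_minus_def a_comm)
    show ?thesis unfolding fields using True c
      by (auto simp add: SL2_inv_def 1 2 3 4 fields)
  qed
qed

lemma SL_M2: "M \<in> SL ==> M \<in> M2" using SL_iff by blast

lemma SL_mult: assumes "M \<in> SL" "N \<in> SL" shows "M \<odot> N \<in> SL"
proof -
  have c: "M \<in> M2" "N \<in> M2" "star M \<in> M2" "star N \<in> M2" using assms SL_M2 by auto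
  have "(M \<odot> N) \<odot> star (M \<odot> N) = M \<odot> (N \<odot> star N) \<odot> star M" using c by (simp add: star_mult mm_assoc)
  also have "... = I2" using assms c by (simp add: SL_iff)
  finally show ?thesis using c SL_iff by simp
qed

lemma SL_one: "I2 \<in> SL" by (simp add: SL_iff)

definition Up :: "'a => 'a mat2" where "Up x = (\<one>, x, \<zero>, \<one>)"
definition Lo :: "'a => 'a mat2" where "Lo x = (\<one>, \<zero>, x, \<one>)"
definition Dg :: "'a => 'a mat2" where "Dg a = (a, \<zero>, \<zero>, inv (\<sigma> a))"

lemma Fix_carrier: "x \<in> Fix ==> x \<in> carrier R" by (simp add: Fix_iff)

lemma sigma_unit:
  assumes "a \<in> Units R" shows "\<sigma> a \<in> Units R" "inv (\<sigma> a) = \<sigma> (inv a)"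
proof -
  have c: "a \<in> carrier R" "inv a \<in> carrier R" using assms Units_closed Units_inv_closed by auto
  have "\<sigma> a \<otimes> \<sigma> (inv a) = \<sigma> (inv a \<otimes> a)" "\<sigma> (inv a) \<otimes> \<sigma> a = \<sigma> (a \<otimes> inv a)"
    using sigma_mult c by auto
  hence "\<sigma> a \<otimes> \<sigma> (inv a) = \<one>" "\<sigma> (inv a) \<otimes> \<sigma> a = \<one>" using Units_l_inv[OF assms] Units_r_inv[OF assms] by auto
  thus "\<sigma> a \<in> Units R" "inv (\<sigma> a) = \<sigma> (inv a)" using unit_if[of "\<sigma> a" "\<sigma> (inv a)"] c by auto
qed

lemma inv_Fix: "a \<in> Units R ==> a \<in> Fix ==> inv a \<in> Fix"
  using sigma_unit[of a] by (simp add: Fix_iff)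

text \<open>By \<open>SL_iff\<close>, membership in \<open>SL\<close> makes \<open>star M\<close> a
  right inverse of \<open>M\<close>. For the factors of the decomposition below it is checked to be
  a left inverse too, and \<open>SL_star_left\<close> extends this to all of
  \<open>SL\<close>.\<close>

lemma elementary_two_sided:
  "x \<in> Fix ==> Up x \<in> SL \<and> star (Up x) \<odot> Up x = I2"
  "x \<in> Fix ==> Lo x \<in> SL \<and> star (Lo x) \<odot> Lo x = I2"
  "a \<in> Units R ==> Dg a \<in> SL \<and> star (Dg a) \<odot> Dg a = I2"
proof -
  show "x \<in> Fix ==> Up x \<in> SL \<and> star (Up x) \<odot> Up x = I2"
    by (simp add: SL_iff Up_def Fix_iff r_neg l_neg)
  show "x \<in> Fix ==> Lo x \<in> SL \<and> star (Lo x) \<odot> Lo x = I2"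
    by (simp add: SL_iff Lo_def Fix_iff r_neg l_neg)
  assume a: "a \<in> Units R"
  have c: "a \<in> carrier R" "inv a \<in> carrier R" "\<sigma> (inv a) \<in> carrier R" using a by auto
  have s: "\<sigma> (inv (\<sigma> a)) = inv a" using sigma_unit[OF a] c by simp
  have t: "\<sigma> a \<otimes> inv (\<sigma> a) = \<one>" "inv (\<sigma> a) \<otimes> \<sigma> a = \<one>" "inv (\<sigma> a) \<in> carrier R"
    using sigma_unit(1)[OF a] by auto
  show "Dg a \<in> SL \<and> star (Dg a) \<odot> Dg a = I2"
    using c t a by (simp add: SL_iff Dg_def s)
qed

lemma Lo_mult: "x \<in> carrier R ==> y \<in> carrier R ==> Lo x \<odot> Lo y = Lo (x \<oplus> y)" by (simp add: Lo_def)

text \<open>A column operation with the element \<open>x\<close> of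
  \<open>invertible_combination\<close> makes the upper left entry a unit, and Gaussian elimination
  does the rest. The defining relations of \<open>SL\<close> are what makes the multipliers
  \<open>y\<close> and \<open>z\<close> fixed.\<close>

theorem SL_decomposition:
  assumes "M \<in> SL"
  shows "\<exists>a\<in>Units R. \<exists>x\<in>Fix. \<exists>y\<in>Fix. \<exists>z\<in>Fix. M = Lo y \<odot> Dg a \<odot> Up z \<odot> Lo x"
proof -
  obtain a b c d where M: "M = (a, b, c, d)" by (cases M)
  have cc: "a \<in> carrier R" "b \<in> carrier R" "c \<in> carrier R" "d \<in> carrier R" using SL_M2[OF assms] M by auto
  have det: "a \<otimes> \<sigma> d \<ominus> b \<otimes> \<sigma> c = \<one>" using assms M by (simp add: SL2_inv_def)
  obtain x where x: "x \<in> Fix" "a \<oplus> b \<otimes> x \<in> Units R" using invertible_combination[OF cc det] by blast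
  note xc = Fix_carrier[OF x(1)]
  define N where "N = M \<odot> Lo x"
  have N: "N \<in> SL" unfolding N_def using SL_mult[OF assms] elementary_two_sided(2)[OF x(1)] by blast
  define a' where "a' = a \<oplus> b \<otimes> x"
  define c' where "c' = c \<oplus> d \<otimes> x"
  have Ne: "N = (a', b, c', d)" unfolding N_def M Lo_def a'_def c'_def using cc xc by simp
  have a': "a' \<in> Units R" using x a'_def by simp
  have c: "a' \<in> carrier R" "inv a' \<in> carrier R" "c' \<in> carrier R" using a' cc xc c'_def by auto
  have i1: "a' \<otimes> inv a' = \<one>" "inv a' \<otimes> a' = \<one>" using a' by auto
  have sa: "\<sigma> (inv a') \<otimes> \<sigma> a' = \<one>" "\<sigma> a' \<otimes> \<sigma> (inv a') = \<one>"
    unfolding sigma_mult[OF c(1,2), symmetric] sigma_mult[OF c(2,1), symmetric] i1 by (rule sigma_one)+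
  have sc: "\<sigma> (inv a') \<in> carrier R" "\<sigma> a' \<in> carrier R" "\<sigma> b \<in> carrier R" "\<sigma> c' \<in> carrier R" "\<sigma> d \<in> carrier R" using c cc by auto
  have f1: "a' \<otimes> \<sigma> b = b \<otimes> \<sigma> a'" and f2: "c' \<otimes> \<sigma> d = d \<otimes> \<sigma> c'" and f3: "a' \<otimes> \<sigma> d \<ominus> b \<otimes> \<sigma> c' = \<one>"
    using N Ne c cc by (auto simp: SL2_inv_def Fix_iff sigma_mult)
  define z where "z = inv a' \<otimes> b"
  define y where "y = c' \<otimes> inv a'"
  have zc: "z \<in> carrier R" "y \<in> carrier R" using c cc by (auto simp: z_def y_def)
  have z: "z \<in> Fix"
  proof -
    have "\<sigma> z = \<sigma> b \<otimes> \<sigma> (inv a')" unfolding z_def using c cc by (simp add: sigma_mult)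
    also have "... = (inv a' \<otimes> a') \<otimes> \<sigma> b \<otimes> \<sigma> (inv a')" using i1 sc by simp
    also have "... = inv a' \<otimes> (a' \<otimes> \<sigma> b) \<otimes> \<sigma> (inv a')" using c sc by (simp add: m_assoc)
    also have "... = inv a' \<otimes> b \<otimes> (\<sigma> a' \<otimes> \<sigma> (inv a'))" unfolding f1 using c sc cc by (simp add: m_assoc)
    also have "... = z" unfolding sa z_def using c cc by simp
    finally show ?thesis using zc by (simp add: Fix_iff)
  qed
  have ba: "b = a' \<otimes> z" unfolding z_def using i1 c cc by (simp add: m_assoc[symmetric])
  have ca: "c' = y \<otimes> a'" unfolding y_def using i1 c cc by (simp add: m_assoc)
  have d1: "a' \<otimes> \<sigma> d = \<one> \<oplus> b \<otimes> \<sigma> c'"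
  proof -
    have "a' \<otimes> \<sigma> d = (a' \<otimes> \<sigma> d \<ominus> b \<otimes> \<sigma> c') \<oplus> b \<otimes> \<sigma> c'" using c(1) cc(2) sc by algebra
    thus ?thesis unfolding f3 .
  qed
  \<comment> \<open>The determinant condition solved for \<open>\<sigma> d\<close>; it expresses
    \<open>d\<close> by the other entries, and the symmetry condition on the lower row then becomes
    a condition on \<open>y\<close>.\<close>
  have sd: "\<sigma> d = inv a' \<oplus> z \<otimes> \<sigma> c'"
  proof -
    have "\<sigma> d = inv a' \<otimes> (a' \<otimes> \<sigma> d)" using i1 c sc by (simp add: m_assoc[symmetric])
    thus ?thesis unfolding d1 z_def using c cc sc by (simp add: r_distr m_assoc)
  qed
  have d: "d = \<sigma> (inv a') \<oplus> c' \<otimes> z"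
  proof -
    have "d = \<sigma> (\<sigma> d)" using cc by simp
    also have "... = \<sigma> (inv a') \<oplus> \<sigma> (\<sigma> c') \<otimes> \<sigma> z" unfolding sd using c sc zc by (simp add: sigma_add sigma_mult)
    finally show ?thesis using z c by (simp add: Fix_iff)
  qed
  have y: "y \<in> Fix"
  proof -
    have l: "c' \<otimes> \<sigma> d = y \<oplus> c' \<otimes> z \<otimes> \<sigma> c'" unfolding sd y_def using c sc zc by (simp add: r_distr m_assoc)
    have r: "d \<otimes> \<sigma> c' = \<sigma> y \<oplus> c' \<otimes> z \<otimes> \<sigma> c'"
      unfolding y_def by (subst d) (use c sc zc in \<open>simp add: l_distr sigma_mult\<close>)
    have t: "c' \<otimes> z \<otimes> \<sigma> c' \<in> carrier R" using c sc zc by simp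
    have eq: "y \<oplus> c' \<otimes> z \<otimes> \<sigma> c' = \<sigma> y \<oplus> c' \<otimes> z \<otimes> \<sigma> c'" using l r f2 by simp
    have cancel: "(u \<oplus> w) \<ominus> w = u" if "u \<in> carrier R" "w \<in> carrier R" for u w using that by algebra
    have "(y \<oplus> c' \<otimes> z \<otimes> \<sigma> c') \<ominus> c' \<otimes> z \<otimes> \<sigma> c' = \<sigma> y"
      unfolding eq by (rule cancel[OF sigma_closed[OF zc(2)] t])
    hence "\<sigma> y = y" unfolding cancel[OF zc(2) t] ..
    thus ?thesis using zc by (simp add: Fix_iff)
  qed
  have Nd: "N = Lo y \<odot> Dg a' \<odot> Up z"
  proof -
    have "Lo y \<odot> Dg a' \<odot> Up z = (a', a' \<otimes> z, y \<otimes> a', y \<otimes> a' \<otimes> z \<oplus> \<sigma> (inv a'))"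
      unfolding Lo_def Dg_def Up_def sigma_unit(2)[OF a'] using c(1) zc sc(1) by simp
    also have "... = (a', b, c', c' \<otimes> z \<oplus> \<sigma> (inv a'))" by (simp only: ba[symmetric] ca[symmetric])
    also have "c' \<otimes> z \<oplus> \<sigma> (inv a') = \<sigma> (inv a') \<oplus> c' \<otimes> z" by (rule a_comm) (use c zc sc in auto)
    also have "... = d" by (rule d[symmetric])
    finally show ?thesis unfolding Ne ..
  qed
  have mx: "\<ominus> x \<in> Fix" using Fix_basic(6)[OF x(1)] .
  have "N \<odot> Lo (\<ominus> x) = M \<odot> (Lo x \<odot> Lo (\<ominus> x))"
    unfolding N_def by (rule mm_assoc) (use SL_M2[OF assms] xc in \<open>simp_all add: Lo_def\<close>)
  also have "Lo x \<odot> Lo (\<ominus> x) = I2" using xc by (simp add: Lo_mult r_neg) (simp add: Lo_def)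
  also have "M \<odot> I2 = M" using SL_M2[OF assms] by simp
  finally have "M = Lo y \<odot> Dg a' \<odot> Up z \<odot> Lo (\<ominus> x)" using Nd by simp
  thus ?thesis using a' mx y z by blast
qed

lemma two_sided_mult:
  assumes "M \<in> SL" "star M \<odot> M = I2" "N \<in> SL" "star N \<odot> N = I2"
  shows "star (M \<odot> N) \<odot> (M \<odot> N) = I2"
proof -
  have c: "M \<in> M2" "N \<in> M2" "star M \<in> M2" "star N \<in> M2" using assms SL_M2 by auto
  have "star (M \<odot> N) \<odot> (M \<odot> N) = star N \<odot> (star M \<odot> M) \<odot> N" using c by (simp add: star_mult mm_assoc)
  thus ?thesis using assms c by simp
qed

lemma SL_star_left: assumes "M \<in> SL" shows "star M \<odot> M = I2"
proof -
  obtain a x y z where d: "a \<in> Units R" "x \<in> Fix" "y \<in> Fix" "z \<in> Fix" "M = Lo y \<odot> Dg a \<odot> Up z \<odot> Lo x"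
    using SL_decomposition[OF assms] by blast
  note E = elementary_two_sided
  show ?thesis unfolding d(5)
    by (intro two_sided_mult SL_mult conjunct1[OF E(1)] conjunct1[OF E(2)] conjunct1[OF E(3)]
      conjunct2[OF E(1)] conjunct2[OF E(2)] conjunct2[OF E(3)] d(1-4))
qed

lemma SL_star: "M \<in> SL ==> star M \<in> SL"
  using SL_star_left[of M] SL_iff by simp

lemma SL_group: "group (SL2_inv R \<sigma>)"
proof (rule groupI)
  show "\<exists>y\<in>SL. y \<otimes>\<^bsub>SL2_inv R \<sigma>\<^esub> x = \<one>\<^bsub>SL2_inv R \<sigma>\<^esub>" if "x \<in> SL" for x
    using SL_star[OF that] SL_star_left[OF that] by (intro bexI[of _ "star x"]) (simp_all add: SL2_inv_def)
next
  fix x y assume "x \<in> SL" "y \<in> SL"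
  hence "x \<odot> y \<in> SL" by (rule SL_mult)
  thus "x \<otimes>\<^bsub>SL2_inv R \<sigma>\<^esub> y \<in> SL" by (simp add: SL2_inv_def)
next
  show "\<one>\<^bsub>SL2_inv R \<sigma>\<^esub> \<in> SL" using SL_one by (simp add: SL2_inv_def)
next
  fix x y z assume "x \<in> SL" "y \<in> SL" "z \<in> SL"
  hence "x \<odot> y \<odot> z = x \<odot> (y \<odot> z)" using SL_M2 by (intro mm_assoc)
  thus "x \<otimes>\<^bsub>SL2_inv R \<sigma>\<^esub> y \<otimes>\<^bsub>SL2_inv R \<sigma>\<^esub> z = x \<otimes>\<^bsub>SL2_inv R \<sigma>\<^esub> (y \<otimes>\<^bsub>SL2_inv R \<sigma>\<^esub> z)" by (simp add: SL2_inv_def)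
next
  fix x assume "x \<in> SL"
  hence "I2 \<odot> x = x" using SL_M2 by simp
  thus "\<one>\<^bsub>SL2_inv R \<sigma>\<^esub> \<otimes>\<^bsub>SL2_inv R \<sigma>\<^esub> x = x" by (simp add: SL2_inv_def)
qed

lemma SL_inv: "M \<in> SL ==> inv\<^bsub>SL2_inv R \<sigma>\<^esub> M = star M"
  by (rule group.inv_equality[OF SL_group]) (use SL_star_left SL_star in \<open>simp_all add: SL2_inv_def\<close>)

text \<open>Conjugation is a bijection of \<open>SL\<close>, so the equality of sets becomes an
  equivalence of memberships, which can be examined one prime at a time.\<close>

lemma conjugate_in_iff:
  assumes "S \<subseteq> SL" "T \<subseteq> SL"
  shows "conjugate_in (SL2_inv R \<sigma>) S T \<longleftrightarrow> (\<exists>g\<in>SL. \<forall>x\<in>SL. x \<in> S \<longleftrightarrow> g \<odot> x \<odot> star g \<in> T)"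
proof -
  have e: "(g <#\<^bsub>SL2_inv R \<sigma>\<^esub> S) #>\<^bsub>SL2_inv R \<sigma>\<^esub> inv\<^bsub>SL2_inv R \<sigma>\<^esub> g = {g \<odot> x \<odot> star g | x. x \<in> S}" if "g \<in> SL" for g
    unfolding SL_inv[OF that] l_coset_def r_coset_def by (auto simp: SL2_inv_def)
  have conj_back: "star g \<odot> (g \<odot> x \<odot> star g) \<odot> g = x" "g \<odot> (star g \<odot> x \<odot> g) \<odot> star g = x" if "g \<in> SL" "x \<in> SL" for g x
  proof -
    have c: "g \<in> M2" "x \<in> M2" "star g \<in> M2" using that SL_M2 by auto
    have gg: "star g \<odot> g = I2" "g \<odot> star g = I2" using SL_star_left[OF that(1)] that(1) SL_iff by auto
    have "star g \<odot> (g \<odot> x \<odot> star g) \<odot> g = (star g \<odot> g) \<odot> x \<odot> (star g \<odot> g)" using c by (simp add: mm_assoc)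
    thus "star g \<odot> (g \<odot> x \<odot> star g) \<odot> g = x" unfolding gg using c by simp
    have "g \<odot> (star g \<odot> x \<odot> g) \<odot> star g = (g \<odot> star g) \<odot> x \<odot> (g \<odot> star g)" using c by (simp add: mm_assoc)
    thus "g \<odot> (star g \<odot> x \<odot> g) \<odot> star g = x" unfolding gg using c by simp
  qed
  have "T = {g \<odot> x \<odot> star g | x. x \<in> S} \<longleftrightarrow> (\<forall>x\<in>SL. x \<in> S \<longleftrightarrow> g \<odot> x \<odot> star g \<in> T)" if g: "g \<in> SL" for g
  proof
    assume T: "T = {g \<odot> x \<odot> star g | x. x \<in> S}"
    show "\<forall>x\<in>SL. x \<in> S \<longleftrightarrow> g \<odot> x \<odot> star g \<in> T"
    proof (intro ballI iffI)
      fix x assume "x \<in> SL" "x \<in> S" thus "g \<odot> x \<odot> star g \<in> T" using T by blast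
    next
      fix x assume x: "x \<in> SL" "g \<odot> x \<odot> star g \<in> T"
      then obtain x' where x': "x' \<in> S" "g \<odot> x \<odot> star g = g \<odot> x' \<odot> star g" using T by blast
      hence "x = x'" using conj_back(1)[OF g x(1)] conj_back(1)[OF g, of x'] assms(1) by (metis subsetD)
      thus "x \<in> S" using x' by simp
    qed
  next
    assume a: "\<forall>x\<in>SL. x \<in> S \<longleftrightarrow> g \<odot> x \<odot> star g \<in> T"
    show "T = {g \<odot> x \<odot> star g | x. x \<in> S}"
    proof (intro equalityI subsetI)
      fix t assume t: "t \<in> T"
      hence ts: "t \<in> SL" using assms by blast
      have "star g \<odot> t \<odot> g \<in> SL" using SL_mult[OF SL_mult[OF SL_star[OF g] ts] g] .
      hence "star g \<odot> t \<odot> g \<in> S" using a conj_back(2)[OF g ts] t by simp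
      thus "t \<in> {g \<odot> x \<odot> star g | x. x \<in> S}" using conj_back(2)[OF g ts] by (intro CollectI exI[of _ "star g \<odot> t \<odot> g"]) simp
    next
      fix t assume "t \<in> {g \<odot> x \<odot> star g | x. x \<in> S}"
      thus "t \<in> T" using a assms(1) by blast
    qed
  qed
  thus ?thesis unfolding conjugate_in_def using e by auto
qed

text \<open>Upper and lower factors alternate, with a pair of entries for each step. As entries may
  be zero, every product of unipotent factors fits, and words can be padded to a common
  length.\<close>

fun word :: "('a \<times> 'a) list => 'a mat2" where
  "word [] = I2"
| "word ((x, y) # ws) = Up x \<odot> Lo y \<odot> word ws"

abbreviation FixP :: "('a \<times> 'a) list set" where "FixP \<equiv> lists (Fix \<times> Fix)"

lemma word_SL: "ws \<in> FixP ==> word ws \<in> SL"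
proof (induction ws)
  case Nil thus ?case using SL_one by simp
next
  case (Cons p ws)
  obtain x y where p: "p = (x, y)" by (cases p)
  have xy: "x \<in> Fix" "y \<in> Fix" "word ws \<in> SL" using Cons p by auto
  show ?case unfolding p word.simps
    by (intro SL_mult conjunct1[OF elementary_two_sided(1)] conjunct1[OF elementary_two_sided(2)] xy)
qed

lemma word_append: "ws \<in> FixP ==> vs \<in> FixP ==> word (ws @ vs) = word ws \<odot> word vs"
proof (induction ws)
  case Nil thus ?case using SL_M2[OF word_SL] by simp
next
  case (Cons p ws)
  obtain x y where p: "p = (x, y)" by (cases p)
  have c: "x \<in> carrier R" "y \<in> carrier R" "word ws \<in> M2" "word vs \<in> M2" "ws \<in> FixP"
    using Cons.prems p Fix_carrier SL_M2[OF word_SL] by auto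
  have "Up x \<odot> Lo y \<in> M2" using c by (simp add: Up_def Lo_def)
  thus ?case unfolding p using Cons.IH[OF c(5) Cons.prems(2)] c(3,4) by (simp add: mm_assoc)
qed

definition EL :: "'a mat2 set" where "EL = word ` FixP"

lemma EL_mult: "M \<in> EL ==> N \<in> EL ==> M \<odot> N \<in> EL"
proof -
  assume "M \<in> EL" "N \<in> EL"
  then obtain ws vs where w: "ws \<in> FixP" "M = word ws" and v: "vs \<in> FixP" "N = word vs" by (auto simp: EL_def)
  have "word (ws @ vs) \<in> EL" unfolding EL_def by (rule imageI) (use w v in auto)
  thus ?thesis unfolding w(2) v(2) word_append[OF w(1) v(1)] .
qed

lemma EL_Up: "x \<in> Fix ==> Up x \<in> EL"
proof -
  assume x: "x \<in> Fix"
  have "word [(x, \<zero>)] = Up x" using Fix_carrier[OF x] by (simp add: Up_def Lo_def)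
  moreover have "[(x, \<zero>)] \<in> FixP" using x Fix_basic(1) by simp
  ultimately show ?thesis unfolding EL_def by (metis imageI)
qed

lemma EL_Lo: "x \<in> Fix ==> Lo x \<in> EL"
proof -
  assume x: "x \<in> Fix"
  have "word [(\<zero>, x)] = Lo x" using Fix_carrier[OF x] by (simp add: Up_def Lo_def)
  moreover have "[(\<zero>, x)] \<in> FixP" using x Fix_basic(1) by simp
  ultimately show ?thesis unfolding EL_def by (metis imageI)
qed

text \<open>Whitehead's identity: the two triple products are antidiagonal, with entries
  \<open>s\<close>, \<open>\<ominus> t\<close> and \<open>\<ominus> \<one>\<close>,
  \<open>\<one>\<close>, and their product is diagonal.\<close>

lemma EL_Dg_Fix: assumes s: "s \<in> Fix" "s \<in> Units R" shows "Dg s \<in> EL"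
proof -
  define t where "t = inv s"
  have t: "t \<in> Fix" "s \<otimes> t = \<one>" "t \<otimes> s = \<one>" using inv_Fix s by (auto simp: t_def)
  have c: "s \<in> carrier R" "t \<in> carrier R" using s t Fix_carrier by auto
  have "Dg s = (s, \<zero>, \<zero>, t)" using s by (simp add: Dg_def t_def Fix_iff)
  also have "... = (Up s \<odot> Lo (\<ominus> t) \<odot> Up s) \<odot> (Up (\<ominus> \<one>) \<odot> Lo \<one> \<odot> Up (\<ominus> \<one>))"
    using c t by (simp add: Up_def Lo_def r_minus l_minus r_neg l_neg)
  also have "... \<in> EL" by (intro EL_mult EL_Up EL_Lo s t Fix_basic)
  finally show ?thesis .
qed

lemma Dg_mult: assumes "a \<in> Units R" "b \<in> Units R" shows "Dg a \<odot> Dg b = Dg (a \<otimes> b)"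
proof -
  have c: "a \<in> carrier R" "b \<in> carrier R" "inv a \<in> carrier R" "inv b \<in> carrier R" using assms by auto
  have ab: "a \<otimes> b \<in> Units R" using assms by simp
  have iab: "inv (a \<otimes> b) = inv b \<otimes> inv a"
  proof (rule unit_if(2))
    have "a \<otimes> b \<otimes> (inv b \<otimes> inv a) = a \<otimes> (b \<otimes> inv b) \<otimes> inv a" using c by (simp add: m_assoc)
    thus "a \<otimes> b \<otimes> (inv b \<otimes> inv a) = \<one>" using assms c by simp
    have "inv b \<otimes> inv a \<otimes> (a \<otimes> b) = inv b \<otimes> (inv a \<otimes> a) \<otimes> b" using c by (simp add: m_assoc)
    thus "inv b \<otimes> inv a \<otimes> (a \<otimes> b) = \<one>" using assms c by simp
  qed (use c in auto)
  show ?thesis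
    using c sigma_unit(2)[OF assms(1)] sigma_unit(2)[OF assms(2)] sigma_unit(2)[OF ab] by (simp add: Dg_def iab sigma_mult)
qed

text \<open>By \<open>unit_factor\<close>, \<open>a\<close> is a product of two fixed units.\<close>

lemma EL_Dg: assumes a: "a \<in> Units R" shows "Dg a \<in> EL"
proof -
  obtain u where u: "u \<in> Fix" "u \<in> Units R" "u \<otimes> a \<in> Fix" using unit_factor[OF a] by blast
  have ua: "u \<otimes> a \<in> Units R" using u a by simp
  have iu: "inv u \<in> Units R" using u by simp
  have c: "u \<in> carrier R" "a \<in> carrier R" "inv u \<in> carrier R" using u a by auto
  have "inv u \<otimes> (u \<otimes> a) = a" using u c by (simp add: m_assoc[symmetric])
  hence "Dg a = Dg (inv u) \<odot> Dg (u \<otimes> a)" using Dg_mult[OF iu ua] by simp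
  thus ?thesis using EL_mult[OF EL_Dg_Fix[OF inv_Fix[OF u(2,1)] iu] EL_Dg_Fix[OF u(3) ua]] by simp
qed

theorem SL_elementary: "M \<in> SL ==> \<exists>ws\<in>FixP. M = word ws"
proof -
  assume M: "M \<in> SL"
  obtain a x y z where d: "a \<in> Units R" "x \<in> Fix" "y \<in> Fix" "z \<in> Fix" "M = Lo y \<odot> Dg a \<odot> Up z \<odot> Lo x"
    using SL_decomposition[OF M] by blast
  have "M \<in> EL" unfolding d(5) by (intro EL_mult EL_Up EL_Lo EL_Dg d)
  thus ?thesis by (auto simp: EL_def)
qed

end

section \<open>Topology on a quaternion algebra\<close>

text \<open>The filtration \<open>D\<close> stands for \<open>val_ge\<close> on \<open>K\<close> as
  well as for the image of \<open>BB\<close> in the completed algebra, so that continuity is proved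
  once for both. Integrality of the squares in \<open>D_AB\<close> makes the coordinatewise
  filtration \<open>UU\<close> compatible with products.\<close>

locale vquat = quat +
  fixes D :: "nat => 'a set"
  assumes D_L: "D n \<subseteq> L"
    and D_zero: "\<zero> \<in> D n"
    and D_add: "x \<in> D n ==> y \<in> D n ==> x \<oplus> y \<in> D n"
    and D_uminus: "x \<in> D n ==> \<ominus> x \<in> D n"
    and D_mono: "m \<le> n ==> x \<in> D n ==> x \<in> D m"
    and D_mult: "x \<in> D m ==> y \<in> D n ==> x \<otimes> y \<in> D (m + n)"
    and D_one: "\<one> \<in> D 0"
    and D_scale: "l \<in> L ==> \<exists>c. \<forall>n. \<forall>x\<in>D (n + c). l \<otimes> x \<in> D n"
    and D_unit: "d \<in> D 1 ==> \<one> \<oplus> d \<noteq> \<zero> \<and> inv (\<one> \<oplus> d) \<in> D 0"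
    and D_AB: "i \<otimes> i \<in> D 0" "j \<otimes> j \<in> D 0"
begin

definition UU :: "nat => 'a set" where "UU n = {q a b c d | a b c d. a \<in> D n \<and> b \<in> D n \<and> c \<in> D n \<and> d \<in> D n}"

lemma D_in_L: "x \<in> D n ==> x \<in> L" using D_L by blast

lemma UU_I: "a \<in> D n ==> b \<in> D n ==> c \<in> D n ==> d \<in> D n ==> q a b c d \<in> UU n" unfolding UU_def by blast

lemma UU_E:
  assumes "x \<in> UU n"
  obtains a b c d where "a \<in> D n" "b \<in> D n" "c \<in> D n" "d \<in> D n" "x = q a b c d"
    "a \<in> L" "b \<in> L" "c \<in> L" "d \<in> L"
  using assms D_in_L unfolding UU_def by blast

lemma UU_carrier: "x \<in> UU n ==> x \<in> carrier R" by (erule UU_E) simp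

lemma q_in_UU: "a \<in> L ==> b \<in> L ==> c \<in> L ==> d \<in> L ==> q a b c d \<in> UU n \<longleftrightarrow> a \<in> D n \<and> b \<in> D n \<and> c \<in> D n \<and> d \<in> D n"
proof
  assume l: "a \<in> L" "b \<in> L" "c \<in> L" "d \<in> L" and "q a b c d \<in> UU n"
  then obtain a' b' c' d' where h: "a' \<in> D n" "b' \<in> D n" "c' \<in> D n" "d' \<in> D n" "q a b c d = q a' b' c' d'"
    "a' \<in> L" "b' \<in> L" "c' \<in> L" "d' \<in> L" by (elim UU_E)
  thus "a \<in> D n \<and> b \<in> D n \<and> c \<in> D n \<and> d \<in> D n" using q_inject[OF l h(6-9,5)] by simp
qed (auto intro: UU_I)

lemma UU_zero: "\<zero> \<in> UU n"
  using UU_I[OF D_zero D_zero D_zero D_zero] by (simp add: q_def)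

lemma UU_add: "x \<in> UU n ==> y \<in> UU n ==> x \<oplus> y \<in> UU n"
  by (elim UU_E) (simp add: q_add UU_I D_add)

lemma UU_uminus: "x \<in> UU n ==> \<ominus> x \<in> UU n"
  by (elim UU_E) (simp add: q_uminus UU_I D_uminus)

lemma UU_mono: "m \<le> n ==> x \<in> UU n ==> x \<in> UU m"
  by (elim UU_E) (simp add: UU_I D_mono)

lemma D_mult0: "x \<in> D n ==> y \<in> D 0 ==> x \<otimes> y \<in> D n" using D_mult[of x n y 0] by simp

lemma UU_mult: "x \<in> UU m ==> y \<in> UU n ==> x \<otimes> y \<in> UU (m + n)"
proof -
  assume "x \<in> UU m" "y \<in> UU n"
  then obtain a b c d a' b' c' d' where x: "a \<in> D m" "b \<in> D m" "c \<in> D m" "d \<in> D m" "x = q a b c d"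
      "a \<in> L" "b \<in> L" "c \<in> L" "d \<in> L" and
    y: "a' \<in> D n" "b' \<in> D n" "c' \<in> D n" "d' \<in> D n" "y = q a' b' c' d'"
      "a' \<in> L" "b' \<in> L" "c' \<in> L" "d' \<in> L" by (elim UU_E)
  show ?thesis unfolding x(5) y(5) q_mult[OF x(6-9) y(6-9)]
    by (intro UU_I D_add D_mult0[OF _ D_AB(1)] D_mult0[OF _ D_AB(2)] D_mult D_uminus x(1-4) y(1-4))
qed

lemma UU_sigma: "x \<in> UU n ==> \<sigma> x \<in> UU n"
  by (elim UU_E) (simp add: sigma_q UU_I D_uminus)

lemma UU_cj: "x \<in> UU n ==> cj x \<in> UU n"
  by (elim UU_E) (simp add: cj_q UU_I D_uminus)

lemma D_UU: "x \<in> L ==> x \<in> UU n \<longleftrightarrow> x \<in> D n"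
  using q_in_UU[of x \<zero> \<zero> \<zero> n] D_zero by (simp add: q_def)

lemma UU_basis: "\<one> \<in> UU 0" "i \<in> UU 0" "j \<in> UU 0" "i \<otimes> j \<in> UU 0"
proof -
  have "q \<one> \<zero> \<zero> \<zero> \<in> UU 0" "q \<zero> \<one> \<zero> \<zero> \<in> UU 0" "q \<zero> \<zero> \<one> \<zero> \<in> UU 0" "q \<zero> \<zero> \<zero> \<one> \<in> UU 0"
    by (intro UU_I D_zero D_one)+
  thus "\<one> \<in> UU 0" "i \<in> UU 0" "j \<in> UU 0" "i \<otimes> j \<in> UU 0" by (simp_all add: q_def)
qed

lemma UU_scale: assumes "x \<in> carrier R"
  shows "\<exists>c. \<forall>n. \<forall>y\<in>UU (n + c). x \<otimes> y \<in> UU n \<and> y \<otimes> x \<in> UU n"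
proof -
  obtain a b c d where x: "a \<in> L" "b \<in> L" "c \<in> L" "d \<in> L" "x = q a b c d" using q_exists[OF assms] .
  note cc = x(1-4)[THEN L_carrier]
  have ex: "\<exists>e. \<forall>n. \<forall>y\<in>UU (n + e). l \<otimes> y \<in> UU n" if l: "l \<in> L" for l
  proof -
    obtain e where e: "!!n x. x \<in> D (n + e) ==> l \<otimes> x \<in> D n" using D_scale[OF l] by blast
    have "l \<otimes> y \<in> UU n" if "y \<in> UU (n + e)" for y n
      using that by (elim UU_E) (simp add: q_scale l UU_I e)
    thus ?thesis by blast
  qed
  obtain ea where ea: "!!n y. y \<in> UU (n + ea) ==> a \<otimes> y \<in> UU n" using ex[OF x(1)] by blast
  obtain eb where eb: "!!n y. y \<in> UU (n + eb) ==> b \<otimes> y \<in> UU n" using ex[OF x(2)] by blast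
  obtain ec where ec: "!!n y. y \<in> UU (n + ec) ==> c \<otimes> y \<in> UU n" using ex[OF x(3)] by blast
  obtain ed where ed: "!!n y. y \<in> UU (n + ed) ==> d \<otimes> y \<in> UU n" using ex[OF x(4)] by blast
  have "x \<otimes> y \<in> UU n \<and> y \<otimes> x \<in> UU n" if y: "y \<in> UU (n + (ea + eb + ec + ed))" for y n
  proof -
    have yc: "y \<in> carrier R" using UU_carrier[OF y] .
    have m: "y' \<in> UU (n + ea)" "y' \<in> UU (n + eb)" "y' \<in> UU (n + ec)" "y' \<in> UU (n + ed)"
      if "y' \<in> UU (n + (ea + eb + ec + ed))" for y'
      using UU_mono[OF _ that] by auto
    have l: "e \<otimes> y \<in> UU (n + (ea + eb + ec + ed))" "y \<otimes> e \<in> UU (n + (ea + eb + ec + ed))" if "e \<in> UU 0" for e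
      using UU_mult[OF that y] UU_mult[OF y that] by auto
    have xy: "x \<otimes> y = a \<otimes> y \<oplus> b \<otimes> (i \<otimes> y) \<oplus> c \<otimes> (j \<otimes> y) \<oplus> d \<otimes> ((i \<otimes> j) \<otimes> y)"
      unfolding x(5) q_def using cc yc ij_closed by algebra
    have "y \<otimes> x = y \<otimes> a \<oplus> y \<otimes> (b \<otimes> i) \<oplus> y \<otimes> (c \<otimes> j) \<oplus> y \<otimes> (d \<otimes> (i \<otimes> j))"
      unfolding x(5) q_def using cc yc ij_closed by algebra
    also have "... = a \<otimes> y \<oplus> b \<otimes> (y \<otimes> i) \<oplus> c \<otimes> (y \<otimes> j) \<oplus> d \<otimes> (y \<otimes> (i \<otimes> j))"
      using central[OF x(1) yc] by (simp only: L_left[OF x(2) yc] L_left[OF x(3) yc] L_left[OF x(4) yc] ij_closed m_closed)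
    finally have yx: "y \<otimes> x = a \<otimes> y \<oplus> b \<otimes> (y \<otimes> i) \<oplus> c \<otimes> (y \<otimes> j) \<oplus> d \<otimes> (y \<otimes> (i \<otimes> j))" .
    show ?thesis unfolding xy yx
      by (intro conjI UU_add ea eb ec ed m(1) m(2) m(3) m(4) l UU_basis y)
  qed
  thus ?thesis by blast
qed

definition near :: "nat => 'a => 'a => bool" where
  "near n x' x \<longleftrightarrow> x' \<in> carrier R \<and> x \<in> carrier R \<and> x' \<ominus> x \<in> UU n"

lemma near_refl: "x \<in> carrier R ==> near n x x" using UU_zero by (simp add: near_def a_minus_def r_neg)
lemma near_mono: "m \<le> n ==> near n x' x ==> near m x' x" by (auto simp: near_def intro: UU_mono)
lemma near_add: assumes "near n x' x" "near n y' y" shows "near n (x' \<oplus> y') (x \<oplus> y)"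
proof -
  have c: "x' \<in> carrier R" "x \<in> carrier R" "y' \<in> carrier R" "y \<in> carrier R" using assms by (auto simp: near_def)
  have "(x' \<oplus> y') \<ominus> (x \<oplus> y) = (x' \<ominus> x) \<oplus> (y' \<ominus> y)" using c by algebra
  thus ?thesis using assms c UU_add by (simp add: near_def)
qed
lemma near_sigma: assumes "near n x' x" shows "near n (\<sigma> x') (\<sigma> x)"
  using assms UU_sigma[of "x' \<ominus> x" n] by (simp add: near_def sigma_minus)
lemma near_sym: assumes "near n x' x" shows "near n x x'"
proof -
  have c: "x' \<in> carrier R" "x \<in> carrier R" using assms by (auto simp: near_def)
  have "x \<ominus> x' = \<ominus> (x' \<ominus> x)" using c by algebra
  thus ?thesis using assms c UU_uminus by (simp add: near_def)
qed
lemma near_trans: assumes "near n x' x" "near n x y" shows "near n x' y"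
proof -
  have c: "x' \<in> carrier R" "x \<in> carrier R" "y \<in> carrier R" using assms by (auto simp: near_def)
  have "x' \<ominus> y = (x' \<ominus> x) \<oplus> (x \<ominus> y)" using c by algebra
  thus ?thesis using assms c UU_add by (simp add: near_def)
qed

lemma near_mult:
  assumes "x \<in> carrier R" "y \<in> carrier R"
  shows "\<exists>m. \<forall>x' y'. near m x' x --> near m y' y --> near n (x' \<otimes> y') (x \<otimes> y)"
proof -
  obtain c where c: "!!n z. z \<in> UU (n + c) ==> x \<otimes> z \<in> UU n" using UU_scale[OF assms(1)] by blast
  obtain d where d: "!!n z. z \<in> UU (n + d) ==> z \<otimes> y \<in> UU n" using UU_scale[OF assms(2)] by blast
  have "near n (x' \<otimes> y') (x \<otimes> y)" if h: "near (n + (c + d)) x' x" "near (n + (c + d)) y' y" for x' y'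
  proof -
    have cr: "x' \<in> carrier R" "y' \<in> carrier R" using h by (auto simp: near_def)
    have u: "x' \<ominus> x \<in> UU (n + (c + d))" "y' \<ominus> y \<in> UU (n + (c + d))" using h by (auto simp: near_def)
    have e: "x' \<otimes> y' \<ominus> x \<otimes> y = (x' \<ominus> x) \<otimes> (y' \<ominus> y) \<oplus> (x' \<ominus> x) \<otimes> y \<oplus> x \<otimes> (y' \<ominus> y)" using cr assms by algebra
    have "(x' \<ominus> x) \<otimes> (y' \<ominus> y) \<in> UU n" using UU_mono[OF _ UU_mult[OF u]] by simp
    moreover have "(x' \<ominus> x) \<otimes> y \<in> UU n" using d UU_mono[OF _ u(1), of "n + d"] by simp
    moreover have "x \<otimes> (y' \<ominus> y) \<in> UU n" using c UU_mono[OF _ u(2), of "n + c"] by simp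
    ultimately show ?thesis using e cr assms UU_add by (simp add: near_def)
  qed
  thus ?thesis by blast
qed

text \<open>Write \<open>a' = a \<otimes> (\<one> \<oplus> e)\<close>. The norm of
  \<open>\<one> \<oplus> e\<close> is \<one> plus a small scalar, so it has an integral inverse by
  \<open>D_unit\<close>. Hence the inverse of \<open>\<one> \<oplus> e\<close> is integral and
  differs from \<one> by a multiple of \<open>e\<close>.\<close>

lemma near_inv:
  assumes a: "a \<in> Units R"
  shows "\<exists>m. \<forall>a'. near m a' a --> a' \<in> Units R \<and> near n (inv a') (inv a)"
proof -
  have ac: "a \<in> carrier R" "inv a \<in> carrier R" "inv a \<otimes> a = \<one>" "a \<otimes> inv a = \<one>" using a by auto
  obtain c where c: "!!n z. z \<in> UU (n + c) ==> inv a \<otimes> z \<in> UU n \<and> z \<otimes> inv a \<in> UU n" using UU_scale[OF ac(2)] by blast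
  \<comment> \<open>One \<open>c\<close> is lost in forming
    \<open>inv a \<otimes> (a' \<ominus> a)\<close>, the other in multiplying by
    \<open>inv a\<close> at the end; the \<open>Suc\<close> places the error of the norm in
    \<open>D 1\<close>.\<close>
  have "a' \<in> Units R \<and> near n (inv a') (inv a)" if h: "near (Suc (n + c) + c) a' a" for a'
  proof -
    define N where "N = Suc (n + c)"
    have a'c: "a' \<in> carrier R" using h by (simp add: near_def)
    define e where "e = inv a \<otimes> (a' \<ominus> a)"
    have e: "e \<in> UU N" unfolding e_def N_def using c h by (simp add: near_def)
    hence ec: "e \<in> carrier R" using UU_carrier by blast
    have a'e: "a' = a \<otimes> (\<one> \<oplus> e)"
    proof -
      have "a \<otimes> (\<one> \<oplus> e) = a \<oplus> a \<otimes> e" using ac(1) ec by (simp add: r_distr)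
      also have "... = a \<oplus> (a \<otimes> inv a) \<otimes> (a' \<ominus> a)" unfolding e_def using ac(1,2) a'c by algebra
      also have "... = a'" unfolding ac using ac(1) a'c by algebra
      finally show ?thesis ..
    qed
    define v where "v = nrm (\<one> \<oplus> e)"
    have vL: "v \<in> L" unfolding v_def using ec by simp
    have ce: "cj e \<in> UU N" using UU_cj[OF e] .
    have "v = \<one> \<oplus> (e \<oplus> cj e \<oplus> e \<otimes> cj e)"
    proof -
      have "v = (\<one> \<oplus> e) \<otimes> (\<one> \<oplus> cj e)" unfolding v_def nrm_def using ec cj_L[OF L_closed(2)] by (simp add: cj_add)
      also have "... = \<one> \<oplus> (e \<oplus> cj e \<oplus> e \<otimes> cj e)"
        using ec cj_closed[OF ec] by (simp add: l_distr r_distr a_ac)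
      finally show ?thesis .
    qed
    define t where "t = e \<oplus> cj e \<oplus> e \<otimes> cj e"
    have tU: "t \<in> UU N" unfolding t_def using UU_add[OF UU_add[OF e ce]] UU_mono[OF _ UU_mult[OF e ce]] by simp
    have tc: "t \<in> carrier R" using tU UU_carrier by blast
    have vt: "v = \<one> \<oplus> t" using \<open>v = _ \<oplus> _\<close> t_def by simp
    have "t = v \<ominus> \<one>" unfolding vt using tc by algebra
    hence "t \<in> L" using vL by simp
    hence "t \<in> D N" using D_UU tU by blast
    hence "t \<in> D 1" using D_mono[of 1 N] by (simp add: N_def)
    hence v: "v \<noteq> \<zero>" "inv v \<in> D 0" using D_unit vt by auto
    have c1: "\<one> \<oplus> e \<in> carrier R" using ec by simp
    note iv = nrm_unit[OF c1, folded v_def, OF v(1)]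
    define h where "h = inv (\<one> \<oplus> e)"
    have h1: "(\<one> \<oplus> e) \<otimes> h = \<one>" "h \<otimes> (\<one> \<oplus> e) = \<one>" "h \<in> carrier R" using iv(1) by (auto simp: h_def)
    have "inv v \<in> UU 0" using v(2) D_UU D_in_L by blast
    moreover have "cj (\<one> \<oplus> e) \<in> UU 0" using UU_cj[OF UU_add[OF UU_basis(1) UU_mono[OF _ e]]] by simp
    ultimately have h0: "h \<in> UU 0" unfolding h_def iv(2) using UU_mult[of "inv v" 0 _ 0] by simp
    have "h \<ominus> \<one> = h \<ominus> (\<one> \<oplus> e) \<otimes> h" unfolding h1 ..
    also have "... = \<ominus> (e \<otimes> h)" using h1(3) ec by algebra
    finally have h2: "h \<ominus> \<one> \<in> UU N" using UU_uminus[OF UU_mult[OF e h0]] by simp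
    have i1: "a' \<otimes> (h \<otimes> inv a) = \<one>"
    proof -
      have "a' \<otimes> (h \<otimes> inv a) = a \<otimes> ((\<one> \<oplus> e) \<otimes> h) \<otimes> inv a" unfolding a'e using ac(1,2) h1(3) c1 by (simp add: m_assoc)
      thus ?thesis unfolding h1 using ac by simp
    qed
    have i2: "(h \<otimes> inv a) \<otimes> a' = \<one>"
    proof -
      have "(h \<otimes> inv a) \<otimes> a' = h \<otimes> (inv a \<otimes> a) \<otimes> (\<one> \<oplus> e)" unfolding a'e using ac(1,2) h1(3) c1 by (simp add: m_assoc)
      thus ?thesis unfolding ac using h1 by simp
    qed
    have u: "a' \<in> Units R" "inv a' = h \<otimes> inv a" using unit_if[OF a'c _ i1 i2] h1 ac by auto
    have "inv a' \<ominus> inv a = (h \<ominus> \<one>) \<otimes> inv a" unfolding u(2) using h1(3) ac(2) by algebra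
    moreover have "(h \<ominus> \<one>) \<otimes> inv a \<in> UU (Suc n)" using c[of "h \<ominus> \<one>" "Suc n"] h2 N_def by simp
    ultimately have "inv a' \<ominus> inv a \<in> UU n" using UU_mono[of n "Suc n"] by simp
    thus ?thesis using u ac h1 by (simp add: near_def)
  qed
  thus ?thesis by blast
qed

fun mnear :: "nat => 'a mat2 => 'a mat2 => bool" where
  "mnear n (a', b', c', d') (a, b, c, d) \<longleftrightarrow> near n a' a \<and> near n b' b \<and> near n c' c \<and> near n d' d"

lemma mnear_mono: "m \<le> n ==> mnear n M' M ==> mnear m M' M"
  by (cases M; cases M') (auto intro: near_mono)
lemma mnear_refl: "M \<in> M2 ==> mnear n M M" by (cases M) (auto intro: near_refl)
lemma mnear_sym: "mnear n M' M ==> mnear n M M'" by (cases M; cases M') (auto intro: near_sym)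
lemma mnear_trans: "mnear n M' M ==> mnear n M N ==> mnear n M' N"
  by (cases M; cases M'; cases N) (auto intro: near_trans)
lemma near_mult_add:
  assumes "x \<in> carrier R" "y \<in> carrier R" "z \<in> carrier R" "w \<in> carrier R"
  shows "\<exists>m. \<forall>x' y' z' w'. near m x' x --> near m y' y --> near m z' z --> near m w' w -->
    near n (x' \<otimes> y' \<oplus> z' \<otimes> w') (x \<otimes> y \<oplus> z \<otimes> w)"
proof -
  obtain m where m: "!!x' y'. near m x' x ==> near m y' y ==> near n (x' \<otimes> y') (x \<otimes> y)"
    using near_mult[OF assms(1,2)] by blast
  obtain k where k: "!!x' y'. near k x' z ==> near k y' w ==> near n (x' \<otimes> y') (z \<otimes> w)"
    using near_mult[OF assms(3,4)] by blast
  have "near n (x' \<otimes> y' \<oplus> z' \<otimes> w') (x \<otimes> y \<oplus> z \<otimes> w)"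
    if "near (max m k) x' x" "near (max m k) y' y" "near (max m k) z' z" "near (max m k) w' w" for x' y' z' w'
    by (intro near_add m k) (use that near_mono[of m "max m k"] near_mono[of k "max m k"] in auto)
  thus ?thesis by blast
qed

lemma mnear_mult:
  assumes "M \<in> M2" "N \<in> M2"
  shows "\<exists>m. \<forall>M' N'. mnear m M' M --> mnear m N' N --> mnear n (M' \<odot> N') (M \<odot> N)"
proof -
  obtain a b c d a' b' c' d' where M: "M = (a, b, c, d)" "N = (a', b', c', d')" by (cases M; cases N) blast
  have cc: "a \<in> carrier R" "b \<in> carrier R" "c \<in> carrier R" "d \<in> carrier R" "a' \<in> carrier R" "b' \<in> carrier R" "c' \<in> carrier R" "d' \<in> carrier R"
    using assms M by auto
  obtain m1 where m1: "!!x y z w. near m1 x a ==> near m1 y a' ==> near m1 z b ==> near m1 w c' ==> near n (x \<otimes> y \<oplus> z \<otimes> w) (a \<otimes> a' \<oplus> b \<otimes> c')"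
    using near_mult_add[OF cc(1,5,2,7)] by blast
  obtain m2 where m2: "!!x y z w. near m2 x a ==> near m2 y b' ==> near m2 z b ==> near m2 w d' ==> near n (x \<otimes> y \<oplus> z \<otimes> w) (a \<otimes> b' \<oplus> b \<otimes> d')"
    using near_mult_add[OF cc(1,6,2,8)] by blast
  obtain m3 where m3: "!!x y z w. near m3 x c ==> near m3 y a' ==> near m3 z d ==> near m3 w c' ==> near n (x \<otimes> y \<oplus> z \<otimes> w) (c \<otimes> a' \<oplus> d \<otimes> c')"
    using near_mult_add[OF cc(3,5,4,7)] by blast
  obtain m4 where m4: "!!x y z w. near m4 x c ==> near m4 y b' ==> near m4 z d ==> near m4 w d' ==> near n (x \<otimes> y \<oplus> z \<otimes> w) (c \<otimes> b' \<oplus> d \<otimes> d')"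
    using near_mult_add[OF cc(3,6,4,8)] by blast
  define m where "m = m1 + m2 + m3 + m4"
  have "mnear n (M' \<odot> N') (M \<odot> N)" if h: "mnear m M' M" "mnear m N' N" for M' N'
  proof -
    obtain x y z w x' y' z' w' where M': "M' = (x, y, z, w)" "N' = (x', y', z', w')" by (cases M'; cases N') blast
    have l: "m1 \<le> m" "m2 \<le> m" "m3 \<le> m" "m4 \<le> m" by (auto simp: m_def)
    have nr: "near m x a" "near m y b" "near m z c" "near m w d" "near m x' a'" "near m y' b'" "near m z' c'" "near m w' d'"
      using h M M' by auto
    show ?thesis unfolding M M' mat2_mult.simps mnear.simps
      by (intro conjI m1 m2 m3 m4; (rule near_mono[OF l(1)] near_mono[OF l(2)] near_mono[OF l(3)] near_mono[OF l(4)])?; rule nr)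
  qed
  thus ?thesis by blast
qed

lemma mnear_Up: "near n x' x ==> mnear n (Up x') (Up x)"
  and mnear_Lo: "near n x' x ==> mnear n (Lo x') (Lo x)"
  by (auto simp: Up_def Lo_def intro: near_refl)

lemma mnear_Dg:
  assumes a: "a \<in> Units R"
  shows "\<exists>m. \<forall>a'. near m a' a --> a' \<in> Units R \<and> mnear n (Dg a') (Dg a)"
proof -
  obtain m where m: "!!a'. near m a' a ==> a' \<in> Units R \<and> near n (inv a') (inv a)" using near_inv[OF a] by blast
  have "a' \<in> Units R \<and> mnear n (Dg a') (Dg a)" if h: "near (max m n) a' a" for a'
  proof -
    have a': "a' \<in> Units R" "near n (inv a') (inv a)" using m near_mono[OF _ h, of m] by auto
    have "near n (inv (\<sigma> a')) (inv (\<sigma> a))" unfolding sigma_unit(2)[OF a] sigma_unit(2)[OF a'(1)] by (rule near_sigma[OF a'(2)])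
    thus ?thesis using a' near_mono[OF _ h, of n] near_refl[of \<zero>] by (simp add: Dg_def)
  qed
  thus ?thesis by blast
qed

text \<open>\<open>list_all2\<close> fixes the length of the word, so finitely many uses of
  \<open>mnear_mult\<close> suffice.\<close>

lemma word_near:
  assumes "ws \<in> FixP"
  shows "\<exists>m. \<forall>ws'. list_all2 (%p' p. near m (fst p') (fst p) \<and> near m (snd p') (snd p)) ws' ws --> mnear n (word ws') (word ws)"
  using assms
proof (induction ws arbitrary: n rule: list.induct)
  case Nil thus ?case using mnear_refl[OF I2_M2] by auto
next
  case (Cons p ws)
  obtain x y where p: "p = (x, y)" by (cases p)
  have c: "x \<in> carrier R" "y \<in> carrier R" "ws \<in> FixP" using Cons.prems p Fix_carrier by auto
  have w: "word ws \<in> M2" using SL_M2[OF word_SL[OF c(3)]] .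
  have ul: "Up x \<in> M2" "Lo y \<in> M2" using c by (auto simp: Up_def Lo_def)
  obtain m1 where m1: "!!M' N'. mnear m1 M' (Up x \<odot> Lo y) ==> mnear m1 N' (word ws) ==> mnear n (M' \<odot> N') (Up x \<odot> Lo y \<odot> word ws)"
    using mnear_mult[OF mm_closed[OF ul] w] by blast
  obtain m2 where m2: "!!M' N'. mnear m2 M' (Up x) ==> mnear m2 N' (Lo y) ==> mnear m1 (M' \<odot> N') (Up x \<odot> Lo y)"
    using mnear_mult[OF ul] by blast
  obtain m3 where m3: "!!ws'. list_all2 (%p' p. near m3 (fst p') (fst p) \<and> near m3 (snd p') (snd p)) ws' ws ==> mnear m1 (word ws') (word ws)"
    using Cons.IH[OF c(3)] by blast
  have "mnear n (word ws') (word (p # ws))" if h: "list_all2 (%p' p. near (max m2 m3) (fst p') (fst p) \<and> near (max m2 m3) (snd p') (snd p)) ws' (p # ws)" for ws'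
  proof -
    obtain x' y' vs where ws': "ws' = (x', y') # vs" using h by (cases ws') auto
    have v: "near (max m2 m3) x' x" "near (max m2 m3) y' y"
      "list_all2 (%p' p. near (max m2 m3) (fst p') (fst p) \<and> near (max m2 m3) (snd p') (snd p)) vs ws" using h ws' p by auto
    have "list_all2 (%p' p. near m3 (fst p') (fst p) \<and> near m3 (snd p') (snd p)) vs ws"
      using v(3) by (rule list_all2_mono) (auto intro: near_mono[of m3 "max m2 m3"])
    hence 3: "mnear m1 (word vs) (word ws)" by (rule m3)
    have "mnear m1 (Up x' \<odot> Lo y') (Up x \<odot> Lo y)"
      by (intro m2 mnear_Up mnear_Lo near_mono[OF _ v(1)] near_mono[OF _ v(2)]) auto
    thus ?thesis unfolding ws' p word.simps using m1 3 by blast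
  qed
  thus ?case by blast
qed

end

section \<open>Weak approximation\<close>

text \<open>A dense embedding of filtered algebras with matching bases; the case of interest is
  \<open>H\<close> in its completion. Density and compatibility of the filtrations are required on
  the central fields and carry over through coordinates.\<close>

locale qpair =
  H: vquat H K i j \<sigma> D + A: vquat A L i' j' s D'
  for H :: "('a, 'm) ring_scheme" (structure) and K i j \<sigma> D and A :: "('c, 'k) ring_scheme" and L i' j' s D' +
  fixes \<iota> :: "'a => 'c"
  assumes hom: "\<iota> \<in> ring_hom H A" and iota_i: "\<iota> i = i'" and iota_j: "\<iota> j = j'" and iota_K: "!!k. k \<in> K ==> \<iota> k \<in> L"
    and D_iff: "!!k n. k \<in> K ==> \<iota> k \<in> D' n \<longleftrightarrow> k \<in> D n"
    and dense: "!!l n. l \<in> L ==> \<exists>k\<in>K. \<iota> k \<ominus>\<^bsub>A\<^esub> l \<in> D' n"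
begin

sublocale \<iota>: ring_hom_ring H A \<iota>
  by (rule ring_hom_ringI2[OF H.ring_axioms A.ring_axioms hom])

lemma iota_q: "a \<in> K ==> b \<in> K ==> c \<in> K ==> d \<in> K ==> \<iota> (H.q a b c d) = A.q (\<iota> a) (\<iota> b) (\<iota> c) (\<iota> d)"
  by (simp add: H.q_def A.q_def iota_i iota_j)

lemma iota_sigma: "h \<in> carrier H ==> s (\<iota> h) = \<iota> (\<sigma> h)"
  by (rule H.q_exists[of h]) (auto simp: iota_q H.sigma_q A.sigma_q iota_K)

lemma iota_cj: "h \<in> carrier H ==> A.cj (\<iota> h) = \<iota> (H.cj h)"
  by (rule H.q_exists[of h]) (auto simp: iota_q H.cj_q A.cj_q iota_K)

lemma iota_nrm: "h \<in> carrier H ==> A.nrm (\<iota> h) = \<iota> (H.nrm h)"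
  by (simp add: A.nrm_def H.nrm_def iota_cj)

lemma iota_UU: "h \<in> carrier H ==> \<iota> h \<in> A.UU n \<longleftrightarrow> h \<in> H.UU n"
  by (rule H.q_exists[of h]) (auto simp: iota_q H.q_in_UU A.q_in_UU iota_K D_iff)

lemma iota_near: "x \<in> carrier H ==> y \<in> carrier H ==> A.near n (\<iota> x) (\<iota> y) \<longleftrightarrow> H.near n x y"
  using iota_UU[of "x \<ominus> y" n] by (simp add: A.near_def H.near_def a_minus_def \<iota>.hom_a_inv)

text \<open>The last clause keeps a vanishing \<open>k\<close> coordinate zero, so that fixed
  elements are approximated by fixed elements.\<close>

lemma iota_dense_q:
  assumes "a \<in> L" "b \<in> L" "c \<in> L" "d \<in> L"
  shows "\<exists>a'\<in>K. \<exists>b'\<in>K. \<exists>c'\<in>K. \<exists>d'\<in>K. A.near n (\<iota> (H.q a' b' c' d')) (A.q a b c d) \<and> (d = \<zero>\<^bsub>A\<^esub> --> d' = \<zero>)"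
proof -
  obtain a' where a': "a' \<in> K" "\<iota> a' \<ominus>\<^bsub>A\<^esub> a \<in> D' n" using dense[OF assms(1)] by blast
  obtain b' where b': "b' \<in> K" "\<iota> b' \<ominus>\<^bsub>A\<^esub> b \<in> D' n" using dense[OF assms(2)] by blast
  obtain c' where c': "c' \<in> K" "\<iota> c' \<ominus>\<^bsub>A\<^esub> c \<in> D' n" using dense[OF assms(3)] by blast
  have "\<exists>d'\<in>K. \<iota> d' \<ominus>\<^bsub>A\<^esub> d \<in> D' n \<and> (d = \<zero>\<^bsub>A\<^esub> --> d' = \<zero>)"
  proof (cases "d = \<zero>\<^bsub>A\<^esub>")
    case True
    thus ?thesis using A.D_zero by (intro bexI[of _ "\<zero>"]) (auto simp: a_minus_def)
  next
    case False thus ?thesis using dense[OF assms(4)] by blast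
  qed
  then obtain d' where d': "d' \<in> K" "\<iota> d' \<ominus>\<^bsub>A\<^esub> d \<in> D' n" "d = \<zero>\<^bsub>A\<^esub> --> d' = \<zero>" by blast
  note m = a'(1) b'(1) c'(1) d'(1)
  note mi = iota_K[OF a'(1)] iota_K[OF b'(1)] iota_K[OF c'(1)] iota_K[OF d'(1)]
  have "\<iota> (H.q a' b' c' d') \<ominus>\<^bsub>A\<^esub> A.q a b c d
      = A.q (\<iota> a' \<ominus>\<^bsub>A\<^esub> a) (\<iota> b' \<ominus>\<^bsub>A\<^esub> b) (\<iota> c' \<ominus>\<^bsub>A\<^esub> c) (\<iota> d' \<ominus>\<^bsub>A\<^esub> d)"
    using m mi assms by (simp add: iota_q a_minus_def A.q_uminus A.q_add)
  also have "... \<in> A.UU n" by (rule A.UU_I[OF a'(2) b'(2) c'(2) d'(2)])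
  finally show ?thesis using m mi assms d'(3) unfolding A.near_def
    by (intro bexI[OF _ a'(1)] bexI[OF _ b'(1)] bexI[OF _ c'(1)] bexI[OF _ d'(1)]) (simp add: iota_q)
qed

lemma dense_carrier: "x \<in> carrier A ==> \<exists>h\<in>carrier H. A.near n (\<iota> h) x"
proof -
  assume "x \<in> carrier A"
  then obtain a b c d where x: "a \<in> L" "b \<in> L" "c \<in> L" "d \<in> L" "x = A.q a b c d" using A.q_exists by blast
  obtain a' b' c' d' where h: "a' \<in> K" "b' \<in> K" "c' \<in> K" "d' \<in> K" "A.near n (\<iota> (H.q a' b' c' d')) (A.q a b c d)"
    using iota_dense_q[OF x(1-4)] by blast
  thus ?thesis unfolding x(5) using H.q_closed by blast
qed

lemma dense_Fix: "x \<in> A.Fix ==> \<exists>h\<in>H.Fix. A.near n (\<iota> h) x"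
proof -
  assume "x \<in> A.Fix"
  then obtain a b c where x: "a \<in> L" "b \<in> L" "c \<in> L" "\<zero>\<^bsub>A\<^esub> \<in> L" "x = A.q a b c \<zero>\<^bsub>A\<^esub>"
    using A.Fix_coordinates A.L_closed(1) by blast
  obtain a' b' c' d' where h: "a' \<in> K" "b' \<in> K" "c' \<in> K" "d' \<in> K" "A.near n (\<iota> (H.q a' b' c' d')) (A.q a b c \<zero>\<^bsub>A\<^esub>)" "d' = \<zero>"
    using iota_dense_q[OF x(1-4)] by blast
  have "H.q a' b' c' d' \<in> H.Fix" using h by (simp add: H.Fix_iff H.sigma_q)
  thus ?thesis unfolding x(5) using h by blast
qed

lemma iota_unit: assumes "h \<in> Units H" shows "\<iota> h \<in> Units A" "inv\<^bsub>A\<^esub> (\<iota> h) = \<iota> (inv h)"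
proof -
  have c: "h \<in> carrier H" "inv h \<in> carrier H" using assms by auto
  have "\<iota> h \<otimes>\<^bsub>A\<^esub> \<iota> (inv h) = \<one>\<^bsub>A\<^esub>" "\<iota> (inv h) \<otimes>\<^bsub>A\<^esub> \<iota> h = \<one>\<^bsub>A\<^esub>"
    using \<iota>.hom_mult[OF c] \<iota>.hom_mult[OF c(2,1)] H.Units_r_inv[OF assms] H.Units_l_inv[OF assms] \<iota>.hom_one by auto
  thus "\<iota> h \<in> Units A" "inv\<^bsub>A\<^esub> (\<iota> h) = \<iota> (inv h)" using A.unit_if[of "\<iota> h" "\<iota> (inv h)"] c by auto
qed

text \<open>The norm commutes with \<open>\<iota>\<close> and detects units in both
  algebras.\<close>

lemma iota_unit_rev: assumes "h \<in> carrier H" "\<iota> h \<in> Units A" shows "h \<in> Units H"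
proof -
  have "A.nrm (\<iota> h) \<noteq> \<zero>\<^bsub>A\<^esub>" by (rule A.unit_nrm[OF assms(2)])
  hence "H.nrm h \<noteq> \<zero>" using iota_nrm[OF assms(1)] \<iota>.hom_zero by auto
  thus ?thesis using H.nrm_unit(1)[OF assms(1)] by blast
qed

fun mi :: "'a mat2 => 'c mat2" where "mi (a, b, c, d) = (\<iota> a, \<iota> b, \<iota> c, \<iota> d)"

lemma mi_M2: "M \<in> H.M2 ==> mi M \<in> A.M2" by (cases M) simp
lemma mi_mult: "M \<in> H.M2 ==> N \<in> H.M2 ==> mi (mat2_mult H M N) = mat2_mult A (mi M) (mi N)"
  by (cases M; cases N) simp
lemma mi_star: "M \<in> H.M2 ==> mi (H.star M) = A.star (mi M)"
  by (cases M) (simp add: iota_sigma \<iota>.hom_a_inv)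
lemma mi_SL: "M \<in> H.SL ==> mi M \<in> A.SL"
proof -
  assume M: "M \<in> H.SL"
  have "mat2_mult A (mi M) (A.star (mi M)) = mi (mat2_mult H M (H.star M))"
    using M H.SL_M2 by (simp add: mi_mult mi_star)
  also have "... = A.I2" using M by (simp add: H.SL_iff)
  finally show ?thesis using M H.SL_M2 mi_M2 by (simp add: A.SL_iff)
qed
lemma mi_Up: "mi (H.Up x) = A.Up (\<iota> x)" and mi_Lo: "mi (H.Lo x) = A.Lo (\<iota> x)"
  by (simp_all add: H.Up_def A.Up_def H.Lo_def A.Lo_def)
lemma mi_Dg: "a \<in> Units H ==> mi (H.Dg a) = A.Dg (\<iota> a)"
  using iota_unit(2)[OF H.sigma_unit(1)] H.Units_closed[of a] by (simp add: H.Dg_def A.Dg_def iota_sigma)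
lemma mi_near: "M \<in> H.M2 ==> N \<in> H.M2 ==> A.mnear n (mi M) (mi N) \<longleftrightarrow> H.mnear n M N"
  by (cases M; cases N) (simp add: iota_near)

text \<open>The factors of \<open>SL_decomposition\<close> are approximated one by one, with
  precisions chosen backwards through the product. For the diagonal factor, elements near the unit
  \<open>a\<close> are units, and \<open>iota_unit_rev\<close> brings this back to
  \<open>H\<close>.\<close>

theorem weak_approximation:
  assumes "g \<in> A.SL"
  shows "\<exists>g'\<in>H.SL. A.mnear n (mi g') g"
proof -
  obtain a x y z where d: "a \<in> Units A" "x \<in> A.Fix" "y \<in> A.Fix" "z \<in> A.Fix"
    "g = mat2_mult A (mat2_mult A (mat2_mult A (A.Lo y) (A.Dg a)) (A.Up z)) (A.Lo x)"
    using A.SL_decomposition[OF assms] by blast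
  note E = A.elementary_two_sided
  have m: "A.Lo y \<in> A.M2" "A.Dg a \<in> A.M2" "A.Up z \<in> A.M2" "A.Lo x \<in> A.M2"
    using E(1)[OF d(4)] E(2)[OF d(3)] E(2)[OF d(2)] E(3)[OF d(1)] A.SL_M2 by auto
  obtain m1 where m1: "!!M N. A.mnear m1 M (mat2_mult A (mat2_mult A (A.Lo y) (A.Dg a)) (A.Up z)) ==> A.mnear m1 N (A.Lo x) ==>
     A.mnear n (mat2_mult A M N) g" unfolding d(5) using A.mnear_mult[OF A.mm_closed[OF A.mm_closed[OF m(1,2)] m(3)] m(4), of n] by blast
  obtain m2 where m2: "!!M N. A.mnear m2 M (mat2_mult A (A.Lo y) (A.Dg a)) ==> A.mnear m2 N (A.Up z) ==>
     A.mnear m1 (mat2_mult A M N) (mat2_mult A (mat2_mult A (A.Lo y) (A.Dg a)) (A.Up z))"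
    using A.mnear_mult[OF A.mm_closed[OF m(1,2)] m(3), of m1] by blast
  obtain m3 where m3: "!!M N. A.mnear m3 M (A.Lo y) ==> A.mnear m3 N (A.Dg a) ==>
     A.mnear m2 (mat2_mult A M N) (mat2_mult A (A.Lo y) (A.Dg a))"
    using A.mnear_mult[OF m(1,2), of m2] by blast
  obtain m4 where m4: "!!a'. A.near m4 a' a ==> a' \<in> Units A \<and> A.mnear m3 (A.Dg a') (A.Dg a)" using A.mnear_Dg[OF d(1)] by blast
  obtain x' where x': "x' \<in> H.Fix" "A.near m1 (\<iota> x') x" using dense_Fix[OF d(2)] by blast
  obtain z' where z': "z' \<in> H.Fix" "A.near m2 (\<iota> z') z" using dense_Fix[OF d(4)] by blast
  obtain y' where y': "y' \<in> H.Fix" "A.near m3 (\<iota> y') y" using dense_Fix[OF d(3)] by blast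
  obtain a' where a': "a' \<in> carrier H" "A.near m4 (\<iota> a') a" using dense_carrier[of a] d(1) A.Units_closed by blast
  have au: "a' \<in> Units H" using iota_unit_rev[OF a'(1)] m4[OF a'(2)] by blast
  define g' where "g' = mat2_mult H (mat2_mult H (mat2_mult H (H.Lo y') (H.Dg a')) (H.Up z')) (H.Lo x')"
  note E = H.elementary_two_sided
  have S: "H.Lo y' \<in> H.SL" "H.Dg a' \<in> H.SL" "H.Up z' \<in> H.SL" "H.Lo x' \<in> H.SL"
    using E(1)[OF z'(1)] E(2)[OF y'(1)] E(2)[OF x'(1)] E(3)[OF au] by auto
  have g': "g' \<in> H.SL" unfolding g'_def by (intro H.SL_mult S)
  note SM = S[THEN H.SL_M2]
  have e: "mi g' = mat2_mult A (mat2_mult A (mat2_mult A (A.Lo (\<iota> y')) (A.Dg (\<iota> a'))) (A.Up (\<iota> z'))) (A.Lo (\<iota> x'))"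
    unfolding g'_def using SM by (simp only: mi_mult H.mm_closed mi_Up mi_Lo mi_Dg[OF au])
  have "A.mnear n (mi g') g" unfolding e
    by (intro m1 m2 m3 A.mnear_Up A.mnear_Lo x' y' z' conjunct2[OF m4[OF a'(2)]])
  thus ?thesis using g' by blast
qed

text \<open>The properties of a localized order \<open>Z\<close> and of the completed order
  \<open>ZP\<close> on which the transfer of conjugacy rests: an open subring, stable under the
  involution, that cuts out \<open>Z\<close> on \<open>H\<close>.\<close>

definition lattice_pair :: "'a set => 'c set => bool" where
  "lattice_pair Z ZP \<longleftrightarrow> ZP \<subseteq> carrier A \<and> \<one>\<^bsub>A\<^esub> \<in> ZP \<and> (\<forall>x\<in>ZP. \<forall>y\<in>ZP. x \<oplus>\<^bsub>A\<^esub> y \<in> ZP \<and> x \<otimes>\<^bsub>A\<^esub> y \<in> ZP) \<and>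
    (\<forall>x\<in>ZP. \<ominus>\<^bsub>A\<^esub> x \<in> ZP \<and> s x \<in> ZP) \<and> (\<forall>h\<in>carrier H. \<iota> h \<in> ZP \<longleftrightarrow> h \<in> Z) \<and> (\<exists>c. A.UU c \<subseteq> ZP)"

lemma lattice_mult: "lattice_pair Z ZP ==> M \<in> mat2_set ZP ==> N \<in> mat2_set ZP ==> mat2_mult A M N \<in> mat2_set ZP"
  by (cases M; cases N) (simp add: lattice_pair_def)

lemma lattice_star: "lattice_pair Z ZP ==> M \<in> mat2_set ZP ==> A.star M \<in> mat2_set ZP"
  by (cases M) (simp add: lattice_pair_def)

lemma lattice_mi: "lattice_pair Z ZP ==> M \<in> H.M2 ==> mi M \<in> mat2_set ZP \<longleftrightarrow> M \<in> mat2_set Z"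
  by (cases M) (simp add: lattice_pair_def)

lemma lattice_I2: "lattice_pair Z ZP ==> A.I2 \<in> mat2_set ZP"
  using A.UU_zero by (auto simp: lattice_pair_def)

text \<open>An open subring is a union of cosets of some \<open>A.UU c\<close>.\<close>

lemma lattice_near:
  assumes "lattice_pair Z ZP"
  shows "\<exists>c. \<forall>n\<ge>c. \<forall>M N. A.mnear n N M --> M \<in> mat2_set ZP --> N \<in> mat2_set ZP"
proof -
  obtain c where c: "A.UU c \<subseteq> ZP" using assms by (auto simp: lattice_pair_def)
  have 1: "x' \<in> ZP" if "A.near n x' x" "x \<in> ZP" "n \<ge> c" for n x x'
  proof -
    have cc: "x' \<in> carrier A" "x \<in> carrier A" "x' \<ominus>\<^bsub>A\<^esub> x \<in> ZP"
      using that(1) A.UU_mono[OF that(3)] c by (auto simp: A.near_def)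
    have "x' = x \<oplus>\<^bsub>A\<^esub> (x' \<ominus>\<^bsub>A\<^esub> x)" using cc(1,2) by algebra
    moreover have "x \<oplus>\<^bsub>A\<^esub> (x' \<ominus>\<^bsub>A\<^esub> x) \<in> ZP" using assms that(2) cc(3) unfolding lattice_pair_def by blast
    ultimately show ?thesis by simp
  qed
  have "N \<in> mat2_set ZP" if "A.mnear n N M" "M \<in> mat2_set ZP" "n \<ge> c" for n M N
    using that by (cases M; cases N) (auto intro: 1)
  thus ?thesis by blast
qed

text \<open>For \<open>g'\<close> over \<open>H\<close> near \<open>g\<close>, the quotient
  \<open>\<kappa>\<close> is near the identity and hence a matrix over \<open>Q1\<close>.
  Conjugation by \<open>\<kappa>\<close> preserves the matrices over \<open>Q1\<close>, so
  \<open>g'\<close>, the product of \<open>g\<close> and \<open>\<kappa>\<close>, conjugates in the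
  same way as \<open>g\<close>.\<close>

lemma conjugation_descends:
  assumes l1: "lattice_pair Z1 Q1" and l2: "lattice_pair Z2 Q2" and g: "g \<in> A.SL"
    and conj: "!!x. x \<in> A.SL ==> x \<in> mat2_set Q1 \<longleftrightarrow> A.cnj g x \<in> mat2_set Q2"
  shows "\<exists>g'\<in>H.SL. \<forall>x\<in>H.SL. x \<in> mat2_set Z1 \<longleftrightarrow> H.cnj g' x \<in> mat2_set Z2"
proof -
  obtain c where c: "!!M N. A.mnear c N M ==> M \<in> mat2_set Q1 ==> N \<in> mat2_set Q1" using lattice_near[OF l1] by blast
  have gM: "g \<in> A.M2" "A.star g \<in> A.M2" using A.SL_M2[OF g] by auto
  obtain m where m: "!!M N. A.mnear m M (A.star g) ==> A.mnear m N g ==> A.mnear c (mat2_mult A M N) (mat2_mult A (A.star g) g)"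
    using A.mnear_mult[OF gM(2,1)] by blast
  obtain g' where g': "g' \<in> H.SL" "A.mnear m (mi g') g" using weak_approximation[OF g] by blast
  define \<kappa> where "\<kappa> = mat2_mult A (A.star g) (mi g')"
  have \<kappa>S: "\<kappa> \<in> A.SL" unfolding \<kappa>_def by (intro A.SL_mult A.SL_star g mi_SL g')
  have "A.mnear c \<kappa> A.I2" using m[OF A.mnear_refl[OF gM(2)] g'(2)] A.SL_star_left[OF g] by (simp add: \<kappa>_def)
  hence \<kappa>Q: "\<kappa> \<in> mat2_set Q1" using c lattice_I2[OF l1] by blast
  have \<kappa>M: "\<kappa> \<in> A.M2" "A.star \<kappa> \<in> A.M2" "mi g' \<in> A.M2" using A.SL_M2[OF \<kappa>S] mi_M2 H.SL_M2 g' by auto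
  have gg: "mat2_mult A g (A.star g) = A.I2" using g A.SL_iff by blast
  have kk: "mat2_mult A (A.star \<kappa>) \<kappa> = A.I2" using A.SL_star_left[OF \<kappa>S] .
  have g'k: "mi g' = mat2_mult A g \<kappa>" unfolding \<kappa>_def using gg gM \<kappa>M(3) by (simp add: A.mm_assoc[symmetric])
  show ?thesis
  proof (intro bexI[OF _ g'(1)] ballI)
    fix x assume x: "x \<in> H.SL"
    have xM: "x \<in> H.M2" "mi x \<in> A.M2" "mi x \<in> A.SL" using H.SL_M2[OF x] mi_M2 mi_SL[OF x] by auto
    define y where "y = A.cnj \<kappa> (mi x)"
    have yS: "y \<in> A.SL" unfolding y_def by (intro A.SL_mult A.SL_star \<kappa>S xM)
    have yM: "y \<in> A.M2" using A.SL_M2[OF yS] .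
    have conj_back: "mi x = mat2_mult A (mat2_mult A (A.star \<kappa>) y) \<kappa>"
    proof -
      have "mat2_mult A (mat2_mult A (A.star \<kappa>) y) \<kappa> = mat2_mult A (mat2_mult A (mat2_mult A (A.star \<kappa>) \<kappa>) (mi x)) (mat2_mult A (A.star \<kappa>) \<kappa>)"
        unfolding y_def using \<kappa>M xM by (simp add: A.mm_assoc)
      thus ?thesis unfolding kk using xM by simp
    qed
    have "x \<in> mat2_set Z1 \<longleftrightarrow> mi x \<in> mat2_set Q1" using lattice_mi[OF l1 xM(1)] by simp
    also have "... \<longleftrightarrow> y \<in> mat2_set Q1"
    proof
      assume "mi x \<in> mat2_set Q1"
      thus "y \<in> mat2_set Q1" unfolding y_def by (intro lattice_mult[OF l1] lattice_star[OF l1] \<kappa>Q)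
    next
      assume "y \<in> mat2_set Q1"
      thus "mi x \<in> mat2_set Q1" unfolding conj_back by (intro lattice_mult[OF l1] lattice_star[OF l1] \<kappa>Q)
    qed
    also have "... \<longleftrightarrow> A.cnj g y \<in> mat2_set Q2" using conj[OF yS] .
    also have "A.cnj g y = A.cnj (mi g') (mi x)"
      unfolding g'k y_def using \<kappa>M gM xM by (simp add: A.mm_assoc A.star_mult)
    also have "... = mi (H.cnj g' x)"
      using H.SL_M2[OF g'(1)] xM by (simp add: mi_mult mi_star)
    also have "mi (H.cnj g' x) \<in> mat2_set Q2 \<longleftrightarrow> H.cnj g' x \<in> mat2_set Z2"
      using H.SL_M2[OF g'(1)] xM by (intro lattice_mi[OF l2]) simp
    finally show "x \<in> mat2_set Z1 \<longleftrightarrow> H.cnj g' x \<in> mat2_set Z2" .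
  qed
qed

text \<open>The lattices are closed as well as open. The local \<open>x\<close> is approximated by a
  global \<open>y\<close> in the localized group, and \<open>y\<close> by some \<open>z\<close>
  whose conjugate is known to be integral; continuity of conjugation passes this on to
  \<open>x\<close>. The assumption \<open>approx\<close> bridges the gap between integrality at one
  prime and integrality at all primes, where a global conjugator is under control.\<close>

lemma conjugation_ascends:
  assumes l1: "lattice_pair Z1 Q1" and l2: "lattice_pair Z2 Q2" and g': "g' \<in> H.SL"
    and approx: "!!x n. x \<in> H.SL ==> x \<in> mat2_set Z1 ==>
      \<exists>y\<in>H.SL. H.mnear n y x \<and> H.cnj g' y \<in> mat2_set Z2"
    and x: "x \<in> A.SL" "x \<in> mat2_set Q1"
  shows "A.cnj (mi g') x \<in> mat2_set Q2"
proof -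
  obtain c1 where c1: "!!n M N. n \<ge> c1 ==> A.mnear n N M ==> M \<in> mat2_set Q1 ==> N \<in> mat2_set Q1" using lattice_near[OF l1] by blast
  obtain c2 where c2: "!!M N. A.mnear c2 N M ==> M \<in> mat2_set Q2 ==> N \<in> mat2_set Q2" using lattice_near[OF l2] by blast
  define g where "g = mi g'"
  have gS: "g \<in> A.SL" unfolding g_def by (rule mi_SL[OF g'])
  have M: "g \<in> A.M2" "A.star g \<in> A.M2" "x \<in> A.M2" using A.SL_M2 gS x by auto
  obtain m1 where m1: "!!M N. A.mnear m1 M (mat2_mult A g x) ==> A.mnear m1 N (A.star g) ==>
    A.mnear c2 (mat2_mult A M N) (A.cnj g x)" using A.mnear_mult[OF A.mm_closed[OF M(1,3)] M(2)] by blast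
  obtain m2 where m2: "!!M N. A.mnear m2 M g ==> A.mnear m2 N x ==> A.mnear m1 (mat2_mult A M N) (mat2_mult A g x)"
    using A.mnear_mult[OF M(1,3)] by blast
  obtain y where y: "y \<in> H.SL" "A.mnear (max c1 m2) (mi y) x" using weak_approximation[OF x(1)] by blast
  have "mi y \<in> mat2_set Q1" by (rule c1[OF _ y(2) x(2)]) simp
  hence "y \<in> mat2_set Z1" using lattice_mi[OF l1 H.SL_M2[OF y(1)]] by simp
  then obtain z where z: "z \<in> H.SL" "H.mnear m2 z y" "H.cnj g' z \<in> mat2_set Z2"
    using approx[OF y(1)] by blast
  have zM: "z \<in> H.M2" "g' \<in> H.M2" "y \<in> H.M2" using H.SL_M2 z g' y by auto
  have "A.mnear m2 (mi z) (mi y)" using mi_near[OF zM(1,3)] z by simp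
  hence "A.mnear m2 (mi z) x" by (rule A.mnear_trans[OF _ A.mnear_mono[OF _ y(2)]]) simp
  hence n: "A.mnear c2 (A.cnj g (mi z)) (A.cnj g x)"
    by (intro m1 m2 A.mnear_refl M)
  have "A.cnj g (mi z) = mi (H.cnj g' z)"
    unfolding g_def using zM by (simp add: mi_mult mi_star)
  also have "... \<in> mat2_set Q2" using lattice_mi[OF l2, of "H.cnj g' z"] z(3) zM by simp
  finally show ?thesis using c2[OF A.mnear_sym[OF n]] by (simp add: g_def)
qed

end

section \<open>The local algebras\<close>

lemma (in ring) minus_distr:
  assumes "x \<in> carrier R" "y \<in> carrier R" "z \<in> carrier R"
  shows "z \<otimes> (x \<ominus> y) = z \<otimes> x \<ominus> z \<otimes> y" "(x \<ominus> y) \<otimes> z = x \<otimes> z \<ominus> y \<otimes> z"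
  using assms by algebra+

lemma (in ring) combination_minus:
  assumes "a \<in> carrier R" "b \<in> carrier R" "c \<in> carrier R" "d \<in> carrier R"
    "a' \<in> carrier R" "b' \<in> carrier R" "c' \<in> carrier R" "d' \<in> carrier R"
    "x \<in> carrier R" "y \<in> carrier R" "z \<in> carrier R"
  shows "(a \<oplus> b \<otimes> x \<oplus> c \<otimes> y \<oplus> d \<otimes> z) \<ominus> (a' \<oplus> b' \<otimes> x \<oplus> c' \<otimes> y \<oplus> d' \<otimes> z) =
    (a \<ominus> a') \<oplus> (b \<ominus> b') \<otimes> x \<oplus> (c \<ominus> c') \<otimes> y \<oplus> (d \<ominus> d') \<otimes> z"
  using assms by algebra

text \<open>\<open>AB_int\<close> makes the squares integral at every prime at once, so that one
  basis serves all localizations.\<close>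

locale nquat = H: quat H K i j \<sigma> for H :: "('a, 'm) ring_scheme" (structure) and K i j \<sigma> +
  assumes nf: "number_field (base_field H K)"
    and AB_int: "i \<otimes> i \<in> ring_of_integers (base_field H K)" "j \<otimes> j \<in> ring_of_integers (base_field H K)"
begin

abbreviation F where "F \<equiv> base_field H K"

sublocale F: numfield F
  by (rule numfield.intro) (use nf in \<open>auto simp: number_field_def numfield_axioms_def\<close>)

abbreviation "Pr \<equiv> finite_primes F"

lemma F_uminus: "k \<in> K ==> \<ominus>\<^bsub>F\<^esub> k = \<ominus> k"
  by (rule F.minus_equality) (auto simp: H.l_neg)

lemma F_minus: "k \<in> K ==> l \<in> K ==> k \<ominus>\<^bsub>F\<^esub> l = k \<ominus> l"
  by (simp add: a_minus_def F_uminus)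

lemma F_inv: "k \<in> K ==> k \<noteq> \<zero> ==> inv\<^bsub>F\<^esub> k = inv k"
  by (rule F.comm_inv_char) (auto simp: H.L_inv)

end

locale lquat = nquat +
  fixes P assumes P_prime: "P \<in> finite_primes (base_field H K)"
begin

sublocale N: number_prime F P by unfold_locales (rule P_prime)

sublocale HV: vquat H K i j \<sigma> "val_ge F P"
proof unfold_locales
  show "val_ge F P n \<subseteq> K" for n using N.V_carrier[of _ n] by auto
  show "\<zero> \<in> val_ge F P n" for n using N.V_zero[of n] by simp
  show "x \<oplus> y \<in> val_ge F P n" if "x \<in> val_ge F P n" "y \<in> val_ge F P n" for x y n using N.V_add[OF that] by simp
  show "\<ominus> x \<in> val_ge F P n" if "x \<in> val_ge F P n" for x n
    using N.V_uminus[OF that] N.V_carrier[OF that] F_uminus[of x] by simp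
  show "x \<in> val_ge F P m" if "m \<le> n" "x \<in> val_ge F P n" for m n x by (rule N.V_mono[OF that])
  show "x \<otimes> y \<in> val_ge F P (m + n)" if "x \<in> val_ge F P m" "y \<in> val_ge F P n" for x y m n using N.V_mult[OF that] by simp
  show "\<one> \<in> val_ge F P 0" using N.V_one by simp
  show "\<exists>c. \<forall>n. \<forall>x\<in>val_ge F P (n + c). l \<otimes> x \<in> val_ge F P n" if "l \<in> K" for l
    using N.V_scale[of l] that by simp
  show "\<one> \<oplus> d \<noteq> \<zero> \<and> inv (\<one> \<oplus> d) \<in> val_ge F P 0" if "d \<in> val_ge F P 1" for d
    using N.V_unit[OF that] N.V_carrier[OF that] F_inv[of "\<one> \<oplus> d"] by simp
  show "i \<otimes> i \<in> val_ge F P 0" "j \<otimes> j \<in> val_ge F P 0" using N.ZK_V0 AB_int by auto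
qed

abbreviation KP where "KP \<equiv> completion F P"
abbreviation toK where "toK \<equiv> to_completion F P"
abbreviation BB where "BB \<equiv> N.BB"

sublocale KP: field KP by (rule N.KP_field)

lemma toK: "k \<in> K ==> toK k \<in> carrier KP" "k \<in> K ==> l \<in> K ==> toK (k \<oplus> l) = toK k \<oplus>\<^bsub>KP\<^esub> toK l"
  "k \<in> K ==> l \<in> K ==> toK (k \<otimes> l) = toK k \<otimes>\<^bsub>KP\<^esub> toK l" "toK \<one> = \<one>\<^bsub>KP\<^esub>" "toK \<zero> = \<zero>\<^bsub>KP\<^esub>"
  using N.toK_closed[of k] N.toK_ops[of k l] N.toK_ops(5,6)[of "\<one>" "\<one>"] by simp_all

lemma toK_BB: "k \<in> K ==> toK k \<in> BB n \<longleftrightarrow> k \<in> val_ge F P n" using N.toK_BB[of k n] by simp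

lemma toK_nz: assumes "k \<in> K" "k \<noteq> \<zero>" shows "toK k \<noteq> \<zero>\<^bsub>KP\<^esub>"
proof
  assume "toK k = \<zero>\<^bsub>KP\<^esub>"
  hence "k \<in> val_ge F P n" for n using toK_BB[OF assms(1), of n] N.BB_zero by simp
  thus False using N.V_Inter[of k] assms(2) by simp
qed

sublocale T: tens H K toK KP
proof (rule tens.intro[OF H.ring_axioms KP.is_cring], rule tens_axioms.intro)
  show "subring K H" by (rule subfieldE(1)[OF H.L_subfield])
qed (rule H.central toK; assumption?)+

abbreviation HP where "HP \<equiv> T.TR"
abbreviation hp_mult (infixl "\<star>" 70) where "x \<star> y \<equiv> x \<otimes>\<^bsub>HP\<^esub> y"
abbreviation u where "u l \<equiv> T.pt \<one> l"
abbreviation \<iota> where "\<iota> h \<equiv> T.pt h \<one>\<^bsub>KP\<^esub>"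
abbreviation LP where "LP \<equiv> (%l. u l) ` carrier KP"

lemma u_closed: "l \<in> carrier KP ==> u l \<in> carrier HP" by simp

lemma u_ops: assumes "l \<in> carrier KP" "m \<in> carrier KP"
  shows "u (l \<oplus>\<^bsub>KP\<^esub> m) = u l \<oplus>\<^bsub>HP\<^esub> u m" "u (l \<otimes>\<^bsub>KP\<^esub> m) = u l \<star> u m" "u (\<ominus>\<^bsub>KP\<^esub> l) = \<ominus>\<^bsub>HP\<^esub> u l"
    "u (l \<ominus>\<^bsub>KP\<^esub> m) = u l \<ominus>\<^bsub>HP\<^esub> u m"
  using assms by (simp_all add: T.pt_add_right T.pt_mult T.pt_uminus_right a_minus_def)

lemma u_one: "u \<one>\<^bsub>KP\<^esub> = \<one>\<^bsub>HP\<^esub>" by (rule T.pt_one)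

lemma u_zero: "u \<zero>\<^bsub>KP\<^esub> = \<zero>\<^bsub>HP\<^esub>" by (simp add: T.pt_zero_right)

text \<open>The reduced trace is a \<open>K\<close>-linear form with value \<one> \<oplus> \<one> at
  \<one>, which stays nonzero in the completion. By \<open>pt_separated\<close> the completion
  therefore embeds into the tensor product.\<close>

lemma u_zero_iff: assumes l: "l \<in> carrier KP" and "u l = \<zero>\<^bsub>HP\<^esub>" shows "l = \<zero>\<^bsub>KP\<^esub>"
proof -
  define lam where "lam x = x \<oplus> H.cj x" for x
  have "toK (lam \<one>) \<otimes>\<^bsub>KP\<^esub> l = \<zero>\<^bsub>KP\<^esub>"
  proof (rule T.pt_separated[where lam = lam and a = "\<one>" and l = l])
    show "lam a \<in> K" if "a \<in> carrier H" for a unfolding lam_def by (rule H.trace_L[OF that])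
    show "lam (a \<oplus> b) = lam a \<oplus> lam b" if "a \<in> carrier H" "b \<in> carrier H" for a b
      using that by (simp add: lam_def H.cj_add H.a_ac)
    show "lam (a \<otimes> k) = lam a \<otimes> k" if "a \<in> carrier H" "k \<in> K" for a k
      using that H.central[of k "H.cj a"] by (simp add: lam_def H.cj_mult H.l_distr)
  qed (use assms in auto)
  moreover have "lam \<one> = \<one> \<oplus> \<one>" by (simp add: lam_def)
  moreover have "toK (\<one> \<oplus> \<one>) \<noteq> \<zero>\<^bsub>KP\<^esub>" "toK (\<one> \<oplus> \<one>) \<in> carrier KP"
    using toK_nz[OF _ H.two] toK(1) by auto
  ultimately show ?thesis using KP.integral[of "toK (\<one> \<oplus> \<one>)" l] l by simp
qed

lemma u_inj: assumes "l \<in> carrier KP" "m \<in> carrier KP" "u l = u m" shows "l = m"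
proof -
  have "u (l \<ominus>\<^bsub>KP\<^esub> m) = u m \<ominus>\<^bsub>HP\<^esub> u m" using assms by (simp only: u_ops(4))
  hence "u (l \<ominus>\<^bsub>KP\<^esub> m) = \<zero>\<^bsub>HP\<^esub>" using u_closed[OF assms(2)] by (simp add: a_minus_def T.TR.r_neg)
  hence "l \<ominus>\<^bsub>KP\<^esub> m = \<zero>\<^bsub>KP\<^esub>" using u_zero_iff assms by simp
  thus ?thesis using assms by simp
qed

lemma iota_K: "k \<in> K ==> \<iota> k = u (toK k)"
  using T.pt_balanced[of "\<one>" k "\<one>\<^bsub>KP\<^esub>"] toK(1)[of k] by simp

lemma pt_split: "a \<in> carrier H ==> l \<in> carrier KP ==> T.pt a l = u l \<star> \<iota> a"
  by (simp add: T.pt_mult)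

lemma u_central: assumes "l \<in> carrier KP" "x \<in> carrier HP" shows "u l \<star> x = x \<star> u l"
  using assms(2)
proof (induction rule: T.TR_induct)
  case zero thus ?case using assms(1) by simp
next
  case (of a m) thus ?case using assms(1) by (simp add: T.pt_mult KP.m_comm)
next
  case (diff x y)
  show ?case unfolding T.TR.minus_distr[OF diff(1,2) u_closed[OF assms(1)]] diff(3,4) ..
qed

lemma LP_subfield: "subfield LP HP"
proof -
  have "(%l. u l) \<in> ring_hom KP HP" by (rule ring_hom_memI) (auto simp: u_ops u_one)
  then interpret h: ring_hom_ring KP HP "%l. u l" by (rule ring_hom_ringI2[OF KP.ring_axioms T.TR.ring_axioms])
  have "\<one>\<^bsub>HP\<^esub> \<noteq> \<zero>\<^bsub>HP\<^esub>" using u_zero_iff[of "\<one>\<^bsub>KP\<^esub>"] u_one by auto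
  thus ?thesis using h.img_is_subfield(2)[OF KP.carrier_is_subfield] by simp
qed

lemma HP_span:
  assumes "x \<in> carrier HP"
  shows "\<exists>a\<in>carrier KP. \<exists>b\<in>carrier KP. \<exists>c\<in>carrier KP. \<exists>d\<in>carrier KP.
    x = u a \<oplus>\<^bsub>HP\<^esub> u b \<star> \<iota> i \<oplus>\<^bsub>HP\<^esub> u c \<star> \<iota> j \<oplus>\<^bsub>HP\<^esub> u d \<star> (\<iota> i \<star> \<iota> j)"
  using assms
proof (induction rule: T.TR_induct)
  case zero
  show ?case by (rule bexI[of _ "\<zero>\<^bsub>KP\<^esub>"])+ (simp_all add: u_zero)
next
  case (of h l)
  obtain a b c d where q: "a \<in> K" "b \<in> K" "c \<in> K" "d \<in> K" "h = H.q a b c d" using H.q_exists[OF of(1)] .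
  have e: "T.pt (k \<otimes> x) l = u (toK k \<otimes>\<^bsub>KP\<^esub> l) \<star> \<iota> x" if "k \<in> K" "x \<in> carrier H" for k x
    using T.pt_balanced[of x k l] H.central[OF that] that of(2) toK(1)[of k] pt_split[of x "toK k \<otimes>\<^bsub>KP\<^esub> l"] by simp
  have "T.pt h l = T.pt (a \<otimes> \<one>) l \<oplus>\<^bsub>HP\<^esub> T.pt (b \<otimes> i) l \<oplus>\<^bsub>HP\<^esub> T.pt (c \<otimes> j) l \<oplus>\<^bsub>HP\<^esub> T.pt (d \<otimes> (i \<otimes> j)) l"
    using q of(2) by (simp add: H.q_def T.pt_add_left)
  also have "... = u (toK a \<otimes>\<^bsub>KP\<^esub> l) \<oplus>\<^bsub>HP\<^esub> u (toK b \<otimes>\<^bsub>KP\<^esub> l) \<star> \<iota> i \<oplus>\<^bsub>HP\<^esub> u (toK c \<otimes>\<^bsub>KP\<^esub> l) \<star> \<iota> j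
    \<oplus>\<^bsub>HP\<^esub> u (toK d \<otimes>\<^bsub>KP\<^esub> l) \<star> (\<iota> i \<star> \<iota> j)"
    using q(1-4) of(2) toK(1) T.pt_balanced[of "\<one>" a l] by (simp add: e u_one T.pt_mult del: H.L_carrier)
  finally show ?case using q(1-4) of(2) toK(1) by blast
next
  case (diff x y)
  obtain a b c d where x: "a \<in> carrier KP" "b \<in> carrier KP" "c \<in> carrier KP" "d \<in> carrier KP"
    "x = u a \<oplus>\<^bsub>HP\<^esub> u b \<star> \<iota> i \<oplus>\<^bsub>HP\<^esub> u c \<star> \<iota> j \<oplus>\<^bsub>HP\<^esub> u d \<star> (\<iota> i \<star> \<iota> j)" using diff(3) by blast
  obtain a' b' c' d' where y: "a' \<in> carrier KP" "b' \<in> carrier KP" "c' \<in> carrier KP" "d' \<in> carrier KP"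
    "y = u a' \<oplus>\<^bsub>HP\<^esub> u b' \<star> \<iota> i \<oplus>\<^bsub>HP\<^esub> u c' \<star> \<iota> j \<oplus>\<^bsub>HP\<^esub> u d' \<star> (\<iota> i \<star> \<iota> j)" using diff(4) by blast
  have I: "\<iota> i \<in> carrier HP" "\<iota> j \<in> carrier HP" by auto
  have "x \<ominus>\<^bsub>HP\<^esub> y = (u a \<ominus>\<^bsub>HP\<^esub> u a') \<oplus>\<^bsub>HP\<^esub> (u b \<ominus>\<^bsub>HP\<^esub> u b') \<star> \<iota> i \<oplus>\<^bsub>HP\<^esub> (u c \<ominus>\<^bsub>HP\<^esub> u c') \<star> \<iota> j
    \<oplus>\<^bsub>HP\<^esub> (u d \<ominus>\<^bsub>HP\<^esub> u d') \<star> (\<iota> i \<star> \<iota> j)"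
    unfolding x(5) y(5) using x(1-4)[THEN u_closed] y(1-4)[THEN u_closed] I by (intro T.TR.combination_minus T.TR.m_closed)
  also have "... = u (a \<ominus>\<^bsub>KP\<^esub> a') \<oplus>\<^bsub>HP\<^esub> u (b \<ominus>\<^bsub>KP\<^esub> b') \<star> \<iota> i \<oplus>\<^bsub>HP\<^esub> u (c \<ominus>\<^bsub>KP\<^esub> c') \<star> \<iota> j
    \<oplus>\<^bsub>HP\<^esub> u (d \<ominus>\<^bsub>KP\<^esub> d') \<star> (\<iota> i \<star> \<iota> j)"
    using x(1-4) y(1-4) by (simp add: u_ops(4))
  finally show ?case using x(1-4) y(1-4) KP.minus_closed by blast
qed

abbreviation s where "s \<equiv> local_involution H K P \<sigma>"

lemma s_simps:
  "x \<in> carrier HP ==> s x \<in> carrier HP" "x \<in> carrier HP ==> y \<in> carrier HP ==> s (x \<oplus>\<^bsub>HP\<^esub> y) = s x \<oplus>\<^bsub>HP\<^esub> s y"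
  "x \<in> carrier HP ==> y \<in> carrier HP ==> s (x \<star> y) = s y \<star> s x" "x \<in> carrier HP ==> s (s x) = x"
  "h \<in> carrier H ==> l \<in> carrier KP ==> s (T.pt h l) = T.pt (\<sigma> h) l"
  unfolding local_involution_def
  using T.tmap_closed[OF H.invol] T.tmap_add[OF H.invol] T.tmap_mult[OF H.invol] T.tmap_tmap[OF H.invol] T.tmap_pt[OF H.invol] by auto

lemma s_involution: "involution HP LP s"
  unfolding involution_def
proof (intro conjI ballI)
  show "s (k \<star> x) = k \<star> s x" if "k \<in> LP" "x \<in> carrier HP" for k x
    using that s_simps(1)[OF that(2)] u_central by (auto simp: s_simps)
qed (auto simp: s_simps)

lemma iota_hom: "(%h. \<iota> h) \<in> ring_hom H HP"
  by (rule ring_hom_memI) (auto simp: T.pt_add_left T.pt_mult T.pt_one)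

text \<open>The basis of \<open>H\<close> is carried along by \<open>\<iota>\<close>. That the
  squares and two do not vanish follows from the injectivity of the maps from \<open>K\<close> to
  the completion and from there to the tensor product.\<close>

lemma HP_quat: "quat HP LP (\<iota> i) (\<iota> j) s"
proof -
  have sq: "\<iota> x \<star> \<iota> x \<in> LP \<and> \<iota> x \<star> \<iota> x \<noteq> \<zero>\<^bsub>HP\<^esub>" if "x \<in> carrier H" "x \<otimes> x \<in> K" "x \<otimes> x \<noteq> \<zero>" for x
    using that iota_K[OF that(2)] toK(1)[OF that(2)] toK_nz[OF that(2,3)] u_zero_iff[of "toK (x \<otimes> x)"]
    by (auto simp: T.pt_mult)
  have "qalg HP LP (\<iota> i) (\<iota> j)"
  proof (rule qalg.intro[OF T.TR.ring_axioms], rule qalg_axioms.intro)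
    show "subfield LP HP" by (rule LP_subfield)
    show "k \<star> x = x \<star> k" if "k \<in> LP" "x \<in> carrier HP" for k x using that u_central by auto
    show "\<iota> i \<in> carrier HP" "\<iota> j \<in> carrier HP" by auto
    show "\<iota> i \<star> \<iota> i \<in> LP" "\<iota> i \<star> \<iota> i \<noteq> \<zero>\<^bsub>HP\<^esub>" using sq[of i] H.ii by auto
    show "\<iota> j \<star> \<iota> j \<in> LP" "\<iota> j \<star> \<iota> j \<noteq> \<zero>\<^bsub>HP\<^esub>" using sq[of j] H.jj by auto
    show "\<iota> j \<star> \<iota> i = \<ominus>\<^bsub>HP\<^esub> (\<iota> i \<star> \<iota> j)" by (simp add: T.pt_mult H.anti T.pt_uminus_left)
    show "\<exists>a\<in>LP. \<exists>b\<in>LP. \<exists>c\<in>LP. \<exists>d\<in>LP. x = a \<oplus>\<^bsub>HP\<^esub> b \<star> \<iota> i \<oplus>\<^bsub>HP\<^esub> c \<star> \<iota> j \<oplus>\<^bsub>HP\<^esub> d \<star> (\<iota> i \<star> \<iota> j)"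
      if "x \<in> carrier HP" for x using HP_span[OF that] by blast
    have t: "\<one>\<^bsub>HP\<^esub> \<oplus>\<^bsub>HP\<^esub> \<one>\<^bsub>HP\<^esub> = u (toK (\<one> \<oplus> \<one>))" using toK(2)[of "\<one>" "\<one>"] by (simp add: toK(4) u_ops u_one)
    show "\<one>\<^bsub>HP\<^esub> \<oplus>\<^bsub>HP\<^esub> \<one>\<^bsub>HP\<^esub> \<noteq> \<zero>\<^bsub>HP\<^esub>"
      unfolding t using toK_nz[OF _ H.two] u_zero_iff[of "toK (\<one> \<oplus> \<one>)"] toK(1) by auto
  qed
  thus ?thesis
  proof (rule quat.intro, intro quat_axioms.intro)
    show "involution HP LP s" by (rule s_involution)
    show "s (\<iota> i) = \<iota> i" "s (\<iota> j) = \<iota> j" by (simp_all add: s_simps H.sigma_i H.sigma_j)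
  qed
qed

end

section \<open>The filtration on the completed algebra\<close>

context lquat
begin

abbreviation DP where "DP n \<equiv> (%l. u l) ` BB n"

lemma HP_vquat: "vquat HP LP (\<iota> i) (\<iota> j) s (%n. DP n)"
proof -
  note bc = N.BB_carrier
  show ?thesis
  proof (rule vquat.intro[OF HP_quat], rule vquat_axioms.intro)
    show "DP n \<subseteq> LP" for n using bc by blast
    show "\<zero>\<^bsub>HP\<^esub> \<in> DP n" for n using N.BB_zero[of n] u_zero by (metis image_eqI)
    show "x \<oplus>\<^bsub>HP\<^esub> y \<in> DP n" if xy: "x \<in> DP n" "y \<in> DP n" for x y n
    proof -
      obtain b c where "b \<in> BB n" "c \<in> BB n" "x = u b" "y = u c" using xy by blast
      hence "x \<oplus>\<^bsub>HP\<^esub> y = u (b \<oplus>\<^bsub>KP\<^esub> c)" "b \<oplus>\<^bsub>KP\<^esub> c \<in> BB n" using u_ops(1)[of b c] bc N.BB_add by auto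
      thus ?thesis by blast
    qed
    show "\<ominus>\<^bsub>HP\<^esub> x \<in> DP n" if xy: "x \<in> DP n" for x n
    proof -
      obtain b where "b \<in> BB n" "x = u b" using xy by blast
      hence "\<ominus>\<^bsub>HP\<^esub> x = u (\<ominus>\<^bsub>KP\<^esub> b)" "\<ominus>\<^bsub>KP\<^esub> b \<in> BB n" using u_ops(3)[of b b] bc N.BB_uminus by auto
      thus ?thesis by blast
    qed
    show "x \<in> DP m" if "m \<le> n" "x \<in> DP n" for m n x using that N.BB_mono by blast
    show "x \<star> y \<in> DP (m + n)" if xy: "x \<in> DP m" "y \<in> DP n" for x y m n
    proof -
      obtain b c where "b \<in> BB m" "c \<in> BB n" "x = u b" "y = u c" using xy by blast
      hence "x \<star> y = u (b \<otimes>\<^bsub>KP\<^esub> c)" "b \<otimes>\<^bsub>KP\<^esub> c \<in> BB (m + n)" using u_ops(2)[of b c] bc N.BB_mult by auto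
      thus ?thesis by blast
    qed
    show "\<one>\<^bsub>HP\<^esub> \<in> DP 0" using N.BB_one u_one by (metis image_eqI)
    show "\<exists>c. \<forall>n. \<forall>x\<in>DP (n + c). l \<star> x \<in> DP n" if "l \<in> LP" for l
    proof -
      obtain m where m: "m \<in> carrier KP" "l = u m" using \<open>l \<in> LP\<close> by blast
      obtain c where c: "!!n b. b \<in> BB (n + c) ==> m \<otimes>\<^bsub>KP\<^esub> b \<in> BB n" using N.BB_scale[OF m(1)] by blast
      have "l \<star> x \<in> DP n" if xy: "x \<in> DP (n + c)" for x n
      proof -
        obtain b where b: "b \<in> BB (n + c)" "x = u b" using xy by blast
        hence "l \<star> x = u (m \<otimes>\<^bsub>KP\<^esub> b)" using u_ops(2)[OF m(1), of b] bc m by auto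
        thus ?thesis using c[OF b(1)] by blast
      qed
      thus ?thesis by blast
    qed
    show "\<one>\<^bsub>HP\<^esub> \<oplus>\<^bsub>HP\<^esub> d \<noteq> \<zero>\<^bsub>HP\<^esub> \<and> inv\<^bsub>HP\<^esub> (\<one>\<^bsub>HP\<^esub> \<oplus>\<^bsub>HP\<^esub> d) \<in> DP 0" if "d \<in> DP 1" for d
    proof -
      obtain b where b: "b \<in> BB 1" "d = u b" using \<open>d \<in> DP 1\<close> by blast
      have bC: "b \<in> carrier KP" "\<one>\<^bsub>KP\<^esub> \<oplus>\<^bsub>KP\<^esub> b \<in> carrier KP" using bc[OF b(1)] by auto
      obtain e where e: "e \<in> BB 0" "(\<one>\<^bsub>KP\<^esub> \<oplus>\<^bsub>KP\<^esub> b) \<otimes>\<^bsub>KP\<^esub> e = \<one>\<^bsub>KP\<^esub>" using N.BB_unit[OF b(1)] by blast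
      have ec: "e \<in> carrier KP" using bc[OF e(1)] .
      have 1: "\<one>\<^bsub>HP\<^esub> \<oplus>\<^bsub>HP\<^esub> d = u (\<one>\<^bsub>KP\<^esub> \<oplus>\<^bsub>KP\<^esub> b)" using u_ops(1)[of "\<one>\<^bsub>KP\<^esub>" b] bC b u_one by simp
      have 2: "(\<one>\<^bsub>HP\<^esub> \<oplus>\<^bsub>HP\<^esub> d) \<star> u e = \<one>\<^bsub>HP\<^esub>" unfolding 1 using u_ops(2)[OF bC(2) ec] e(2) u_one by simp
      have 3: "u e \<star> (\<one>\<^bsub>HP\<^esub> \<oplus>\<^bsub>HP\<^esub> d) = \<one>\<^bsub>HP\<^esub>" using 2 u_central[OF ec u_closed[OF bC(2)]] unfolding 1 by simp
      have c: "\<one>\<^bsub>HP\<^esub> \<oplus>\<^bsub>HP\<^esub> d \<in> carrier HP" unfolding 1 using bC by simp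
      have "inv\<^bsub>HP\<^esub> (\<one>\<^bsub>HP\<^esub> \<oplus>\<^bsub>HP\<^esub> d) = u e" by (rule quat.unit_if(2)[OF HP_quat c u_closed[OF ec] 2 3])
      moreover have "\<one>\<^bsub>HP\<^esub> \<oplus>\<^bsub>HP\<^esub> d \<noteq> \<zero>\<^bsub>HP\<^esub>" using 2 quat.one_nz[OF HP_quat] u_closed[OF ec] by auto
      ultimately show ?thesis using e(1) by auto
    qed
    show "\<iota> i \<star> \<iota> i \<in> DP 0" "\<iota> j \<star> \<iota> j \<in> DP 0"
      using iota_K[OF H.ii(1)] iota_K[OF H.jj(1)] toK_BB[OF H.ii(1), of 0] toK_BB[OF H.jj(1), of 0] HV.D_AB
      by (auto simp: T.pt_mult)
  qed
qed

lemma HP_qpair: "qpair H K i j \<sigma> (val_ge F P) HP LP (\<iota> i) (\<iota> j) s (%n. DP n) (%h. \<iota> h)"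
proof (rule qpair.intro[OF HV.vquat_axioms HP_vquat], rule qpair_axioms.intro)
  show "(%h. \<iota> h) \<in> ring_hom H HP" by (rule iota_hom)
  show "\<iota> k \<in> LP" if "k \<in> K" for k using iota_K[OF that] toK(1)[OF that] by blast
  show "\<iota> k \<in> DP n \<longleftrightarrow> k \<in> val_ge F P n" if "k \<in> K" for k n
  proof -
    have "u (toK k) \<in> DP n \<longleftrightarrow> toK k \<in> BB n" using u_inj[OF toK(1)[OF that] N.BB_carrier] by blast
    thus ?thesis using iota_K[OF that] toK_BB[OF that] by simp
  qed
  show "\<exists>k\<in>K. \<iota> k \<ominus>\<^bsub>HP\<^esub> l \<in> DP n" if lp: "l \<in> LP" for l n
  proof -
    obtain m where m: "m \<in> carrier KP" "l = u m" using lp by blast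
    obtain k where k: "k \<in> K" "toK k \<ominus>\<^bsub>KP\<^esub> m \<in> BB n" using N.BB_dense[OF m(1), of n] by auto
    have "\<iota> k \<ominus>\<^bsub>HP\<^esub> l = u (toK k \<ominus>\<^bsub>KP\<^esub> m)" using iota_K[OF k(1)] u_ops(4)[OF toK(1)[OF k(1)] m(1)] m(2) by simp
    thus ?thesis using k by blast
  qed
qed (rule refl)+

end

section \<open>Orders and their localizations\<close>

text \<open>The localized order inside \<open>H\<close>, an intermediate stage between an order and
  its completion at which approximations over the number field can be stated.\<close>

definition loc :: "('a, 'm) ring_scheme => 'a set => 'a set => 'a set => 'a set" where
  "loc H K P \<O> = {h \<in> carrier H. \<exists>s\<in>ring_of_integers (base_field H K) - P. s \<otimes>\<^bsub>H\<^esub> h \<in> \<O>}"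

lemma (in ring) Span_Cons: "Span K (v # Vs) = line_extension K v (Span K Vs)" and Span_Nil: "Span K [] = {\<zero>}"
  by simp_all

locale norder = nquat + fixes \<O> assumes order: "involution_order H K \<sigma> \<O>"
begin

abbreviation oK where "oK \<equiv> ring_of_integers F"

lemma oK_K: "k \<in> oK ==> k \<in> K" using F.ZK_carrier by auto
lemma oK_H [simp]: "k \<in> oK ==> k \<in> carrier H" using oK_K by auto
lemma oK_closed: "k \<in> oK ==> l \<in> oK ==> k \<otimes> l \<in> oK" "k \<in> oK ==> l \<in> oK ==> k \<oplus> l \<in> oK"
  "\<one> \<in> oK" "\<zero> \<in> oK"
  using F.ZK_mult[of k l] F.ZK_add[of k l] F.ZK_one F.ZK_zero by simp_all

lemma O_subring: "subring \<O> H" using order by (simp add: involution_order_def algebra_order_def)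

lemmas O_ops = subringE(2,3,5,6,7)[OF O_subring]

lemma O_H: "x \<in> \<O> ==> x \<in> carrier H" using subringE(1)[OF O_subring] by blast

lemma O_sigma: "x \<in> \<O> ==> \<sigma> x \<in> \<O>" using order by (auto simp: involution_order_def)

text \<open>The span over the integers is an iterated line extension; its closure under scalars is
  proved by induction on the generators.\<close>

lemma O_scale: assumes "k \<in> oK" "x \<in> \<O>" shows "k \<otimes> x \<in> \<O>"
proof -
  obtain Us where Us: "set Us \<subseteq> \<O>" "H.Span oK Us = \<O>" using order by (auto simp: involution_order_def algebra_order_def)
  have "k \<otimes> y \<in> H.Span oK Vs" if "y \<in> H.Span oK Vs" "set Vs \<subseteq> \<O>" for y Vs
    using that
  proof (induction Vs arbitrary: y)
    case Nil thus ?case using assms(1) by simp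
  next
    case (Cons v Vs)
    then obtain c w where cw: "c \<in> oK" "w \<in> H.Span oK Vs" "y = c \<otimes> v \<oplus> w"
      by (auto simp: H.Span_Cons H.line_extension_mem_iff simp del: H.Span.simps)
    have wc: "w \<in> carrier H" using cw(2) Cons.prems(2) H.Span_in_carrier[of oK Vs] O_H oK_H by (auto simp: subset_eq)
    have vc: "v \<in> carrier H" using Cons.prems O_H by auto
    have "k \<otimes> y = (k \<otimes> c) \<otimes> v \<oplus> k \<otimes> w" unfolding cw(3) using wc vc cw(1) assms(1) by (simp add: H.r_distr H.m_assoc)
    thus ?case using Cons.IH[OF cw(2)] Cons.prems oK_closed(1)[OF assms(1) cw(1)]
      by (auto simp: H.Span_Cons H.line_extension_mem_iff simp del: H.Span.simps)
  qed
  thus ?thesis using Us assms(2) by blast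
qed

lemma common_denominator:
  assumes "s \<in> oK" "t \<in> oK" "s \<noteq> \<zero>" "t \<noteq> \<zero>" shows "s \<otimes> t \<in> oK" "s \<otimes> t \<noteq> \<zero>"
  using oK_closed(1)[OF assms(1,2)] H.L_cancel[OF oK_K[OF assms(1)] assms(3), of t] assms by auto

lemma O_denominator: assumes "h \<in> carrier H" shows "\<exists>s\<in>oK. s \<noteq> \<zero> \<and> s \<otimes> h \<in> \<O>"
proof -
  obtain Vs where Vs: "set Vs \<subseteq> \<O>" "H.Span K Vs = carrier H" using order by (auto simp: involution_order_def algebra_order_def)
  have "\<exists>s\<in>oK. s \<noteq> \<zero> \<and> s \<otimes> y \<in> \<O>" if "y \<in> H.Span K Vs" "set Vs \<subseteq> \<O>" for y Vs
    using that
  proof (induction Vs arbitrary: y)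
    case Nil
    thus ?case using oK_closed(3) O_ops(1) H.one_nz by auto
  next
    case (Cons v Vs)
    then obtain c w where cw: "c \<in> K" "w \<in> H.Span K Vs" "y = c \<otimes> v \<oplus> w"
      by (auto simp: H.Span_Cons H.line_extension_mem_iff simp del: H.Span.simps)
    have wc: "w \<in> carrier H" using cw(2) Cons.prems(2) H.Span_in_carrier[of K Vs] O_H by (auto simp: subset_eq)
    have vc: "v \<in> carrier H" "v \<in> \<O>" using Cons.prems O_H by auto
    obtain s where s: "s \<in> oK" "s \<noteq> \<zero>" "s \<otimes> w \<in> \<O>" using Cons.IH[OF cw(2)] Cons.prems by auto
    obtain t where t: "t \<in> oK" "t \<noteq> \<zero>" "t \<otimes> c \<in> oK" using F.fraction[of c] cw(1) by auto
    have "(s \<otimes> t) \<otimes> y = s \<otimes> ((t \<otimes> c) \<otimes> v) \<oplus> t \<otimes> (s \<otimes> w)"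
      unfolding cw(3) using wc vc cw(1) s t H.central[OF oK_K[OF t(1)], of s]
      by (simp add: H.r_distr H.m_assoc H.L_left[OF oK_K[OF t(1)], of s])
    also have "... \<in> \<O>" by (intro O_ops(5) O_scale s t vc)
    finally show ?case using common_denominator[OF s(1) t(1) s(2) t(2)] by blast
  qed
  thus ?thesis using Vs assms by blast
qed

abbreviation OP where "OP P \<equiv> loc H K P \<O>"

lemma O_OP: "P \<in> Pr ==> x \<in> \<O> ==> x \<in> OP P"
  using O_H[of x] oK_closed(3) number_prime.one_notin_P[OF F.number_prime_I[of P]]
  unfolding loc_def by (auto intro!: bexI[of _ "\<one>"])

lemma OP_H: "x \<in> OP P ==> x \<in> carrier H" by (simp add: loc_def)

text \<open>The integers that multiply \<open>h\<close> into the order form a nonzero ideal. It lies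
  in no prime, because \<open>h\<close> is in every localization, so it contains \<one>.\<close>

lemma O_Inter:
  assumes h: "h \<in> carrier H" and P: "!!P. P \<in> Pr ==> h \<in> OP P" shows "h \<in> \<O>"
proof (rule ccontr)
  assume "h \<notin> \<O>"
  define I where "I = {r \<in> oK. r \<otimes> h \<in> \<O>}"
  have "F.zideal I" unfolding F.zideal_def
  proof (intro conjI ballI)
    show "x \<oplus>\<^bsub>F\<^esub> y \<in> I" if "x \<in> I" "y \<in> I" for x y
      using that h O_ops(5) oK_closed(2) by (auto simp: I_def H.l_distr)
    show "a \<otimes>\<^bsub>F\<^esub> x \<in> I" if "a \<in> oK" "x \<in> I" for a x
      using that h O_scale oK_closed(1) by (auto simp: I_def H.m_assoc)
  qed (use h O_ops(1) oK_closed(4) in \<open>auto simp: I_def\<close>)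
  moreover have "\<one>\<^bsub>F\<^esub> \<notin> I" using h \<open>h \<notin> \<O>\<close> by (auto simp: I_def)
  moreover obtain s where "s \<in> I" "s \<noteq> \<zero>" using O_denominator[OF h] by (auto simp: I_def)
  ultimately obtain P where "P \<in> Pr" "I \<subseteq> P" using F.ideal_in_prime[of I s] by auto
  thus False using P[of P] by (auto simp: loc_def I_def)
qed

end

context norder
begin

lemma OP_props:
  assumes P: "P \<in> Pr"
  shows "x \<in> OP P ==> y \<in> OP P ==> x \<oplus> y \<in> OP P" "x \<in> OP P ==> y \<in> OP P ==> x \<otimes> y \<in> OP P"
    "x \<in> OP P ==> \<ominus> x \<in> OP P" "x \<in> OP P ==> \<sigma> x \<in> OP P"
    "l \<in> val_ge F P 0 ==> x \<in> OP P ==> l \<otimes> x \<in> OP P"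
proof -
  interpret N: number_prime F P by (rule F.number_prime_I[OF P])
  have Sm: "s \<otimes> t \<in> oK - P" if "s \<in> oK - P" "t \<in> oK - P" for s t using N.S_mult that by auto
  have SK: "s \<in> K" "s \<in> carrier H" "s \<in> oK" if "s \<in> oK - P" for s using that oK_K by auto
  {
    assume xy: "x \<in> OP P" "y \<in> OP P"
    obtain s t where s: "s \<in> oK - P" "s \<otimes> x \<in> \<O>" "x \<in> carrier H" and t: "t \<in> oK - P" "t \<otimes> y \<in> \<O>" "y \<in> carrier H"
      using xy by (auto simp: loc_def)
    note sk = SK[OF s(1)] and tk = SK[OF t(1)]
    have "(s \<otimes> t) \<otimes> (x \<oplus> y) = t \<otimes> (s \<otimes> x) \<oplus> s \<otimes> (t \<otimes> y)"
      using s t sk tk by (simp add: H.r_distr H.m_assoc H.L_left[OF tk(1) sk(2)])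
    also have "... \<in> \<O>" by (intro O_ops(5) O_scale s t sk tk)
    finally show "x \<oplus> y \<in> OP P" using Sm[OF s(1) t(1)] s t by (auto simp: loc_def)
    have "(s \<otimes> t) \<otimes> (x \<otimes> y) = (s \<otimes> x) \<otimes> (t \<otimes> y)"
      using H.term_mult[OF sk(1) tk(1) s(3) t(3)] by simp
    also have "... \<in> \<O>" by (intro O_ops(4) s t)
    finally show "x \<otimes> y \<in> OP P" using Sm[OF s(1) t(1)] s t by (auto simp: loc_def)
  }
  show "\<ominus> x \<in> OP P" "\<sigma> x \<in> OP P" if "x \<in> OP P"
  proof -
    obtain s where s: "s \<in> oK - P" "s \<otimes> x \<in> \<O>" "x \<in> carrier H" using \<open>x \<in> OP P\<close> by (auto simp: loc_def)
    note sk = SK[OF s(1)]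
    have "s \<otimes> (\<ominus> x) \<in> \<O>" "s \<otimes> \<sigma> x \<in> \<O>"
      using O_ops(3)[OF s(2)] O_sigma[OF s(2)] s(3) sk by (simp_all add: H.r_minus H.sigma_scale)
    thus "\<ominus> x \<in> OP P" "\<sigma> x \<in> OP P" using s by (auto simp: loc_def)
  qed
  show "l \<otimes> x \<in> OP P" if "l \<in> val_ge F P 0" "x \<in> OP P"
  proof -
    obtain s where s: "s \<in> oK - P" "s \<otimes> x \<in> \<O>" "x \<in> carrier H" using \<open>x \<in> OP P\<close> by (auto simp: loc_def)
    obtain t where t: "t \<in> oK - P" "t \<otimes> l \<in> oK" "l \<in> K" using \<open>l \<in> val_ge F P 0\<close> N.V0_iff[of l] by auto
    note sk = SK[OF s(1)] and tk = SK[OF t(1)]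
    have "(t \<otimes> s) \<otimes> (l \<otimes> x) = (t \<otimes> l) \<otimes> (s \<otimes> x)"
      using t(3) s(3) sk tk by (simp add: H.m_assoc H.L_left[OF t(3) sk(2)])
    also have "... \<in> \<O>" by (intro O_scale s t)
    finally show ?thesis using Sm[OF t(1) s(1)] s t by (auto simp: loc_def)
  qed
qed

lemma finite_denominator:
  assumes "finite A" "A \<subseteq> carrier H" shows "\<exists>s\<in>oK. s \<noteq> \<zero> \<and> (\<forall>h\<in>A. s \<otimes> h \<in> \<O>)"
  using assms
proof (induction A rule: finite_induct)
  case empty thus ?case using oK_closed(3) H.one_nz by blast
next
  case (insert h A)
  obtain s where s: "s \<in> oK" "s \<noteq> \<zero>" "!!x. x \<in> A ==> s \<otimes> x \<in> \<O>" using insert by auto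
  obtain t where t: "t \<in> oK" "t \<noteq> \<zero>" "t \<otimes> h \<in> \<O>" using O_denominator[of h] insert by auto
  have "(s \<otimes> t) \<otimes> h = s \<otimes> (t \<otimes> h)" using s t insert by (simp add: H.m_assoc)
  moreover have "(s \<otimes> t) \<otimes> x = t \<otimes> (s \<otimes> x)" if "x \<in> A" for x
    using s(1) t(1) that insert.prems H.L_comm[OF oK_K[OF s(1)] oK_K[OF t(1)]] by (auto simp: H.m_assoc)
  ultimately show ?case using common_denominator[OF s(1) t(1) s(2) t(2)] O_scale s t by (intro bexI[of _ "s \<otimes> t"]) auto
qed

lemma basis_denominator:
  "\<exists>t\<in>oK. t \<noteq> \<zero> \<and> t \<in> \<O> \<and> t \<otimes> i \<in> \<O> \<and> t \<otimes> j \<in> \<O> \<and> t \<otimes> (i \<otimes> j) \<in> \<O>"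
  using finite_denominator[of "{\<one>, i, j, i \<otimes> j}"] by auto

text \<open>\<open>s\<close> is a common denominator, with respect to \<open>\<O>\<close>, of
  finitely many generators of \<open>\<O>'\<close>.\<close>

lemma order_comparison:
  assumes "involution_order H K \<sigma> \<O>'"
  shows "\<exists>s\<in>oK. s \<noteq> \<zero> \<and> (\<forall>x\<in>\<O>'. s \<otimes> x \<in> \<O>)"
proof -
  interpret O': norder H K i j \<sigma> \<O>' by unfold_locales (rule assms)
  obtain Us where Us: "set Us \<subseteq> \<O>'" "H.Span oK Us = \<O>'" using assms by (auto simp: involution_order_def algebra_order_def)
  have Uc: "set Us \<subseteq> carrier H" using Us(1) O'.O_H by blast
  obtain s where s: "s \<in> oK" "s \<noteq> \<zero>" "\<forall>h\<in>set Us. s \<otimes> h \<in> \<O>" using finite_denominator[OF _ Uc] by auto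
  have "s \<otimes> x \<in> \<O>" if "x \<in> H.Span oK Vs" "set Vs \<subseteq> set Us" for x Vs
    using that
  proof (induction Vs arbitrary: x)
    case Nil thus ?case using s(1) O_ops(1) by simp
  next
    case (Cons v Vs)
    then obtain c w where cw: "c \<in> oK" "w \<in> H.Span oK Vs" "x = c \<otimes> v \<oplus> w"
      by (auto simp: H.Span_Cons H.line_extension_mem_iff simp del: H.Span.simps)
    have wc: "w \<in> carrier H" "v \<in> carrier H" using cw(2) Cons.prems(2) Uc H.Span_in_carrier[of oK Vs] oK_H by (auto simp: subset_eq)
    have "s \<otimes> x = c \<otimes> (s \<otimes> v) \<oplus> s \<otimes> w"
      unfolding cw(3) using wc cw(1) s(1) by (simp add: H.r_distr H.L_left[OF oK_K[OF cw(1)], of s])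
    moreover have "s \<otimes> v \<in> \<O>" "s \<otimes> w \<in> \<O>" using Cons.IH[OF cw(2)] Cons.prems(2) s(3) by auto
    ultimately show ?case using O_ops(5) O_scale[OF cw(1)] by simp
  qed
  thus ?thesis using Us s by blast
qed

lemma loc_subset:
  assumes P: "P \<in> Pr" and s: "s \<in> oK - P" "\<forall>x\<in>\<O>'. s \<otimes> x \<in> \<O>"
  shows "loc H K P \<O>' \<subseteq> loc H K P \<O>"
proof
  interpret N: number_prime F P by (rule F.number_prime_I[OF P])
  fix x assume "x \<in> loc H K P \<O>'"
  then obtain t where t: "x \<in> carrier H" "t \<in> oK - P" "t \<otimes> x \<in> \<O>'" by (auto simp: loc_def)
  hence "(s \<otimes> t) \<otimes> x \<in> \<O>" using s by (auto simp: H.m_assoc)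
  thus "x \<in> loc H K P \<O>" using t N.S_mult[OF s(1) t(2)] by (auto simp: loc_def)
qed

text \<open>Each order is multiplied into the other by a nonzero integer. At a prime containing
  neither of the two integers the localizations agree.\<close>

lemma loc_eq_almost_all:
  assumes O': "involution_order H K \<sigma> \<O>'"
  shows "finite {P \<in> Pr. loc H K P \<O> \<noteq> loc H K P \<O>'}"
proof -
  interpret O': norder H K i j \<sigma> \<O>' by unfold_locales (rule O')
  obtain s where s: "s \<in> oK" "s \<noteq> \<zero>" "\<forall>x\<in>\<O>'. s \<otimes> x \<in> \<O>" using order_comparison[OF O'] by blast
  obtain t where t: "t \<in> oK" "t \<noteq> \<zero>" "\<forall>x\<in>\<O>. t \<otimes> x \<in> \<O>'" using O'.order_comparison[OF order] by blast
  have "{P \<in> Pr. loc H K P \<O> \<noteq> loc H K P \<O>'} \<subseteq> {P \<in> Pr. s \<in> P} \<union> {P \<in> Pr. t \<in> P}"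
    using loc_subset[OF _ _ s(3)] O'.loc_subset[OF _ _ t(3)] s(1) t(1) by blast
  moreover have "finite ({P \<in> Pr. s \<in> P} \<union> {P \<in> Pr. t \<in> P})"
    using F.finite_primes_containing[of s] F.finite_primes_containing[of t] s t by simp
  ultimately show ?thesis by (rule finite_subset)
qed

end

locale nlorder = norder + lquat
begin

text \<open>The integer \<open>t\<close> multiplies the basis into the order. Coordinates small
  enough at \<open>P\<close> to absorb \<open>inv t\<close> therefore give elements of the localized
  order, which is thus open.\<close>

lemma UU_OP: "\<exists>c. HV.UU c \<subseteq> OP P"
proof -
  obtain t where t: "t \<in> oK" "t \<noteq> \<zero>" "t \<in> \<O>" "t \<otimes> i \<in> \<O>" "t \<otimes> j \<in> \<O>" "t \<otimes> (i \<otimes> j) \<in> \<O>"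
    using basis_denominator by blast
  note ti = H.L_inv[OF oK_K[OF t(1)] t(2)]
  obtain c where c: "!!n x. x \<in> val_ge F P (n + c) ==> inv t \<otimes> x \<in> val_ge F P n" using HV.D_scale[OF ti(1)] by blast
  have e: "a \<otimes> x \<in> OP P" if "a \<in> val_ge F P c" "t \<otimes> x \<in> \<O>" "x \<in> carrier H" for a x
  proof -
    have ak: "a \<in> K" using HV.D_in_L[OF that(1)] .
    have "a \<otimes> x = (inv t \<otimes> a) \<otimes> (t \<otimes> x)"
      using H.term_mult[OF ti(1) oK_K[OF t(1)], of a x] ak that(3) t(1) ti by simp
    thus ?thesis using OP_props(5)[OF P_prime c[of a 0] O_OP[OF P_prime that(2)]] that(1) by simp
  qed
  have "HV.UU c \<subseteq> OP P"
  proof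
    fix x assume "x \<in> HV.UU c"
    then obtain a b d f where x: "a \<in> val_ge F P c" "b \<in> val_ge F P c" "d \<in> val_ge F P c" "f \<in> val_ge F P c" "x = H.q a b d f"
      by (rule HV.UU_E)
    have "a \<otimes> \<one> \<in> OP P" by (rule e[OF x(1)]) (use t in auto)
    hence "a \<in> OP P" using HV.D_in_L[OF x(1)] by simp
    thus "x \<in> OP P" unfolding x(5) H.q_def
      by (intro OP_props(1)[OF P_prime] e x t H.ij_closed H.m_closed)
  qed
  thus ?thesis by blast
qed

section \<open>The completed order\<close>

abbreviation LO where "LO \<equiv> local_order H K P \<O>"
abbreviation UP where "UP n \<equiv> vquat.UU HP (\<iota> i) (\<iota> j) (%n. DP n) n"

lemma LO_def': "LO = generate (add_monoid HP) {T.pt x l | x l. x \<in> \<O> \<and> l \<in> BB 0}"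
  by (simp add: local_order_def local_algebra_def N.completion_integers_BB)

lemma gens_HP: "{T.pt x l | x l. x \<in> \<O> \<and> l \<in> BB 0} \<subseteq> carrier HP"
  using O_H N.BB_carrier by auto

lemma LO_HP: "x \<in> LO ==> x \<in> carrier HP"
  unfolding LO_def' by (rule T.TR.add.generate_in_carrier[OF gens_HP])

lemma LO_zero: "\<zero>\<^bsub>HP\<^esub> \<in> LO" using generate.one[of "add_monoid HP"] by (simp add: LO_def')

lemma LO_gen: "x \<in> \<O> ==> l \<in> BB 0 ==> T.pt x l \<in> LO" unfolding LO_def' by (rule generate.incl) blast

lemma LO_add: "x \<in> LO ==> y \<in> LO ==> x \<oplus>\<^bsub>HP\<^esub> y \<in> LO" using generate.eng[of x "add_monoid HP" _ y] by (simp add: LO_def')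

text \<open>The sign of a negated generator can be moved into the factor from the order, so sums of
  pure tensors exhaust the generated group.\<close>

lemma LO_induct [consumes 1, case_names zero gen add]:
  assumes "x \<in> LO" "Q \<zero>\<^bsub>HP\<^esub>" "!!x l. x \<in> \<O> ==> l \<in> BB 0 ==> Q (T.pt x l)"
    "!!x y. x \<in> LO ==> y \<in> LO ==> Q x ==> Q y ==> Q (x \<oplus>\<^bsub>HP\<^esub> y)"
  shows "Q x"
  using assms(1) unfolding LO_def'
proof (induction rule: generate.induct)
  case one thus ?case using assms(2) by simp
next
  case (incl h) thus ?case using assms(3) by blast
next
  case (inv h)
  then obtain y l where y: "h = T.pt y l" "y \<in> \<O>" "l \<in> BB 0" by blast
  have "inv\<^bsub>add_monoid HP\<^esub> h = \<ominus>\<^bsub>HP\<^esub> h" by (simp only: a_inv_def)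
  also have "... = T.pt (\<ominus> y) l" unfolding y(1) using T.pt_uminus_left[OF O_H[OF y(2)] N.BB_carrier[OF y(3)]] by simp
  finally have "inv\<^bsub>add_monoid HP\<^esub> h = T.pt (\<ominus> y) l" .
  thus ?case using assms(3)[OF O_ops(3)[OF y(2)] y(3)] by simp
next
  case (eng x y) thus ?case using assms(4)[of x y] by (simp add: LO_def')
qed

lemma LO_mult: "x \<in> LO ==> y \<in> LO ==> x \<star> y \<in> LO"
proof (induction rule: LO_induct)
  case zero thus ?case using LO_HP LO_zero by simp
next
  case (gen x l)
  from gen(3) show ?case
  proof (induction rule: LO_induct)
    case zero thus ?case using gen O_H N.BB_carrier LO_zero by simp
  next
    case (gen y m)
    thus ?case using LO_gen[OF O_ops(4)[of x y]] N.BB_mult[of l 0 m 0] \<open>x \<in> \<O>\<close> \<open>l \<in> BB 0\<close> O_H N.BB_carrier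
      by (simp add: T.pt_mult)
  next
    case (add y z)
    have "T.pt x l \<in> carrier HP" using gen O_H N.BB_carrier by simp
    thus ?case using add LO_add LO_HP by (simp add: T.TR.r_distr)
  qed
next
  case (add x y) thus ?case using LO_add LO_HP by (simp add: T.TR.l_distr)
qed

lemma LO_uminus: "x \<in> LO ==> \<ominus>\<^bsub>HP\<^esub> x \<in> LO"
  unfolding LO_def' by (rule T.TR.add.generate_m_inv_closed[OF gens_HP])

lemma LO_s: "x \<in> LO ==> s x \<in> LO"
proof (induction rule: LO_induct)
  case zero
  have "s (T.pt \<zero> \<one>\<^bsub>KP\<^esub>) = T.pt (\<sigma> \<zero>) \<one>\<^bsub>KP\<^esub>" by (rule s_simps(5)) auto
  thus ?case using LO_zero by (simp add: T.pt_zero_left)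
next
  case (gen x l) thus ?case using O_H N.BB_carrier LO_gen O_sigma by (simp add: s_simps)
next
  case (add x y) thus ?case using LO_add LO_HP by (simp add: s_simps)
qed

text \<open>A denominator outside \<open>P\<close> is a unit among the integers of the completion,
  so it can be moved into the second tensor factor.\<close>

lemma OP_LO: assumes "h \<in> OP P" shows "\<iota> h \<in> LO"
proof -
  obtain s where s: "s \<in> oK - P" "s \<otimes> h \<in> \<O>" "h \<in> carrier H" using assms by (auto simp: loc_def)
  have sK: "s \<in> K" "s \<noteq> \<zero>" using s(1) oK_K N.S_nz[of s] by auto
  note si = H.L_inv[OF sK]
  have "s \<otimes>\<^bsub>F\<^esub> (inv s) \<in> oK" using si oK_closed(3) by simp
  hence "inv s \<in> val_ge F P 0" unfolding N.V0_iff using s(1) si(1) by auto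
  hence 1: "toK (inv s) \<in> BB 0" using toK_BB[OF si(1)] by simp
  have "\<iota> h = \<iota> ((s \<otimes> h) \<otimes> inv s)"
    using H.central[OF si(1), of "s \<otimes> h"] s(3) sK(1) si by (simp add: H.m_assoc[symmetric])
  also have "... = T.pt (s \<otimes> h) (toK (inv s))" using T.pt_balanced[OF O_H[OF s(2)] si(1), of "\<one>\<^bsub>KP\<^esub>"] toK(1)[OF si(1)] by simp
  finally show ?thesis using LO_gen[OF s(2) 1] by simp
qed

text \<open>In a pure tensor the second factor is replaced by a nearby element of \<open>K\<close>,
  which is integral at \<open>P\<close> as well; the tensor then comes from the localized
  order.\<close>

lemma LO_approx: "x \<in> LO ==> \<exists>h\<in>OP P. x \<ominus>\<^bsub>HP\<^esub> \<iota> h \<in> UP n"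
proof (induction rule: LO_induct)
  case zero
  have "\<zero> \<in> OP P" using O_OP[OF P_prime O_ops(1)] .
  moreover have "\<zero>\<^bsub>HP\<^esub> \<ominus>\<^bsub>HP\<^esub> \<iota> \<zero> \<in> UP n" using vquat.UU_zero[OF HP_vquat, of n] by (simp add: T.pt_zero_left a_minus_def)
  ultimately show ?case by blast
next
  case (gen x l)
  note xc = O_H[OF gen(1)] and lc = N.BB_carrier[OF gen(2)]
  have ixc: "\<iota> x \<in> carrier HP" using xc by simp
  obtain c where c: "!!n y. y \<in> UP (n + c) ==> y \<star> \<iota> x \<in> UP n" using vquat.UU_scale[OF HP_vquat ixc] by blast
  obtain k where "k \<in> carrier F" "toK k \<ominus>\<^bsub>KP\<^esub> l \<in> BB (n + c)" using N.BB_dense[OF lc, of "n + c"] by blast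
  hence k: "k \<in> K" "toK k \<ominus>\<^bsub>KP\<^esub> l \<in> BB (n + c)" by auto
  note kc = toK(1)[OF k(1)]
  have "toK k = (toK k \<ominus>\<^bsub>KP\<^esub> l) \<oplus>\<^bsub>KP\<^esub> l" using kc lc by (simp add: a_minus_def KP.a_assoc KP.l_neg)
  hence "toK k \<in> BB 0" using N.BB_add[OF N.BB_mono[OF _ k(2)] gen(2)] by simp
  hence kx: "k \<otimes> x \<in> OP P" using OP_props(5)[OF P_prime _ O_OP[OF P_prime gen(1)]] toK_BB[OF k(1)] by simp
  have "\<iota> (k \<otimes> x) = T.pt x (toK k)" using T.pt_balanced[OF xc k(1), of "\<one>\<^bsub>KP\<^esub>"] kc H.central[OF k(1) xc] by simp
  hence "T.pt x l \<ominus>\<^bsub>HP\<^esub> \<iota> (k \<otimes> x) = u (\<ominus>\<^bsub>KP\<^esub> (toK k \<ominus>\<^bsub>KP\<^esub> l)) \<star> \<iota> x"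
    using xc lc kc pt_split[OF xc, of "\<ominus>\<^bsub>KP\<^esub> (toK k \<ominus>\<^bsub>KP\<^esub> l)"]
    by (simp add: a_minus_def T.pt_uminus_right[symmetric] T.pt_add_right[symmetric] KP.minus_add KP.a_comm)
  also have "... \<in> UP n"
  proof (rule c)
    have "u (\<ominus>\<^bsub>KP\<^esub> (toK k \<ominus>\<^bsub>KP\<^esub> l)) \<in> DP (n + c)" using N.BB_uminus[OF k(2)] by blast
    thus "u (\<ominus>\<^bsub>KP\<^esub> (toK k \<ominus>\<^bsub>KP\<^esub> l)) \<in> UP (n + c)"
      using vquat.D_UU[OF HP_vquat vquat.D_in_L[OF HP_vquat]] by blast
  qed
  finally show ?case using kx by blast
next
  case (add x y)
  obtain h g where h: "h \<in> OP P" "x \<ominus>\<^bsub>HP\<^esub> \<iota> h \<in> UP n" and g: "g \<in> OP P" "y \<ominus>\<^bsub>HP\<^esub> \<iota> g \<in> UP n" using add by blast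
  have c: "x \<in> carrier HP" "y \<in> carrier HP" "\<iota> h \<in> carrier HP" "\<iota> g \<in> carrier HP" "h \<in> carrier H" "g \<in> carrier H"
    using add LO_HP OP_H h(1) g(1) by auto
  have "(x \<oplus>\<^bsub>HP\<^esub> y) \<ominus>\<^bsub>HP\<^esub> \<iota> (h \<oplus> g) = (x \<ominus>\<^bsub>HP\<^esub> \<iota> h) \<oplus>\<^bsub>HP\<^esub> (y \<ominus>\<^bsub>HP\<^esub> \<iota> g)"
    using c by (simp add: T.pt_add_left a_minus_def T.TR.minus_add T.TR.a_ac)
  thus ?case using vquat.UU_add[OF HP_vquat h(2) g(2)] OP_props(1)[OF P_prime h(1) g(1)] by metis
qed

text \<open>Approximate \<open>\<iota> h\<close> by some \<open>\<iota> g\<close> with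
  \<open>g\<close> in the localized order. By \<open>iota_UU\<close> the difference
  \<open>h \<ominus> g\<close> is small in \<open>H\<close> itself, so it lies in the open set
  \<open>OP P\<close>.\<close>

lemma LO_OP: assumes h: "h \<in> carrier H" "\<iota> h \<in> LO" shows "h \<in> OP P"
proof -
  obtain c where c: "HV.UU c \<subseteq> OP P" using UU_OP by blast
  obtain g where g: "g \<in> OP P" "\<iota> h \<ominus>\<^bsub>HP\<^esub> \<iota> g \<in> UP c" using LO_approx[OF h(2)] by blast
  note gc = OP_H[OF g(1)]
  have "\<iota> (h \<ominus> g) = \<iota> h \<ominus>\<^bsub>HP\<^esub> \<iota> g" using h gc by (simp add: a_minus_def T.pt_add_left T.pt_uminus_left)
  hence "h \<ominus> g \<in> HV.UU c" using qpair.iota_UU[OF HP_qpair, of "h \<ominus> g" c] g h gc by simp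
  hence "(h \<ominus> g) \<oplus> g \<in> OP P" using OP_props(1)[OF P_prime _ g(1)] c by blast
  thus ?thesis using h gc by (simp add: a_minus_def H.a_assoc H.l_neg)
qed

lemma UP_LO: "\<exists>c. UP c \<subseteq> LO"
proof -
  obtain t where t: "t \<in> oK" "t \<noteq> \<zero>" "t \<in> \<O>" "t \<otimes> i \<in> \<O>" "t \<otimes> j \<in> \<O>" "t \<otimes> (i \<otimes> j) \<in> \<O>"
    using basis_denominator by blast
  note tK = oK_K[OF t(1)]
  note ti = H.L_inv[OF tK t(2)]
  obtain c where c: "!!n x. x \<in> BB (n + c) ==> toK (inv t) \<otimes>\<^bsub>KP\<^esub> x \<in> BB n" using N.BB_scale[OF toK(1)[OF ti(1)]] by blast
  have e: "u a \<star> \<iota> x \<in> LO" if a: "a \<in> BB c" and x: "t \<otimes> x \<in> \<O>" "x \<in> carrier H" for a x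
  proof -
    define m where "m = toK (inv t) \<otimes>\<^bsub>KP\<^esub> a"
    note ac = N.BB_carrier[OF a]
    have m: "m \<in> BB 0" "m \<in> carrier KP" using c[of a 0] a N.BB_carrier by (auto simp: m_def)
    have "toK t \<otimes>\<^bsub>KP\<^esub> toK (inv t) = \<one>\<^bsub>KP\<^esub>" using toK(3)[OF tK ti(1)] ti(2) toK(4) by simp
    hence "toK t \<otimes>\<^bsub>KP\<^esub> m = a" using toK(1)[OF tK] toK(1)[OF ti(1)] ac by (simp add: m_def KP.m_assoc[symmetric])
    hence "u a \<star> \<iota> x = T.pt (x \<otimes> t) m" using T.pt_balanced[OF x(2) tK m(2)] pt_split[OF x(2) ac] by simp
    also have "x \<otimes> t = t \<otimes> x" using H.central[OF tK x(2)] by simp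
    finally show ?thesis using LO_gen[OF x(1) m(1)] by simp
  qed
  have "UP c \<subseteq> LO"
  proof
    fix x assume "x \<in> UP c"
    then obtain a' b' d' f' where "a' \<in> DP c" "b' \<in> DP c" "d' \<in> DP c" "f' \<in> DP c" "x = qalg.q HP (\<iota> i) (\<iota> j) a' b' d' f'"
      using vquat.UU_E[OF HP_vquat] by metis
    then obtain a b d f where x: "a \<in> BB c" "b \<in> BB c" "d \<in> BB c" "f \<in> BB c" "x = qalg.q HP (\<iota> i) (\<iota> j) (u a) (u b) (u d) (u f)"
      by blast
    have "u a \<star> \<iota> \<one> \<in> LO" by (rule e[OF x(1)]) (use t in auto)
    hence 1: "u a \<in> LO" using N.BB_carrier[OF x(1)] by (simp add: T.pt_one)
    have 2: "\<iota> i \<star> \<iota> j = \<iota> (i \<otimes> j)" by (simp add: T.pt_mult)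
    show "x \<in> LO" unfolding x(5) qalg.q_def[OF quat.axioms(1)[OF HP_quat]] 2
      by (intro LO_add 1 e x t H.ij_closed H.m_closed)
  qed
  thus ?thesis by blast
qed

lemma lattice: "qpair.lattice_pair H HP (\<iota> i) (\<iota> j) s (%n. DP n) (%h. \<iota> h) (OP P) LO"
  unfolding qpair.lattice_pair_def[OF HP_qpair]
proof (intro conjI ballI)
  show "LO \<subseteq> carrier HP" using LO_HP by blast
  show "\<one>\<^bsub>HP\<^esub> \<in> LO" using LO_gen[OF O_ops(2) N.BB_one] T.pt_one by simp
  show "\<iota> h \<in> LO \<longleftrightarrow> h \<in> OP P" if "h \<in> carrier H" for h using LO_OP[OF that] OP_LO by blast
  show "\<exists>c. UP c \<subseteq> LO" by (rule UP_LO)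
qed (auto intro: LO_add LO_mult LO_uminus LO_s)

end

section \<open>Strong approximation in the special linear group\<close>

lemma (in lquat) HV_vquat: "vquat H K i j \<sigma> (val_ge F P)" by (rule HV.vquat_axioms)

lemma finite_uniform:
  assumes "finite T" "!!P. P \<in> T ==> \<exists>c::nat. Q P c" "!!P c d. P \<in> T ==> c \<le> d ==> Q P c ==> Q P d"
  shows "\<exists>c. \<forall>P\<in>T. Q P c"
  using assms
proof (induction T rule: finite_induct)
  case empty thus ?case by simp
next
  case (insert P T)
  obtain c where c: "\<forall>P\<in>T. Q P c" using insert.IH insert.prems by auto
  obtain d where d: "Q P d" using insert.prems by blast
  have "Q R (max c d)" if "R \<in> insert P T" for R
    using that c d insert.prems(2)[of R c "max c d"] insert.prems(2)[of R d "max c d"] by auto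
  thus ?case by blast
qed

context norder
begin

lemma lquat_I: "P \<in> Pr ==> lquat H K i j \<sigma> P" by unfold_locales

lemma nlorder_I: "P \<in> Pr ==> nlorder H K i j \<sigma> \<O> P"
  by (rule nlorder.intro[OF norder_axioms lquat_I])

lemma vquat_I: "P \<in> Pr ==> vquat H K i j \<sigma> (val_ge F P)"
  by (rule lquat.HV_vquat[OF lquat_I])

abbreviation nr where "nr P \<equiv> vquat.near H i j (val_ge F P)"
abbreviation mnr where "mnr P \<equiv> vquat.mnear H i j (val_ge F P)"

text \<open>The role of \<open>t\<close> is that of an integer multiplying the basis into the order.
  At primes outside \<open>T\<close>, a coordinate of the form \<open>t \<otimes> y\<close> with
  \<open>y\<close> integral ensures that its product with a basis vector lies in the localized
  order.\<close>

lemma scalar_approximation: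
  assumes T: "finite T" "T \<subseteq> Pr" and a: "!!P. P \<in> T ==> a P \<in> K" and t: "t \<in> oK" "t \<noteq> \<zero>"
  shows "\<exists>y\<in>K. (\<forall>P\<in>T. t \<otimes> y \<ominus> a P \<in> val_ge F P n) \<and> (\<forall>Q\<in>Pr - T. y \<in> val_ge F Q 0)"
proof -
  note tK = oK_K[OF t(1)]
  note ti = H.L_inv[OF tK t(2)]
  have "\<exists>c. \<forall>P\<in>T. \<forall>x\<in>val_ge F P c. t \<otimes> x \<in> val_ge F P n"
  proof (rule finite_uniform[OF T(1)])
    fix P assume P: "P \<in> T"
    interpret V: vquat H K i j \<sigma> "val_ge F P" using vquat_I P T by blast
    obtain c where "!!n x. x \<in> val_ge F P (n + c) ==> t \<otimes> x \<in> val_ge F P n" using V.D_scale[OF tK] by blast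
    thus "\<exists>c. \<forall>x\<in>val_ge F P c. t \<otimes> x \<in> val_ge F P n" by blast
    show "\<forall>x\<in>val_ge F P d. t \<otimes> x \<in> val_ge F P n" if "c \<le> d" "\<forall>x\<in>val_ge F P c. t \<otimes> x \<in> val_ge F P n" for c d
      using that V.D_mono by blast
  qed
  then obtain c where c: "!!P x. P \<in> T ==> x \<in> val_ge F P c ==> t \<otimes> x \<in> val_ge F P n" by blast
  have "inv t \<otimes> a P \<in> carrier F" if "P \<in> T" for P using a[OF that] ti by simp
  then obtain y where y: "y \<in> carrier F" "\<forall>P\<in>T. y \<ominus>\<^bsub>F\<^esub> inv t \<otimes> a P \<in> val_ge F P c" "\<forall>Q\<in>Pr - T. y \<in> val_ge F Q 0"
    using F.strong_approximation[OF T, of "%P. inv t \<otimes> a P" c] by blast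
  have yK: "y \<in> K" using y(1) by simp
  have "t \<otimes> y \<ominus> a P \<in> val_ge F P n" if P: "P \<in> T" for P
  proof -
    have ia: "inv t \<otimes> a P \<in> K" using a[OF P] ti by simp
    have "t \<otimes> (y \<ominus> inv t \<otimes> a P) \<in> val_ge F P n" by (rule c[OF P y(2)[rule_format, OF P, unfolded F_minus[OF yK ia]]])
    also have "t \<otimes> (y \<ominus> inv t \<otimes> a P) = t \<otimes> y \<ominus> (t \<otimes> inv t) \<otimes> a P"
      using H.minus_distr(1)[of y "inv t \<otimes> a P" t] yK tK ti(1) a[OF P] by (simp add: H.m_assoc del: H.L_inv)
    finally show ?thesis using ti a[OF P] by simp
  qed
  thus ?thesis using y yK by blast
qed

text \<open>The coordinates at \<one>, \<open>i\<close> and \<open>j\<close> of a fixed element are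
  arbitrary, so each is approximated on its own, while the one at \<open>k\<close> is kept
  zero.\<close>

lemma Fix_approximation:
  assumes T: "finite T" "T \<subseteq> Pr" and x: "!!P. P \<in> T ==> x P \<in> H.Fix"
  shows "\<exists>y\<in>H.Fix. (\<forall>P\<in>T. nr P n y (x P)) \<and> (\<forall>Q\<in>Pr - T. y \<in> OP Q)"
proof -
  obtain t where t: "t \<in> oK" "t \<noteq> \<zero>" "t \<in> \<O>" "t \<otimes> i \<in> \<O>" "t \<otimes> j \<in> \<O>" using basis_denominator by blast
  note tK = oK_K[OF t(1)]
  have "\<forall>P. \<exists>a b c. P \<in> T --> a \<in> K \<and> b \<in> K \<and> c \<in> K \<and> x P = H.q a b c \<zero>" using H.Fix_coordinates[OF x] by blast
  then obtain a b c where "\<forall>P. P \<in> T --> a P \<in> K \<and> b P \<in> K \<and> c P \<in> K \<and> x P = H.q (a P) (b P) (c P) \<zero>" by metis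
  hence abc: "!!P. P \<in> T ==> a P \<in> K" "!!P. P \<in> T ==> b P \<in> K" "!!P. P \<in> T ==> c P \<in> K"
    "!!P. P \<in> T ==> x P = H.q (a P) (b P) (c P) \<zero>" by auto
  obtain a' where a': "a' \<in> K" "!!P. P \<in> T ==> t \<otimes> a' \<ominus> a P \<in> val_ge F P n" "!!Q. Q \<in> Pr - T ==> a' \<in> val_ge F Q 0"
    using scalar_approximation[OF T, of a t n] abc(1) t(1,2) by blast
  obtain b' where b': "b' \<in> K" "!!P. P \<in> T ==> t \<otimes> b' \<ominus> b P \<in> val_ge F P n" "!!Q. Q \<in> Pr - T ==> b' \<in> val_ge F Q 0"
    using scalar_approximation[OF T, of b t n] abc(2) t(1,2) by blast
  obtain c' where c': "c' \<in> K" "!!P. P \<in> T ==> t \<otimes> c' \<ominus> c P \<in> val_ge F P n" "!!Q. Q \<in> Pr - T ==> c' \<in> val_ge F Q 0"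
    using scalar_approximation[OF T, of c t n] abc(3) t(1,2) by blast
  define y where "y = H.q (t \<otimes> a') (t \<otimes> b') (t \<otimes> c') \<zero>"
  note k = a'(1) b'(1) c'(1) tK
  have yF: "y \<in> H.Fix" unfolding y_def using k by (simp add: H.Fix_iff H.sigma_q)
  have "nr P n y (x P)" if P: "P \<in> T" for P
  proof -
    interpret V: vquat H K i j \<sigma> "val_ge F P" using vquat_I P T by blast
    have "y \<ominus> x P = H.q (t \<otimes> a' \<ominus> a P) (t \<otimes> b' \<ominus> b P) (t \<otimes> c' \<ominus> c P) \<zero>"
      unfolding y_def abc(4)[OF P] using abc(1-3)[OF P] k by (simp add: a_minus_def H.q_uminus H.q_add)
    also have "... \<in> V.UU n" by (intro V.UU_I a' b' c' P V.D_zero)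
    finally show ?thesis using H.Fix_carrier[OF yF] H.Fix_carrier[OF x[OF P]] by (simp add: V.near_def)
  qed
  moreover have "y \<in> OP Q" if Q: "Q \<in> Pr - T" for Q
  proof -
    have Qp: "Q \<in> Pr" using Q by blast
    have e: "(t \<otimes> l) \<otimes> z \<in> OP Q" if "l \<in> val_ge F Q 0" "l \<in> K" "t \<otimes> z \<in> \<O>" "z \<in> carrier H" for l z
      using OP_props(5)[OF Qp that(1) O_OP[OF Qp that(3)]] that k H.L_comm[OF tK that(2)] by (simp add: H.m_assoc)
    have "(t \<otimes> a') \<otimes> \<one> \<in> OP Q" by (rule e[OF a'(3)[OF Q] a'(1)]) (use t in auto)
    hence 1: "t \<otimes> a' \<in> OP Q" using k by simp
    have "y = t \<otimes> a' \<oplus> (t \<otimes> b') \<otimes> i \<oplus> (t \<otimes> c') \<otimes> j" unfolding y_def H.q_def using k by simp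
    thus ?thesis using OP_props(1)[OF Qp] 1 e[OF b'(3)[OF Q] b'(1) t(4)] e[OF c'(3)[OF Q] c'(1) t(5)] by simp
  qed
  ultimately show ?thesis using yF by blast
qed

lemma word_padding: "ws \<in> H.FixP ==> H.word (ws @ replicate m (\<zero>, \<zero>)) = H.word ws"
proof -
  assume ws: "ws \<in> H.FixP"
  have z: "replicate m (\<zero>, \<zero>) \<in> H.FixP" for m using H.Fix_basic(1) by (auto simp: set_replicate_conv_if split: if_splits)
  have "H.word (replicate m (\<zero>, \<zero>)) = H.I2" by (induction m) (simp_all add: H.Up_def H.Lo_def)
  thus ?thesis using H.word_append[OF ws z] H.SL_M2[OF H.word_SL[OF ws]] by simp
qed

lemma OP_mat_mult: "P \<in> Pr ==> M \<in> mat2_set (OP P) ==> N \<in> mat2_set (OP P) ==> mat2_mult H M N \<in> mat2_set (OP P)"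
  by (cases M; cases N) (simp add: OP_props)

lemma OP_star: "P \<in> Pr ==> M \<in> mat2_set (OP P) ==> H.star M \<in> mat2_set (OP P)"
  by (cases M) (simp add: OP_props)

lemma word_OP:
  assumes Q: "Q \<in> Pr"
  shows "(!!p. p \<in> set ws ==> fst p \<in> OP Q \<and> snd p \<in> OP Q) ==> H.word ws \<in> mat2_set (OP Q)"
proof (induction ws)
  case Nil
  thus ?case using O_OP[OF Q O_ops(1)] O_OP[OF Q O_ops(2)] by simp
next
  case (Cons p ws)
  obtain x y where p: "p = (x, y)" by (cases p)
  have "x \<in> OP Q" "y \<in> OP Q" using Cons.prems[of p] p by auto
  hence "H.Up x \<in> mat2_set (OP Q)" "H.Lo y \<in> mat2_set (OP Q)"
    using O_OP[OF Q O_ops(1)] O_OP[OF Q O_ops(2)] by (simp_all add: H.Up_def H.Lo_def)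
  thus ?case using Cons OP_mat_mult[OF Q] p by simp
qed

text \<open>The matrices at the primes of \<open>T\<close> are written as words of a common length
  \<open>N\<close>, and each entry is approximated at all these primes simultaneously. At the other
  primes the entries are integral, and with them the word.\<close>

theorem SL_approximation:
  assumes T: "finite T" "T \<subseteq> Pr" and g: "!!P. P \<in> T ==> g P \<in> H.SL"
  shows "\<exists>g'\<in>H.SL. (\<forall>P\<in>T. mnr P n g' (g P)) \<and> (\<forall>Q\<in>Pr - T. g' \<in> mat2_set (OP Q))"
proof -
  have "\<forall>P. \<exists>ws. P \<in> T --> ws \<in> H.FixP \<and> g P = H.word ws" using H.SL_elementary g by blast
  then obtain ws0 where ws0: "!!P. P \<in> T ==> ws0 P \<in> H.FixP" "!!P. P \<in> T ==> g P = H.word (ws0 P)" by metis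
  define N where "N = Max (insert 0 ((%P. length (ws0 P)) ` T))"
  have N: "length (ws0 P) \<le> N" if "P \<in> T" for P unfolding N_def using T(1) that by (intro Max_ge) auto
  define ws where "ws P = ws0 P @ replicate (N - length (ws0 P)) (\<zero>, \<zero>)" for P
  have ws: "length (ws P) = N" "ws P \<in> H.FixP" "g P = H.word (ws P)" if "P \<in> T" for P
    using N[OF that] ws0[OF that] word_padding[OF ws0(1)[OF that]] H.Fix_basic(1)
    by (auto simp: ws_def set_replicate_conv_if split: if_splits)
  define near2 where "near2 P m = (%p' p. nr P m (fst p') (fst p) \<and> nr P m (snd p') (snd p))" for P m
  have "\<exists>c. \<forall>P\<in>T. \<forall>ws'. list_all2 (near2 P c) ws' (ws P) --> mnr P n (H.word ws') (H.word (ws P))"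
  proof (rule finite_uniform[OF T(1)])
    fix P assume P: "P \<in> T"
    interpret V: vquat H K i j \<sigma> "val_ge F P" using vquat_I P T by blast
    show "\<exists>c. \<forall>ws'. list_all2 (near2 P c) ws' (ws P) --> mnr P n (H.word ws') (H.word (ws P))"
      unfolding near2_def by (rule V.word_near[OF ws(2)[OF P]])
    fix c d assume cd: "c \<le> (d::nat)" "\<forall>ws'. list_all2 (near2 P c) ws' (ws P) --> mnr P n (H.word ws') (H.word (ws P))"
    have "list_all2 (near2 P c) ws' (ws P)" if "list_all2 (near2 P d) ws' (ws P)" for ws'
      using that by (rule list_all2_mono) (auto simp: near2_def intro: V.near_mono[OF cd(1)])
    thus "\<forall>ws'. list_all2 (near2 P d) ws' (ws P) --> mnr P n (H.word ws') (H.word (ws P))" using cd(2) by blast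
  qed
  then obtain c where c: "!!P ws'. P \<in> T ==> list_all2 (near2 P c) ws' (ws P) ==> mnr P n (H.word ws') (H.word (ws P))" by blast
  have fx: "fst (ws P ! k) \<in> H.Fix" "snd (ws P ! k) \<in> H.Fix" if "P \<in> T" "k < N" for P k
    using ws(1,2)[OF that(1)] that(2) nth_mem[of k "ws P"] by (auto simp: in_lists_conv_set mem_Times_iff)
  have "\<forall>k. \<exists>y. k < N --> y \<in> H.Fix \<and> (\<forall>P\<in>T. nr P c y (fst (ws P ! k))) \<and> (\<forall>Q\<in>Pr - T. y \<in> OP Q)"
    using Fix_approximation[OF T, of "%P. fst (ws P ! k)" c for k] fx(1) by blast
  then obtain f where f: "\<forall>k. k < N --> f k \<in> H.Fix \<and> (\<forall>P\<in>T. nr P c (f k) (fst (ws P ! k))) \<and> (\<forall>Q\<in>Pr - T. f k \<in> OP Q)"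
    by (rule choice[THEN exE])
  have "\<forall>k. \<exists>y. k < N --> y \<in> H.Fix \<and> (\<forall>P\<in>T. nr P c y (snd (ws P ! k))) \<and> (\<forall>Q\<in>Pr - T. y \<in> OP Q)"
    using Fix_approximation[OF T, of "%P. snd (ws P ! k)" c for k] fx(2) by blast
  then obtain h where h: "\<forall>k. k < N --> h k \<in> H.Fix \<and> (\<forall>P\<in>T. nr P c (h k) (snd (ws P ! k))) \<and> (\<forall>Q\<in>Pr - T. h k \<in> OP Q)"
    by (rule choice[THEN exE])
  define w where "w = map (%k. (f k, h k)) [0..<N]"
  have wF: "w \<in> H.FixP" using f h by (auto simp: w_def)
  have "mnr P n (H.word w) (g P)" if P: "P \<in> T" for P
    unfolding ws(3)[OF P]
  proof (rule c[OF P])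
    show "list_all2 (near2 P c) w (ws P)" using ws(1)[OF P] f h P by (auto simp: list_all2_conv_all_nth w_def near2_def)
  qed
  moreover have "H.word w \<in> mat2_set (OP Q)" if Q: "Q \<in> Pr - T" for Q
    by (rule word_OP) (use Q f h in \<open>auto simp: w_def\<close>)
  ultimately show ?thesis using H.word_SL[OF wF] by blast
qed

end

section \<open>The local-global principle\<close>

context quat
begin

lemma conjugate_cancel:
  assumes g': "g' \<in> SL" and x: "x \<in> M2"
  shows "star g' \<odot> (g' \<odot> x \<odot> star g') \<odot> g' = x"
proof -
  note g = SL_M2[OF g']
  have "star g' \<odot> (g' \<odot> x \<odot> star g') \<odot> g' = (star g' \<odot> g') \<odot> x \<odot> (star g' \<odot> g')"
    using g x by (simp add: mm_assoc)
  thus ?thesis using SL_star_left[OF g'] x by simp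
qed

lemma conjugate_in_order_iff:
  "conjugate_in (SL2_inv R \<sigma>) (SL2_inv_order R \<sigma> Z) (SL2_inv_order R \<sigma> Z') \<longleftrightarrow>
    (\<exists>g\<in>SL. \<forall>x\<in>SL. x \<in> mat2_set Z \<longleftrightarrow> g \<odot> x \<odot> star g \<in> mat2_set Z')"
proof -
  have "g \<odot> x \<odot> star g \<in> SL" if "g \<in> SL" "x \<in> SL" for g x using SL_mult[OF SL_mult[OF that] SL_star[OF that(1)]] .
  thus ?thesis
    using conjugate_in_iff[of "SL2_inv_order R \<sigma> Z" "SL2_inv_order R \<sigma> Z'"] by (auto simp: SL2_inv_order_def)
qed

end

text \<open>For the converse, \<open>conjugation_ascends\<close> is applied to the inverse of
  \<open>g'\<close>, which undoes the conjugation.\<close>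

lemma (in qpair) conjugation_ascends_iff:
  assumes l1: "lattice_pair Z1 Q1" and l2: "lattice_pair Z2 Q2" and g': "g' \<in> H.SL"
    and approx1: "!!x n. x \<in> H.SL ==> x \<in> mat2_set Z1 ==>
      \<exists>y\<in>H.SL. H.mnear n y x \<and> H.cnj g' y \<in> mat2_set Z2"
    and approx2: "!!x n. x \<in> H.SL ==> x \<in> mat2_set Z2 ==>
      \<exists>y\<in>H.SL. H.mnear n y x \<and> H.cnj (H.star g') y \<in> mat2_set Z1"
    and x: "x \<in> A.SL"
  shows "x \<in> mat2_set Q1 \<longleftrightarrow> A.cnj (mi g') x \<in> mat2_set Q2"
proof
  show "A.cnj (mi g') x \<in> mat2_set Q2" if "x \<in> mat2_set Q1"
    by (rule conjugation_ascends[OF l1 l2 g' approx1 x that])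
  define z where "z = A.cnj (mi g') x"
  note g = mi_SL[OF g']
  note gM = A.SL_M2[OF g]
  have zS: "z \<in> A.SL" unfolding z_def by (intro A.SL_mult A.SL_star g x)
  have e: "mi (H.star g') = A.star (mi g')" by (rule mi_star[OF H.SL_M2[OF g']])
  have "A.cnj (mi (H.star g')) z = x"
    unfolding e A.star_star[OF gM] z_def by (rule A.conjugate_cancel[OF g A.SL_M2[OF x]])
  thus "x \<in> mat2_set Q1" if "A.cnj (mi g') x \<in> mat2_set Q2"
    using conjugation_ascends[OF l2 l1 H.SL_star[OF g'] approx2 zS] that unfolding z_def by simp
qed

context norder
begin

lemma OP_conjugate_iff:
  assumes P: "P \<in> Pr" and g': "g' \<in> H.SL" "g' \<in> mat2_set (OP P)" and x: "x \<in> H.M2"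
  shows "H.cnj g' x \<in> mat2_set (OP P) \<longleftrightarrow> x \<in> mat2_set (OP P)"
proof
  note s = OP_star[OF P g'(2)]
  show "H.cnj g' x \<in> mat2_set (OP P)" if "x \<in> mat2_set (OP P)"
    by (intro OP_mat_mult[OF P] g' s that)
  show "x \<in> mat2_set (OP P)" if "H.cnj g' x \<in> mat2_set (OP P)"
    using OP_mat_mult[OF P OP_mat_mult[OF P s that] g'(2)] H.conjugate_cancel[OF g'(1) x] by simp
qed

lemma near_OP:
  assumes P: "P \<in> Pr"
  shows "\<exists>c. \<forall>M N. mnr P c M N --> N \<in> mat2_set (OP P) --> M \<in> mat2_set (OP P)"
proof -
  interpret V: vquat H K i j \<sigma> "val_ge F P" by (rule vquat_I[OF P])
  obtain c where c: "V.UU c \<subseteq> OP P" using nlorder.UU_OP[OF nlorder_I[OF P]] by blast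
  have e: "x \<in> OP P" if "V.near c x y" "y \<in> OP P" for x y
  proof -
    have xy: "x \<in> carrier H" "y \<in> carrier H" "x \<ominus> y \<in> OP P" using that(1) c by (auto simp: V.near_def)
    have "x = (x \<ominus> y) \<oplus> y" using xy(1,2) by (simp add: a_minus_def H.a_assoc H.l_neg)
    thus ?thesis using OP_props(1)[OF P xy(3) that(2)] by simp
  qed
  have "M \<in> mat2_set (OP P)" if "V.mnear c M N" "N \<in> mat2_set (OP P)" for M N
    using that by (cases M; cases N) (auto intro: e)
  thus ?thesis by blast
qed

text \<open>For \<open>g'\<close> near \<open>g\<close>, the product \<open>e'\<close> of
  \<open>g'\<close> with the inverse of \<open>g\<close> is near the identity and thus integral at
  \<open>P\<close>, so a further conjugation by \<open>e'\<close> does not affect integrality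
  there.\<close>

lemma near_conjugation:
  assumes P: "P \<in> Pr" and g: "g \<in> H.SL"
  shows "\<exists>m. \<forall>g'\<in>H.SL. mnr P m g' g --> (\<forall>x\<in>H.SL. H.cnj g' x \<in> mat2_set (OP P) \<longleftrightarrow>
    H.cnj g x \<in> mat2_set (OP P))"
proof -
  interpret V: vquat H K i j \<sigma> "val_ge F P" by (rule vquat_I[OF P])
  obtain c where c: "!!M N. mnr P c M N ==> N \<in> mat2_set (OP P) ==> M \<in> mat2_set (OP P)" using near_OP[OF P] by blast
  have gs: "g \<in> H.M2" "H.star g \<in> H.M2" "H.star g \<in> H.SL" using H.SL_M2[OF g] H.SL_star[OF g] by auto
  obtain m where m: "!!M N. mnr P m M g ==> mnr P m N (H.star g) ==> mnr P c (mat2_mult H M N) (mat2_mult H g (H.star g))"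
    using V.mnear_mult[OF gs(1,2)] by blast
  have "H.cnj g' x \<in> mat2_set (OP P) \<longleftrightarrow> H.cnj g x \<in> mat2_set (OP P)"
    if g': "g' \<in> H.SL" "mnr P m g' g" and x: "x \<in> H.SL" for g' x
  proof -
    define e' where "e' = mat2_mult H g' (H.star g)"
    note gM = H.SL_M2[OF g'(1)] and xM = H.SL_M2[OF x]
    have "mat2_mult H g (H.star g) = H.I2" using g H.SL_iff by blast
    hence "mnr P c e' H.I2" using m[OF g'(2) V.mnear_refl[OF gs(2)]] by (simp add: e'_def)
    moreover have "H.I2 \<in> mat2_set (OP P)" using O_OP[OF P O_ops(1)] O_OP[OF P O_ops(2)] by simp
    ultimately have d: "e' \<in> mat2_set (OP P)" using c by blast
    have dS: "e' \<in> H.SL" unfolding e'_def by (rule H.SL_mult[OF g'(1) gs(3)])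
    have dg: "mat2_mult H e' g = g'" unfolding e'_def using H.SL_star_left[OF g] gM gs by (simp add: H.mm_assoc)
    have "H.cnj g' x = H.cnj e' (H.cnj g x)"
      unfolding dg[symmetric] using H.SL_M2[OF dS] gs xM by (simp add: H.mm_assoc H.star_mult)
    thus ?thesis using OP_conjugate_iff[OF P dS d, of "H.cnj g x"] gs xM by simp
  qed
  thus ?thesis by blast
qed

lemma mat_O_iff: "M \<in> H.M2 ==> M \<in> mat2_set \<O> \<longleftrightarrow> (\<forall>P\<in>Pr. M \<in> mat2_set (OP P))"
  by (cases M) (auto intro: O_OP O_Inter)

end

context nquat
begin

abbreviation loc_conjugate where
  "loc_conjugate P \<O>\<^sub>1 \<O>\<^sub>2 \<equiv> conjugate_in (SL2_inv (local_algebra H K P) (local_involution H K P \<sigma>))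
        (SL2_inv_order (local_algebra H K P) (local_involution H K P \<sigma>) (local_order H K P \<O>\<^sub>1))
        (SL2_inv_order (local_algebra H K P) (local_involution H K P \<sigma>) (local_order H K P \<O>\<^sub>2))"

theorem local_to_global:
  assumes O1: "involution_order H K \<sigma> \<O>\<^sub>1" and O2: "involution_order H K \<sigma> \<O>\<^sub>2"
    and loc: "!!P. P \<in> Pr ==> loc_conjugate P \<O>\<^sub>1 \<O>\<^sub>2"
  shows "conjugate_in (SL2_inv H \<sigma>) (SL2_inv_order H \<sigma> \<O>\<^sub>1) (SL2_inv_order H \<sigma> \<O>\<^sub>2)"
proof -
  interpret A: norder H K i j \<sigma> \<O>\<^sub>1 by unfold_locales (rule O1)
  interpret B: norder H K i j \<sigma> \<O>\<^sub>2 by unfold_locales (rule O2)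
  have "\<exists>g\<in>H.SL. \<forall>x\<in>H.SL. x \<in> mat2_set (A.OP P) \<longleftrightarrow> H.cnj g x \<in> mat2_set (B.OP P)"
    if P: "P \<in> Pr" for P
  proof -
    note q = lquat.HP_quat[OF A.lquat_I[OF P], folded local_algebra_def]
    and qp = lquat.HP_qpair[OF A.lquat_I[OF P], folded local_algebra_def]
    note e = loc[OF P, unfolded quat.conjugate_in_order_iff[OF q]]
    show ?thesis
      by (rule bexE[OF e], rule qpair.conjugation_descends[OF qp nlorder.lattice[OF A.nlorder_I[OF P], folded local_algebra_def] nlorder.lattice[OF B.nlorder_I[OF P], folded local_algebra_def]])
        blast+
  qed
  hence "\<forall>P. \<exists>g. P \<in> Pr --> g \<in> H.SL \<and>
      (\<forall>x\<in>H.SL. x \<in> mat2_set (A.OP P) \<longleftrightarrow> H.cnj g x \<in> mat2_set (B.OP P))" by blast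
  then obtain g where "\<forall>P. P \<in> Pr --> g P \<in> H.SL \<and>
      (\<forall>x\<in>H.SL. x \<in> mat2_set (A.OP P) \<longleftrightarrow> H.cnj (g P) x \<in> mat2_set (B.OP P))"
    by (rule choice[THEN exE])
  hence g: "!!P. P \<in> Pr ==> g P \<in> H.SL"
    "!!P x. P \<in> Pr ==> x \<in> H.SL ==>
      x \<in> mat2_set (A.OP P) \<longleftrightarrow> H.cnj (g P) x \<in> mat2_set (B.OP P)" by blast+
  define T where "T = {P \<in> Pr. A.OP P \<noteq> B.OP P}"
  have T: "finite T" "T \<subseteq> Pr" using A.loc_eq_almost_all[OF O2] by (auto simp: T_def)
  \<comment> \<open>\<open>good P g'\<close> means that \<open>g'\<close> can replace the local
    conjugator at \<open>P\<close>. Being close enough implies it, so one precision \<open>m\<close>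
    works for the finite set \<open>T\<close>.\<close>
  define good where "good P g' \<longleftrightarrow> (\<forall>x\<in>H.SL. H.cnj g' x \<in> mat2_set (B.OP P) \<longleftrightarrow>
    H.cnj (g P) x \<in> mat2_set (B.OP P))" for P g'
  have "\<exists>m. \<forall>P\<in>T. \<forall>g'\<in>H.SL. B.mnr P m g' (g P) --> good P g'"
  proof (rule finite_uniform[OF T(1)])
    fix P assume "P \<in> T"
    hence P: "P \<in> Pr" using T by blast
    interpret V: vquat H K i j \<sigma> "val_ge F P" by (rule A.vquat_I[OF P])
    show "\<exists>m. \<forall>g'\<in>H.SL. B.mnr P m g' (g P) --> good P g'" unfolding good_def by (rule B.near_conjugation[OF P g(1)[OF P]])
    show "\<forall>g'\<in>H.SL. B.mnr P n g' (g P) --> good P g'" if "m \<le> n" "\<forall>g'\<in>H.SL. B.mnr P m g' (g P) --> good P g'" for m n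
      using that V.mnear_mono by blast
  qed
  then obtain m where m: "!!P g'. P \<in> T ==> g' \<in> H.SL ==> B.mnr P m g' (g P) ==> good P g'" by blast
  obtain g' where g': "g' \<in> H.SL" "!!P. P \<in> T ==> B.mnr P m g' (g P)" "!!Q. Q \<in> Pr - T ==> g' \<in> mat2_set (B.OP Q)"
    using B.SL_approximation[OF T, of g m] g(1) T by blast
  have "x \<in> mat2_set (A.OP P) \<longleftrightarrow> H.cnj g' x \<in> mat2_set (B.OP P)"
    if P: "P \<in> Pr" and x: "x \<in> H.SL" for P x
  proof (cases "P \<in> T")
    case True
    thus ?thesis using m[OF True g'(1) g'(2)[OF True]] g(2)[OF P x] x unfolding good_def by blast
  next
    \<comment> \<open>Outside \<open>T\<close> the two localized orders coincide and
      \<open>g'\<close> is integral, so conjugation by it preserves the integral matrices.\<close>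
    case False
    hence "A.OP P = B.OP P" using P by (simp add: T_def)
    thus ?thesis using B.OP_conjugate_iff[OF P g'(1) g'(3) H.SL_M2[OF x]] P False by simp
  qed
  hence "x \<in> mat2_set \<O>\<^sub>1 \<longleftrightarrow> H.cnj g' x \<in> mat2_set \<O>\<^sub>2" if x: "x \<in> H.SL" for x
    using A.mat_O_iff[OF H.SL_M2[OF x]] B.mat_O_iff[of "H.cnj g' x"]
      H.SL_M2[OF x] H.SL_M2[OF g'(1)] x by simp
  thus ?thesis unfolding H.conjugate_in_order_iff using g'(1) by blast
qed

text \<open>\<open>SL_approximation\<close> at the single prime \<open>P\<close> gives a matrix
  \<open>y\<close> near \<open>x\<close> that is integral at all other primes. If it is near enough,
  it is integral at \<open>P\<close> too, hence has entries in the order, where \<open>conj\<close>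
  applies.\<close>

lemma global_approximation:
  assumes O1: "involution_order H K \<sigma> \<O>\<^sub>1" and O2: "involution_order H K \<sigma> \<O>\<^sub>2" and P: "P \<in> Pr"
    and conj: "!!x. x \<in> H.SL ==> x \<in> mat2_set \<O>\<^sub>1 ==> H.cnj g' x \<in> mat2_set \<O>\<^sub>2"
    and x: "x \<in> H.SL" "x \<in> mat2_set (loc H K P \<O>\<^sub>1)"
  shows "\<exists>y\<in>H.SL. vquat.mnear H i j (val_ge F P) n y x \<and> H.cnj g' y \<in> mat2_set (loc H K P \<O>\<^sub>2)"
proof -
  interpret A: norder H K i j \<sigma> \<O>\<^sub>1 by unfold_locales (rule O1)
  interpret B: norder H K i j \<sigma> \<O>\<^sub>2 by unfold_locales (rule O2)
  interpret V: vquat H K i j \<sigma> "val_ge F P" by (rule A.vquat_I[OF P])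
  obtain c where c: "!!M N. A.mnr P c M N ==> N \<in> mat2_set (A.OP P) ==> M \<in> mat2_set (A.OP P)" using A.near_OP[OF P] by blast
  \<comment> \<open>\<open>n\<close> is the precision asked for, and \<open>c\<close> the one that
    preserves integrality at \<open>P\<close>.\<close>
  obtain y where y: "y \<in> H.SL" "A.mnr P (max n c) y x" "!!Q. Q \<in> Pr - {P} ==> y \<in> mat2_set (A.OP Q)"
    using A.SL_approximation[of "{P}" "%_. x" "max n c"] P x(1) by auto
  have yn: "A.mnr P n y x" "A.mnr P c y x" by (rule V.mnear_mono[OF _ y(2)]; simp)+
  have "y \<in> mat2_set (A.OP P)" by (rule c[OF yn(2) x(2)])
  hence "y \<in> mat2_set \<O>\<^sub>1" using A.mat_O_iff[OF H.SL_M2[OF y(1)]] y(3) by blast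
  hence "H.cnj g' y \<in> mat2_set \<O>\<^sub>2" using conj[OF y(1)] by blast
  moreover have "M \<in> mat2_set (B.OP P)" if "M \<in> mat2_set \<O>\<^sub>2" for M using that B.O_OP[OF P] by (cases M) simp
  ultimately show ?thesis using y(1) yn(1) by blast
qed

theorem global_to_local:
  assumes O1: "involution_order H K \<sigma> \<O>\<^sub>1" and O2: "involution_order H K \<sigma> \<O>\<^sub>2"
    and glob: "conjugate_in (SL2_inv H \<sigma>) (SL2_inv_order H \<sigma> \<O>\<^sub>1) (SL2_inv_order H \<sigma> \<O>\<^sub>2)"
    and P: "P \<in> Pr"
  shows "loc_conjugate P \<O>\<^sub>1 \<O>\<^sub>2"
proof -
  interpret A: norder H K i j \<sigma> \<O>\<^sub>1 by unfold_locales (rule O1)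
  interpret B: norder H K i j \<sigma> \<O>\<^sub>2 by unfold_locales (rule O2)
  obtain g' where g': "g' \<in> H.SL" "!!x. x \<in> H.SL ==> x \<in> mat2_set \<O>\<^sub>1 \<longleftrightarrow> H.cnj g' x \<in> mat2_set \<O>\<^sub>2"
    using glob unfolding H.conjugate_in_order_iff by blast
  note s = H.SL_star[OF g'(1)]
  have ss: "H.star (H.star g') = g'" using H.SL_M2[OF g'(1)] by simp
  have rev: "H.cnj (H.star g') x \<in> mat2_set \<O>\<^sub>1" if x: "x \<in> H.SL" "x \<in> mat2_set \<O>\<^sub>2" for x
  proof -
    define y where "y = H.cnj (H.star g') x"
    have yS: "y \<in> H.SL" unfolding y_def by (intro H.SL_mult H.SL_star g'(1) x(1))
    have "H.cnj g' y = x"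
      using H.conjugate_cancel[OF s H.SL_M2[OF x(1)]] unfolding y_def ss .
    thus ?thesis using g'(2)[OF yS] x(2) unfolding y_def by simp
  qed
  note q = lquat.HP_quat[OF A.lquat_I[OF P], folded local_algebra_def]
    and qp = lquat.HP_qpair[OF A.lquat_I[OF P], folded local_algebra_def]
  note l1 = nlorder.lattice[OF A.nlorder_I[OF P], folded local_algebra_def] and l2 = nlorder.lattice[OF B.nlorder_I[OF P], folded local_algebra_def]
  show ?thesis
    unfolding quat.conjugate_in_order_iff[OF q]
  proof (rule bexI[OF _ qpair.mi_SL[OF qp g'(1)]], rule ballI)
    fix x
    assume x: "x \<in> carrier (SL2_inv (local_algebra H K P) (local_involution H K P \<sigma>))"
    show "x \<in> mat2_set (local_order H K P \<O>\<^sub>1) \<longleftrightarrow>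
        mat2_mult (local_algebra H K P)
          (mat2_mult (local_algebra H K P)
            (qpair.mi (%h. pure_tensor H K (to_completion F P) (completion F P) h \<one>\<^bsub>completion F P\<^esub>) g') x)
          (quat.star (local_algebra H K P) (local_involution H K P \<sigma>)
            (qpair.mi (%h. pure_tensor H K (to_completion F P) (completion F P) h \<one>\<^bsub>completion F P\<^esub>) g'))
        \<in> mat2_set (local_order H K P \<O>\<^sub>2)"
    proof (rule qpair.conjugation_ascends_iff[OF qp l1 l2 g'(1) _ _ x])
      show "\<exists>y\<in>H.SL. vquat.mnear H i j (val_ge F P) n y x \<and> H.cnj g' y \<in> mat2_set (B.OP P)"
        if "x \<in> H.SL" "x \<in> mat2_set (A.OP P)" for x n
        using global_approximation[OF O1 O2 P _ that] g'(2) by blast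
      show "\<exists>y\<in>H.SL. vquat.mnear H i j (val_ge F P) n y x \<and> H.cnj (H.star g') y \<in> mat2_set (A.OP P)"
        if "x \<in> H.SL" "x \<in> mat2_set (B.OP P)" for x n
        by (rule global_approximation[OF O2 O1 P rev that])
    qed
  qed
qed

end

lemma (in nquat) conjugate_iff_locally_conjugate:
  assumes "involution_order H K \<sigma> \<O>\<^sub>1" "involution_order H K \<sigma> \<O>\<^sub>2"
  shows "conjugate_in (SL2_inv H \<sigma>) (SL2_inv_order H \<sigma> \<O>\<^sub>1) (SL2_inv_order H \<sigma> \<O>\<^sub>2) \<longleftrightarrow>
    (\<forall>P\<in>Pr. loc_conjugate P \<O>\<^sub>1 \<O>\<^sub>2)"
  using local_to_global[OF assms] global_to_local[OF assms] by blast

lemma quaternion_basis_qalg: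
  assumes H: "central_algebra H K" and b: "quaternion_basis H K i j" and two: "\<one>\<^bsub>H\<^esub> \<oplus>\<^bsub>H\<^esub> \<one>\<^bsub>H\<^esub> \<noteq> \<zero>\<^bsub>H\<^esub>"
  shows "qalg H K i j"
proof -
  interpret H: ring H using H by (simp add: central_algebra_def)
  have K: "subfield K H" and c: "!!k x. k \<in> K ==> x \<in> carrier H ==> k \<otimes>\<^bsub>H\<^esub> x = x \<otimes>\<^bsub>H\<^esub> k"
    using H by (auto simp: central_algebra_def)
  have ij: "i \<in> carrier H" "j \<in> carrier H" using b by (auto simp: quaternion_basis_def)
  show ?thesis
  proof (rule qalg.intro[OF H.ring_axioms], rule qalg_axioms.intro[OF K c])
    fix x assume "x \<in> carrier H"
    hence "x \<in> H.Span K [\<one>\<^bsub>H\<^esub>, i, j, i \<otimes>\<^bsub>H\<^esub> j]" using b by (simp add: quaternion_basis_def)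
    then obtain a b c d where abcd: "a \<in> K" "b \<in> K" "c \<in> K" "d \<in> K"
      "x = a \<otimes>\<^bsub>H\<^esub> \<one>\<^bsub>H\<^esub> \<oplus>\<^bsub>H\<^esub> (b \<otimes>\<^bsub>H\<^esub> i \<oplus>\<^bsub>H\<^esub> (c \<otimes>\<^bsub>H\<^esub> j \<oplus>\<^bsub>H\<^esub> (d \<otimes>\<^bsub>H\<^esub> (i \<otimes>\<^bsub>H\<^esub> j) \<oplus>\<^bsub>H\<^esub> \<zero>\<^bsub>H\<^esub>)))"
      by (auto simp: H.line_extension_mem_iff)
    moreover have "a \<in> carrier H" "b \<in> carrier H" "c \<in> carrier H" "d \<in> carrier H" using abcd subfieldE(3)[OF K] by auto
    ultimately have "x = a \<oplus>\<^bsub>H\<^esub> b \<otimes>\<^bsub>H\<^esub> i \<oplus>\<^bsub>H\<^esub> c \<otimes>\<^bsub>H\<^esub> j \<oplus>\<^bsub>H\<^esub> d \<otimes>\<^bsub>H\<^esub> (i \<otimes>\<^bsub>H\<^esub> j)" using ij by (simp add: H.a_assoc)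
    thus "\<exists>a\<in>K. \<exists>b\<in>K. \<exists>c\<in>K. \<exists>d\<in>K. x = a \<oplus>\<^bsub>H\<^esub> b \<otimes>\<^bsub>H\<^esub> i \<oplus>\<^bsub>H\<^esub> c \<otimes>\<^bsub>H\<^esub> j \<oplus>\<^bsub>H\<^esub> d \<otimes>\<^bsub>H\<^esub> (i \<otimes>\<^bsub>H\<^esub> j)"
      using abcd(1-4) by blast
  qed (use b two in \<open>auto simp: quaternion_basis_def\<close>)
qed

text \<open>An involution that is -1 on all pure quaternions is quaternion conjugation with respect
  to the given basis.\<close>

lemma (in qalg) orthogonal_not_minus:
  fixes \<sigma> :: "'a => 'a"
  assumes b: "quaternion_basis R L i j" and \<sigma>: "orthogonal_involution R L \<sigma>"
  shows "\<exists>u. pure u \<and> u \<oplus> \<sigma> u \<noteq> \<zero>"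
proof (rule ccontr)
  assume n: "\<not> ?thesis"
  have inv: "involution R L \<sigma>" using \<sigma> by (simp add: orthogonal_involution_def)
  have neg: "\<sigma> u = \<ominus> u" if "pure u" for u
    using n that si(1)[OF inv pure_closed[OF that]] pure_closed[OF that] minus_equality[of "\<sigma> u" u] by (metis a_comm)
  have "quaternion_conjugation R L \<sigma>"
    unfolding quaternion_conjugation_def
  proof (intro exI conjI ballI)
    show "quaternion_basis R L i j" by (rule b)
    fix t x y z assume l: "t \<in> L" "x \<in> L" "y \<in> L" "z \<in> L"
    have e: "t \<oplus> x \<otimes> i \<oplus> y \<otimes> j \<oplus> z \<otimes> k = t \<oplus> q \<zero> x y z" using l by (simp add: q_def a_assoc)
    have "\<sigma> (t \<oplus> q \<zero> x y z) = t \<oplus> \<ominus> q \<zero> x y z" using si(2)[OF inv, of t "q \<zero> x y z"] si_L[OF inv l(1)] neg[OF pure_q[OF l(2-4)]] l by simp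
    also have "... = t \<ominus> x \<otimes> i \<ominus> y \<otimes> j \<ominus> z \<otimes> k" unfolding q_def using l[THEN L_carrier] ij_closed by algebra
    finally show "\<sigma> (t \<oplus> x \<otimes> i \<oplus> y \<otimes> j \<oplus> z \<otimes> k) = t \<ominus> x \<otimes> i \<ominus> y \<otimes> j \<ominus> z \<otimes> k" unfolding e .
  qed
  thus False using \<sigma> by (simp add: orthogonal_involution_def)
qed

theorem theorem8p1:
  fixes H :: "('a, 'b) ring_scheme" and K :: "'a set" and \<sigma> :: "'a \<Rightarrow> 'a" and \<O>\<^sub>1 \<O>\<^sub>2 :: "'a set"
  assumes "quaternion_algebra H K"
    and "number_field (base_field H K)"
    and "orthogonal_involution H K \<sigma>"
    and "maximal_involution_order H K \<sigma> \<O>\<^sub>1"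
    and "maximal_involution_order H K \<sigma> \<O>\<^sub>2"
  shows "conjugate_in (SL2_inv H \<sigma>) (SL2_inv_order H \<sigma> \<O>\<^sub>1) (SL2_inv_order H \<sigma> \<O>\<^sub>2) \<longleftrightarrow>
    (\<forall>P \<in> finite_primes (base_field H K).
      conjugate_in (SL2_inv (local_algebra H K P) (local_involution H K P \<sigma>))
        (SL2_inv_order (local_algebra H K P) (local_involution H K P \<sigma>) (local_order H K P \<O>\<^sub>1))
        (SL2_inv_order (local_algebra H K P) (local_involution H K P \<sigma>) (local_order H K P \<O>\<^sub>2)))"
proof -
  interpret F: numfield "base_field H K"
    by (rule numfield.intro) (use assms(2) in \<open>auto simp: number_field_def numfield_axioms_def\<close>)
  obtain i0 j0 where H: "central_algebra H K" and b: "quaternion_basis H K i0 j0"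
    using assms(1) by (auto simp: quaternion_algebra_def)
  \<comment> \<open>Characteristic zero at \<open>n = 2\<close>, where the multiple of \<one>
    unfolds to the sum of two copies.\<close>
  have "add_pow (base_field H K) (Suc (Suc 0)) \<one>\<^bsub>base_field H K\<^esub> \<noteq> \<zero>\<^bsub>base_field H K\<^esub>"
    using assms(2) unfolding number_field_def char_zero_def by blast
  hence two: "\<one>\<^bsub>H\<^esub> \<oplus>\<^bsub>H\<^esub> \<one>\<^bsub>H\<^esub> \<noteq> \<zero>\<^bsub>H\<^esub>"
    using F.l_zero[OF F.one_closed] by simp
  interpret B: qalg H K i0 j0 by (rule quaternion_basis_qalg[OF H b two])
  have inv: "involution H K \<sigma>" using assms(3) by (simp add: orthogonal_involution_def)
  obtain i1 j1 where "i1 \<in> carrier H \<and> j1 \<in> carrier H \<and> i1 \<otimes>\<^bsub>H\<^esub> i1 \<in> K \<and> j1 \<otimes>\<^bsub>H\<^esub> j1 \<in> K \<and>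
      (\<forall>s\<in>K - {\<zero>\<^bsub>H\<^esub>}. \<forall>t\<in>K - {\<zero>\<^bsub>H\<^esub>}. quat H K (s \<otimes>\<^bsub>H\<^esub> i1) (t \<otimes>\<^bsub>H\<^esub> j1) \<sigma>)"
    using B.adapted_basis[OF inv B.orthogonal_not_minus[OF b assms(3)]] by (elim exE)
  hence c: "i1 \<in> carrier H" "j1 \<in> carrier H" and ij: "i1 \<otimes>\<^bsub>H\<^esub> i1 \<in> K" "j1 \<otimes>\<^bsub>H\<^esub> j1 \<in> K"
    and q: "\<forall>s\<in>K - {\<zero>\<^bsub>H\<^esub>}. \<forall>t\<in>K - {\<zero>\<^bsub>H\<^esub>}. quat H K (s \<otimes>\<^bsub>H\<^esub> i1) (t \<otimes>\<^bsub>H\<^esub> j1) \<sigma>" by auto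
  \<comment> \<open>One factor \<open>s\<close> makes the square of \<open>i1\<close> integral.
    Scaling the vector by \<open>s\<close> brings in a second factor, which is itself integral;
    likewise for \<open>t\<close> and \<open>j1\<close>.\<close>
  obtain s where s: "s \<in> F.ZK" "s \<noteq> \<zero>\<^bsub>H\<^esub>" "s \<otimes>\<^bsub>H\<^esub> (i1 \<otimes>\<^bsub>H\<^esub> i1) \<in> F.ZK" using F.fraction[of "i1 \<otimes>\<^bsub>H\<^esub> i1"] ij(1) by auto
  obtain t where t: "t \<in> F.ZK" "t \<noteq> \<zero>\<^bsub>H\<^esub>" "t \<otimes>\<^bsub>H\<^esub> (j1 \<otimes>\<^bsub>H\<^esub> j1) \<in> F.ZK" using F.fraction[of "j1 \<otimes>\<^bsub>H\<^esub> j1"] ij(2) by auto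
  have st: "s \<in> K" "t \<in> K" using F.ZK_carrier[OF s(1)] F.ZK_carrier[OF t(1)] by auto
  have e: "(r \<otimes>\<^bsub>H\<^esub> x) \<otimes>\<^bsub>H\<^esub> (r \<otimes>\<^bsub>H\<^esub> x) = r \<otimes>\<^bsub>H\<^esub> (r \<otimes>\<^bsub>H\<^esub> (x \<otimes>\<^bsub>H\<^esub> x))" if "r \<in> K" "x \<in> carrier H" for r x
    unfolding B.term_mult[OF that(1,1) that(2,2)] using that by (intro B.m_assoc) auto
  have "(s \<otimes>\<^bsub>H\<^esub> i1) \<otimes>\<^bsub>H\<^esub> (s \<otimes>\<^bsub>H\<^esub> i1) \<in> F.ZK" "(t \<otimes>\<^bsub>H\<^esub> j1) \<otimes>\<^bsub>H\<^esub> (t \<otimes>\<^bsub>H\<^esub> j1) \<in> F.ZK"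
    unfolding e[OF st(1) c(1)] e[OF st(2) c(2)] using F.ZK_mult[OF s(1,3)] F.ZK_mult[OF t(1,3)] by simp_all
  moreover have "quat H K (s \<otimes>\<^bsub>H\<^esub> i1) (t \<otimes>\<^bsub>H\<^esub> j1) \<sigma>" using q s t st by blast
  ultimately have "nquat H K (s \<otimes>\<^bsub>H\<^esub> i1) (t \<otimes>\<^bsub>H\<^esub> j1) \<sigma>"
    by (intro nquat.intro nquat_axioms.intro assms(2))
  thus ?thesis
    using nquat.conjugate_iff_locally_conjugate[of H K _ _ \<sigma> \<O>\<^sub>1 \<O>\<^sub>2] assms(4,5) by (simp add: maximal_involution_order_def)
qed

end
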